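(* Let $K$ be a field, $A=\bigoplus_{n\in\mathbb Z}A_n$ a unital $\mathbb Z$-graded $K$-algebra, and $\sigma$ a graded automorphism of $A$; write $\sigma_0=\sigma|_{A_0}$. Let $F\colon\mathsf{Gr}\text{-}A\to\mathsf{Gr}\text{-}A^\sigma$ be Zhang's equivalence. Then the following statements hold: (1) $I_{A^\sigma}=I_A$ as graded subspaces of $A$. (2) $F$ restricts to an equivalence $\mathrm{Tors}_I(A)\simeq\mathrm{Tors}_I(A^{\sigma})$. It therefore induces an equivalence $\mathsf{QGr}_I\text{-}A\simeq \mathsf{QGr}_I\text{-}A^{\sigma}$ sending $\pi(A_A)$ to $\pi(A^\sigma_{A^\sigma})$. (3) If $A$ is strongly graded, then so is $A^{\sigma}$, and $A^\sigma_0=A_0$ as algebras. Under the identifications $\mathsf{QGr}_I\text{-}A=\mathsf{Gr}\text{-}A\simeq\mathsf{Mod}\text{-}A_0$ and $\mathsf{QGr}_I\text{-}A^\sigma=\mathsf{Gr}\text{-}A^\sigma\simeq\mathsf{Mod}\text{-}A_0^\sigma=\mathsf{Mod}\text{-}A_0$ given by $M\mapsto M_0$, the equivalence in (2) is the identity functor of $\mathsf{Mod}\text{-}A_0$, and $$\operatorname{proj} A^\sigma\;\simeq\;\big(\mathsf{Mod}\text{-}A_0,\ A_0,\ \sigma_0^{*}\circ(-\otimes_{A_0}A_1)\big).$$ Thus (compared with $\operatorname{proj}A\simeq(\mathsf{Mod}\text{-}A_0,A_0,-\otimes_{A_0}A_1)$) the passage from $A$ to $A^\sigma$ leaves the pair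 $(\mathsf{Mod}\text{-}A_0,A_0)$ unchanged and composes the shift with $\sigma_0^{*}$.
   Context: All modules are right modules. $\mathsf{Mod}\text{-}A_0$ is the category of right $A_0$-modules; $\mathsf{Gr}\text{-}A$ is the category of $\mathbb Z$-graded right $A$-modules with degree-preserving homomorphisms; $M(1)$ is the shift, $M(1)_n=M_{n+1}$. $A$ is strongly graded if $A_nA_m=A_{n+m}$ for all $n,m\in\mathbb Z$ (in that case $I_A=A$, $\mathrm{Tors}_I(A)=0$ and $M\mapsto M_0$ is an equivalence $\mathsf{Gr}\text{-}A\to\mathsf{Mod}\text{-}A_0$). For a unital $\mathbb Z$-graded $K$-algebra $A$ put $I_A=A\big(\bigoplus_{n\ne 0}A_n\big)A$, a graded two-sided ideal. A full subcategory of a Grothendieck category is localizing if it is closed under subobjects, quotients, extensions and arbitrary direct sums. $\mathrm{Tors}_I(A)$ is the smallest localizing subcategory of $\mathsf{Gr}\text{-}A$ containing every graded module $M$ with $MI_A=0$. Put $\mathsf{QGr}_I\text{-}A=\mathsf{Gr}\text{-}A/\mathrm{Tors}_I(A)$ (Gabriel quotient), with quotient functor $\pi$. The noncommutative projective scheme of $A$ is the triple $\operatorname{proj}A=(\mathsf{QGr}_I\text{-}A,\ \pi(A_A),\ s)$, where $s$ is the autoequivalence induced by $M\mapsto M(1)$. Two triples $(\mathcal C,\mathcal O,s)$ and $(\mathcal C',\mathcal O',s')$ are equivalent, written $\simeq$, if there is an equivalence $G\colon\mathcal C\to\mathcal C'$ with $G(\mathcal O)\cong\mathcal O'$ and a natural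 isomorphism $G\circ s\cong s'\circ G$. Zhang twist: $A^\sigma$ is the graded algebra with the same underlying graded space as $A$ and multiplication $a\star b=a\,\sigma^m(b)$ for $a\in A_m$, $b\in A$. Zhang's equivalence $F\colon\mathsf{Gr}\text{-}A\to\mathsf{Gr}\text{-}A^\sigma$ sends $M$ to the same graded vector space with action $m\star a=m\,\sigma^n(a)$ for $m\in M_n$, $a\in A$, and is the identity on morphisms. For a right $A_0$-module $N$, $\sigma_0^*N$ denotes $N$ with the action $n\cdot b=n\,\sigma_0(b)$. *)

theory Defs
  imports "HOL-Algebra.Module" "HOL-Algebra.QuotRing" "HOL-Algebra.Ideal_Product" "HOL-Algebra.Free_Abelian_Groups"
begin

section \<open>Categories, functors, equivalences\<close>

text \<open>Hom-sets are indexed by source and target and need not be disjoint; accordingly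
  composition and the morphism part of a functor take the objects as arguments.
  \<open>Cmp C x y z g f\<close> is the composite \<open>x \<rightarrow> y \<rightarrow> z\<close>, first \<open>f\<close> and then \<open>g\<close>.\<close>

record ('o, 'm) cat =
  Ob :: "'o set"
  Hom :: "'o \<Rightarrow> 'o \<Rightarrow> 'm set"
  Idt :: "'o \<Rightarrow> 'm"
  Cmp :: "'o \<Rightarrow> 'o \<Rightarrow> 'o \<Rightarrow> 'm \<Rightarrow> 'm \<Rightarrow> 'm"

definition category :: "('o, 'm) cat \<Rightarrow> bool" where
  "category C \<longleftrightarrow>
    (\<forall>x\<in>Ob C. Idt C x \<in> Hom C x x) \<and>
    (\<forall>x\<in>Ob C. \<forall>y\<in>Ob C. \<forall>z\<in>Ob C. \<forall>f\<in>Hom C x y. \<forall>g\<in>Hom C y z.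
       Cmp C x y z g f \<in> Hom C x z) \<and>
    (\<forall>x\<in>Ob C. \<forall>y\<in>Ob C. \<forall>f\<in>Hom C x y.
       Cmp C x x y f (Idt C x) = f \<and> Cmp C x y y (Idt C y) f = f) \<and>
    (\<forall>w\<in>Ob C. \<forall>x\<in>Ob C. \<forall>y\<in>Ob C. \<forall>z\<in>Ob C.
       \<forall>f\<in>Hom C w x. \<forall>g\<in>Hom C x y. \<forall>h\<in>Hom C y z.
       Cmp C w x z (Cmp C x y z h g) f = Cmp C w y z h (Cmp C w x y g f))"

definition full_subcat :: "('o, 'm) cat \<Rightarrow> 'o set \<Rightarrow> ('o, 'm) cat" where
  "full_subcat C T = C\<lparr>Ob := T\<rparr>"

definition iso_arrow :: "('o, 'm) cat \<Rightarrow> 'o \<Rightarrow> 'o \<Rightarrow> 'm \<Rightarrow> bool" where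
  "iso_arrow C x y f \<longleftrightarrow> f \<in> Hom C x y \<and>
    (\<exists>g\<in>Hom C y x. Cmp C x y x g f = Idt C x \<and> Cmp C y x y f g = Idt C y)"

definition isomorphic_in :: "('o, 'm) cat \<Rightarrow> 'o \<Rightarrow> 'o \<Rightarrow> bool" where
  "isomorphic_in C x y \<longleftrightarrow> x \<in> Ob C \<and> y \<in> Ob C \<and> (\<exists>f. iso_arrow C x y f)"

record ('o, 'm, 'p, 'n) fnc =
  fo :: "'o \<Rightarrow> 'p"
  fm :: "'o \<Rightarrow> 'o \<Rightarrow> 'm \<Rightarrow> 'n"

definition is_functor ::
  "('o, 'm) cat \<Rightarrow> ('p, 'n) cat \<Rightarrow> ('o, 'm, 'p, 'n) fnc \<Rightarrow> bool" where
  "is_functor C D F \<longleftrightarrow> category C \<and> category D \<and>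
    (\<forall>x\<in>Ob C. fo F x \<in> Ob D) \<and>
    (\<forall>x\<in>Ob C. \<forall>y\<in>Ob C. \<forall>f\<in>Hom C x y. fm F x y f \<in> Hom D (fo F x) (fo F y)) \<and>
    (\<forall>x\<in>Ob C. fm F x x (Idt C x) = Idt D (fo F x)) \<and>
    (\<forall>x\<in>Ob C. \<forall>y\<in>Ob C. \<forall>z\<in>Ob C. \<forall>f\<in>Hom C x y. \<forall>g\<in>Hom C y z.
       fm F x z (Cmp C x y z g f) =
         Cmp D (fo F x) (fo F y) (fo F z) (fm F y z g) (fm F x y f))"

definition id_functor :: "('o, 'm, 'o, 'm) fnc" where
  "id_functor = \<lparr>fo = (\<lambda>x. x), fm = (\<lambda>x y f. f)\<rparr>"

definition fcomp ::
  "('p, 'n, 'q, 'l) fnc \<Rightarrow> ('o, 'm, 'p, 'n) fnc \<Rightarrow> ('o, 'm, 'q, 'l) fnc"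
  (infixr \<open>\<circ>\<^sub>F\<close> 55) where
  "G \<circ>\<^sub>F F = \<lparr>fo = (\<lambda>x. fo G (fo F x)),
            fm = (\<lambda>x y f. fm G (fo F x) (fo F y) (fm F x y f))\<rparr>"

text \<open>Equality of two functors on the category \<open>C\<close>; their values outside \<open>C\<close> are irrelevant.\<close>

definition functor_eq ::
  "('o, 'm) cat \<Rightarrow> ('o, 'm, 'p, 'n) fnc \<Rightarrow> ('o, 'm, 'p, 'n) fnc \<Rightarrow> bool" where
  "functor_eq C F G \<longleftrightarrow> (\<forall>x\<in>Ob C. fo F x = fo G x) \<and>
    (\<forall>x\<in>Ob C. \<forall>y\<in>Ob C. \<forall>f\<in>Hom C x y. fm F x y f = fm G x y f)"

definition naturally_isomorphic ::
  "('o, 'm) cat \<Rightarrow> ('p, 'n) cat \<Rightarrow> ('o, 'm, 'p, 'n) fnc \<Rightarrow> ('o, 'm, 'p, 'n) fnc \<Rightarrow> bool" where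
  "naturally_isomorphic C D F G \<longleftrightarrow> is_functor C D F \<and> is_functor C D G \<and>
    (\<exists>\<eta>. (\<forall>x\<in>Ob C. iso_arrow D (fo F x) (fo G x) (\<eta> x)) \<and>
      (\<forall>x\<in>Ob C. \<forall>y\<in>Ob C. \<forall>f\<in>Hom C x y.
         Cmp D (fo F x) (fo F y) (fo G y) (\<eta> y) (fm F x y f) =
         Cmp D (fo F x) (fo G x) (fo G y) (fm G x y f) (\<eta> x)))"

definition cat_equivalence ::
  "('o, 'm) cat \<Rightarrow> ('p, 'n) cat \<Rightarrow> ('o, 'm, 'p, 'n) fnc \<Rightarrow> bool" where
  "cat_equivalence C D F \<longleftrightarrow> is_functor C D F \<and>
    (\<exists>G. is_functor D C G \<and>
       naturally_isomorphic C C id_functor (G \<circ>\<^sub>F F) \<and>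
       naturally_isomorphic D D (F \<circ>\<^sub>F G) id_functor)"

definition cat_isomorphism ::
  "('o, 'm) cat \<Rightarrow> ('p, 'n) cat \<Rightarrow> ('o, 'm, 'p, 'n) fnc \<Rightarrow> bool" where
  "cat_isomorphism C D F \<longleftrightarrow> is_functor C D F \<and> bij_betw (fo F) (Ob C) (Ob D) \<and>
    (\<forall>x\<in>Ob C. \<forall>y\<in>Ob C. bij_betw (fm F x y) (Hom C x y) (Hom D (fo F x) (fo F y)))"

text \<open>Triples (category, object, autoequivalence).\<close>

type_synonym ('o, 'm) triple = "('o, 'm) cat \<times> 'o \<times> ('o, 'm, 'o, 'm) fnc"

definition is_triple :: "('o, 'm) triple \<Rightarrow> bool" where
  "is_triple P \<longleftrightarrow> (case P of (C, U, s) \<Rightarrow> U \<in> Ob C \<and> cat_equivalence C C s)"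

definition triple_equivalence ::
  "('o, 'm) triple \<Rightarrow> ('p, 'n) triple \<Rightarrow> ('o, 'm, 'p, 'n) fnc \<Rightarrow> bool" where
  "triple_equivalence P P' G \<longleftrightarrow> is_triple P \<and> is_triple P' \<and>
    (case P of (C, U, s) \<Rightarrow> case P' of (C', U', s') \<Rightarrow>
      cat_equivalence C C' G \<and> isomorphic_in C' (fo G U) U' \<and>
      naturally_isomorphic C C' (G \<circ>\<^sub>F s) (s' \<circ>\<^sub>F G))"

definition triple_equivalent ::
  "('o, 'm) triple \<Rightarrow> ('p, 'n) triple \<Rightarrow> bool" (infix \<open>\<simeq>\<^sub>T\<close> 50) where
  "P \<simeq>\<^sub>T P' \<longleftrightarrow> (\<exists>G. triple_equivalence P P' G)"


section \<open>Graded algebras and Zhang twists\<close>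

text \<open>\<open>D\<close> is a \<open>\<int>\<close>-grading of the abelian group \<open>G\<close>: \<open>G\<close> is the internal direct sum of the
  subgroups \<open>D n\<close>.\<close>

definition graded_by :: "('u, 'x) ring_scheme \<Rightarrow> (int \<Rightarrow> 'u set) \<Rightarrow> bool" where
  "graded_by G D \<longleftrightarrow> (\<forall>n. additive_subgroup (D n) G) \<and>
    (\<forall>x\<in>carrier G. \<exists>!c. (\<forall>n. c n \<in> D n) \<and> finite {n. c n \<noteq> \<zero>\<^bsub>G\<^esub>} \<and>
        x = (\<Oplus>\<^bsub>G\<^esub>n\<in>{n. c n \<noteq> \<zero>\<^bsub>G\<^esub>}. c n))"

text \<open>The homogeneous component of degree \<open>n\<close> of \<open>x\<close>.\<close>

definition hpart :: "('u, 'x) ring_scheme \<Rightarrow> (int \<Rightarrow> 'u set) \<Rightarrow> int \<Rightarrow> 'u \<Rightarrow> 'u" where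
  "hpart G D n x = (THE c. (\<forall>n. c n \<in> D n) \<and> finite {n. c n \<noteq> \<zero>\<^bsub>G\<^esub>} \<and>
        x = (\<Oplus>\<^bsub>G\<^esub>n\<in>{n. c n \<noteq> \<zero>\<^bsub>G\<^esub>}. c n)) n"

record ('k, 'u) galgebra = "('k, 'u) module" +
  homog :: "int \<Rightarrow> 'u set"

text \<open>The library locale \<open>algebra\<close> is restricted to commutative rings.\<close>

definition graded_algebra :: "('k, 'x) ring_scheme \<Rightarrow> ('k, 'u) galgebra \<Rightarrow> bool" where
  "graded_algebra K A \<longleftrightarrow> field K \<and> ring A \<and> module K A \<and>
    (\<forall>k\<in>carrier K. \<forall>a\<in>carrier A. \<forall>b\<in>carrier A.
       (k \<odot>\<^bsub>A\<^esub> a) \<otimes>\<^bsub>A\<^esub> b = k \<odot>\<^bsub>A\<^esub> (a \<otimes>\<^bsub>A\<^esub> b) \<and> a \<otimes>\<^bsub>A\<^esub> (k \<odot>\<^bsub>A\<^esub> b) = k \<odot>\<^bsub>A\<^esub> (a \<otimes>\<^bsub>A\<^esub> b)) \<and>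
    graded_by A (homog A) \<and>
    (\<forall>n. \<forall>k\<in>carrier K. \<forall>a\<in>homog A n. k \<odot>\<^bsub>A\<^esub> a \<in> homog A n) \<and>
    \<one>\<^bsub>A\<^esub> \<in> homog A 0 \<and>
    (\<forall>n m. \<forall>a\<in>homog A n. \<forall>b\<in>homog A m. a \<otimes>\<^bsub>A\<^esub> b \<in> homog A (n + m))"

definition graded_subspace ::
  "('k, 'x) ring_scheme \<Rightarrow> ('k, 'u) galgebra \<Rightarrow> 'u set \<Rightarrow> bool" where
  "graded_subspace K A S \<longleftrightarrow> additive_subgroup S A \<and>
    (\<forall>k\<in>carrier K. \<forall>a\<in>S. k \<odot>\<^bsub>A\<^esub> a \<in> S) \<and>
    (\<forall>a\<in>S. \<forall>n. hpart A (homog A) n a \<in> S)"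

definition graded_automorphism ::
  "('k, 'x) ring_scheme \<Rightarrow> ('k, 'u) galgebra \<Rightarrow> ('u \<Rightarrow> 'u) \<Rightarrow> bool" where
  "graded_automorphism K A \<sigma> \<longleftrightarrow> \<sigma> \<in> ring_iso A A \<and>
    (\<forall>k\<in>carrier K. \<forall>a\<in>carrier A. \<sigma> (k \<odot>\<^bsub>A\<^esub> a) = k \<odot>\<^bsub>A\<^esub> \<sigma> a) \<and>
    (\<forall>n. \<sigma> ` homog A n = homog A n)"

text \<open>\<open>\<sigma>\<^sup>n\<close> for an integer \<open>n\<close>.\<close>

definition zpower :: "('u, 'x) ring_scheme \<Rightarrow> ('u \<Rightarrow> 'u) \<Rightarrow> int \<Rightarrow> 'u \<Rightarrow> 'u" where
  "zpower A \<sigma> n = (if 0 \<le> n then \<sigma> ^^ nat n else inv_into (carrier A) \<sigma> ^^ nat (- n))"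

text \<open>The additive extension of \<open>a \<star> b = a \<sigma>\<^sup>m(b)\<close> for \<open>a\<close> homogeneous of degree \<open>m\<close>.\<close>

definition zhang_twist :: "('k, 'u) galgebra \<Rightarrow> ('u \<Rightarrow> 'u) \<Rightarrow> ('k, 'u) galgebra" where
  "zhang_twist A \<sigma> = A\<lparr>monoid.mult := (\<lambda>a b.
     \<Oplus>\<^bsub>A\<^esub>m\<in>{m. hpart A (homog A) m a \<noteq> \<zero>\<^bsub>A\<^esub>}. hpart A (homog A) m a \<otimes>\<^bsub>A\<^esub> zpower A \<sigma> m b)\<rparr>"

text \<open>The library's \<open>ideal_prod\<close>, written as an infix dot, is the additive span of the products;
  its definition makes sense for arbitrary subsets.\<close>

definition strongly_graded :: "('k, 'x) ring_scheme \<Rightarrow> ('k, 'u) galgebra \<Rightarrow> bool" where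
  "strongly_graded K A \<longleftrightarrow> graded_algebra K A \<and>
    (\<forall>n m. homog A n \<cdot>\<^bsub>A\<^esub> homog A m = homog A (n + m))"

definition nonzero_degrees :: "('k, 'u) galgebra \<Rightarrow> 'u set" where
  "nonzero_degrees A =
    {\<Oplus>\<^bsub>A\<^esub>n\<in>S. c n | c S. finite S \<and> 0 \<notin> S \<and> (\<forall>n\<in>S. c n \<in> homog A n)}"

definition ideal_I :: "('k, 'u) galgebra \<Rightarrow> 'u set" where
  "ideal_I A = (carrier A \<cdot>\<^bsub>A\<^esub> nonzero_degrees A) \<cdot>\<^bsub>A\<^esub> carrier A"

definition deg0 :: "('k, 'u) galgebra \<Rightarrow> ('k, 'u) module" where
  "deg0 A = \<lparr>carrier = homog A 0, monoid.mult = monoid.mult A, monoid.one = monoid.one A,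
             ring.zero = ring.zero A, ring.add = ring.add A, smult = smult A\<rparr>"

text \<open>Equality of algebras: the operations need only agree on the carrier.\<close>

definition same_algebra ::
  "('k, 'x) ring_scheme \<Rightarrow> ('k, 'u) module \<Rightarrow> ('k, 'u) module \<Rightarrow> bool" where
  "same_algebra K B B' \<longleftrightarrow> carrier B = carrier B' \<and> \<zero>\<^bsub>B\<^esub> = \<zero>\<^bsub>B'\<^esub> \<and> \<one>\<^bsub>B\<^esub> = \<one>\<^bsub>B'\<^esub> \<and>
    (\<forall>a\<in>carrier B. \<forall>b\<in>carrier B. a \<oplus>\<^bsub>B\<^esub> b = a \<oplus>\<^bsub>B'\<^esub> b \<and> a \<otimes>\<^bsub>B\<^esub> b = a \<otimes>\<^bsub>B'\<^esub> b) \<and>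
    (\<forall>k\<in>carrier K. \<forall>a\<in>carrier B. k \<odot>\<^bsub>B\<^esub> a = k \<odot>\<^bsub>B'\<^esub> a)"


section \<open>Module categories\<close>

text \<open>As for the library's modules, the fields \<open>mult\<close> and \<open>one\<close> of a right module are unused.
  \<open>ract M m a\<close> is \<open>m a\<close>.\<close>

record ('a, 'm) rmod = "'m ring" +
  ract :: "'m \<Rightarrow> 'a \<Rightarrow> 'm"

record ('a, 'm) gmod = "('a, 'm) rmod" +
  gr :: "int \<Rightarrow> 'm set"

definition rmodule :: "('a, 'x) ring_scheme \<Rightarrow> ('a, 'm, 'y) rmod_scheme \<Rightarrow> bool" where
  "rmodule R M \<longleftrightarrow> ring R \<and> abelian_group M \<and>
    (\<forall>m\<in>carrier M. \<forall>a\<in>carrier R. ract M m a \<in> carrier M) \<and>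
    (\<forall>m\<in>carrier M. \<forall>m'\<in>carrier M. \<forall>a\<in>carrier R.
       ract M (m \<oplus>\<^bsub>M\<^esub> m') a = ract M m a \<oplus>\<^bsub>M\<^esub> ract M m' a) \<and>
    (\<forall>m\<in>carrier M. \<forall>a\<in>carrier R. \<forall>b\<in>carrier R.
       ract M m (a \<oplus>\<^bsub>R\<^esub> b) = ract M m a \<oplus>\<^bsub>M\<^esub> ract M m b \<and>
       ract M m (a \<otimes>\<^bsub>R\<^esub> b) = ract M (ract M m a) b) \<and>
    (\<forall>m\<in>carrier M. ract M m \<one>\<^bsub>R\<^esub> = m)"

definition graded_rmodule :: "('k, 'a) galgebra \<Rightarrow> ('a, 'm) gmod \<Rightarrow> bool" where
  "graded_rmodule A M \<longleftrightarrow> rmodule A M \<and> graded_by M (gr M) \<and>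
    (\<forall>n k. \<forall>m\<in>gr M n. \<forall>a\<in>homog A k. ract M m a \<in> gr M (n + k))"

definition rhom :: "('a, 'x) ring_scheme \<Rightarrow> ('a, 'm, 'y) rmod_scheme \<Rightarrow>
    ('a, 'n, 'z) rmod_scheme \<Rightarrow> ('m \<Rightarrow> 'n) set" where
  "rhom R M N = {f \<in> carrier M \<rightarrow>\<^sub>E carrier N.
    (\<forall>x\<in>carrier M. \<forall>y\<in>carrier M. f (x \<oplus>\<^bsub>M\<^esub> y) = f x \<oplus>\<^bsub>N\<^esub> f y) \<and>
    (\<forall>x\<in>carrier M. \<forall>a\<in>carrier R. f (ract M x a) = ract N (f x) a)}"

definition ghom :: "('k, 'a) galgebra \<Rightarrow> ('a, 'm) gmod \<Rightarrow> ('a, 'n) gmod \<Rightarrow> ('m \<Rightarrow> 'n) set" where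
  "ghom A M N = {f \<in> rhom A M N. \<forall>n. f ` gr M n \<subseteq> gr N n}"

text \<open>The type \<open>'u\<close> plays the role of the universe: all rings and modules have carriers in \<open>'u\<close>,
  and those of cardinality less than \<open>|'u|\<close> are the small ones. If \<open>|'u|\<close> is strongly
  inaccessible, these are up to isomorphism the modules in a Grothendieck universe; if it is
  the successor of \<open>\<kappa>\<close>, they are the modules of cardinality at most \<open>\<kappa>\<close>.\<close>

definition small :: "'u set \<Rightarrow> bool" where
  "small S \<longleftrightarrow> |S| <o |UNIV :: 'u set|"

definition RMod :: "('u, 'x) ring_scheme \<Rightarrow> (('u, 'u) rmod, 'u \<Rightarrow> 'u) cat" where
  "RMod R = \<lparr>Ob = {M. rmodule R M \<and> small (carrier M)},
            Hom = rhom R,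
            Idt = (\<lambda>M. \<lambda>x\<in>carrier M. x),
            Cmp = (\<lambda>L M N g f. compose (carrier L) g f)\<rparr>"

definition Gr :: "('k, 'u) galgebra \<Rightarrow> (('u, 'u) gmod, 'u \<Rightarrow> 'u) cat" where
  "Gr A = \<lparr>Ob = {M. graded_rmodule A M \<and> small (carrier M)},
           Hom = ghom A,
           Idt = (\<lambda>M. \<lambda>x\<in>carrier M. x),
           Cmp = (\<lambda>L M N g f. compose (carrier L) g f)\<rparr>"

definition reg_rmod :: "('u, 'x) ring_scheme \<Rightarrow> ('u, 'u) rmod" where
  "reg_rmod R = \<lparr>carrier = carrier R, monoid.mult = undefined, monoid.one = undefined,
                 ring.zero = ring.zero R, ring.add = ring.add R, ract = monoid.mult R\<rparr>"

definition reg_gmod :: "('k, 'u) galgebra \<Rightarrow> ('u, 'u) gmod" where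
  "reg_gmod A = \<lparr>carrier = carrier A, monoid.mult = undefined, monoid.one = undefined,
                 ring.zero = ring.zero A, ring.add = ring.add A, ract = monoid.mult A, gr = homog A\<rparr>"

definition shift :: "(('a, 'm) gmod, 'm \<Rightarrow> 'm, ('a, 'm) gmod, 'm \<Rightarrow> 'm) fnc" where
  "shift = \<lparr>fo = (\<lambda>M. M\<lparr>gr := (\<lambda>n. gr M (n + 1))\<rparr>), fm = (\<lambda>M N f. f)\<rparr>"

definition zhang_functor :: "('k, 'u) galgebra \<Rightarrow> ('u \<Rightarrow> 'u) \<Rightarrow>
    (('u, 'u) gmod, 'u \<Rightarrow> 'u, ('u, 'u) gmod, 'u \<Rightarrow> 'u) fnc" where
  "zhang_functor A \<sigma> =
    \<lparr>fo = (\<lambda>M. M\<lparr>ract := (\<lambda>m a.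
       \<Oplus>\<^bsub>M\<^esub>n\<in>{n. hpart M (gr M) n m \<noteq> \<zero>\<^bsub>M\<^esub>}. ract M (hpart M (gr M) n m) (zpower A \<sigma> n a))\<rparr>),
     fm = (\<lambda>M N f. f)\<rparr>"

text \<open>\<open>M \<mapsto> M\<^sub>0\<close>. The action is cut down to \<open>M\<^sub>0 \<times> A\<^sub>0\<close>, so that the record does not
  remember the action of the rest of \<open>A\<close> and equality of functors into \<open>RMod (deg0 A)\<close> is
  meaningful.\<close>

definition deg0_functor :: "('k, 'u) galgebra \<Rightarrow>
    (('u, 'u) gmod, 'u \<Rightarrow> 'u, ('u, 'u) rmod, 'u \<Rightarrow> 'u) fnc" where
  "deg0_functor A =
    \<lparr>fo = (\<lambda>M. \<lparr>carrier = gr M 0, monoid.mult = undefined, monoid.one = undefined,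
                ring.zero = ring.zero M, ring.add = ring.add M,
                ract = (\<lambda>m\<in>gr M 0. \<lambda>a\<in>homog A 0. ract M m a)\<rparr>),
     fm = (\<lambda>M N f. restrict f (gr M 0))\<rparr>"

definition pullback :: "('u \<Rightarrow> 'u) \<Rightarrow>
    (('u, 'u) rmod, 'u \<Rightarrow> 'u, ('u, 'u) rmod, 'u \<Rightarrow> 'u) fnc" where
  "pullback \<rho> = \<lparr>fo = (\<lambda>N. N\<lparr>ract := (\<lambda>x b. ract N x (\<rho> b))\<rparr>), fm = (\<lambda>N N' f. f)\<rparr>"


section \<open>The functor of tensoring with the degree one part\<close>

text \<open>\<open>N \<otimes> A\<^sub>1\<close> over \<open>A\<^sub>0\<close>: the free abelian group on \<open>N \<times> A\<^sub>1\<close> modulo the biadditivity and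
  balancing relations, with right action \<open>(x \<otimes> b) a = x \<otimes> b a\<close>.\<close>

definition tensor_free :: "('k, 'u) galgebra \<Rightarrow> ('u, 'u) rmod \<Rightarrow> ('u \<times> 'u \<Rightarrow>\<^sub>0 int) monoid" where
  "tensor_free A N = free_Abelian_group (carrier N \<times> homog A 1)"

definition tensor_rel :: "('k, 'u) galgebra \<Rightarrow> ('u, 'u) rmod \<Rightarrow> ('u \<times> 'u \<Rightarrow>\<^sub>0 int) set" where
  "tensor_rel A N = generate (tensor_free A N)
    ({frag_of (x \<oplus>\<^bsub>N\<^esub> y, b) - frag_of (x, b) - frag_of (y, b) | x y b.
        x \<in> carrier N \<and> y \<in> carrier N \<and> b \<in> homog A 1} \<union>
     {frag_of (x, b \<oplus>\<^bsub>A\<^esub> c) - frag_of (x, b) - frag_of (x, c) | x b c.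
        x \<in> carrier N \<and> b \<in> homog A 1 \<and> c \<in> homog A 1} \<union>
     {frag_of (ract N x r, b) - frag_of (x, r \<otimes>\<^bsub>A\<^esub> b) | x r b.
        x \<in> carrier N \<and> r \<in> homog A 0 \<and> b \<in> homog A 1})"

definition tensor_mod :: "('k, 'u) galgebra \<Rightarrow> ('u, 'u) rmod \<Rightarrow> ('u, ('u \<times> 'u \<Rightarrow>\<^sub>0 int) set) rmod"
  where "tensor_mod A N =
    \<lparr>carrier = carrier (tensor_free A N Mod tensor_rel A N),
     monoid.mult = undefined, monoid.one = undefined,
     ring.zero = monoid.one (tensor_free A N Mod tensor_rel A N),
     ring.add = monoid.mult (tensor_free A N Mod tensor_rel A N),
     ract = (\<lambda>C a. \<Union>c\<in>C. tensor_rel A N #>\<^bsub>tensor_free A N\<^esub>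
                          frag_extend (\<lambda>(x, b). frag_of (x, b \<otimes>\<^bsub>A\<^esub> a)) c)\<rparr>"

definition tensor_map :: "('k, 'u) galgebra \<Rightarrow> ('u, 'u) rmod \<Rightarrow> ('u, 'u) rmod \<Rightarrow> ('u \<Rightarrow> 'u) \<Rightarrow>
    ('u \<times> 'u \<Rightarrow>\<^sub>0 int) set \<Rightarrow> ('u \<times> 'u \<Rightarrow>\<^sub>0 int) set" where
  "tensor_map A N N' f = (\<lambda>C\<in>carrier (tensor_mod A N).
     \<Union>c\<in>C. tensor_rel A N' #>\<^bsub>tensor_free A N'\<^esub> frag_extend (\<lambda>(x, b). frag_of (f x, b)) c)"

text \<open>The elements of this module are not in \<open>'u\<close>, so it is replaced by an isomorphic copy.\<close>

definition copy_map :: "('a, 'm) rmod \<Rightarrow> 'm \<Rightarrow> 'u" where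
  "copy_map M = (SOME e. inj_on e (carrier M))"

definition uncopy_map :: "('a, 'm) rmod \<Rightarrow> 'u \<Rightarrow> 'm" where
  "uncopy_map M = inv_into (carrier M) (copy_map M)"

definition copy_mod :: "('a, 'm) rmod \<Rightarrow> ('a, 'u) rmod" where
  "copy_mod M = \<lparr>carrier = copy_map M ` carrier M, monoid.mult = undefined, monoid.one = undefined,
     ring.zero = copy_map M \<zero>\<^bsub>M\<^esub>,
     ring.add = (\<lambda>x y. copy_map M (uncopy_map M x \<oplus>\<^bsub>M\<^esub> uncopy_map M y)),
     ract = (\<lambda>x a. copy_map M (ract M (uncopy_map M x) a))\<rparr>"

definition tensor_functor :: "('k, 'u) galgebra \<Rightarrow>
    (('u, 'u) rmod, 'u \<Rightarrow> 'u, ('u, 'u) rmod, 'u \<Rightarrow> 'u) fnc" where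
  "tensor_functor A =
    \<lparr>fo = (\<lambda>N. copy_mod (tensor_mod A N)),
     fm = (\<lambda>N N' f. \<lambda>x\<in>carrier (copy_mod (tensor_mod A N)).
             copy_map (tensor_mod A N') (tensor_map A N N' f (uncopy_map (tensor_mod A N) x)))\<rparr>"


section \<open>Localizing subcategories and Gabriel quotients\<close>

definition is_direct_sum :: "('k, 'u) galgebra \<Rightarrow> 'u set \<Rightarrow> ('u \<Rightarrow> ('u, 'u) gmod) \<Rightarrow>
    ('u, 'u) gmod \<Rightarrow> ('u \<Rightarrow> 'u \<Rightarrow> 'u) \<Rightarrow> bool" where
  "is_direct_sum A J Y S \<iota> \<longleftrightarrow> (\<forall>j\<in>J. \<iota> j \<in> ghom A (Y j) S) \<and>
    (\<forall>x\<in>carrier S. \<exists>!c. c \<in> (\<Pi>\<^sub>E j\<in>J. carrier (Y j)) \<and> finite {j\<in>J. c j \<noteq> \<zero>\<^bsub>Y j\<^esub>} \<and>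
        x = (\<Oplus>\<^bsub>S\<^esub>j\<in>{j\<in>J. c j \<noteq> \<zero>\<^bsub>Y j\<^esub>}. \<iota> j (c j)))"

text \<open>Closed under subobjects, quotients, extensions and (small) direct sums.\<close>

definition localizing :: "('k, 'u) galgebra \<Rightarrow> ('u, 'u) gmod set \<Rightarrow> bool" where
  "localizing A T \<longleftrightarrow> T \<subseteq> Ob (Gr A) \<and>
    (\<forall>M\<in>T. \<forall>N\<in>Ob (Gr A). \<forall>f\<in>ghom A N M. inj_on f (carrier N) \<longrightarrow> N \<in> T) \<and>
    (\<forall>M\<in>T. \<forall>N\<in>Ob (Gr A). \<forall>f\<in>ghom A M N. f ` carrier M = carrier N \<longrightarrow> N \<in> T) \<and>
    (\<forall>L\<in>T. \<forall>N\<in>T. \<forall>M\<in>Ob (Gr A). \<forall>f\<in>ghom A L M. \<forall>g\<in>ghom A M N.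
       inj_on f (carrier L) \<and> f ` carrier L = {x\<in>carrier M. g x = \<zero>\<^bsub>N\<^esub>} \<and>
       g ` carrier M = carrier N \<longrightarrow> M \<in> T) \<and>
    (\<forall>J Y \<iota>. \<forall>S\<in>Ob (Gr A). small J \<and> (\<forall>j\<in>J. Y j \<in> T) \<and> is_direct_sum A J Y S \<iota> \<longrightarrow> S \<in> T)"

definition Tors :: "('k, 'u) galgebra \<Rightarrow> ('u, 'u) gmod set" where
  "Tors A = \<Inter> {T. localizing A T \<and>
    {M\<in>Ob (Gr A). \<forall>m\<in>carrier M. \<forall>a\<in>ideal_I A. ract M m a = \<zero>\<^bsub>M\<^esub>} \<subseteq> T}"

text \<open>Graded submodules, given by their underlying sets, and graded quotient modules.\<close>

definition gsubmodule :: "('k, 'a) galgebra \<Rightarrow> ('a, 'm) gmod \<Rightarrow> 'm set \<Rightarrow> bool" where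
  "gsubmodule A M S \<longleftrightarrow> additive_subgroup S M \<and>
    (\<forall>x\<in>S. \<forall>a\<in>carrier A. ract M x a \<in> S) \<and>
    (\<forall>x\<in>S. \<forall>n. hpart M (gr M) n x \<in> S)"

definition gsub :: "('a, 'm) gmod \<Rightarrow> 'm set \<Rightarrow> ('a, 'm) gmod" where
  "gsub M S = M\<lparr>carrier := S, gr := (\<lambda>n. gr M n \<inter> S)\<rparr>"

definition gquot :: "('a, 'm) gmod \<Rightarrow> 'm set \<Rightarrow> ('a, 'm set) gmod" where
  "gquot M S = \<lparr>carrier = a_rcosets\<^bsub>M\<^esub> S, monoid.mult = undefined, monoid.one = undefined,
     ring.zero = S, ring.add = set_add M,
     ract = (\<lambda>C a. \<Union>x\<in>C. S +>\<^bsub>M\<^esub> ract M x a),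
     gr = (\<lambda>n. (\<lambda>x. S +>\<^bsub>M\<^esub> x) ` gr M n)\<rparr>"

text \<open>\<open>M'\<close> is a graded submodule of \<open>M\<close> with \<open>M/M'\<close> torsion, respectively a torsion graded
  submodule of \<open>N\<close>. As the elements of \<open>M/M'\<close> are not in \<open>'u\<close>, \<open>M/M' \<in> Tors A\<close> is
  expressed up to isomorphism.\<close>

definition cotorsion_sub :: "('k, 'u) galgebra \<Rightarrow> ('u, 'u) gmod \<Rightarrow> 'u set \<Rightarrow> bool" where
  "cotorsion_sub A M M' \<longleftrightarrow> gsubmodule A M M' \<and>
    (\<exists>Q\<in>Tors A. \<exists>\<phi>\<in>ghom A (gquot M M') Q. bij_betw \<phi> (carrier (gquot M M')) (carrier Q))"

definition torsion_sub :: "('k, 'u) galgebra \<Rightarrow> ('u, 'u) gmod \<Rightarrow> 'u set \<Rightarrow> bool" where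
  "torsion_sub A N N' \<longleftrightarrow> gsubmodule A N N' \<and> gsub N N' \<in> Tors A"

text \<open>Gabriel's construction: \<open>Hom(\<pi> M, \<pi> N)\<close> is the filtered colimit of the groups
  \<open>Hom(M', N/N')\<close> over the submodules \<open>M'\<close> of \<open>M\<close> with \<open>M/M'\<close> torsion and the torsion
  submodules \<open>N'\<close> of \<open>N\<close>. A representative is a triple \<open>(M', N', f)\<close>, where the values of
  \<open>f\<close> are cosets of \<open>N'\<close>; two triples are identified if they induce the same map
  \<open>M'' \<rightarrow> N/N''\<close> for some smaller \<open>M''\<close> and larger \<open>N''\<close>.\<close>

type_synonym 'u qrep = "'u set \<times> 'u set \<times> ('u \<Rightarrow> 'u set)"

definition qreps :: "('k, 'u) galgebra \<Rightarrow> ('u, 'u) gmod \<Rightarrow> ('u, 'u) gmod \<Rightarrow> 'u qrep set" where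
  "qreps A M N = {(M', N', f). cotorsion_sub A M M' \<and> torsion_sub A N N' \<and>
     f \<in> ghom A (gsub M M') (gquot N N')}"

definition qrel ::
  "('k, 'u) galgebra \<Rightarrow> ('u, 'u) gmod \<Rightarrow> ('u, 'u) gmod \<Rightarrow> ('u qrep \<times> 'u qrep) set" where
  "qrel A M N = {((M1, N1, f1), (M2, N2, f2)).
     (M1, N1, f1) \<in> qreps A M N \<and> (M2, N2, f2) \<in> qreps A M N \<and>
     (\<exists>M'' N''. cotorsion_sub A M M'' \<and> torsion_sub A N N'' \<and>
        M'' \<subseteq> M1 \<inter> M2 \<and> N1 \<union> N2 \<subseteq> N'' \<and>
        (\<forall>m\<in>M''. f1 m <+>\<^bsub>N\<^esub> N'' = f2 m <+>\<^bsub>N\<^esub> N''))}"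

text \<open>The composite of \<open>f : M' \<rightarrow> N/N'\<close> and \<open>g : N\<^sub>1 \<rightarrow> P/P\<^sub>1\<close>: it is defined on the
  preimage under \<open>f\<close> of \<open>(N\<^sub>1 + N')/N' \<cong> N\<^sub>1/(N\<^sub>1 \<inter> N')\<close>, and takes values in \<open>P\<close> modulo the
  submodule containing \<open>P\<^sub>1\<close> which is the image of \<open>N\<^sub>1 \<inter> N'\<close> under \<open>g\<close>.\<close>

definition qrep_comp :: "'u qrep \<Rightarrow> 'u qrep \<Rightarrow> 'u qrep" where
  "qrep_comp = (\<lambda>(N1, P1, g) (M', N', f).
     ({m\<in>M'. f m \<inter> N1 \<noteq> {}},
      \<Union>n\<in>N1 \<inter> N'. g n,
      \<lambda>m\<in>{m\<in>M'. f m \<inter> N1 \<noteq> {}}. \<Union>n\<in>f m \<inter> N1. g n))"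

definition rep_of :: "('u, 'u) gmod \<Rightarrow> ('u, 'u) gmod \<Rightarrow> ('u \<Rightarrow> 'u) \<Rightarrow> 'u qrep" where
  "rep_of M N f = (carrier M, {\<zero>\<^bsub>N\<^esub>}, \<lambda>m\<in>carrier M. {\<zero>\<^bsub>N\<^esub>} +>\<^bsub>N\<^esub> f m)"

definition QGr :: "('k, 'u) galgebra \<Rightarrow> (('u, 'u) gmod, 'u qrep set) cat" where
  "QGr A = \<lparr>Ob = Ob (Gr A),
     Hom = (\<lambda>M N. qreps A M N // qrel A M N),
     Idt = (\<lambda>M. qrel A M M `` {rep_of M M (\<lambda>x\<in>carrier M. x)}),
     Cmp = (\<lambda>M N P d c. qrel A M P `` {qrep_comp u t | u t. u \<in> d \<and> t \<in> c})\<rparr>"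

definition quot_functor :: "('k, 'u) galgebra \<Rightarrow>
    (('u, 'u) gmod, 'u \<Rightarrow> 'u, ('u, 'u) gmod, 'u qrep set) fnc" where
  "quot_functor A = \<lparr>fo = (\<lambda>M. M), fm = (\<lambda>M N f. qrel A M N `` {rep_of M N f})\<rparr>"

text \<open>The functor between the quotient categories induced by a functor \<open>H\<close> that, like the shift
  and Zhang's functor, changes neither the underlying sets nor the underlying maps: applying \<open>H\<close> to
  a representative \<open>(M', N', f)\<close> yields the same triple, as a representative of a morphism
  \<open>H M \<rightarrow> H N\<close>.\<close>

definition induced :: "('k, 'u) galgebra \<Rightarrow>
    (('u, 'u) gmod, 'u \<Rightarrow> 'u, ('u, 'u) gmod, 'u \<Rightarrow> 'u) fnc \<Rightarrow>
    (('u, 'u) gmod, 'u qrep set, ('u, 'u) gmod, 'u qrep set) fnc" where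
  "induced B H = \<lparr>fo = fo H, fm = (\<lambda>M N c. qrel B (fo H M) (fo H N) `` c)\<rparr>"

definition nc_proj :: "('k, 'u) galgebra \<Rightarrow> (('u, 'u) gmod, 'u qrep set) triple" where
  "nc_proj A = (QGr A, fo (quot_functor A) (reg_gmod A), induced A shift)"

end

(* I_A is the additive span of the products a d b with a, d, b homogeneous and d of nonzero degree.
   As sigma permutes each homogeneous component, these products span the same group for A and for the twist.

   A morphism from M to N in the quotient category is a class of graded submodules R of M x N such that
   the domain of R has torsion quotient and the elements related to 0 form a torsion module;
   composition of morphisms is composition of relations. Zhang's functor and the shift preserve underlying
   groups and graded submodules, hence also torsion, and act on such relations as the identity.

   If A is strongly graded, then 1 is a sum of products u v with u and v of degrees -n and n. Hence
   torsion modules vanish, a graded module is determined by its part of degree 0, the quasi-inverse of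
   M |-> M_0 is coinduction N |-> (+)_n Hom(A_-n, N), and multiplication M_0 (x) A_1 -> M_1 is bijective.
   The tensor products N (x) A_1 for A and for the twist have the same generators and relations;
   only the right action changes, by sigma, because b * a = b sigma(a) for b of degree 1. *)
theory Submission imports Defs begin

section \<open>Functors and equivalences of categories\<close>

text \<open>Gabriel's composite of representatives passes through preimages and images of
  submodules, and the quotient modules involved have sets as elements, outside the universe
  \<open>'u\<close>. Relations avoid both obstacles: preimage, image, kernel and quotient become
  composites of sets of pairs, and \<open>T/S\<close> is named by any module \<open>Q\<close> in
  \<open>'u\<close> together with a relation from \<open>M\<close> to \<open>Q\<close>. One torsion
  lemma, that a relation carries torsion subquotients to torsion subquotients, then yields
  composition of morphisms and its invariance.

  Functors between categories of records are seldom inverse on the nose. Untwisting a twist restores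
  the action only on the carrier, so the round trip is compared through the identity relation. A
  degree zero part, by contrast, has its action cut down, and there equality of functors holds
  literally.

  That the universe is uncountable enters through finite sums: elements of coinduced modules and of
  tensor products are coded by lists, and lists over small sets have to remain fewer than the
  elements of the universe.\<close>

lemma category_idt: "category C \<Longrightarrow> x \<in> Ob C \<Longrightarrow> Idt C x \<in> Hom C x x"
  by (simp add: category_def)

lemma category_cmp:
  "category C \<Longrightarrow> x \<in> Ob C \<Longrightarrow> y \<in> Ob C \<Longrightarrow> z \<in> Ob C \<Longrightarrow> f \<in> Hom C x y \<Longrightarrow> g \<in> Hom C y z
    \<Longrightarrow> Cmp C x y z g f \<in> Hom C x z"
  by (simp add: category_def)

lemma category_idr:
  "category C \<Longrightarrow> x \<in> Ob C \<Longrightarrow> y \<in> Ob C \<Longrightarrow> f \<in> Hom C x y \<Longrightarrow> Cmp C x x y f (Idt C x) = f"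
  by (simp add: category_def)

lemma category_idl:
  "category C \<Longrightarrow> x \<in> Ob C \<Longrightarrow> y \<in> Ob C \<Longrightarrow> f \<in> Hom C x y \<Longrightarrow> Cmp C x y y (Idt C y) f = f"
  by (simp add: category_def)

lemma category_assoc:
  "category C \<Longrightarrow> w \<in> Ob C \<Longrightarrow> x \<in> Ob C \<Longrightarrow> y \<in> Ob C \<Longrightarrow> z \<in> Ob C \<Longrightarrow> f \<in> Hom C w x
    \<Longrightarrow> g \<in> Hom C x y \<Longrightarrow> h \<in> Hom C y z
    \<Longrightarrow> Cmp C w x z (Cmp C x y z h g) f = Cmp C w y z h (Cmp C w x y g f)"
  by (simp add: category_def)

lemmas category_laws = category_idt category_cmp category_idr category_idl

lemma is_functorD:
  assumes "is_functor C D F"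
  shows "category C" "category D"
    "\<And>x. x \<in> Ob C \<Longrightarrow> fo F x \<in> Ob D"
    "\<And>x y f. x \<in> Ob C \<Longrightarrow> y \<in> Ob C \<Longrightarrow> f \<in> Hom C x y \<Longrightarrow> fm F x y f \<in> Hom D (fo F x) (fo F y)"
    "\<And>x. x \<in> Ob C \<Longrightarrow> fm F x x (Idt C x) = Idt D (fo F x)"
    "\<And>x y z f g. x \<in> Ob C \<Longrightarrow> y \<in> Ob C \<Longrightarrow> z \<in> Ob C \<Longrightarrow> f \<in> Hom C x y \<Longrightarrow> g \<in> Hom C y z \<Longrightarrow>
       fm F x z (Cmp C x y z g f) =
         Cmp D (fo F x) (fo F y) (fo F z) (fm F y z g) (fm F x y f)"
  using assms by (auto simp: is_functor_def)

lemma is_functorI: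
  assumes "category C" "category D"
    "\<And>x. x \<in> Ob C \<Longrightarrow> fo F x \<in> Ob D"
    "\<And>x y f. x \<in> Ob C \<Longrightarrow> y \<in> Ob C \<Longrightarrow> f \<in> Hom C x y \<Longrightarrow> fm F x y f \<in> Hom D (fo F x) (fo F y)"
    "\<And>x. x \<in> Ob C \<Longrightarrow> fm F x x (Idt C x) = Idt D (fo F x)"
    "\<And>x y z f g. x \<in> Ob C \<Longrightarrow> y \<in> Ob C \<Longrightarrow> z \<in> Ob C \<Longrightarrow> f \<in> Hom C x y \<Longrightarrow> g \<in> Hom C y z \<Longrightarrow>
       fm F x z (Cmp C x y z g f) =
         Cmp D (fo F x) (fo F y) (fo F z) (fm F y z g) (fm F x y f)"
  shows "is_functor C D F"
  using assms by (auto simp: is_functor_def)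

lemma id_functor_simps [simp]: "fo id_functor x = x" "fm id_functor x y = (\<lambda>f. f)"
  by (simp_all add: id_functor_def fun_eq_iff)

lemma fcomp_simps [simp]:
  "fo (G \<circ>\<^sub>F F) x = fo G (fo F x)"
  "fm (G \<circ>\<^sub>F F) x y = (\<lambda>f. fm G (fo F x) (fo F y) (fm F x y f))"
  by (simp_all add: fcomp_def)

lemma is_functor_id: "category C \<Longrightarrow> is_functor C C id_functor"
  by (rule is_functorI) auto

lemma is_functor_comp:
  assumes F: "is_functor C D F" and G: "is_functor D E G"
  shows "is_functor C E (G \<circ>\<^sub>F F)"
  by (rule is_functorI) (simp_all add: is_functorD[OF F] is_functorD[OF G])

section \<open>Mutually inverse arrows and isomorphic objects\<close>

text \<open>Both arrows are named because \<open>iso_arrow\<close> hides the inverse behind an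
  existential, while conjugation and functoriality arguments have to carry it along.\<close>

definition inverse_arrows :: "('o, 'm) cat \<Rightarrow> 'o \<Rightarrow> 'o \<Rightarrow> 'm \<Rightarrow> 'm \<Rightarrow> bool" where
  "inverse_arrows C x y f g \<longleftrightarrow> f \<in> Hom C x y \<and> g \<in> Hom C y x \<and>
     Cmp C x y x g f = Idt C x \<and> Cmp C y x y f g = Idt C y"

lemma iso_arrow_iff_inverse: "iso_arrow C x y f \<longleftrightarrow> (\<exists>g. inverse_arrows C x y f g)"
  by (auto simp: iso_arrow_def inverse_arrows_def)

lemma inverse_arrows_sym: "inverse_arrows C x y f g \<Longrightarrow> inverse_arrows C y x g f"
  by (auto simp: inverse_arrows_def)

lemma inverse_arrows_idt: "category C \<Longrightarrow> x \<in> Ob C \<Longrightarrow> inverse_arrows C x x (Idt C x) (Idt C x)"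
  by (simp add: inverse_arrows_def category_laws)

lemma cmp_cancel_left:
  assumes "category C" "w \<in> Ob C" "x \<in> Ob C" "y \<in> Ob C" "inverse_arrows C x y f g"
    and "h \<in> Hom C w x"
  shows "Cmp C w y x g (Cmp C w x y f h) = h"
  using assms unfolding inverse_arrows_def
  by (metis category_assoc category_idl)

lemma cmp_cancel_right:
  assumes "category C" "w \<in> Ob C" "x \<in> Ob C" "y \<in> Ob C" "inverse_arrows C x y f g"
    and "h \<in> Hom C y w"
  shows "Cmp C y x w (Cmp C x y w h f) g = h"
  using assms unfolding inverse_arrows_def
  by (metis category_assoc category_idr)

lemma inverse_arrows_comp:
  assumes C: "category C" "x \<in> Ob C" "y \<in> Ob C" "z \<in> Ob C"
    and f: "inverse_arrows C x y f f'" and g: "inverse_arrows C y z g g'"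
  shows "inverse_arrows C x z (Cmp C x y z g f) (Cmp C z y x f' g')"
proof -
  have h: "f \<in> Hom C x y" "f' \<in> Hom C y x" "g \<in> Hom C y z" "g' \<in> Hom C z y"
    using f g by (auto simp: inverse_arrows_def)
  have "Cmp C x z x (Cmp C z y x f' g') (Cmp C x y z g f) = Cmp C x y x f' (Cmp C x z y g' (Cmp C x y z g f))"
    using C h by (simp add: category_assoc category_cmp)
  also have "\<dots> = Idt C x"
    using cmp_cancel_left[OF C(1) C(2,3,4) g h(1)] f by (simp add: inverse_arrows_def)
  finally have 1: "Cmp C x z x (Cmp C z y x f' g') (Cmp C x y z g f) = Idt C x" .
  have "Cmp C z x z (Cmp C x y z g f) (Cmp C z y x f' g') = Cmp C z y z g (Cmp C z x y f (Cmp C z y x f' g'))"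
    using C h by (simp add: category_assoc category_cmp)
  also have "\<dots> = Idt C z"
    using cmp_cancel_left[OF C(1) C(4,3,2) inverse_arrows_sym[OF f] h(4)] g by (simp add: inverse_arrows_def)
  finally show ?thesis
    using 1 C h by (simp add: inverse_arrows_def category_cmp)
qed

lemma functor_inverse_arrows:
  assumes F: "is_functor C D F" and "x \<in> Ob C" "y \<in> Ob C" and fg: "inverse_arrows C x y f g"
  shows "inverse_arrows D (fo F x) (fo F y) (fm F x y f) (fm F y x g)"
  using assms(2,3) fg unfolding inverse_arrows_def
  by (metis (no_types, lifting) F is_functorD(4,5,6))

lemma isomorphic_in_iff:
  "isomorphic_in C x y \<longleftrightarrow> x \<in> Ob C \<and> y \<in> Ob C \<and> (\<exists>f g. inverse_arrows C x y f g)"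
  by (auto simp: isomorphic_in_def iso_arrow_iff_inverse)

lemma isomorphic_in_refl: "category C \<Longrightarrow> x \<in> Ob C \<Longrightarrow> isomorphic_in C x x"
  unfolding isomorphic_in_iff using inverse_arrows_idt by fast

lemma isomorphic_in_sym: "isomorphic_in C x y \<Longrightarrow> isomorphic_in C y x"
  unfolding isomorphic_in_iff using inverse_arrows_sym by fast

lemma isomorphic_in_trans:
  "category C \<Longrightarrow> isomorphic_in C x y \<Longrightarrow> isomorphic_in C y z \<Longrightarrow> isomorphic_in C x z"
  unfolding isomorphic_in_iff using inverse_arrows_comp by fast

lemma functor_isomorphic_in:
  "is_functor C D F \<Longrightarrow> isomorphic_in C x y \<Longrightarrow> isomorphic_in D (fo F x) (fo F y)"
  unfolding isomorphic_in_iff using functor_inverse_arrows is_functorD(3) by fast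

section \<open>Full faithfulness and essential surjectivity\<close>

text \<open>Equivalences below are recognized by this property and \<open>ess_surjective\<close>,
  which are tested on Hom-sets and objects separately, instead of by exhibiting a quasi-inverse with
  two natural isomorphisms.\<close>

definition fully_faithful ::
  "('o, 'm) cat \<Rightarrow> ('p, 'n) cat \<Rightarrow> ('o, 'm, 'p, 'n) fnc \<Rightarrow> bool" where
  "fully_faithful C D F \<longleftrightarrow>
    (\<forall>x\<in>Ob C. \<forall>y\<in>Ob C. bij_betw (fm F x y) (Hom C x y) (Hom D (fo F x) (fo F y)))"

definition ess_surjective ::
  "('o, 'm) cat \<Rightarrow> ('p, 'n) cat \<Rightarrow> ('o, 'm, 'p, 'n) fnc \<Rightarrow> bool" where
  "ess_surjective C D F \<longleftrightarrow> (\<forall>z\<in>Ob D. \<exists>x\<in>Ob C. isomorphic_in D (fo F x) z)"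

lemma fully_faithfulD:
  "fully_faithful C D F \<Longrightarrow> x \<in> Ob C \<Longrightarrow> y \<in> Ob C \<Longrightarrow>
    bij_betw (fm F x y) (Hom C x y) (Hom D (fo F x) (fo F y))"
  by (auto simp: fully_faithful_def)

text \<open>Sending \<open>h\<close> to \<open>j h i'\<close> is undone by sending it to
  \<open>j' h i\<close>.\<close>

lemma bij_betw_conjugation:
  assumes C: "category C" "x \<in> Ob C" "y \<in> Ob C" "x' \<in> Ob C" "y' \<in> Ob C"
    and i: "inverse_arrows C x x' i i'" and j: "inverse_arrows C y y' j j'"
  shows "bij_betw (\<lambda>h. Cmp C x' x y' (Cmp C x y y' j h) i') (Hom C x y) (Hom C x' y')"
proof (rule bij_betw_byWitness[where f' = "\<lambda>h. Cmp C x x' y (Cmp C x' y' y j' h) i"])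
  have ij: "i \<in> Hom C x x'" "i' \<in> Hom C x' x" "j \<in> Hom C y y'" "j' \<in> Hom C y' y"
    using i j by (auto simp: inverse_arrows_def)
  note rules = category_assoc category_cmp
  show "\<forall>h\<in>Hom C x y. Cmp C x x' y (Cmp C x' y' y j' (Cmp C x' x y' (Cmp C x y y' j h) i')) i = h"
  by (metis C ij cmp_cancel_left j rules cmp_cancel_right inverse_arrows_sym i)
  show "\<forall>h\<in>Hom C x' y'. Cmp C x' x y' (Cmp C x y y' j (Cmp C x x' y (Cmp C x' y' y j' h) i)) i' = h"
  by (metis C ij cmp_cancel_left inverse_arrows_sym j rules cmp_cancel_right i)
  show "(\<lambda>h. Cmp C x' x y' (Cmp C x y y' j h) i') ` Hom C x y \<subseteq> Hom C x' y'"
    "(\<lambda>h. Cmp C x x' y (Cmp C x' y' y j' h) i) ` Hom C x' y' \<subseteq> Hom C x y"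
    using C ij by (auto simp: category_cmp)
qed

text \<open>A functor turns conjugation by \<open>i\<close> and \<open>j\<close> into conjugation by
  their images. In the resulting commutative square three sides are bijections, hence so is the
  fourth.\<close>

lemma bij_betw_functor_transport:
  assumes F: "is_functor C D F"
    and C: "x \<in> Ob C" "y \<in> Ob C" "x' \<in> Ob C" "y' \<in> Ob C"
    and i: "inverse_arrows C x x' i i'" and j: "inverse_arrows C y y' j j'"
    and b: "bij_betw (fm F x y) (Hom C x y) (Hom D (fo F x) (fo F y))"
  shows "bij_betw (fm F x' y') (Hom C x' y') (Hom D (fo F x') (fo F y'))"
proof -
  note F' = is_functorD[OF F]
  let ?c = "\<lambda>h. Cmp C x' x y' (Cmp C x y y' j h) i'"
  let ?d = "\<lambda>h. Cmp D (fo F x') (fo F x) (fo F y') (Cmp D (fo F x) (fo F y) (fo F y') (fm F y y' j) h) (fm F x' x i')"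
  have c: "bij_betw ?c (Hom C x y) (Hom C x' y')"
    by (rule bij_betw_conjugation[OF F'(1) C i j])
  have d: "bij_betw ?d (Hom D (fo F x) (fo F y)) (Hom D (fo F x') (fo F y'))"
    by (rule bij_betw_conjugation[OF F'(2)])
      (use C F' functor_inverse_arrows[OF F] i j in auto)
  have ij: "i' \<in> Hom C x' x" "j \<in> Hom C y y'"
    using i j by (auto simp: inverse_arrows_def)
  have "bij_betw (?d \<circ> fm F x y) (Hom C x y) (Hom D (fo F x') (fo F y'))"
    using b d by (rule bij_betw_trans)
  moreover have "(?d \<circ> fm F x y) h = (fm F x' y' \<circ> ?c) h" if "h \<in> Hom C x y" for h
    using that ij C by (simp add: F' category_cmp)
  ultimately have "bij_betw (fm F x' y' \<circ> ?c) (Hom C x y) (Hom D (fo F x') (fo F y'))"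
    by (simp add: bij_betw_cong[of _ "?d \<circ> fm F x y" "fm F x' y' \<circ> ?c"])
  then show ?thesis
    using bij_betw_comp_iff[OF c] by blast
qed

section \<open>Calculus of natural isomorphisms\<close>

lemma naturally_isomorphicE:
  assumes "naturally_isomorphic C D F G"
  obtains \<eta> \<theta> where "is_functor C D F" "is_functor C D G"
    "\<And>x. x \<in> Ob C \<Longrightarrow> inverse_arrows D (fo F x) (fo G x) (\<eta> x) (\<theta> x)"
    "\<And>x y f. x \<in> Ob C \<Longrightarrow> y \<in> Ob C \<Longrightarrow> f \<in> Hom C x y \<Longrightarrow>
         Cmp D (fo F x) (fo F y) (fo G y) (\<eta> y) (fm F x y f) =
         Cmp D (fo F x) (fo G x) (fo G y) (fm G x y f) (\<eta> x)"
proof -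
  obtain \<eta> where *: "is_functor C D F" "is_functor C D G"
    "\<And>x. x \<in> Ob C \<Longrightarrow> iso_arrow D (fo F x) (fo G x) (\<eta> x)"
    "\<And>x y f. x \<in> Ob C \<Longrightarrow> y \<in> Ob C \<Longrightarrow> f \<in> Hom C x y \<Longrightarrow>
         Cmp D (fo F x) (fo F y) (fo G y) (\<eta> y) (fm F x y f) =
         Cmp D (fo F x) (fo G x) (fo G y) (fm G x y f) (\<eta> x)"
    using assms unfolding naturally_isomorphic_def by blast
  define \<theta> where "\<theta> x = (SOME g. inverse_arrows D (fo F x) (fo G x) (\<eta> x) g)" for x
  have "inverse_arrows D (fo F x) (fo G x) (\<eta> x) (\<theta> x)" if "x \<in> Ob C" for x
    using *(3)[OF that] unfolding iso_arrow_iff_inverse \<theta>_def by (rule someI_ex)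
  with * that show ?thesis by blast
qed

lemma naturally_isomorphicI:
  assumes "is_functor C D F" "is_functor C D G"
    "\<And>x. x \<in> Ob C \<Longrightarrow> inverse_arrows D (fo F x) (fo G x) (\<eta> x) (\<theta> x)"
    "\<And>x y f. x \<in> Ob C \<Longrightarrow> y \<in> Ob C \<Longrightarrow> f \<in> Hom C x y \<Longrightarrow>
         Cmp D (fo F x) (fo F y) (fo G y) (\<eta> y) (fm F x y f) =
         Cmp D (fo F x) (fo G x) (fo G y) (fm G x y f) (\<eta> x)"
  shows "naturally_isomorphic C D F G"
  unfolding naturally_isomorphic_def iso_arrow_iff_inverse using assms by blast

text \<open>The inverse components form a natural transformation: cancel \<open>\<eta>\<close> on
  either side of its naturality square.\<close>

lemma naturally_isomorphic_sym:
  assumes "naturally_isomorphic C D F G"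
  shows "naturally_isomorphic C D G F"
proof -
  obtain \<eta> \<theta> where F: "is_functor C D F" and G: "is_functor C D G"
    and inv: "\<And>x. x \<in> Ob C \<Longrightarrow> inverse_arrows D (fo F x) (fo G x) (\<eta> x) (\<theta> x)"
    and nat: "\<And>x y f. x \<in> Ob C \<Longrightarrow> y \<in> Ob C \<Longrightarrow> f \<in> Hom C x y \<Longrightarrow>
         Cmp D (fo F x) (fo F y) (fo G y) (\<eta> y) (fm F x y f) =
         Cmp D (fo F x) (fo G x) (fo G y) (fm G x y f) (\<eta> x)"
    using naturally_isomorphicE[OF assms] by metis
  show ?thesis
  proof (rule naturally_isomorphicI[OF G F])
    show "inverse_arrows D (fo G x) (fo F x) (\<theta> x) (\<eta> x)" if "x \<in> Ob C" for x
      by (rule inverse_arrows_sym[OF inv[OF that]])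
  next
    fix x y f assume a: "x \<in> Ob C" "y \<in> Ob C" "f \<in> Hom C x y"
    note m = is_functorD(4)[OF F a] is_functorD(4)[OF G a]
    note o = is_functorD(3)[OF F a(1)] is_functorD(3)[OF F a(2)] is_functorD(3)[OF G a(1)] is_functorD(3)[OF G a(2)]
    have h: "\<eta> x \<in> Hom D (fo F x) (fo G x)" "\<theta> x \<in> Hom D (fo G x) (fo F x)"
      "\<eta> y \<in> Hom D (fo F y) (fo G y)" "\<theta> y \<in> Hom D (fo G y) (fo F y)"
      using inv[OF a(1)] inv[OF a(2)] by (auto simp: inverse_arrows_def)
    note D = is_functorD(2)[OF F]
    let ?g = "Cmp D (fo G x) (fo F x) (fo F y) (fm F x y f) (\<theta> x)"
    have "Cmp D (fo G x) (fo F y) (fo G y) (\<eta> y) ?g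
      = Cmp D (fo G x) (fo F x) (fo G y) (Cmp D (fo F x) (fo F y) (fo G y) (\<eta> y) (fm F x y f)) (\<theta> x)"
      using D m o h by (simp add: category_assoc)
    also have "\<dots> = fm G x y f"
      unfolding nat[OF a] using cmp_cancel_right[OF D o(4) o(1) o(3) inv[OF a(1)] m(2)] .
    finally show "Cmp D (fo G x) (fo G y) (fo F y) (\<theta> y) (fm G x y f) = ?g"
      using cmp_cancel_left[OF D o(3) o(2) o(4) inv[OF a(2)], of ?g] D m o h by (simp add: category_cmp)
  qed
qed

lemma naturally_isomorphic_trans:
  assumes "naturally_isomorphic C D F G" "naturally_isomorphic C D G H"
  shows "naturally_isomorphic C D F H"
proof -
  obtain \<eta> \<theta> where F: "is_functor C D F" and G: "is_functor C D G"
    and inv: "\<And>x. x \<in> Ob C \<Longrightarrow> inverse_arrows D (fo F x) (fo G x) (\<eta> x) (\<theta> x)"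
    and nat: "\<And>x y f. x \<in> Ob C \<Longrightarrow> y \<in> Ob C \<Longrightarrow> f \<in> Hom C x y \<Longrightarrow>
         Cmp D (fo F x) (fo F y) (fo G y) (\<eta> y) (fm F x y f) =
         Cmp D (fo F x) (fo G x) (fo G y) (fm G x y f) (\<eta> x)"
    using naturally_isomorphicE[OF assms(1)] by metis
  obtain \<eta>' \<theta>' where H: "is_functor C D H"
    and inv': "\<And>x. x \<in> Ob C \<Longrightarrow> inverse_arrows D (fo G x) (fo H x) (\<eta>' x) (\<theta>' x)"
    and nat': "\<And>x y f. x \<in> Ob C \<Longrightarrow> y \<in> Ob C \<Longrightarrow> f \<in> Hom C x y \<Longrightarrow>
         Cmp D (fo G x) (fo G y) (fo H y) (\<eta>' y) (fm G x y f) =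
         Cmp D (fo G x) (fo H x) (fo H y) (fm H x y f) (\<eta>' x)"
    using naturally_isomorphicE[OF assms(2)] by metis
  note D = is_functorD(2)[OF F]
  show ?thesis
  proof (rule naturally_isomorphicI[OF F H])
    fix x assume x: "x \<in> Ob C"
    show "inverse_arrows D (fo F x) (fo H x) (Cmp D (fo F x) (fo G x) (fo H x) (\<eta>' x) (\<eta> x))
       (Cmp D (fo H x) (fo G x) (fo F x) (\<theta> x) (\<theta>' x))"
      by (rule inverse_arrows_comp[OF D is_functorD(3)[OF F x] is_functorD(3)[OF G x] is_functorD(3)[OF H x]
            inv[OF x] inv'[OF x]])
  next
    fix x y f assume a: "x \<in> Ob C" "y \<in> Ob C" "f \<in> Hom C x y"
    note o = is_functorD(3)[OF F a(1)] is_functorD(3)[OF F a(2)] is_functorD(3)[OF G a(1)] is_functorD(3)[OF G a(2)]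
      is_functorD(3)[OF H a(1)] is_functorD(3)[OF H a(2)]
    have h: "\<eta> x \<in> Hom D (fo F x) (fo G x)" "\<eta>' x \<in> Hom D (fo G x) (fo H x)"
      "\<eta> y \<in> Hom D (fo F y) (fo G y)" "\<eta>' y \<in> Hom D (fo G y) (fo H y)"
      using inv[OF a(1)] inv[OF a(2)] inv'[OF a(1)] inv'[OF a(2)] by (auto simp: inverse_arrows_def)
    note m = is_functorD(4)[OF F a] is_functorD(4)[OF G a] is_functorD(4)[OF H a]
    have "Cmp D (fo F x) (fo F y) (fo H y) (Cmp D (fo F y) (fo G y) (fo H y) (\<eta>' y) (\<eta> y)) (fm F x y f)
      = Cmp D (fo F x) (fo G x) (fo H y) (Cmp D (fo G x) (fo G y) (fo H y) (\<eta>' y) (fm G x y f)) (\<eta> x)"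
      using D o h m by (simp add: category_assoc nat[OF a])
    also have "\<dots> = Cmp D (fo F x) (fo H x) (fo H y) (fm H x y f) (Cmp D (fo F x) (fo G x) (fo H x) (\<eta>' x) (\<eta> x))"
      using D o h m by (simp add: category_assoc nat'[OF a])
    finally show "Cmp D (fo F x) (fo F y) (fo H y) (Cmp D (fo F y) (fo G y) (fo H y) (\<eta>' y) (\<eta> y)) (fm F x y f)
      = Cmp D (fo F x) (fo H x) (fo H y) (fm H x y f) (Cmp D (fo F x) (fo G x) (fo H x) (\<eta>' x) (\<eta> x))" .
  qed
qed

lemma naturally_isomorphic_whisker_right:
  assumes "naturally_isomorphic C D F G" "is_functor B C H"
  shows "naturally_isomorphic B D (F \<circ>\<^sub>F H) (G \<circ>\<^sub>F H)"
proof -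
  obtain \<eta> \<theta> where F: "is_functor C D F" and G: "is_functor C D G"
    and inv: "\<And>x. x \<in> Ob C \<Longrightarrow> inverse_arrows D (fo F x) (fo G x) (\<eta> x) (\<theta> x)"
    and nat: "\<And>x y f. x \<in> Ob C \<Longrightarrow> y \<in> Ob C \<Longrightarrow> f \<in> Hom C x y \<Longrightarrow>
         Cmp D (fo F x) (fo F y) (fo G y) (\<eta> y) (fm F x y f) =
         Cmp D (fo F x) (fo G x) (fo G y) (fm G x y f) (\<eta> x)"
    using naturally_isomorphicE[OF assms(1)] by metis
  note H = is_functorD[OF assms(2)]
  show ?thesis
    by (rule naturally_isomorphicI[where \<eta> = "\<lambda>x. \<eta> (fo H x)" and \<theta> = "\<lambda>x. \<theta> (fo H x)"])
      (auto intro: is_functor_comp assms(2) F G simp: inv nat H)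
qed

text \<open>Naturality expresses \<open>G f\<close> as \<open>F f\<close> conjugated by the
  components at \<open>x\<close> and \<open>y\<close>, and conjugation is bijective on
  Hom-sets.\<close>

lemma fully_faithful_naturally_isomorphic:
  assumes "naturally_isomorphic C D F G" "fully_faithful C D F"
  shows "fully_faithful C D G"
  unfolding fully_faithful_def
proof (intro ballI)
  fix x y assume a: "x \<in> Ob C" "y \<in> Ob C"
  obtain \<eta> \<theta> where F: "is_functor C D F" and G: "is_functor C D G"
    and inv: "\<And>x. x \<in> Ob C \<Longrightarrow> inverse_arrows D (fo F x) (fo G x) (\<eta> x) (\<theta> x)"
    and nat: "\<And>x y f. x \<in> Ob C \<Longrightarrow> y \<in> Ob C \<Longrightarrow> f \<in> Hom C x y \<Longrightarrow>
         Cmp D (fo F x) (fo F y) (fo G y) (\<eta> y) (fm F x y f) =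
         Cmp D (fo F x) (fo G x) (fo G y) (fm G x y f) (\<eta> x)"
    using naturally_isomorphicE[OF assms(1)] by metis
  note D = is_functorD(2)[OF F]
  note o = is_functorD(3)[OF F a(1)] is_functorD(3)[OF F a(2)] is_functorD(3)[OF G a(1)] is_functorD(3)[OF G a(2)]
  let ?c = "\<lambda>h. Cmp D (fo G x) (fo F x) (fo G y) (Cmp D (fo F x) (fo F y) (fo G y) (\<eta> y) h) (\<theta> x)"
  have c: "bij_betw ?c (Hom D (fo F x) (fo F y)) (Hom D (fo G x) (fo G y))"
    by (rule bij_betw_conjugation[OF D o inv[OF a(1)] inv[OF a(2)]])
  have "bij_betw (?c \<circ> fm F x y) (Hom C x y) (Hom D (fo G x) (fo G y))"
    by (rule bij_betw_trans[OF fully_faithfulD[OF assms(2) a] c])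
  moreover have "(?c \<circ> fm F x y) h = fm G x y h" if "h \<in> Hom C x y" for h
    using cmp_cancel_right[OF D o(4,1,3) inv[OF a(1)] is_functorD(4)[OF G a that]]
    by (simp add: nat[OF a that])
  ultimately show "bij_betw (fm G x y) (Hom C x y) (Hom D (fo G x) (fo G y))"
    by (simp add: bij_betw_cong[of _ "?c \<circ> fm F x y" "fm G x y"])
qed

lemma naturally_isomorphic_objects:
  assumes "naturally_isomorphic C D F G" "x \<in> Ob C"
  shows "isomorphic_in D (fo F x) (fo G x)"
  using assms is_functorD(3)[of C D F x] is_functorD(3)[of C D G x]
  unfolding naturally_isomorphic_def isomorphic_in_def by auto

lemma ess_surjective_naturally_isomorphic:
  assumes "naturally_isomorphic C D F G" "ess_surjective C D F"
  shows "ess_surjective C D G"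
proof -
  have D: "category D" using assms(1) is_functorD(2) unfolding naturally_isomorphic_def by metis
  show ?thesis
    using assms(2) isomorphic_in_trans[OF D isomorphic_in_sym[OF naturally_isomorphic_objects[OF assms(1)]]]
    unfolding ess_surjective_def by blast
qed

lemma fully_faithful_comp:
  assumes "is_functor C D F" "fully_faithful C D F" "fully_faithful D E G"
  shows "fully_faithful C E (G \<circ>\<^sub>F F)"
  unfolding fully_faithful_def
proof (intro ballI)
  fix x y assume a: "x \<in> Ob C" "y \<in> Ob C"
  have "bij_betw (fm G (fo F x) (fo F y) \<circ> fm F x y) (Hom C x y) (Hom E (fo G (fo F x)) (fo G (fo F y)))"
    by (rule bij_betw_trans[OF fully_faithfulD[OF assms(2) a]
          fully_faithfulD[OF assms(3) is_functorD(3)[OF assms(1) a(1)] is_functorD(3)[OF assms(1) a(2)]]])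
  then show "bij_betw (fm (G \<circ>\<^sub>F F) x y) (Hom C x y) (Hom E (fo (G \<circ>\<^sub>F F) x) (fo (G \<circ>\<^sub>F F) y))"
    by (simp add: comp_def)
qed

lemma ess_surjective_comp:
  assumes "is_functor D E G" "ess_surjective C D F" "ess_surjective D E G"
  shows "ess_surjective C E (G \<circ>\<^sub>F F)"
  unfolding ess_surjective_def
proof
  fix z assume "z \<in> Ob E"
  then obtain y where y: "y \<in> Ob D" "isomorphic_in E (fo G y) z"
    using assms(3) by (auto simp: ess_surjective_def)
  then obtain x where x: "x \<in> Ob C" "isomorphic_in D (fo F x) y"
    using assms(2) by (auto simp: ess_surjective_def)
  show "\<exists>x\<in>Ob C. isomorphic_in E (fo (G \<circ>\<^sub>F F) x) z"
    using isomorphic_in_trans[OF is_functorD(2)[OF assms(1)] functor_isomorphic_in[OF assms(1) x(2)] y(2)] x(1)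
    by auto
qed

section \<open>Equivalences as fully faithful, essentially surjective functors\<close>

text \<open>Both composites are isomorphic to identities and hence fully faithful. So
  \<open>F\<close> is injective on each Hom-set, and \<open>G\<close> on those between objects
  \<open>F x\<close>. Given \<open>h\<close>, the arrow \<open>f\<close> with
  \<open>G F f = G h\<close> satisfies \<open>F f = h\<close> by the injectivity of
  \<open>G\<close>.\<close>

lemma fully_faithful_quasi_inverse:
  assumes "is_functor C D F" "is_functor D C G"
    and "naturally_isomorphic C C id_functor (G \<circ>\<^sub>F F)"
    and "naturally_isomorphic D D (F \<circ>\<^sub>F G) id_functor"
  shows "fully_faithful C D F"
  unfolding fully_faithful_def
proof (intro ballI)
  fix x y assume a: "x \<in> Ob C" "y \<in> Ob C"
  have ff: "fully_faithful C C (G \<circ>\<^sub>F F)" "fully_faithful D D (F \<circ>\<^sub>F G)"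
    using fully_faithful_naturally_isomorphic[OF assms(3)]
      fully_faithful_naturally_isomorphic[OF naturally_isomorphic_sym[OF assms(4)]]
    by (simp_all add: fully_faithful_def bij_betw_def)
  note F = is_functorD[OF assms(1)] and G = is_functorD[OF assms(2)]
  let ?Fx = "fo F x" and ?Fy = "fo F y"
  have bGF: "bij_betw (\<lambda>f. fm G ?Fx ?Fy (fm F x y f)) (Hom C x y) (Hom C (fo G ?Fx) (fo G ?Fy))"
    using fully_faithfulD[OF ff(1) a] by simp
  have bFG: "bij_betw (\<lambda>f. fm F (fo G ?Fx) (fo G ?Fy) (fm G ?Fx ?Fy f)) (Hom D ?Fx ?Fy)
       (Hom D (fo F (fo G ?Fx)) (fo F (fo G ?Fy)))"
    using fully_faithfulD[OF ff(2) F(3) F(3), OF a] by simp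
  have injG: "inj_on (fm G ?Fx ?Fy) (Hom D ?Fx ?Fy)"
    using bFG unfolding bij_betw_def inj_on_def by metis
  show "bij_betw (fm F x y) (Hom C x y) (Hom D ?Fx ?Fy)"
    unfolding bij_betw_def
  proof
    show "inj_on (fm F x y) (Hom C x y)"
      using bGF unfolding bij_betw_def inj_on_def by metis
    show "fm F x y ` Hom C x y = Hom D ?Fx ?Fy"
    proof
      show "fm F x y ` Hom C x y \<subseteq> Hom D ?Fx ?Fy" using F(4) a by blast
      show "Hom D ?Fx ?Fy \<subseteq> fm F x y ` Hom C x y"
      proof
        fix h assume h: "h \<in> Hom D ?Fx ?Fy"
        then have "fm G ?Fx ?Fy h \<in> Hom C (fo G ?Fx) (fo G ?Fy)" using G(4) F(3) a by blast
        then obtain f where f: "f \<in> Hom C x y" "fm G ?Fx ?Fy h = fm G ?Fx ?Fy (fm F x y f)"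
          using bGF unfolding bij_betw_def by (metis (no_types, lifting) imageE)
        then show "h \<in> fm F x y ` Hom C x y"
          using inj_onD[OF injG f(2) h] F(4) a by blast
      qed
    qed
  qed
qed

text \<open>Choose for each \<open>z\<close> an object \<open>g z\<close> with an isomorphism
  \<open>i z\<close> from \<open>F (g z)\<close> to \<open>z\<close>. The quasi-inverse sends
  \<open>h\<close> to the unique preimage under \<open>F\<close> of its conjugate
  \<open>conj z w h\<close>; the natural isomorphisms are \<open>i\<close> on one side and the
  preimages of \<open>j (fo F x)\<close> on the other.\<close>

lemma cat_equivalenceI:
  assumes F: "is_functor C D F" and ff: "fully_faithful C D F" and es: "ess_surjective C D F"
  shows "cat_equivalence C D F"
proof -
  note F' = is_functorD[OF F]
  have "\<forall>z. \<exists>x i j. z \<in> Ob D \<longrightarrow> x \<in> Ob C \<and> inverse_arrows D (fo F x) z i j"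
    using es unfolding ess_surjective_def isomorphic_in_iff by blast
  then obtain g i j where g: "\<And>z. z \<in> Ob D \<Longrightarrow> g z \<in> Ob C"
    and ij: "\<And>z. z \<in> Ob D \<Longrightarrow> inverse_arrows D (fo F (g z)) z (i z) (j z)"
    by metis
  have ih: "\<And>z. z \<in> Ob D \<Longrightarrow> i z \<in> Hom D (fo F (g z)) z"
    and jh: "\<And>z. z \<in> Ob D \<Longrightarrow> j z \<in> Hom D z (fo F (g z))"
    and ji: "\<And>z. z \<in> Ob D \<Longrightarrow> Cmp D (fo F (g z)) z (fo F (g z)) (j z) (i z) = Idt D (fo F (g z))"
    and ij': "\<And>z. z \<in> Ob D \<Longrightarrow> Cmp D z (fo F (g z)) z (i z) (j z) = Idt D z"
    using ij by (auto simp: inverse_arrows_def)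
  define lift where "lift x y h = inv_into (Hom C x y) (fm F x y) h" for x y h
  have lift: "lift x y h \<in> Hom C x y" "fm F x y (lift x y h) = h"
    if "x \<in> Ob C" "y \<in> Ob C" "h \<in> Hom D (fo F x) (fo F y)" for x y h
    using fully_faithfulD[OF ff that(1,2)] that(3) unfolding lift_def bij_betw_def
    by (auto intro: inv_into_into f_inv_into_f)
  \<comment> \<open>Equations between arrows of \<open>C\<close> will be checked after applying
    \<open>F\<close>.\<close>
  have faithful: "f = f'"
    if "x \<in> Ob C" "y \<in> Ob C" "f \<in> Hom C x y" "f' \<in> Hom C x y" "fm F x y f = fm F x y f'" for x y f f'
    using fully_faithfulD[OF ff that(1,2)] that(3-) unfolding bij_betw_def inj_on_def by blast
  define conj where "conj z w h = Cmp D (fo F (g z)) w (fo F (g w)) (j w) (Cmp D (fo F (g z)) z w h (i z))" for z w h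
  have conj: "conj z w h \<in> Hom D (fo F (g z)) (fo F (g w))"
    if "z \<in> Ob D" "w \<in> Ob D" "h \<in> Hom D z w" for z w h
    unfolding conj_def using that ih jh g by (simp add: category_cmp F')
  define G where "G = \<lparr>fo = g, fm = \<lambda>z w. \<lambda>h. lift (g z) (g w) (conj z w h)\<rparr>"
  have Gs [simp]: "fo G z = g z" "fm G z w = (\<lambda>h. lift (g z) (g w) (conj z w h))" for z w
    by (simp_all add: G_def)
  have FG: "fm F (g z) (g w) (lift (g z) (g w) (conj z w h)) = conj z w h"
    and Gh: "lift (g z) (g w) (conj z w h) \<in> Hom C (g z) (g w)"
    if "z \<in> Ob D" "w \<in> Ob D" "h \<in> Hom D z w" for z w h
    using lift[OF g[OF that(1)] g[OF that(2)] conj[OF that]] by simp_all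
  \<comment> \<open>Naturality of \<open>i\<close>; it serves both the functoriality of
    \<open>G\<close> and the isomorphism of \<open>F G\<close> with the identity.\<close>
  have ic: "Cmp D (fo F (g z)) (fo F (g w)) w (i w) (conj z w h) = Cmp D (fo F (g z)) z w h (i z)"
    if "z \<in> Ob D" "w \<in> Ob D" "h \<in> Hom D z w" for z w h
    unfolding conj_def
    by (rule cmp_cancel_left[OF F'(2) _ _ _ inverse_arrows_sym[OF ij]])
      (use that ih jh g in \<open>simp_all add: category_cmp F'\<close>)
  have G: "is_functor D C G"
  proof (rule is_functorI)
    fix z assume z: "z \<in> Ob D"
    have "conj z z (Idt D z) = Idt D (fo F (g z))"
      unfolding conj_def using z ih jh g ji by (simp add: category_idl F')
    then show "fm G z z (Idt D z) = Idt C (fo G z)"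
      using faithful[of "g z" "g z" "lift (g z) (g z) (conj z z (Idt D z))" "Idt C (g z)"] z g
        FG[OF z z category_idt[OF F'(2) z]] Gh[OF z z category_idt[OF F'(2) z]]
      by (simp add: category_idt F')
  next
    fix x y z f h assume a: "x \<in> Ob D" "y \<in> Ob D" "z \<in> Ob D" "f \<in> Hom D x y" "h \<in> Hom D y z"
    have "Cmp D (fo F (g x)) (fo F (g y)) (fo F (g z)) (conj y z h) (conj x y f)
      = Cmp D (fo F (g x)) z (fo F (g z)) (j z)
         (Cmp D (fo F (g x)) y z h (Cmp D (fo F (g x)) (fo F (g y)) y (i y) (conj x y f)))"
      using a conj[OF a(1,2,4)] ih jh g
      unfolding conj_def[of y z h] by (simp add: category_assoc category_cmp F')
    also have "\<dots> = conj x z (Cmp D x y z h f)"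
      unfolding ic[OF a(1,2,4)] unfolding conj_def using a ih jh g by (simp add: category_assoc category_cmp F')
    finally have c: "Cmp D (fo F (g x)) (fo F (g y)) (fo F (g z)) (conj y z h) (conj x y f) =
      conj x z (Cmp D x y z h f)" .
    have m: "lift (g x) (g z) (conj x z (Cmp D x y z h f)) \<in> Hom C (g x) (g z)"
      "fm F (g x) (g z) (lift (g x) (g z) (conj x z (Cmp D x y z h f))) = conj x z (Cmp D x y z h f)"
      using FG[OF a(1,3)] Gh[OF a(1,3)] a F'(2) by (simp_all add: category_cmp)
    show "fm G x z (Cmp D x y z h f) = Cmp C (fo G x) (fo G y) (fo G z) (fm G y z h) (fm G x y f)"
      unfolding Gs
      by (rule faithful[OF g[OF a(1)] g[OF a(3)] m(1)])
        (use a g Gh FG c m in \<open>simp_all add: category_cmp F'\<close>)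
  qed (use F' g Gh in auto)
  have nFG: "naturally_isomorphic D D (F \<circ>\<^sub>F G) id_functor"
    by (rule naturally_isomorphicI[where \<eta> = i and \<theta> = j])
      (use is_functor_comp[OF G F] F' is_functor_id ij ic FG in auto)
  have lj: "inverse_arrows C x (g (fo F x)) (lift x (g (fo F x)) (j (fo F x))) (lift (g (fo F x)) x (i (fo F x)))"
    if x: "x \<in> Ob C" for x
  proof -
    note z = F'(3)[OF x]
    note gx = g[OF z]
    note l1 = lift[OF x gx jh[OF z]] and l2 = lift[OF gx x ih[OF z]]
    show ?thesis
      unfolding inverse_arrows_def
    proof (intro conjI l1 l2)
      show "Cmp C x (g (fo F x)) x (lift (g (fo F x)) x (i (fo F x))) (lift x (g (fo F x)) (j (fo F x))) = Idt C x"
        by (rule faithful[OF x x]) (use x gx l1 l2 ij' z in \<open>simp_all add: category_cmp category_idt F'\<close>)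
      show "Cmp C (g (fo F x)) x (g (fo F x)) (lift x (g (fo F x)) (j (fo F x))) (lift (g (fo F x)) x (i (fo F x))) = Idt C (g (fo F x))"
        by (rule faithful[OF gx gx]) (use x gx l1 l2 ji z in \<open>simp_all add: category_cmp category_idt F'\<close>)
    qed
  qed
  have nGF: "naturally_isomorphic C C id_functor (G \<circ>\<^sub>F F)"
  proof (rule naturally_isomorphicI[where \<eta> = "\<lambda>x. lift x (g (fo F x)) (j (fo F x))" and \<theta> = "\<lambda>x. lift (g (fo F x)) x (i (fo F x))"])
    fix x y f assume a: "x \<in> Ob C" "y \<in> Ob C" "f \<in> Hom C x y"
    note Ff = F'(4)[OF a] and zx = F'(3)[OF a(1)] and zy = F'(3)[OF a(2)]
    note l = lift[OF a(1) g[OF zx] jh[OF zx]] lift[OF a(2) g[OF zy] jh[OF zy]]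
    have "Cmp D (fo F x) (fo F (g (fo F x))) (fo F (g (fo F y))) (conj (fo F x) (fo F y) (fm F x y f)) (j (fo F x))
      = Cmp D (fo F x) (fo F y) (fo F (g (fo F y))) (j (fo F y)) (Cmp D (fo F x) (fo F (g (fo F x))) (fo F y)
        (Cmp D (fo F (g (fo F x))) (fo F x) (fo F y) (fm F x y f) (i (fo F x))) (j (fo F x)))"
      unfolding conj_def using Ff zx zy ih jh g by (simp add: category_assoc category_cmp F')
    also have "\<dots> = Cmp D (fo F x) (fo F y) (fo F (g (fo F y))) (j (fo F y)) (fm F x y f)"
      using cmp_cancel_right[OF F'(2) zy F'(3)[OF g[OF zx]] zx ij[OF zx] Ff] by simp
    finally have c: "Cmp D (fo F x) (fo F (g (fo F x))) (fo F (g (fo F y))) (conj (fo F x) (fo F y) (fm F x y f)) (j (fo F x))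
      = Cmp D (fo F x) (fo F y) (fo F (g (fo F y))) (j (fo F y)) (fm F x y f)" .
    have "Cmp C x y (g (fo F y)) (lift y (g (fo F y)) (j (fo F y))) f =
       Cmp C x (g (fo F x)) (g (fo F y)) (lift (g (fo F x)) (g (fo F y)) (conj (fo F x) (fo F y) (fm F x y f))) (lift x (g (fo F x)) (j (fo F x)))"
      by (rule faithful[OF a(1) g[OF zy]])
        (use a g zx zy l Gh[OF zx zy Ff] FG[OF zx zy Ff] c in \<open>simp_all add: category_cmp F'\<close>)
    then show "Cmp C (fo id_functor x) (fo id_functor y) (fo (G \<circ>\<^sub>F F) y) (lift y (g (fo F y)) (j (fo F y))) (fm id_functor x y f) =
       Cmp C (fo id_functor x) (fo (G \<circ>\<^sub>F F) x) (fo (G \<circ>\<^sub>F F) y) (fm (G \<circ>\<^sub>F F) x y f) (lift x (g (fo F x)) (j (fo F x)))"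
      by simp
  qed (use is_functor_comp[OF F G] F' is_functor_id lj in auto)
  show ?thesis
    unfolding cat_equivalence_def using F G nFG nGF by blast
qed

lemma cat_equivalence_iff:
  "cat_equivalence C D F \<longleftrightarrow> is_functor C D F \<and> fully_faithful C D F \<and> ess_surjective C D F"
proof
  assume "cat_equivalence C D F"
  then obtain G where G: "is_functor C D F" "is_functor D C G"
       "naturally_isomorphic C C id_functor (G \<circ>\<^sub>F F)"
       "naturally_isomorphic D D (F \<circ>\<^sub>F G) id_functor"
    unfolding cat_equivalence_def by blast
  have "ess_surjective C D F"
    unfolding ess_surjective_def
    using naturally_isomorphic_objects[OF G(4)] is_functorD(3)[OF G(2)] by auto
  then show "is_functor C D F \<and> fully_faithful C D F \<and> ess_surjective C D F"
    using G fully_faithful_quasi_inverse by blast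
qed (use cat_equivalenceI in blast)

lemma cat_equivalence_comp:
  "cat_equivalence C D F \<Longrightarrow> cat_equivalence D E G \<Longrightarrow> cat_equivalence C E (G \<circ>\<^sub>F F)"
  unfolding cat_equivalence_iff
  by (simp add: is_functor_comp[of C D F E G] fully_faithful_comp[of C D F E G] ess_surjective_comp[of D E G C F])

lemma cat_equivalence_naturally_isomorphic:
  "cat_equivalence C D F \<Longrightarrow> naturally_isomorphic C D F G \<Longrightarrow> cat_equivalence C D G"
  unfolding cat_equivalence_iff
  using fully_faithful_naturally_isomorphic ess_surjective_naturally_isomorphic
  by (metis naturally_isomorphic_def)

text \<open>Since \<open>T E\<close> is isomorphic to the equivalence \<open>E s\<close>, the
  functor \<open>T\<close> is fully faithful on objects \<open>E x\<close>, and by transport along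
  isomorphisms everywhere. This will make tensoring with the degree one part an autoequivalence,
  because it corresponds to the shift.\<close>

lemma cat_equivalence_conjugate:
  assumes E: "cat_equivalence C D E" and s: "cat_equivalence C C s" and T: "is_functor D D T"
    and n: "naturally_isomorphic C D (E \<circ>\<^sub>F s) (T \<circ>\<^sub>F E)"
  shows "cat_equivalence D D T"
proof -
  have TE: "cat_equivalence C D (T \<circ>\<^sub>F E)"
    using cat_equivalence_naturally_isomorphic[OF cat_equivalence_comp[OF s E] n] .
  note E' = E[unfolded cat_equivalence_iff] and TE' = TE[unfolded cat_equivalence_iff]
  have "fully_faithful D D T"
    unfolding fully_faithful_def
  proof (intro ballI)
    fix z w assume zw: "z \<in> Ob D" "w \<in> Ob D"
    then obtain x y i i' j j' where x: "x \<in> Ob C" "y \<in> Ob C"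
      and ij: "inverse_arrows D (fo E x) z i i'" "inverse_arrows D (fo E y) w j j'"
      using E' unfolding ess_surjective_def isomorphic_in_iff by metis
    have b: "bij_betw (fm E x y) (Hom C x y) (Hom D (fo E x) (fo E y))"
      "bij_betw (fm T (fo E x) (fo E y) \<circ> fm E x y) (Hom C x y) (Hom D (fo T (fo E x)) (fo T (fo E y)))"
      using E' TE' x unfolding fully_faithful_def by (auto simp: comp_def)
    then have "bij_betw (fm T (fo E x) (fo E y)) (Hom D (fo E x) (fo E y)) (Hom D (fo T (fo E x)) (fo T (fo E y)))"
      using bij_betw_comp_iff by blast
    then show "bij_betw (fm T z w) (Hom D z w) (Hom D (fo T z) (fo T w))"
      using bij_betw_functor_transport[OF T _ _ zw ij] E' x is_functorD(3) by metis
  qed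
  moreover have "ess_surjective D D T"
    using TE' E' is_functorD(3) unfolding ess_surjective_def by (metis fcomp_simps(1))
  ultimately show ?thesis
    using T cat_equivalence_iff by blast
qed

section \<open>Full subcategories\<close>

lemma fully_faithful_full_subcat:
  "fully_faithful C D F \<Longrightarrow> S \<subseteq> Ob C \<Longrightarrow> fully_faithful (full_subcat C S) (full_subcat D T) F"
  by (auto simp: fully_faithful_def full_subcat_def)

lemma category_full_subcat:
  assumes "category C" "S \<subseteq> Ob C"
  shows "category (full_subcat C S)"
proof -
  have [simp]: "x \<in> S \<Longrightarrow> x \<in> Ob C" for x using assms(2) by auto
  show ?thesis
    unfolding category_def full_subcat_def using assms(1)
    by (simp add: category_laws category_assoc)
qed

lemma is_functor_full_subcat:
  assumes "is_functor C D F" "S \<subseteq> Ob C" "T \<subseteq> Ob D" "\<And>x. x \<in> S \<Longrightarrow> fo F x \<in> T"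
  shows "is_functor (full_subcat C S) (full_subcat D T) F"
proof -
  have "x \<in> S \<Longrightarrow> x \<in> Ob C" for x using assms(2) by auto
  then show ?thesis
    using category_full_subcat[of C S] category_full_subcat[of D T] assms is_functorD[OF assms(1)]
    by (intro is_functorI) (auto simp: full_subcat_def)
qed

section \<open>Graded abelian groups\<close>

locale graded_group = abelian_group G for G (structure) +
  fixes D :: "int \<Rightarrow> 'a set"
  assumes graded: "graded_by G D"
begin

lemma minus_zero_right [simp]: "x \<in> carrier G \<Longrightarrow> x \<ominus> \<zero> = x"
  by (simp add: minus_eq add.inv_one)

lemma minus_eq_zero_iff:
  assumes "x \<in> carrier G" "y \<in> carrier G" shows "x \<ominus> y = \<zero> \<longleftrightarrow> x = y"
proof
  assume "x \<ominus> y = \<zero>"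
  moreover have "(x \<ominus> y) \<oplus> y = x" using assms by (simp add: minus_eq a_assoc l_neg)
  ultimately show "x = y" using assms by simp
qed (use assms in \<open>simp add: minus_eq r_neg\<close>)

lemma homog_additive_subgroup: "additive_subgroup (D n) G"
  using graded by (simp add: graded_by_def)

lemma homog_carrier: "x \<in> D n \<Longrightarrow> x \<in> carrier G"
  using additive_subgroup.a_Hcarr[OF homog_additive_subgroup] by blast

lemma homog_zero [simp]: "\<zero> \<in> D n"
  using additive_subgroup.zero_closed[OF homog_additive_subgroup] by blast

lemma homog_add: "x \<in> D n \<Longrightarrow> y \<in> D n \<Longrightarrow> x \<oplus> y \<in> D n"
  using additive_subgroup.a_closed[OF homog_additive_subgroup] by blast

lemma homog_a_inv: "x \<in> D n \<Longrightarrow> \<ominus> x \<in> D n"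
  using add.subgroupE(3)[OF additive_subgroup.a_subgroup[OF homog_additive_subgroup]] by blast

section \<open>Homogeneous components\<close>

text \<open>The uniqueness clause of \<open>graded_by\<close> identifies any finite homogeneous
  decomposition with the one selected by the description operator in \<open>hpart\<close>.\<close>

lemma hpart_unique:
  assumes "\<And>n. c n \<in> D n" "finite {n. c n \<noteq> \<zero>}" "x = (\<Oplus>n\<in>{n. c n \<noteq> \<zero>}. c n)"
  shows "hpart G D n x = c n"
proof -
  have "x \<in> carrier G"
    unfolding assms(3) using assms(1) homog_carrier by (intro finsum_closed) blast
  then have "\<exists>!c. (\<forall>n. c n \<in> D n) \<and> finite {n. c n \<noteq> \<zero>} \<and> x = (\<Oplus>n\<in>{n. c n \<noteq> \<zero>}. c n)"
    using graded by (auto simp: graded_by_def)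
  then have "(THE c. (\<forall>n. c n \<in> D n) \<and> finite {n. c n \<noteq> \<zero>} \<and> x = (\<Oplus>n\<in>{n. c n \<noteq> \<zero>}. c n)) = c"
    by (rule the1_equality) (use assms in blast)
  then show ?thesis
    by (simp add: hpart_def)
qed

lemma
  assumes "x \<in> carrier G"
  shows hpart_homog [simp]: "hpart G D n x \<in> D n"
    and finite_support [simp]: "finite {n. hpart G D n x \<noteq> \<zero>}"
    and finsum_hpart: "(\<Oplus>n\<in>{n. hpart G D n x \<noteq> \<zero>}. hpart G D n x) = x"
proof -
  have "\<exists>!c. (\<forall>n. c n \<in> D n) \<and> finite {n. c n \<noteq> \<zero>} \<and> x = (\<Oplus>n\<in>{n. c n \<noteq> \<zero>}. c n)"
    using graded assms by (auto simp: graded_by_def)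
  from theI'[OF this] show "hpart G D n x \<in> D n" "finite {n. hpart G D n x \<noteq> \<zero>}"
    "(\<Oplus>n\<in>{n. hpart G D n x \<noteq> \<zero>}. hpart G D n x) = x"
    unfolding hpart_def by auto
qed

lemma hpart_closed [simp]: "x \<in> carrier G \<Longrightarrow> hpart G D n x \<in> carrier G"
  using homog_carrier hpart_homog by blast

lemma finsum_hpart_superset:
  assumes "x \<in> carrier G" "finite F" "{n. hpart G D n x \<noteq> \<zero>} \<subseteq> F"
  shows "(\<Oplus>n\<in>F. hpart G D n x) = x"
proof -
  have "(\<Oplus>n\<in>{n. hpart G D n x \<noteq> \<zero>}. hpart G D n x) = (\<Oplus>n\<in>F. hpart G D n x)"
    by (rule add.finprod_mono_neutral_cong_left) (use assms in auto)
  then show ?thesis using finsum_hpart[OF assms(1)] by simp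
qed

text \<open>A homogeneous family on a finite set, extended by zero, is the decomposition of its own
  sum.\<close>

lemma hpart_finsum:
  assumes "finite F" "\<And>n. n \<in> F \<Longrightarrow> c n \<in> D n"
  shows "hpart G D k (\<Oplus>n\<in>F. c n) = (if k \<in> F then c k else \<zero>)"
proof -
  let ?c = "\<lambda>n. if n \<in> F then c n else \<zero>"
  have fin: "finite {n. ?c n \<noteq> \<zero>}" by (rule finite_subset[OF _ assms(1)]) auto
  have "(\<Oplus>n\<in>F. c n) = (\<Oplus>n\<in>{n. ?c n \<noteq> \<zero>}. ?c n)"
    by (rule sym, rule add.finprod_mono_neutral_cong_left)
      (use assms homog_carrier in \<open>auto split: if_splits\<close>)
  from hpart_unique[OF _ fin this, of k] show ?thesis
    using assms(2) by simp
qed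

lemma hpart_of_homog: "x \<in> D n \<Longrightarrow> hpart G D k x = (if k = n then x else \<zero>)"
  using hpart_finsum[of "{n}" "\<lambda>_. x" k] homog_carrier[of x n] by (simp split: if_splits)

lemma hpart_zero [simp]: "hpart G D k \<zero> = \<zero>"
  using hpart_of_homog[OF homog_zero, of k k] by simp

lemma hpart_add:
  assumes "x \<in> carrier G" "y \<in> carrier G"
  shows "hpart G D k (x \<oplus> y) = hpart G D k x \<oplus> hpart G D k y"
proof -
  \<comment> \<open>Adding \<open>k\<close> to the supports puts the later use of
    \<open>hpart_finsum\<close> at \<open>k\<close> into its first case.\<close>
  let ?F = "insert k ({n. hpart G D n x \<noteq> \<zero>} \<union> {n. hpart G D n y \<noteq> \<zero>})"
  have F: "finite ?F" using assms by simp
  have "x \<oplus> y = (\<Oplus>n\<in>?F. hpart G D n x) \<oplus> (\<Oplus>n\<in>?F. hpart G D n y)"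
    using finsum_hpart_superset[OF assms(1) F] finsum_hpart_superset[OF assms(2) F] by (simp add: subset_insertI2)
  also have "\<dots> = (\<Oplus>n\<in>?F. hpart G D n x \<oplus> hpart G D n y)"
    using assms by (simp add: finsum_addf Pi_def)
  finally have "hpart G D k (x \<oplus> y) = hpart G D k (\<Oplus>n\<in>?F. hpart G D n x \<oplus> hpart G D n y)"
    by simp
  also have "\<dots> = hpart G D k x \<oplus> hpart G D k y"
    using hpart_finsum[OF F, of "\<lambda>n. hpart G D n x \<oplus> hpart G D n y" k] assms by (simp add: homog_add)
  finally show ?thesis .
qed

lemma finsum_induct:
  assumes "finite F" "\<And>n. n \<in> F \<Longrightarrow> c n \<in> carrier G" "P \<zero>" "\<And>n. n \<in> F \<Longrightarrow> P (c n)"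
    "\<And>x y. x \<in> carrier G \<Longrightarrow> y \<in> carrier G \<Longrightarrow> P x \<Longrightarrow> P y \<Longrightarrow> P (x \<oplus> y)"
  shows "P (\<Oplus>n\<in>F. c n)"
  using assms(1,2,4)
proof (induction F rule: finite_induct)
  case (insert n F)
  have c: "c n \<in> carrier G" "c \<in> F \<rightarrow> carrier G" using insert.prems(1) by auto
  have P: "P (c n)" "P (\<Oplus>n\<in>F. c n)" using insert.prems insert.IH by simp_all
  show ?case
    unfolding finsum_insert[OF insert.hyps c(2,1)] using assms(5)[OF c(1) finsum_closed[OF c(2)] P] .
qed (simp add: assms(3))

text \<open>Statements stable under addition reduce to homogeneous elements. Zero is covered by the
  homogeneous case.\<close>

lemma graded_induct [consumes 1, case_names homog add]:
  assumes "x \<in> carrier G" "\<And>n x. x \<in> D n \<Longrightarrow> P x"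
    "\<And>x y. x \<in> carrier G \<Longrightarrow> y \<in> carrier G \<Longrightarrow> P x \<Longrightarrow> P y \<Longrightarrow> P (x \<oplus> y)"
  shows "P x"
proof -
  have "P (\<Oplus>n\<in>{n. hpart G D n x \<noteq> \<zero>}. hpart G D n x)"
  proof (rule finsum_induct[where P = P and c = "\<lambda>n. hpart G D n x"])
    show "P (x \<oplus> y)" if "x \<in> carrier G" "y \<in> carrier G" "P x" "P y" for x y
      using that by (rule assms(3))
  qed (use assms(1) assms(2)[OF homog_zero] assms(2)[OF hpart_homog[OF assms(1)]] in simp_all)
  then show ?thesis by (simp add: finsum_hpart assms(1))
qed

lemma eq_if_hpart_eq:
  assumes "x \<in> carrier G" "y \<in> carrier G" "\<And>n. hpart G D n x = hpart G D n y"
  shows "x = y"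
  by (rule trans[OF sym[OF finsum_hpart[OF assms(1), unfolded assms(3)]] finsum_hpart[OF assms(2)]])

end

text \<open>Existence is asked with any finite index set, and uniqueness only as independence of the
  components; subtracting two decompositions yields uniqueness in the sense of
  \<open>graded_by\<close>.\<close>

lemma graded_byI:
  fixes G (structure)
  assumes "abelian_group G" and sub: "\<And>n. additive_subgroup (D n) G"
    and ex: "\<And>x. x \<in> carrier G \<Longrightarrow>
      \<exists>c F. finite F \<and> (\<forall>n. c n \<in> D n) \<and> (\<forall>n. n \<notin> F \<longrightarrow> c n = \<zero>) \<and> x = (\<Oplus>n\<in>F. c n)"
    and indep: "\<And>c F. finite F \<Longrightarrow> (\<forall>n. c n \<in> D n) \<Longrightarrow> (\<Oplus>n\<in>F. c n) = \<zero> \<Longrightarrow> \<forall>n\<in>F. c n = \<zero>"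
  shows "graded_by G D"
  unfolding graded_by_def
proof (intro conjI allI sub ballI)
  interpret abelian_group G by fact
  have Dc: "y \<in> carrier G" if "y \<in> D n" for y n
    using additive_subgroup.a_Hcarr[OF sub that] .
  fix x assume "x \<in> carrier G"
  with ex obtain c F where F: "finite F" and c: "\<forall>n. c n \<in> D n" "\<forall>n. n \<notin> F \<longrightarrow> c n = \<zero>"
    and x: "x = (\<Oplus>n\<in>F. c n)"
    by metis
  have supp: "{n. c n \<noteq> \<zero>} \<subseteq> F" using c(2) by auto
  have fin: "finite {n. c n \<noteq> \<zero>}" by (rule finite_subset[OF supp F])
  have sumc: "(\<Oplus>n\<in>{n. c n \<noteq> \<zero>}. c n) = x"
    unfolding x by (rule add.finprod_mono_neutral_cong_left) (use F supp c Dc in blast)+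
  show "\<exists>!c. (\<forall>n. c n \<in> D n) \<and> finite {n. c n \<noteq> \<zero>} \<and> x = (\<Oplus>n\<in>{n. c n \<noteq> \<zero>}. c n)"
  proof (rule ex1I[of _ c])
    show "(\<forall>n. c n \<in> D n) \<and> finite {n. c n \<noteq> \<zero>} \<and> x = (\<Oplus>n\<in>{n. c n \<noteq> \<zero>}. c n)"
      using c fin sumc by simp
  next
    fix d assume d: "(\<forall>n. d n \<in> D n) \<and> finite {n. d n \<noteq> \<zero>} \<and> x = (\<Oplus>n\<in>{n. d n \<noteq> \<zero>}. d n)"
    \<comment> \<open>Over a common index set the two decompositions can be subtracted
      termwise.\<close>
    let ?E = "F \<union> {n. d n \<noteq> \<zero>}"
    have E: "finite ?E" using F d by simp
    have cD: "c n \<in> carrier G" and dD: "d n \<in> carrier G" for n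
      using c(1) d Dc by blast+
    have xd: "x = (\<Oplus>n\<in>?E. d n)"
      using d dD E by (auto intro!: add.finprod_mono_neutral_cong_left)
    have xc: "x = (\<Oplus>n\<in>?E. c n)"
      unfolding x by (rule add.finprod_mono_neutral_cong_left) (use E c cD in auto)
    have neg: "\<ominus> d n \<in> D n" for n
      using d add.subgroupE(3)[OF additive_subgroup.a_subgroup[OF sub]] by blast
    have "(\<Oplus>n\<in>?E. c n \<oplus> \<ominus> d n) \<oplus> (\<Oplus>n\<in>?E. d n) = (\<Oplus>n\<in>?E. (c n \<oplus> \<ominus> d n) \<oplus> d n)"
      using cD dD by (intro finsum_addf[symmetric]) auto
    also have "\<dots> = (\<Oplus>n\<in>?E. c n)"
      using cD dD by (intro finsum_cong') (auto simp: a_assoc l_neg)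
    finally have "(\<Oplus>n\<in>?E. c n \<oplus> \<ominus> d n) \<oplus> x = x"
      using xc xd by simp
    moreover have cl: "(\<Oplus>n\<in>?E. c n \<oplus> \<ominus> d n) \<in> carrier G" "x \<in> carrier G"
      using cD dD \<open>x \<in> carrier G\<close> by (auto intro!: finsum_closed)
    ultimately have "(\<Oplus>n\<in>?E. c n \<oplus> \<ominus> d n) = \<zero>"
      by simp
    then have "\<forall>n\<in>?E. c n \<oplus> \<ominus> d n = \<zero>"
      using c neg additive_subgroup.a_closed[OF sub] by (intro indep[OF E]) auto
    then have "\<forall>n\<in>?E. d n = c n"
      using cD dD by (metis add.inv_closed minus_equality minus_minus)
    then show "d = c"
      using c(2) by (intro ext) (metis (mono_tags, lifting) UnCI mem_Collect_eq)
  qed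
qed

text \<open>Components depend on a record only through its zero and its finite sums, so they survive
  a change of multiplication or action.\<close>

lemma hpart_cong:
  assumes "(finsum G :: (int \<Rightarrow> _) \<Rightarrow> _) = finsum G'" "\<zero>\<^bsub>G\<^esub> = \<zero>\<^bsub>G'\<^esub>"
  shows "hpart G D = hpart G' D"
  unfolding hpart_def fun_eq_iff using assms by simp

section \<open>Graded modules and their submodules\<close>

locale graded_ring = ring A + graded_group A "homog A" for A :: "('k, 'u) galgebra" (structure) +
  assumes one_homog [simp]: "\<one> \<in> homog A 0"
    and mult_homog: "a \<in> homog A n \<Longrightarrow> b \<in> homog A m \<Longrightarrow> a \<otimes> b \<in> homog A (n + m)"

lemma graded_algebra_graded_ring: "graded_algebra K A \<Longrightarrow> graded_ring A"
  unfolding graded_algebra_def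
  by (auto simp: graded_ring_def graded_group_def graded_group_axioms_def graded_ring_axioms_def ring.is_abelian_group)

locale right_module = abelian_group M for R :: "('a, 'x) ring_scheme" and M :: "('a, 'm, 'y) rmod_scheme" (structure) +
  assumes rmodule: "rmodule R M"
begin

sublocale R: ring R using rmodule by (simp add: rmodule_def)

lemma ract_closed [simp]: "m \<in> carrier M \<Longrightarrow> a \<in> carrier R \<Longrightarrow> ract M m a \<in> carrier M"
  and ract_add_left: "m \<in> carrier M \<Longrightarrow> m' \<in> carrier M \<Longrightarrow> a \<in> carrier R \<Longrightarrow>
    ract M (m \<oplus> m') a = ract M m a \<oplus> ract M m' a"
  and ract_add_right: "m \<in> carrier M \<Longrightarrow> a \<in> carrier R \<Longrightarrow> b \<in> carrier R \<Longrightarrow>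
    ract M m (a \<oplus>\<^bsub>R\<^esub> b) = ract M m a \<oplus> ract M m b"
  and ract_mult: "m \<in> carrier M \<Longrightarrow> a \<in> carrier R \<Longrightarrow> b \<in> carrier R \<Longrightarrow>
    ract M m (a \<otimes>\<^bsub>R\<^esub> b) = ract M (ract M m a) b"
  and ract_one [simp]: "m \<in> carrier M \<Longrightarrow> ract M m \<one>\<^bsub>R\<^esub> = m"
  using rmodule by (auto simp: rmodule_def)

lemma ract_zero_left [simp]: "a \<in> carrier R \<Longrightarrow> ract M \<zero> a = \<zero>"
  using ract_add_left[of \<zero> \<zero> a] add.l_cancel_one[of "ract M \<zero> a" "ract M \<zero> a"] by simp

lemma ract_zero_right [simp]: "m \<in> carrier M \<Longrightarrow> ract M m \<zero>\<^bsub>R\<^esub> = \<zero>"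
  using ract_add_right[of m "\<zero>\<^bsub>R\<^esub>" "\<zero>\<^bsub>R\<^esub>"] add.l_cancel_one[of "ract M m \<zero>\<^bsub>R\<^esub>" "ract M m \<zero>\<^bsub>R\<^esub>"] by simp

text \<open>Because acting by \<open>-1\<close> is negation, subsets closed under addition and the
  action are closed under negation; this spares a clause for inverses in submodules and
  relations.\<close>

lemma ract_minus_one [simp]: "m \<in> carrier M \<Longrightarrow> ract M m (\<ominus>\<^bsub>R\<^esub> \<one>\<^bsub>R\<^esub>) = \<ominus> m"
  using ract_add_right[of m "\<ominus>\<^bsub>R\<^esub> \<one>\<^bsub>R\<^esub>" "\<one>\<^bsub>R\<^esub>"] by (simp add: R.l_neg minus_equality)

lemma ract_finsum_left:
  assumes "finite F" "\<And>n. n \<in> F \<Longrightarrow> c n \<in> carrier M" "a \<in> carrier R"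
  shows "ract M (\<Oplus>n\<in>F. c n) a = (\<Oplus>n\<in>F. ract M (c n) a)"
  using assms(1,2)
proof (induction F rule: finite_induct)
  case (insert n F)
  then show ?case using assms(3) by (simp add: Pi_def finsum_closed ract_add_left)
qed (simp add: assms(3))

end

lemma right_moduleI: "rmodule R M \<Longrightarrow> right_module R M"
  by (simp add: right_module_def right_module_axioms_def rmodule_def)

locale graded_module = A: graded_ring A + graded_group M "gr M" + right_module A M
  for A :: "('k, 'a) galgebra" and M :: "('a, 'm) gmod" (structure) +
  assumes ract_homog: "m \<in> gr M n \<Longrightarrow> a \<in> homog A k \<Longrightarrow> ract M m a \<in> gr M (n + k)"

lemma graded_module_iff: "graded_module A M \<longleftrightarrow> graded_ring A \<and> graded_rmodule A M"
  unfolding graded_module_def graded_module_axioms_def graded_rmodule_def right_module_def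
    right_module_axioms_def graded_group_def graded_group_axioms_def
  by (auto simp: rmodule_def)

section \<open>Graded relations between modules\<close>

text \<open>These are the graded submodules of the product of \<open>M\<close> and \<open>N\<close>;
  keeping them as sets of pairs avoids a record for the product. Submodules (on the diagonal),
  homomorphisms (as graphs) and projections to subquotients are all instances.\<close>

definition grel :: "('k, 'a) galgebra \<Rightarrow> ('a, 'm) gmod \<Rightarrow> ('a, 'n) gmod \<Rightarrow> ('m \<times> 'n) set \<Rightarrow> bool" where
  "grel A M N R \<longleftrightarrow> R \<subseteq> carrier M \<times> carrier N \<and> (\<zero>\<^bsub>M\<^esub>, \<zero>\<^bsub>N\<^esub>) \<in> R \<and>
    (\<forall>x y x' y'. (x, y) \<in> R \<longrightarrow> (x', y') \<in> R \<longrightarrow> (x \<oplus>\<^bsub>M\<^esub> x', y \<oplus>\<^bsub>N\<^esub> y') \<in> R) \<and>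
    (\<forall>x y a. (x, y) \<in> R \<longrightarrow> a \<in> carrier A \<longrightarrow> (ract M x a, ract N y a) \<in> R) \<and>
    (\<forall>x y n. (x, y) \<in> R \<longrightarrow> (hpart M (gr M) n x, hpart N (gr N) n y) \<in> R)"

lemma grelD:
  assumes "grel A M N R"
  shows "R \<subseteq> carrier M \<times> carrier N" "(\<zero>\<^bsub>M\<^esub>, \<zero>\<^bsub>N\<^esub>) \<in> R"
    "\<And>x y x' y'. (x, y) \<in> R \<Longrightarrow> (x', y') \<in> R \<Longrightarrow> (x \<oplus>\<^bsub>M\<^esub> x', y \<oplus>\<^bsub>N\<^esub> y') \<in> R"
    "\<And>x y a. (x, y) \<in> R \<Longrightarrow> a \<in> carrier A \<Longrightarrow> (ract M x a, ract N y a) \<in> R"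
    "\<And>x y n. (x, y) \<in> R \<Longrightarrow> (hpart M (gr M) n x, hpart N (gr N) n y) \<in> R"
    "\<And>x y. (x, y) \<in> R \<Longrightarrow> x \<in> carrier M" "\<And>x y. (x, y) \<in> R \<Longrightarrow> y \<in> carrier N"
  using assms by (auto simp: grel_def)

lemma grelI:
  assumes "R \<subseteq> carrier M \<times> carrier N" "(\<zero>\<^bsub>M\<^esub>, \<zero>\<^bsub>N\<^esub>) \<in> R"
    "\<And>x y x' y'. (x, y) \<in> R \<Longrightarrow> (x', y') \<in> R \<Longrightarrow> (x \<oplus>\<^bsub>M\<^esub> x', y \<oplus>\<^bsub>N\<^esub> y') \<in> R"
    "\<And>x y a. (x, y) \<in> R \<Longrightarrow> a \<in> carrier A \<Longrightarrow> (ract M x a, ract N y a) \<in> R"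
    "\<And>x y n. (x, y) \<in> R \<Longrightarrow> (hpart M (gr M) n x, hpart N (gr N) n y) \<in> R"
  shows "grel A M N R"
  using assms by (auto simp: grel_def)

lemma pair_finsum_closed:
  fixes M :: "('m, 'y) ring_scheme" and N :: "('n, 'z) ring_scheme"
  assumes "abelian_group M" "abelian_group N"
    and "R \<subseteq> carrier M \<times> carrier N" "(\<zero>\<^bsub>M\<^esub>, \<zero>\<^bsub>N\<^esub>) \<in> R"
    "\<And>x y x' y'. (x, y) \<in> R \<Longrightarrow> (x', y') \<in> R \<Longrightarrow> (x \<oplus>\<^bsub>M\<^esub> x', y \<oplus>\<^bsub>N\<^esub> y') \<in> R"
    and "finite F" "\<And>n. n \<in> F \<Longrightarrow> (f n, g n) \<in> R"
  shows "((\<Oplus>\<^bsub>M\<^esub>n\<in>F. f n), (\<Oplus>\<^bsub>N\<^esub>n\<in>F. g n)) \<in> R"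
proof -
  interpret M: abelian_group M by fact
  interpret N: abelian_group N by fact
  show ?thesis
    using assms(6,7)
  proof (induction F rule: finite_induct)
    case (insert n F)
    have "f \<in> F \<rightarrow> carrier M" "g \<in> F \<rightarrow> carrier N" "f n \<in> carrier M" "g n \<in> carrier N"
      using insert.prems assms(3) by auto
    then show ?case using insert assms(5) by (simp add: M.finsum_insert N.finsum_insert)
  qed (use assms(4) in simp)
qed

lemma grel_converse: "grel A M N R \<Longrightarrow> grel A N M (R\<inverse>)"
  by (auto simp: grel_def)

lemma grel_relcomp: "grel A M N R \<Longrightarrow> grel A N P S \<Longrightarrow> grel A M P (R O S)"
proof (rule grelI)
  assume R: "grel A M N R" and S: "grel A N P S"
  show "R O S \<subseteq> carrier M \<times> carrier P" using grelD(1)[OF R] grelD(1)[OF S] by auto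
  show "(\<zero>\<^bsub>M\<^esub>, \<zero>\<^bsub>P\<^esub>) \<in> R O S" using grelD(2)[OF R] grelD(2)[OF S] by auto
  fix x z assume "(x, z) \<in> R O S"
  then obtain y where y: "(x, y) \<in> R" "(y, z) \<in> S" by auto
  show "(ract M x a, ract P z a) \<in> R O S" if "a \<in> carrier A" for a
    using grelD(4)[OF R y(1) that] grelD(4)[OF S y(2) that] by auto
  show "(hpart M (gr M) n x, hpart P (gr P) n z) \<in> R O S" for n
    using grelD(5)[OF R y(1)] grelD(5)[OF S y(2)] by auto
  fix x' z' assume "(x', z') \<in> R O S"
  then obtain y' where y': "(x', y') \<in> R" "(y', z') \<in> S" by auto
  show "(x \<oplus>\<^bsub>M\<^esub> x', z \<oplus>\<^bsub>P\<^esub> z') \<in> R O S"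
    using grelD(3)[OF R y(1) y'(1)] grelD(3)[OF S y(2) y'(2)] by auto
qed

lemma grel_minus:
  assumes M: "graded_module A M" and N: "graded_module A N" and R: "grel A M N R"
    and xy: "(x, y) \<in> R" "(x', y') \<in> R"
  shows "(x \<ominus>\<^bsub>M\<^esub> x', y \<ominus>\<^bsub>N\<^esub> y') \<in> R"
proof -
  interpret M: graded_module A M by fact
  interpret N: graded_module A N by fact
  have "(ract M x' (\<ominus>\<^bsub>A\<^esub> \<one>\<^bsub>A\<^esub>), ract N y' (\<ominus>\<^bsub>A\<^esub> \<one>\<^bsub>A\<^esub>)) \<in> R"
    using grelD(4)[OF R xy(2)] by simp
  then show ?thesis
    using grelD(3)[OF R xy(1)] grelD(6,7)[OF R xy(2)] by (simp add: M.minus_eq N.minus_eq)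
qed

text \<open>A pair splits into pairs of components of equal degree, and these again lie in the
  relation, so the action is tested only on pairs homogeneous of one degree. There a twist acts on
  both entries through the same map, which is why this form is wanted.\<close>

lemma grel_iff_homogeneous:
  assumes M: "graded_module A M" and N: "graded_module A N"
  shows "grel A M N R \<longleftrightarrow> R \<subseteq> carrier M \<times> carrier N \<and> (\<zero>\<^bsub>M\<^esub>, \<zero>\<^bsub>N\<^esub>) \<in> R \<and>
    (\<forall>x y x' y'. (x, y) \<in> R \<longrightarrow> (x', y') \<in> R \<longrightarrow> (x \<oplus>\<^bsub>M\<^esub> x', y \<oplus>\<^bsub>N\<^esub> y') \<in> R) \<and>
    (\<forall>n x y a. (x, y) \<in> R \<longrightarrow> x \<in> gr M n \<longrightarrow> y \<in> gr N n \<longrightarrow> a \<in> carrier A \<longrightarrow> (ract M x a, ract N y a) \<in> R) \<and>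
    (\<forall>x y n. (x, y) \<in> R \<longrightarrow> (hpart M (gr M) n x, hpart N (gr N) n y) \<in> R)"
    (is "_ \<longleftrightarrow> ?h")
proof
  interpret M: graded_module A M by fact
  interpret N: graded_module A N by fact
  assume h: ?h
  show "grel A M N R"
  proof (rule grelI)
    fix x y a assume xy: "(x, y) \<in> R" and a: "a \<in> carrier A"
    have c: "x \<in> carrier M" "y \<in> carrier N" using xy h by auto
    \<comment> \<open>The union of the supports serves as one index set for both entries.\<close>
    let ?F = "{n. hpart M (gr M) n x \<noteq> \<zero>\<^bsub>M\<^esub>} \<union> {n. hpart N (gr N) n y \<noteq> \<zero>\<^bsub>N\<^esub>}"
    have F: "finite ?F" using c by simp
    have x: "x = (\<Oplus>\<^bsub>M\<^esub>n\<in>?F. hpart M (gr M) n x)"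
      using M.finsum_hpart_superset[OF c(1) F] by auto
    have y: "y = (\<Oplus>\<^bsub>N\<^esub>n\<in>?F. hpart N (gr N) n y)"
      using N.finsum_hpart_superset[OF c(2) F] by auto
    have "ract M x a = (\<Oplus>\<^bsub>M\<^esub>n\<in>?F. ract M (hpart M (gr M) n x) a)"
      by (subst x, rule M.ract_finsum_left) (use F c a in auto)
    moreover have "ract N y a = (\<Oplus>\<^bsub>N\<^esub>n\<in>?F. ract N (hpart N (gr N) n y) a)"
      by (subst y, rule N.ract_finsum_left) (use F c a in auto)
    moreover have "(ract M (hpart M (gr M) n x) a, ract N (hpart N (gr N) n y) a) \<in> R" for n
      using h xy a c M.hpart_homog[OF c(1)] N.hpart_homog[OF c(2)] by blast
    moreover have "((\<Oplus>\<^bsub>M\<^esub>n\<in>?F. ract M (hpart M (gr M) n x) a), (\<Oplus>\<^bsub>N\<^esub>n\<in>?F. ract N (hpart N (gr N) n y) a)) \<in> R"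
    proof (rule pair_finsum_closed[OF M.abelian_group_axioms N.abelian_group_axioms _ _ _ F])
      show "(u \<oplus>\<^bsub>M\<^esub> u', v \<oplus>\<^bsub>N\<^esub> v') \<in> R" if "(u, v) \<in> R" "(u', v') \<in> R" for u v u' v'
        using h that by simp
    qed (use h calculation(3) in simp_all)
    ultimately show "(ract M x a, ract N y a) \<in> R" by simp
  qed (use h in auto)
qed (auto simp: grel_def)

section \<open>Graded submodules\<close>

lemma gsubmodule_iff:
  assumes M: "graded_module A M"
  shows "gsubmodule A M S \<longleftrightarrow> S \<subseteq> carrier M \<and> \<zero>\<^bsub>M\<^esub> \<in> S \<and> (\<forall>x\<in>S. \<forall>y\<in>S. x \<oplus>\<^bsub>M\<^esub> y \<in> S) \<and>
    (\<forall>x\<in>S. \<forall>a\<in>carrier A. ract M x a \<in> S) \<and> (\<forall>x\<in>S. \<forall>n. hpart M (gr M) n x \<in> S)"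
proof -
  interpret M: graded_module A M by fact
  have "subgroup S (add_monoid M)"
    if "S \<subseteq> carrier M" "\<zero>\<^bsub>M\<^esub> \<in> S" "\<forall>x\<in>S. \<forall>y\<in>S. x \<oplus>\<^bsub>M\<^esub> y \<in> S" "\<forall>x\<in>S. \<forall>a\<in>carrier A. ract M x a \<in> S"
  proof (rule M.add.subgroupI)
    fix x assume "x \<in> S"
    then have "ract M x (\<ominus>\<^bsub>A\<^esub> \<one>\<^bsub>A\<^esub>) \<in> S" "x \<in> carrier M" using that by auto
    then show "\<ominus>\<^bsub>M\<^esub> x \<in> S" by simp
  qed (use that in auto)
  moreover have "S \<subseteq> carrier M \<and> \<zero>\<^bsub>M\<^esub> \<in> S \<and> (\<forall>x\<in>S. \<forall>y\<in>S. x \<oplus>\<^bsub>M\<^esub> y \<in> S)" if "additive_subgroup S M"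
    using additive_subgroup.a_subset[OF that] additive_subgroup.zero_closed[OF that]
      additive_subgroup.a_closed[OF that] by auto
  ultimately show ?thesis
    unfolding gsubmodule_def using additive_subgroupI by auto
qed

text \<open>Submodules become partial identities; composing with one restricts the domain of a
  relation.\<close>

lemma gsubmodule_iff_grel: "graded_module A M \<Longrightarrow> gsubmodule A M S \<longleftrightarrow> grel A M M (Id_on S)"
  unfolding gsubmodule_iff grel_def Id_on_iff by auto

lemma gsubmodule_carrier:
  assumes "graded_module A M" shows "gsubmodule A M (carrier M)"
proof -
  interpret graded_module A M by fact
  show ?thesis unfolding gsubmodule_iff[OF assms] by simp
qed

lemma gsubmodule_zero:
  assumes "graded_module A M" shows "gsubmodule A M {\<zero>\<^bsub>M\<^esub>}"
proof -
  interpret graded_module A M by fact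
  show ?thesis unfolding gsubmodule_iff[OF assms] by simp
qed

text \<open>Applied to converse relations, this also covers preimages, kernels and domains.\<close>

lemma gsubmodule_Image:
  assumes M: "graded_module A M" and N: "graded_module A N" and R: "grel A M N R" and S: "gsubmodule A M S"
  shows "gsubmodule A N (R `` S)"
  unfolding gsubmodule_iff[OF N]
proof (intro conjI ballI allI)
  note S' = S[unfolded gsubmodule_iff[OF M]]
  show "R `` S \<subseteq> carrier N" using grelD(7)[OF R] by auto
  show "\<zero>\<^bsub>N\<^esub> \<in> R `` S" using grelD(2)[OF R] S' by auto
  fix y assume "y \<in> R `` S"
  then obtain x where x: "x \<in> S" "(x, y) \<in> R" by auto
  show "ract N y a \<in> R `` S" if "a \<in> carrier A" for a
    using grelD(4)[OF R x(2) that] S' x(1) that by auto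
  show "hpart N (gr N) n y \<in> R `` S" for n
    by (rule ImageI[OF grelD(5)[OF R x(2)]]) (use S' x(1) in blast)
  fix y' assume "y' \<in> R `` S"
  then obtain x' where x': "x' \<in> S" "(x', y') \<in> R" by auto
  show "y \<oplus>\<^bsub>N\<^esub> y' \<in> R `` S"
    using grelD(3)[OF R x(2) x'(2)] S' x(1) x'(1) by auto
qed

lemma gsubmodule_Domain:
  assumes M: "graded_module A M" and N: "graded_module A N" and R: "grel A M N R"
  shows "gsubmodule A M (Domain R)"
proof -
  have "Domain R = R\<inverse> `` carrier N" using grelD(1)[OF R] by auto
  then show ?thesis
    using gsubmodule_Image[OF N M grel_converse[OF R] gsubmodule_carrier[OF N]] by simp
qed

text \<open>Two values over one point differ by a value over zero.\<close>

lemma grel_single_valued: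
  assumes M: "graded_module A M" and N: "graded_module A N" and R: "grel A M N R"
    and "R `` {\<zero>\<^bsub>M\<^esub>} = {\<zero>\<^bsub>N\<^esub>}" "(x, y) \<in> R" "(x, y') \<in> R"
  shows "y = y'"
proof -
  interpret M: graded_module A M by fact
  interpret N: graded_module A N by fact
  have "(x \<ominus>\<^bsub>M\<^esub> x, y \<ominus>\<^bsub>N\<^esub> y') \<in> R"
    using grel_minus[OF M N R] assms by blast
  then have "y \<ominus>\<^bsub>N\<^esub> y' = \<zero>\<^bsub>N\<^esub>"
    using assms(4) grelD(6)[OF R assms(5)] by (auto simp: M.minus_eq M.r_neg)
  then show ?thesis
    using grelD(7)[OF R] assms(5,6) N.minus_eq_zero_iff by blast
qed

section \<open>Homomorphisms as relations\<close>

definition fgraph :: "('a, 'm, 'y) rmod_scheme \<Rightarrow> ('m \<Rightarrow> 'n) \<Rightarrow> ('m \<times> 'n) set" where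
  "fgraph M f = (\<lambda>x. (x, f x)) ` carrier M"

text \<open>Being a homomorphism of graded modules is a property of the graph. Hence a functor that
  keeps carriers and graded relations leaves Hom-sets literally unchanged. Extensionality fixes the
  function outside the carrier.\<close>

lemma ghom_iff_grel:
  assumes M: "graded_module A M" and N: "graded_module A N"
  shows "f \<in> ghom A M N \<longleftrightarrow> f \<in> extensional (carrier M) \<and> grel A M N (fgraph M f)"
proof
  interpret M: graded_module A M by fact
  interpret N: graded_module A N by fact
  {
    assume f: "f \<in> ghom A M N"
    then have cl: "\<And>x. x \<in> carrier M \<Longrightarrow> f x \<in> carrier N"
      and add: "\<And>x y. x \<in> carrier M \<Longrightarrow> y \<in> carrier M \<Longrightarrow> f (x \<oplus>\<^bsub>M\<^esub> y) = f x \<oplus>\<^bsub>N\<^esub> f y"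
      and act: "\<And>x a. x \<in> carrier M \<Longrightarrow> a \<in> carrier A \<Longrightarrow> f (ract M x a) = ract N (f x) a"
      and gr: "\<And>n x. x \<in> gr M n \<Longrightarrow> f x \<in> gr N n"
      and ext: "f \<in> extensional (carrier M)"
      by (auto simp: ghom_def rhom_def PiE_def image_subset_iff)
    have z: "f \<zero>\<^bsub>M\<^esub> = \<zero>\<^bsub>N\<^esub>"
      using add[of "\<zero>\<^bsub>M\<^esub>" "\<zero>\<^bsub>M\<^esub>"] cl[of "\<zero>\<^bsub>M\<^esub>"] N.add.l_cancel_one[of "f \<zero>\<^bsub>M\<^esub>" "f \<zero>\<^bsub>M\<^esub>"] by simp
    \<comment> \<open>Preserving degrees amounts to commuting with all components.\<close>
    have hp: "f (hpart M (gr M) n x) = hpart N (gr N) n (f x)" if "x \<in> carrier M" for n x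
      using that
    proof (induction x rule: M.graded_induct)
      case (homog k x)
      then show ?case by (simp add: M.hpart_of_homog N.hpart_of_homog[OF gr] z)
    next
      case (add x y)
      then show ?case by (simp add: M.hpart_add N.hpart_add cl \<open>\<And>x y. x \<in> carrier M \<Longrightarrow> y \<in> carrier M \<Longrightarrow> f (x \<oplus>\<^bsub>M\<^esub> y) = f x \<oplus>\<^bsub>N\<^esub> f y\<close>)
    qed
    have "grel A M N (fgraph M f)"
      unfolding fgraph_def
      by (rule grelI) (auto simp: cl add act z hp image_iff)
    with ext show "f \<in> extensional (carrier M) \<and> grel A M N (fgraph M f)" by simp
  next
    assume f: "f \<in> extensional (carrier M) \<and> grel A M N (fgraph M f)"
    then have R: "grel A M N (fgraph M f)" by simp
    have m: "(x, y) \<in> fgraph M f \<longleftrightarrow> x \<in> carrier M \<and> y = f x" for x y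
      by (auto simp: fgraph_def)
    have "f x \<in> gr N n" if "x \<in> gr M n" for x n
      using grelD(5)[OF R, of x "f x" n] m[of x "f x"] M.homog_carrier[OF that] M.hpart_of_homog[OF that, of n]
        grelD(7)[OF R] N.hpart_homog m by metis
    moreover have "f \<in> carrier M \<rightarrow>\<^sub>E carrier N"
      using f grelD(7)[OF R] m unfolding PiE_def by blast
    moreover have "\<forall>x\<in>carrier M. \<forall>y\<in>carrier M. f (x \<oplus>\<^bsub>M\<^esub> y) = f x \<oplus>\<^bsub>N\<^esub> f y"
      using grelD(3)[OF R] m by metis
    moreover have "\<forall>x\<in>carrier M. \<forall>a\<in>carrier A. f (ract M x a) = ract N (f x) a"
      using grelD(4)[OF R] m by metis
    ultimately show "f \<in> ghom A M N"
      unfolding ghom_def rhom_def by auto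
  }
qed

lemma mem_fgraph: "(x, y) \<in> fgraph M f \<longleftrightarrow> x \<in> carrier M \<and> y = f x"
  by (auto simp: fgraph_def)

lemma fgraph_compose: "f ` carrier M \<subseteq> carrier N \<Longrightarrow> fgraph M (compose (carrier M) g f) = fgraph M f O fgraph N g"
  by (auto simp: mem_fgraph compose_def relcomp.simps image_subset_iff)

lemma fgraph_id: "fgraph M (\<lambda>x\<in>carrier M. x) = Id_on (carrier M)"
  by (auto simp: mem_fgraph)

text \<open>Homomorphisms between modules known only through relations are produced this way:
  compose relations, then check that the composite is total and relates zero only to zero.\<close>

lemma total_grel_is_graph:
  assumes M: "graded_module A M" and N: "graded_module A N" and R: "grel A M N R"
    and dom: "carrier M \<subseteq> Domain R" and z: "R `` {\<zero>\<^bsub>M\<^esub>} \<subseteq> {\<zero>\<^bsub>N\<^esub>}"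
  obtains f where "f \<in> ghom A M N" "R = fgraph M f"
proof -
  have z': "R `` {\<zero>\<^bsub>M\<^esub>} = {\<zero>\<^bsub>N\<^esub>}" using z grelD(2)[OF R] by auto
  define f where "f = (\<lambda>x\<in>carrier M. SOME y. (x, y) \<in> R)"
  have f: "(x, f x) \<in> R" if "x \<in> carrier M" for x
    using dom that someI_ex[of "\<lambda>y. (x, y) \<in> R"] unfolding f_def by auto
  have "R = fgraph M f"
    using f grel_single_valued[OF M N R z'] grelD(6)[OF R] by (auto simp: mem_fgraph)
  moreover have "f \<in> extensional (carrier M)" by (simp add: f_def)
  ultimately show ?thesis
    using that R ghom_iff_grel[OF M N] by metis
qed

lemma ghom_closed: "f \<in> ghom A M N \<Longrightarrow> f ` carrier M \<subseteq> carrier N"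
  by (auto simp: ghom_def rhom_def)

section \<open>The category of graded modules\<close>

lemma category_Gr: assumes "graded_ring A" shows "category (Gr A)"
proof -
  have m: "graded_module A M" if "M \<in> Ob (Gr A)" for M
    using that assms by (simp add: Gr_def graded_module_iff)
  show ?thesis
    unfolding category_def
  proof (intro conjI ballI)
    fix M assume M: "M \<in> Ob (Gr A)"
    show "Idt (Gr A) M \<in> Hom (Gr A) M M"
      using gsubmodule_carrier[OF m[OF M]] m[OF M]
      by (simp add: Gr_def ghom_iff_grel fgraph_id gsubmodule_iff_grel)
  next
    fix M N P f g assume o: "M \<in> Ob (Gr A)" "N \<in> Ob (Gr A)" "P \<in> Ob (Gr A)"
      and fg: "f \<in> Hom (Gr A) M N" "g \<in> Hom (Gr A) N P"
    then have "f ` carrier M \<subseteq> carrier N"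
      using ghom_closed[of f A M N] by (simp add: Gr_def)
    then show "Cmp (Gr A) M N P g f \<in> Hom (Gr A) M P"
      using fg m[OF o(1)] m[OF o(2)] m[OF o(3)]
      by (auto simp: Gr_def ghom_iff_grel fgraph_compose intro: grel_relcomp)
  next
    fix M N f assume "f \<in> Hom (Gr A) M N"
    then have "f \<in> carrier M \<rightarrow> carrier N" "f \<in> extensional (carrier M)"
      by (auto simp: Gr_def ghom_def rhom_def PiE_def)
    then show "Cmp (Gr A) M M N f (Idt (Gr A) M) = f" "Cmp (Gr A) M N N (Idt (Gr A) N) f = f"
      by (auto simp: Gr_def compose_Id Id_compose fun_eq_iff compose_def extensional_def)
  next
    fix L M N P f g h
    assume "f \<in> Hom (Gr A) L M" "g \<in> Hom (Gr A) M N" "h \<in> Hom (Gr A) N P"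
    then show "Cmp (Gr A) L M P (Cmp (Gr A) M N P h g) f = Cmp (Gr A) L N P h (Cmp (Gr A) L M N g f)"
      using ghom_closed by (auto simp: Gr_def compose_def fun_eq_iff ghom_def rhom_def PiE_def Pi_def)
  qed
qed

section \<open>Transport of module structures along surjections\<close>

text \<open>The module laws are equations, and negatives are images of negatives, so everything
  passes along \<open>p\<close>. As no structure on \<open>Q\<close> is presupposed, quotients and
  copies of modules are recognized by this.\<close>

lemma rmodule_image:
  fixes M :: "('a, 'm, 'y) rmod_scheme" (structure) and Q :: "('a, 'n, 'z) rmod_scheme"
  assumes M: "rmodule R M" and p: "p ` carrier M = carrier Q" and z: "p \<zero>\<^bsub>M\<^esub> = \<zero>\<^bsub>Q\<^esub>"
    and add: "\<And>x y. x \<in> carrier M \<Longrightarrow> y \<in> carrier M \<Longrightarrow> p (x \<oplus>\<^bsub>M\<^esub> y) = p x \<oplus>\<^bsub>Q\<^esub> p y"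
    and act: "\<And>x a. x \<in> carrier M \<Longrightarrow> a \<in> carrier R \<Longrightarrow> p (ract M x a) = ract Q (p x) a"
  shows "rmodule R Q"
proof -
  interpret right_module R M by (rule right_moduleI[OF M])
  have s: "\<exists>u\<in>carrier M. x = p u" if "x \<in> carrier Q" for x
    using that p by auto
  have pc: "p u \<in> carrier Q" if "u \<in> carrier M" for u using that p by auto
  have ab: "abelian_group Q"
  proof (rule abelian_groupI)
    fix x y assume "x \<in> carrier Q" "y \<in> carrier Q"
    then obtain u v where u: "u \<in> carrier M" "x = p u" "v \<in> carrier M" "y = p v" using s by metis
    then show "x \<oplus>\<^bsub>Q\<^esub> y \<in> carrier Q" "x \<oplus>\<^bsub>Q\<^esub> y = y \<oplus>\<^bsub>Q\<^esub> x"
      by (simp_all add: add[symmetric] pc a_comm)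
  next
    fix x y w assume "x \<in> carrier Q" "y \<in> carrier Q" "w \<in> carrier Q"
    then obtain u v t where u: "u \<in> carrier M" "x = p u" "v \<in> carrier M" "y = p v" "t \<in> carrier M" "w = p t"
      using s by metis
    then show "x \<oplus>\<^bsub>Q\<^esub> y \<oplus>\<^bsub>Q\<^esub> w = x \<oplus>\<^bsub>Q\<^esub> (y \<oplus>\<^bsub>Q\<^esub> w)"
      by (simp add: add[symmetric] a_assoc)
  next
    show "\<zero>\<^bsub>Q\<^esub> \<in> carrier Q" using pc[of \<zero>] z by simp
  next
    fix x assume "x \<in> carrier Q"
    then obtain u where u: "u \<in> carrier M" "x = p u" using s by metis
    then show "\<zero>\<^bsub>Q\<^esub> \<oplus>\<^bsub>Q\<^esub> x = x" by (simp add: add[symmetric] z[symmetric])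
    have "p (\<ominus> u) \<oplus>\<^bsub>Q\<^esub> x = \<zero>\<^bsub>Q\<^esub>" using u by (simp add: add[symmetric] z[symmetric] l_neg)
    then show "\<exists>y\<in>carrier Q. y \<oplus>\<^bsub>Q\<^esub> x = \<zero>\<^bsub>Q\<^esub>" using u pc by blast
  qed
  show ?thesis
    unfolding rmodule_def
  proof (intro conjI ballI ab R.ring_axioms)
    fix x a assume "x \<in> carrier Q" and a: "a \<in> carrier R"
    then obtain u where u: "u \<in> carrier M" "x = p u" using s by metis
    then show "ract Q x a \<in> carrier Q" by (simp add: act[symmetric] pc a)
    fix b assume b: "b \<in> carrier R"
    show "ract Q x (a \<oplus>\<^bsub>R\<^esub> b) = ract Q x a \<oplus>\<^bsub>Q\<^esub> ract Q x b"
      "ract Q x (a \<otimes>\<^bsub>R\<^esub> b) = ract Q (ract Q x a) b"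
      using u a b by (simp_all add: act[symmetric] add[symmetric] ract_add_right ract_mult)
  next
    fix x y a assume "x \<in> carrier Q" "y \<in> carrier Q" and a: "a \<in> carrier R"
    then obtain u v where u: "u \<in> carrier M" "x = p u" "v \<in> carrier M" "y = p v" using s by metis
    then show "ract Q (x \<oplus>\<^bsub>Q\<^esub> y) a = ract Q x a \<oplus>\<^bsub>Q\<^esub> ract Q y a"
      using a by (simp add: act[symmetric] add[symmetric] ract_add_left)
  next
    fix x assume "x \<in> carrier Q"
    then obtain u where u: "u \<in> carrier M" "x = p u" using s by metis
    then show "ract Q x \<one>\<^bsub>R\<^esub> = x" by (simp add: act[symmetric])
  qed
qed

text \<open>Beyond the module laws, the images of the components must be independent. That is where
  stability of the kernel under taking components enters.\<close>

lemma graded_rmodule_image: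
  fixes M :: "('a, 'm) gmod" (structure) and Q :: "('a, 'n) gmod"
  assumes M: "graded_module A M" and p: "p ` carrier M = carrier Q" and z: "p \<zero>\<^bsub>M\<^esub> = \<zero>\<^bsub>Q\<^esub>"
    and add: "\<And>x y. x \<in> carrier M \<Longrightarrow> y \<in> carrier M \<Longrightarrow> p (x \<oplus>\<^bsub>M\<^esub> y) = p x \<oplus>\<^bsub>Q\<^esub> p y"
    and act: "\<And>x a. x \<in> carrier M \<Longrightarrow> a \<in> carrier A \<Longrightarrow> p (ract M x a) = ract Q (p x) a"
    and gr: "\<And>n. gr Q n = p ` gr M n"
    and ker: "\<And>x n. x \<in> carrier M \<Longrightarrow> p x = \<zero>\<^bsub>Q\<^esub> \<Longrightarrow> p (hpart M (gr M) n x) = \<zero>\<^bsub>Q\<^esub>"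
  shows "graded_rmodule A Q"
proof -
  interpret graded_module A M by fact
  have rm: "rmodule A Q"
    by (rule rmodule_image[OF rmodule p z]) (simp_all add: add act)
  interpret Q: right_module A Q by (rule right_moduleI[OF rm])
  have pc: "p u \<in> carrier Q" if "u \<in> carrier M" for u using that p by auto
  have psum: "p (\<Oplus>n\<in>F. c n) = (\<Oplus>\<^bsub>Q\<^esub>n\<in>F. p (c n))"
    if "finite F" "\<And>n. n \<in> F \<Longrightarrow> c n \<in> carrier M" for F and c :: "int \<Rightarrow> 'm"
    using that
  proof (induction F rule: finite_induct)
    case (insert n F)
    then show ?case by (simp add: Pi_def finsum_closed add Q.finsum_insert pc)
  qed (simp add: z)
  have inv: "p (\<ominus> u) = \<ominus>\<^bsub>Q\<^esub> p u" if "u \<in> carrier M" for u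
    by (rule sym, rule Q.minus_equality) (use that in \<open>simp_all add: add[symmetric] l_neg pc z\<close>)
  have "graded_by Q (gr Q)"
  proof (rule graded_byI[OF Q.abelian_group_axioms])
    fix n
    show "additive_subgroup (gr Q n) Q"
    proof (rule additive_subgroupI, rule Q.add.subgroupI)
      show "gr Q n \<noteq> {}" using homog_zero[of n] unfolding gr by blast
      show "gr Q n \<subseteq> carrier Q" unfolding gr using pc homog_carrier by auto
    next
      fix x assume "x \<in> gr Q n"
      then show "\<ominus>\<^bsub>Q\<^esub> x \<in> gr Q n" unfolding gr using inv homog_carrier homog_a_inv by (auto simp: image_iff) metis
    next
      fix x y assume "x \<in> gr Q n" "y \<in> gr Q n"
      then show "x \<oplus>\<^bsub>Q\<^esub> y \<in> gr Q n" unfolding gr using add homog_carrier homog_add by (auto simp: image_iff) metis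
    qed
  next
    fix x assume "x \<in> carrier Q"
    then obtain u where u: "u \<in> carrier M" "x = p u" using p by auto
    let ?F = "{n. hpart M (gr M) n u \<noteq> \<zero>}"
    have "x = (\<Oplus>\<^bsub>Q\<^esub>n\<in>?F. p (hpart M (gr M) n u))"
      using psum[of ?F "\<lambda>n. hpart M (gr M) n u"] u finsum_hpart[OF u(1)] by simp
    then show "\<exists>c F. finite F \<and> (\<forall>n. c n \<in> gr Q n) \<and> (\<forall>n. n \<notin> F \<longrightarrow> c n = \<zero>\<^bsub>Q\<^esub>) \<and> x = (\<Oplus>\<^bsub>Q\<^esub>n\<in>F. c n)"
      using u z by (intro exI[of _ "\<lambda>n. p (hpart M (gr M) n u)"] exI[of _ ?F]) (auto simp: gr)
  next
    fix c F assume F: "finite F" and c: "\<forall>n. c n \<in> gr Q n" and s: "(\<Oplus>\<^bsub>Q\<^esub>n\<in>F. c n) = \<zero>\<^bsub>Q\<^esub>"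
    have "\<forall>n. \<exists>d. d \<in> gr M n \<and> c n = p d" using c unfolding gr by blast
    then obtain d where d: "\<And>n. d n \<in> gr M n" "\<And>n. c n = p (d n)" by metis
    have dc: "\<And>n. d n \<in> carrier M" using d homog_carrier by blast
    \<comment> \<open>The lifted sum lies in the kernel, and its components are the
      \<open>d n\<close>.\<close>
    have "p (\<Oplus>n\<in>F. d n) = \<zero>\<^bsub>Q\<^esub>"
      using psum[OF F, of d] dc s by (simp add: d(2))
    then have "p (hpart M (gr M) k (\<Oplus>n\<in>F. d n)) = \<zero>\<^bsub>Q\<^esub>" for k
      by (rule ker[rotated]) (use dc in \<open>auto intro!: finsum_closed\<close>)
    then show "\<forall>n\<in>F. c n = \<zero>\<^bsub>Q\<^esub>"
      using hpart_finsum[OF F, of d] d by (metis (full_types))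
  qed
  then show ?thesis
    unfolding graded_rmodule_def using rm
    by (auto simp: gr) (metis act homog_carrier A.homog_carrier ract_homog imageI)
qed

text \<open>The second claim says in particular that components computed in the submodule agree with
  those computed in \<open>M\<close>.\<close>

lemma
  fixes M :: "('a, 'm) gmod" (structure)
  assumes M: "graded_module A M" and S: "gsubmodule A M S"
  shows graded_rmodule_gsub: "graded_rmodule A (gsub M S)"
    and grel_gsub_inclusion: "grel A (gsub M S) M (Id_on S)"
proof -
  interpret graded_module A M by fact
  note S' = S[unfolded gsubmodule_iff[OF M]]
  have Sc: "x \<in> carrier M" if "x \<in> S" for x using S' that by auto
  have [simp]: "carrier (gsub M S) = S" "\<zero>\<^bsub>gsub M S\<^esub> = \<zero>" "add (gsub M S) = add M" "ract (gsub M S) = ract M"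
    "gr (gsub M S) n = gr M n \<inter> S" for n
    by (simp_all add: gsub_def)
  have inv: "\<ominus> x \<in> S" if "x \<in> S" for x
    using S' that ract_minus_one[OF Sc[OF that]] A.a_inv_closed[OF A.one_closed] by metis
  have ex: "\<exists>y\<in>S. x \<oplus> y = \<zero>" if "x \<in> S" for x
    using inv[OF that] r_neg[OF Sc[OF that]] by blast
  have ab: "abelian_group (gsub M S)"
    by (rule abelian_groupI) (use S' Sc ex in \<open>auto simp: a_ac\<close>)
  interpret G: abelian_group "gsub M S" by fact
  have rm: "rmodule A (gsub M S)"
    unfolding rmodule_def using S' Sc ab A.ring_axioms by (simp add: ract_add_left ract_add_right ract_mult)
  have fs: "(\<Oplus>\<^bsub>gsub M S\<^esub>n\<in>F. c n) = (\<Oplus>n\<in>F. c n)" if "finite F" "\<And>n. n \<in> F \<Longrightarrow> c n \<in> S" for F and c :: "int \<Rightarrow> _"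
    using that
  proof (induction F rule: finite_induct)
    case (insert n F)
    then show ?case using Sc by (simp add: Pi_def G.finsum_insert)
  qed simp
  have "graded_by (gsub M S) (gr (gsub M S))"
  proof (rule graded_byI[OF ab])
    fix n show "additive_subgroup (gr (gsub M S) n) (gsub M S)"
    proof (rule additive_subgroupI, rule G.add.subgroupI)
      fix x assume x: "x \<in> gr (gsub M S) n"
      then have "\<ominus>\<^bsub>gsub M S\<^esub> x = \<ominus> x"
        by (intro G.minus_equality) (auto simp: inv l_neg Sc)
      then show "\<ominus>\<^bsub>gsub M S\<^esub> x \<in> gr (gsub M S) n"
        using x by (simp add: inv homog_a_inv)
    next
      have "\<zero> \<in> gr (gsub M S) n" using S' by simp
      then show "gr (gsub M S) n \<noteq> {}" by blast
    qed (use S' homog_add in auto)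
  next
    fix x assume x: "x \<in> carrier (gsub M S)"
    let ?F = "{n. hpart M (gr M) n x \<noteq> \<zero>}"
    show "\<exists>c F. finite F \<and> (\<forall>n. c n \<in> gr (gsub M S) n) \<and> (\<forall>n. n \<notin> F \<longrightarrow> c n = \<zero>\<^bsub>gsub M S\<^esub>) \<and>
        x = (\<Oplus>\<^bsub>gsub M S\<^esub>n\<in>F. c n)"
      using x S' Sc by (intro exI[of _ "\<lambda>n. hpart M (gr M) n x"] exI[of _ ?F]) (simp add: fs finsum_hpart)
  next
    fix c F assume F: "finite F" and c: "\<forall>n. c n \<in> gr (gsub M S) n" and s: "(\<Oplus>\<^bsub>gsub M S\<^esub>n\<in>F. c n) = \<zero>\<^bsub>gsub M S\<^esub>"
    then have s0: "(\<Oplus>n\<in>F. c n) = \<zero>" by (simp add: fs)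
    have "c n = \<zero>" if "n \<in> F" for n
      using hpart_finsum[OF F, of c n] c that unfolding s0 by simp
    then show "\<forall>n\<in>F. c n = \<zero>\<^bsub>gsub M S\<^esub>" by simp
  qed
  then show g: "graded_rmodule A (gsub M S)"
    unfolding graded_rmodule_def using rm S' A.homog_carrier by (auto simp: ract_homog)
  interpret G: graded_module A "gsub M S"
    using g A.graded_ring_axioms by (simp add: graded_module_iff)
  have "hpart (gsub M S) (gr (gsub M S)) n x = hpart M (gr M) n x" if "x \<in> S" for n x
    by (rule G.hpart_unique) (use that S' Sc fs in \<open>auto simp: finsum_hpart\<close>)
  then show "grel A (gsub M S) M (Id_on S)"
    using S' by (intro grelI) auto
qed

section \<open>Subquotients and torsion\<close>

lemma small_subset: "small T \<Longrightarrow> S \<subseteq> T \<Longrightarrow> small S"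
  unfolding small_def by (rule ordLeq_ordLess_trans[OF card_of_mono1])

lemma small_image: "small T \<Longrightarrow> small (f ` T)" for T :: "'u set" and f :: "'u \<Rightarrow> 'u"
  unfolding small_def by (rule ordLeq_ordLess_trans[OF card_of_image])

lemma Gr_simps [simp]:
  "Ob (Gr A) = {M. graded_rmodule A M \<and> small (carrier M)}" "Hom (Gr A) = ghom A"
  "Idt (Gr A) M = (\<lambda>x\<in>carrier M. x)" "Cmp (Gr A) L M N g f = compose (carrier L) g f"
  by (simp_all add: Gr_def)

section \<open>Subquotients\<close>

text \<open>\<open>R\<close> is the graph of a surjection from \<open>T\<close> onto
  \<open>Q\<close> with kernel \<open>S\<close>, so \<open>Q\<close> is a copy of
  \<open>T/S\<close>. Having its elements in \<open>'u\<close>, it can belong to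
  \<open>Tors\<close>, unlike a module of cosets.\<close>

definition subquotient :: "('k, 'a) galgebra \<Rightarrow> ('a, 'm) gmod \<Rightarrow> 'm set \<Rightarrow> 'm set \<Rightarrow>
    ('a, 'n) gmod \<Rightarrow> ('m \<times> 'n) set \<Rightarrow> bool" where
  "subquotient A M T S Q R \<longleftrightarrow> grel A M Q R \<and> Domain R = T \<and> R `` {\<zero>\<^bsub>M\<^esub>} = {\<zero>\<^bsub>Q\<^esub>} \<and>
     Range R = carrier Q \<and> R\<inverse> `` {\<zero>\<^bsub>Q\<^esub>} = S"

text \<open>A set of representatives for the cosets of \<open>S\<close> in \<open>T\<close>, with
  all operations followed by \<open>rp\<close>, is a copy of \<open>T/S\<close> inside the carrier
  of \<open>M\<close>; it is therefore small.\<close>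

lemma subquotient_exists:
  fixes M :: "('u, 'u) gmod" (structure)
  assumes A: "graded_ring A" and M: "M \<in> Ob (Gr A)"
    and T: "gsubmodule A M T" and S: "gsubmodule A M S" "S \<subseteq> T"
  obtains Q :: "('u, 'u) gmod" and R where "Q \<in> Ob (Gr A)" "subquotient A M T S Q R"
proof -
  have gM: "graded_module A M" using A M by (simp add: graded_module_iff)
  interpret graded_module A M by fact
  note T' = T[unfolded gsubmodule_iff[OF gM]] and S' = S(1)[unfolded gsubmodule_iff[OF gM]]
  have Tc: "x \<in> carrier M" if "x \<in> T" for x using T' that by auto
  have addS: "x \<oplus> y \<in> S" if "x \<in> S" "y \<in> S" for x y using S' that by auto
  have negS: "\<ominus> x \<in> S" if "x \<in> S" for x
    using S' that ract_minus_one[of x] A.a_inv_closed[OF A.one_closed] by (metis subsetD)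
  define rp where "rp x = (SOME y. y \<in> T \<and> x \<ominus> y \<in> S)" for x
  have rp: "rp x \<in> T" "x \<ominus> rp x \<in> S" if "x \<in> T" for x
    using someI[of "\<lambda>y. y \<in> T \<and> x \<ominus> y \<in> S" x] that Tc[OF that] S'
    unfolding rp_def by (simp_all add: minus_eq r_neg)
  have rp_eq: "rp x = rp y \<longleftrightarrow> x \<ominus> y \<in> S" if "x \<in> T" "y \<in> T" for x y
  proof
    have c: "x \<in> carrier M" "y \<in> carrier M" "rp y \<in> carrier M" using that Tc rp by auto
    {
      assume e: "rp x = rp y"
      have "(x \<ominus> rp y) \<oplus> \<ominus> (y \<ominus> rp y) \<in> S" using rp(2)[OF that(1)] rp(2)[OF that(2)] e addS negS by simp
      moreover have "(x \<ominus> rp y) \<oplus> \<ominus> (y \<ominus> rp y) = x \<ominus> y"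
        using c a_lcomm[of "\<ominus> rp y" "\<ominus> y" "rp y"] by (simp add: minus_eq minus_add a_assoc l_neg)
      ultimately show "x \<ominus> y \<in> S" by simp
    next
      assume d: "x \<ominus> y \<in> S"
      \<comment> \<open>Elements of one coset give equivalent predicates, so the choice operator
        returns the same representative.\<close>
      have "x \<ominus> z \<in> S \<longleftrightarrow> y \<ominus> z \<in> S" if z: "z \<in> T" for z
      proof -
        have zc: "z \<in> carrier M" using z Tc by simp
        have "x \<ominus> z = (x \<ominus> y) \<oplus> (y \<ominus> z)" "y \<ominus> z = \<ominus> (x \<ominus> y) \<oplus> (x \<ominus> z)"
          using c zc by (simp_all add: minus_eq minus_add a_ac r_neg1 r_neg2 r_neg)
        then show ?thesis using addS negS d by metis
      qed
      then show "rp x = rp y" unfolding rp_def by metis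
    }
  qed
  have zT: "\<zero> \<in> T" using T' by simp
  have rp_add: "rp (rp x \<oplus> rp y) = rp (x \<oplus> y)" if "x \<in> T" "y \<in> T" for x y
  proof -
    have c: "x \<in> carrier M" "y \<in> carrier M" "rp x \<in> carrier M" "rp y \<in> carrier M" using that Tc rp by auto
    have "(x \<oplus> y) \<ominus> (rp x \<oplus> rp y) = (x \<ominus> rp x) \<oplus> (y \<ominus> rp y)"
      using c by (simp add: minus_eq minus_add a_ac)
    also have "\<dots> \<in> S" using addS rp that by blast
    finally show ?thesis
      using rp_eq[of "x \<oplus> y" "rp x \<oplus> rp y"] rp that T' by simp
  qed
  have rp_act: "rp (ract M (rp x) a) = rp (ract M x a)" if "x \<in> T" "a \<in> carrier A" for x a
  proof -
    have c: "x \<in> carrier M" "rp x \<in> carrier M" using that Tc rp by auto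
    have "ract M (x \<ominus> rp x) a = ract M x a \<ominus> ract M (rp x) a"
      using ract_add_left[of "x \<ominus> rp x" "rp x" a] c that(2)
        add.inv_solve_right[of "ract M (x \<ominus> rp x) a" "ract M x a" "ract M (rp x) a"]
      by (simp add: minus_eq a_assoc l_neg)
    moreover have "ract M (x \<ominus> rp x) a \<in> S" using rp S' that by auto
    ultimately show ?thesis
      using rp_eq[of "ract M x a" "ract M (rp x) a"] rp that T' by simp
  qed
  define Q :: "('u, 'u) gmod" where
    "Q = \<lparr>carrier = rp ` T, monoid.mult = undefined, monoid.one = undefined, ring.zero = rp \<zero>,
      ring.add = (\<lambda>x y. rp (x \<oplus> y)), ract = (\<lambda>x a. rp (ract M x a)), gr = (\<lambda>n. rp ` (gr M n \<inter> T))\<rparr>"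
  have Q: "carrier Q = rp ` T" "\<zero>\<^bsub>Q\<^esub> = rp \<zero>" "x \<oplus>\<^bsub>Q\<^esub> y = rp (x \<oplus> y)" "ract Q x a = rp (ract M x a)"
    "gr Q n = rp ` (gr M n \<inter> T)" for x y a n
    by (simp_all add: Q_def)
  let ?T = "gsub M T"
  have sT: "carrier ?T = T" "\<zero>\<^bsub>?T\<^esub> = \<zero>" "add ?T = add M" "ract ?T = ract M" "gr ?T n = gr M n \<inter> T" for n
    by (simp_all add: gsub_def)
  have gT: "graded_module A ?T" using graded_rmodule_gsub[OF gM T] A by (simp add: graded_module_iff)
  have hT: "hpart ?T (gr ?T) n x = hpart M (gr M) n x" if "x \<in> T" for n x
    using grelD(5)[OF grel_gsub_inclusion[OF gM T], of x x n] that by (simp add: Id_on_iff)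
  have ker: "rp (hpart M (gr M) n x) = rp \<zero>" if "x \<in> T" "rp x = rp \<zero>" for x n
  proof -
    have "x \<in> S" using rp_eq[of x \<zero>] that zT Tc by simp
    then have "hpart M (gr M) n x \<in> S" using S' by auto
    then show ?thesis
      using rp_eq[of "hpart M (gr M) n x" \<zero>] zT S(2) Tc by auto
  qed
  have QG: "graded_rmodule A Q"
    by (rule graded_rmodule_image[OF gT, of rp]) (simp_all add: sT Q rp_add rp_act hT ker)
  then have gQ: "graded_module A Q" using A by (simp add: graded_module_iff)
  have "small (carrier Q)"
    using M T' small_subset[of "carrier M" T] small_image[of T rp] by (simp add: Q)
  then have QO: "Q \<in> Ob (Gr A)" using QG by simp
  have f: "restrict rp T \<in> ghom A ?T Q"
    unfolding ghom_def rhom_def using rp_add rp_act T' by (auto simp: sT Q)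
  define R where "R = Id_on T O fgraph ?T (restrict rp T)"
  have R: "(x, y) \<in> R \<longleftrightarrow> x \<in> T \<and> y = rp x" for x y
    unfolding R_def by (auto simp: mem_fgraph sT)
  have "grel A M Q R"
    unfolding R_def
    by (rule grel_relcomp[OF grel_converse[OF grel_gsub_inclusion[OF gM T], unfolded converse_Id_on]])
      (use f ghom_iff_grel[OF gT gQ] in blast)
  moreover have "Domain R = T" "Range R = carrier Q" using R by (auto simp: Q)
  moreover have "R `` {\<zero>} = {\<zero>\<^bsub>Q\<^esub>}" using R zT by (auto simp: Q)
  moreover have "R\<inverse> `` {\<zero>\<^bsub>Q\<^esub>} = S"
  proof -
    have "x \<in> S \<longleftrightarrow> x \<in> T \<and> rp x = rp \<zero>" for x
      using rp_eq[OF _ zT, of x] S(2) Tc by auto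
    then show ?thesis using R by (auto simp: Q)
  qed
  ultimately have "subquotient A M T S Q R" by (simp add: subquotient_def)
  with QO that show ?thesis by blast
qed

section \<open>Localizing subcategories and torsion\<close>

lemma localizingD:
  assumes "localizing A T"
  shows "T \<subseteq> Ob (Gr A)"
    "\<And>M N f. M \<in> T \<Longrightarrow> N \<in> Ob (Gr A) \<Longrightarrow> f \<in> ghom A N M \<Longrightarrow> inj_on f (carrier N) \<Longrightarrow> N \<in> T"
    "\<And>M N f. M \<in> T \<Longrightarrow> N \<in> Ob (Gr A) \<Longrightarrow> f \<in> ghom A M N \<Longrightarrow> f ` carrier M = carrier N \<Longrightarrow> N \<in> T"
    "\<And>L M N f g. L \<in> T \<Longrightarrow> N \<in> T \<Longrightarrow> M \<in> Ob (Gr A) \<Longrightarrow> f \<in> ghom A L M \<Longrightarrow> g \<in> ghom A M N \<Longrightarrow>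
       inj_on f (carrier L) \<Longrightarrow> f ` carrier L = {x\<in>carrier M. g x = \<zero>\<^bsub>N\<^esub>} \<Longrightarrow>
       g ` carrier M = carrier N \<Longrightarrow> M \<in> T"
    "\<And>J Y \<iota> S. S \<in> Ob (Gr A) \<Longrightarrow> small J \<Longrightarrow> (\<And>j. j \<in> J \<Longrightarrow> Y j \<in> T) \<Longrightarrow> is_direct_sum A J Y S \<iota> \<Longrightarrow> S \<in> T"
proof -
  note * = assms[unfolded localizing_def]
  note c = * [THEN conjunct1] *[THEN conjunct2, THEN conjunct1] *[THEN conjunct2, THEN conjunct2, THEN conjunct1]
    *[THEN conjunct2, THEN conjunct2, THEN conjunct2, THEN conjunct1]
    *[THEN conjunct2, THEN conjunct2, THEN conjunct2, THEN conjunct2]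
  show "T \<subseteq> Ob (Gr A)" by (rule c(1))
  show "\<And>M N f. M \<in> T \<Longrightarrow> N \<in> Ob (Gr A) \<Longrightarrow> f \<in> ghom A N M \<Longrightarrow> inj_on f (carrier N) \<Longrightarrow> N \<in> T"
    using c(2) by blast
  show "\<And>M N f. M \<in> T \<Longrightarrow> N \<in> Ob (Gr A) \<Longrightarrow> f \<in> ghom A M N \<Longrightarrow> f ` carrier M = carrier N \<Longrightarrow> N \<in> T"
    using c(3) by blast
  show "M \<in> T" if "L \<in> T" "N \<in> T" "M \<in> Ob (Gr A)" "f \<in> ghom A L M" "g \<in> ghom A M N" "inj_on f (carrier L)"
    "f ` carrier L = {x\<in>carrier M. g x = \<zero>\<^bsub>N\<^esub>}" "g ` carrier M = carrier N" for L M N f g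
    by (intro c(4)[rule_format, of L N M f g] conjI that)
  show "S \<in> T" if "S \<in> Ob (Gr A)" "small J" "\<And>j. j \<in> J \<Longrightarrow> Y j \<in> T" "is_direct_sum A J Y S \<iota>" for J Y \<iota> S
    by (intro c(5)[rule_format, of S J Y \<iota>] conjI ballI that)
qed

lemma localizingI:
  assumes "T \<subseteq> Ob (Gr A)"
    "\<And>M N f. M \<in> T \<Longrightarrow> N \<in> Ob (Gr A) \<Longrightarrow> f \<in> ghom A N M \<Longrightarrow> inj_on f (carrier N) \<Longrightarrow> N \<in> T"
    "\<And>M N f. M \<in> T \<Longrightarrow> N \<in> Ob (Gr A) \<Longrightarrow> f \<in> ghom A M N \<Longrightarrow> f ` carrier M = carrier N \<Longrightarrow> N \<in> T"
    "\<And>L M N f g. L \<in> T \<Longrightarrow> N \<in> T \<Longrightarrow> M \<in> Ob (Gr A) \<Longrightarrow> f \<in> ghom A L M \<Longrightarrow> g \<in> ghom A M N \<Longrightarrow>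
       inj_on f (carrier L) \<Longrightarrow> f ` carrier L = {x\<in>carrier M. g x = \<zero>\<^bsub>N\<^esub>} \<Longrightarrow>
       g ` carrier M = carrier N \<Longrightarrow> M \<in> T"
    "\<And>J Y \<iota> S. S \<in> Ob (Gr A) \<Longrightarrow> small J \<Longrightarrow> (\<And>j. j \<in> J \<Longrightarrow> Y j \<in> T) \<Longrightarrow> is_direct_sum A J Y S \<iota> \<Longrightarrow> S \<in> T"
  shows "localizing A T"
  unfolding localizing_def
proof (intro conjI ballI allI impI)
  show "T \<subseteq> Ob (Gr A)" by (rule assms(1))
next
  show "M \<in> T" if "L \<in> T" "N \<in> T" "M \<in> Ob (Gr A)" "f \<in> ghom A L M" "g \<in> ghom A M N"
    and c: "inj_on f (carrier L) \<and> f ` carrier L = {x\<in>carrier M. g x = \<zero>\<^bsub>N\<^esub>} \<and> g ` carrier M = carrier N"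
    for L M N f g
    using assms(4)[OF that(1-5)] c by blast
next
  show "S \<in> T" if "S \<in> Ob (Gr A)" "small J \<and> (\<forall>j\<in>J. Y j \<in> T) \<and> is_direct_sum A J Y S \<iota>" for J Y \<iota> S
    using assms(5)[OF that(1)] that(2) by blast
qed (rule assms(2) assms(3); assumption)+

text \<open>This member makes the family intersected in \<open>Tors\<close> nonempty, so that the
  intersection stays within the objects of \<open>Gr A\<close>.\<close>

lemma localizing_Ob: "localizing A (Ob (Gr A))"
  by (rule localizingI) simp_all

lemma localizing_Inter:
  assumes "F \<noteq> {}" "\<And>T. T \<in> F \<Longrightarrow> localizing A T"
  shows "localizing A (\<Inter>F)"
proof (rule localizingI)
  show "\<Inter>F \<subseteq> Ob (Gr A)" using assms localizingD(1) by blast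
next
  fix M N f assume "M \<in> \<Inter>F" "N \<in> Ob (Gr A)" "f \<in> ghom A N M" "inj_on f (carrier N)"
  then show "N \<in> \<Inter>F" by (meson InterD InterI assms(2) localizingD(2))
next
  fix M N f assume "M \<in> \<Inter>F" "N \<in> Ob (Gr A)" "f \<in> ghom A M N" "f ` carrier M = carrier N"
  then show "N \<in> \<Inter>F" by (meson InterD InterI assms(2) localizingD(3))
next
  fix L M N f g
  assume h: "L \<in> \<Inter>F" "N \<in> \<Inter>F" "M \<in> Ob (Gr A)" "f \<in> ghom A L M" "g \<in> ghom A M N" "inj_on f (carrier L)"
       "f ` carrier L = {x\<in>carrier M. g x = \<zero>\<^bsub>N\<^esub>}" "g ` carrier M = carrier N"
  show "M \<in> \<Inter>F"
  proof
    fix T assume "T \<in> F"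
    then show "M \<in> T" using localizingD(4)[OF assms(2) _ _ h(3-8)] h(1,2) by blast
  qed
next
  fix J Y \<iota> S assume h: "S \<in> Ob (Gr A)" "small J" "\<And>j. j \<in> J \<Longrightarrow> Y j \<in> \<Inter>F" "is_direct_sum A J Y S \<iota>"
  show "S \<in> \<Inter>F"
  proof
    fix T assume "T \<in> F"
    then show "S \<in> T" using localizingD(5)[OF assms(2) h(1,2) _ h(4)] h(3) by blast
  qed
qed

lemma localizing_Tors: "localizing A (Tors A)"
  unfolding Tors_def by (rule localizing_Inter) (use localizing_Ob in auto)

lemma Tors_least:
  assumes "localizing A T"
    "\<And>M. M \<in> Ob (Gr A) \<Longrightarrow> \<forall>m\<in>carrier M. \<forall>a\<in>ideal_I A. ract M m a = \<zero>\<^bsub>M\<^esub> \<Longrightarrow> M \<in> T"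
  shows "Tors A \<subseteq> T"
  unfolding Tors_def using assms by blast

lemma Tors_annihilated:
  "M \<in> Ob (Gr A) \<Longrightarrow> \<forall>m\<in>carrier M. \<forall>a\<in>ideal_I A. ract M m a = \<zero>\<^bsub>M\<^esub> \<Longrightarrow> M \<in> Tors A"
  unfolding Tors_def by blast

lemmas Tors_Ob = subsetD[OF localizingD(1)[OF localizing_Tors]]

section \<open>Torsion subquotients\<close>

text \<open>One notion of \<open>T/S\<close> being torsion covers both conditions of Gabriel's
  construction: \<open>T = carrier M\<close> gives the condition on domains, and \<open>S\<close>
  consisting of zero alone gives the condition on indeterminacies.\<close>

definition torsion_subquotient :: "('k, 'u) galgebra \<Rightarrow> ('u, 'u) gmod \<Rightarrow> 'u set \<Rightarrow> 'u set \<Rightarrow> bool" where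
  "torsion_subquotient A M T S \<longleftrightarrow> (\<exists>Q\<in>Tors A. \<exists>R. subquotient A M T S Q R)"

context graded_ring
begin

lemma Gr_module: "M \<in> Ob (Gr A) \<Longrightarrow> graded_module A M"
  using graded_ring_axioms by (simp add: graded_module_iff)

lemma subquotient_submodules:
  assumes "M \<in> Ob (Gr A)" "Q \<in> Ob (Gr A)" "subquotient A M T S Q R"
  shows "gsubmodule A M T" "gsubmodule A M S" "S \<subseteq> T"
proof -
  note m = Gr_module[OF assms(1)] Gr_module[OF assms(2)]
  have R: "grel A M Q R" and T: "T = Domain R" and S: "S = R\<inverse> `` {\<zero>\<^bsub>Q\<^esub>}"
    using assms(3) by (auto simp: subquotient_def)
  show "gsubmodule A M T" unfolding T by (rule gsubmodule_Domain[OF m R])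
  show "gsubmodule A M S" unfolding S
    by (rule gsubmodule_Image[OF m(2,1) grel_converse[OF R] gsubmodule_zero[OF m(2)]])
  show "S \<subseteq> T" unfolding S T by auto
qed

text \<open>The submodule \<open>T\<close> embeds into \<open>M\<close> and maps onto
  \<open>Q\<close>; both steps stay in \<open>Tors\<close>.\<close>

lemma Tors_subquotient:
  assumes M: "M \<in> Tors A" and Q: "Q \<in> Ob (Gr A)" and R: "subquotient A M T S Q R"
  shows "Q \<in> Tors A"
proof -
  have MO: "M \<in> Ob (Gr A)" using Tors_Ob[OF M] .
  note mM = Gr_module[OF MO] and mQ = Gr_module[OF Q]
  have T: "gsubmodule A M T" using subquotient_submodules[OF MO Q R] by simp
  have gT: "graded_rmodule A (gsub M T)" using graded_rmodule_gsub[OF mM T] .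
  have "T \<subseteq> carrier M" using T gsubmodule_iff[OF mM] by simp
  then have TO: "gsub M T \<in> Ob (Gr A)"
    using gT MO small_subset by (auto simp: gsub_def)
  note mT = Gr_module[OF TO]
  have cT: "carrier (gsub M T) = T" "\<zero>\<^bsub>gsub M T\<^esub> = \<zero>\<^bsub>M\<^esub>" by (simp_all add: gsub_def)
  have i: "(\<lambda>x\<in>T. x) \<in> ghom A (gsub M T) M"
    unfolding ghom_iff_grel[OF mT mM]
    using grel_gsub_inclusion[OF mM T] fgraph_id[of "gsub M T"] by (simp add: cT)
  have t1: "gsub M T \<in> Tors A"
    by (rule localizingD(2)[OF localizing_Tors M TO i]) (auto simp: cT inj_on_def)
  have "grel A (gsub M T) Q (Id_on T O R)"
    by (rule grel_relcomp[OF grel_gsub_inclusion[OF mM T]]) (use R in \<open>simp add: subquotient_def\<close>)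
  moreover have "carrier (gsub M T) \<subseteq> Domain (Id_on T O R)" using R by (auto simp: subquotient_def cT)
  moreover have "(Id_on T O R) `` {\<zero>\<^bsub>gsub M T\<^esub>} \<subseteq> {\<zero>\<^bsub>Q\<^esub>}" using R by (auto simp: subquotient_def cT)
  ultimately obtain f where f: "f \<in> ghom A (gsub M T) Q" "Id_on T O R = fgraph (gsub M T) f"
    using total_grel_is_graph[OF mT mQ] by blast
  have "Range R = f ` T"
  proof -
    have "Range (Id_on T O R) = f ` T" unfolding f(2) by (auto simp: fgraph_def cT)
    moreover have "Range (Id_on T O R) = Range R" using R unfolding subquotient_def by blast
    ultimately show ?thesis by simp
  qed
  then have "f ` carrier (gsub M T) = carrier Q" using R by (auto simp: subquotient_def cT)
  then show ?thesis
    using localizingD(3)[OF localizing_Tors t1 Q f(1)] by simp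
qed

lemma torsion_subquotient_submodules:
  assumes "M \<in> Ob (Gr A)" "torsion_subquotient A M T S"
  shows "gsubmodule A M T" "gsubmodule A M S" "S \<subseteq> T"
  using assms subquotient_submodules Tors_Ob unfolding torsion_subquotient_def by blast+

text \<open>A relation induces one from \<open>T/S\<close> to the quotient of the images that is
  onto and relates zero only to zero, so the latter is a subquotient of \<open>T/S\<close>. For
  \<open>R\<close> and its converse this handles images of torsion submodules and preimages of
  cotorsion ones at once.\<close>

lemma torsion_subquotient_Image:
  assumes M: "M \<in> Ob (Gr A)" and N: "N \<in> Ob (Gr A)" and R: "grel A M N R"
    and t: "torsion_subquotient A M T S"
  shows "torsion_subquotient A N (R `` T) (R `` S)"
proof -
  note mM = Gr_module[OF M] and mN = Gr_module[OF N]
  note sub = torsion_subquotient_submodules[OF M t]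
  obtain Q R0 where Q: "Q \<in> Tors A" and R0: "subquotient A M T S Q R0"
    using t unfolding torsion_subquotient_def by blast
  have QO: "Q \<in> Ob (Gr A)" using Tors_Ob[OF Q] .
  obtain Q2 R2 where Q2: "Q2 \<in> Ob (Gr A)" and R2: "subquotient A N (R `` T) (R `` S) Q2 R2"
    using subquotient_exists[OF graded_ring_axioms N gsubmodule_Image[OF mM mN R sub(1)]
        gsubmodule_Image[OF mM mN R sub(2)]] sub(3) by (metis Image_mono subset_refl)
  \<comment> \<open>The relation induced on the quotients: lift to \<open>M\<close>, apply
    \<open>R\<close>, project.\<close>
  let ?V = "R0\<inverse> O R O R2"
  have gV: "grel A Q Q2 ?V"
    using R R0 R2 unfolding subquotient_def by (blast intro: grel_relcomp grel_converse)
  have "?V `` {\<zero>\<^bsub>Q\<^esub>} = R2 `` (R `` (R0\<inverse> `` {\<zero>\<^bsub>Q\<^esub>}))" by blast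
  also have "\<dots> = R2 `` (R `` S)" using R0 by (simp add: subquotient_def)
  also have "\<dots> = {\<zero>\<^bsub>Q2\<^esub>}"
  proof
    have S2: "R `` S = R2\<inverse> `` {\<zero>\<^bsub>Q2\<^esub>}" using R2 by (simp add: subquotient_def)
    have gR2: "grel A N Q2 R2" "R2 `` {\<zero>\<^bsub>N\<^esub>} = {\<zero>\<^bsub>Q2\<^esub>}" using R2 by (auto simp: subquotient_def)
    show "R2 `` (R `` S) \<subseteq> {\<zero>\<^bsub>Q2\<^esub>}"
      unfolding S2 using grel_single_valued[OF mN Gr_module[OF Q2] gR2] by blast
    show "{\<zero>\<^bsub>Q2\<^esub>} \<subseteq> R2 `` (R `` S)" unfolding S2 using grelD(2)[OF gR2(1)] by blast
  qed
  finally have V0: "?V `` {\<zero>\<^bsub>Q\<^esub>} = {\<zero>\<^bsub>Q2\<^esub>}" .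
  have "Range ?V = carrier Q2"
  proof
    show "Range ?V \<subseteq> carrier Q2" using grelD(7)[OF gV] by blast
    show "carrier Q2 \<subseteq> Range ?V"
    proof
      fix q assume "q \<in> carrier Q2"
      then obtain n where n: "(n, q) \<in> R2" using R2 unfolding subquotient_def by blast
      then obtain m where "m \<in> T" "(m, n) \<in> R" using R2 unfolding subquotient_def by blast
      moreover then obtain q' where "(m, q') \<in> R0" using R0 unfolding subquotient_def by blast
      ultimately show "q \<in> Range ?V" using n by blast
    qed
  qed
  then have "subquotient A Q (Domain ?V) (?V\<inverse> `` {\<zero>\<^bsub>Q2\<^esub>}) Q2 ?V"
    using gV V0 by (simp add: subquotient_def)
  then have "Q2 \<in> Tors A" using Tors_subquotient[OF Q Q2] by blast
  then show ?thesis using R2 unfolding torsion_subquotient_def by blast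
qed

text \<open>The sequence from \<open>S/U\<close> through \<open>T/U\<close> to \<open>T/S\<close> is
  exact, and \<open>Tors\<close> is closed under extensions. The two maps are composites of the
  projections, taken as relations through \<open>M\<close>.\<close>

lemma torsion_subquotient_trans:
  assumes M: "M \<in> Ob (Gr A)" and t1: "torsion_subquotient A M T S" and t2: "torsion_subquotient A M S U"
  shows "torsion_subquotient A M T U"
proof -
  note mM = Gr_module[OF M]
  note sub1 = torsion_subquotient_submodules[OF M t1] and sub2 = torsion_subquotient_submodules[OF M t2]
  obtain Q1 R1 where Q1: "Q1 \<in> Tors A" and R1: "subquotient A M T S Q1 R1"
    using t1 unfolding torsion_subquotient_def by blast
  obtain Q2 R2 where Q2: "Q2 \<in> Tors A" and R2: "subquotient A M S U Q2 R2"
    using t2 unfolding torsion_subquotient_def by blast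
  obtain Q R where Q: "Q \<in> Ob (Gr A)" and R: "subquotient A M T U Q R"
    using subquotient_exists[OF graded_ring_axioms M sub1(1) sub2(2)] sub1(3) sub2(3) by blast
  note mQ = Gr_module[OF Q] and mQ1 = Gr_module[OF Tors_Ob[OF Q1]] and mQ2 = Gr_module[OF Tors_Ob[OF Q2]]
  have g: "grel A M Q R" "R `` {\<zero>\<^bsub>M\<^esub>} = {\<zero>\<^bsub>Q\<^esub>}" "grel A M Q1 R1" "R1 `` {\<zero>\<^bsub>M\<^esub>} = {\<zero>\<^bsub>Q1\<^esub>}"
    "grel A M Q2 R2" "R2 `` {\<zero>\<^bsub>M\<^esub>} = {\<zero>\<^bsub>Q2\<^esub>}"
    and U: "U = R\<inverse> `` {\<zero>\<^bsub>Q\<^esub>}" "U = R2\<inverse> `` {\<zero>\<^bsub>Q2\<^esub>}" and S: "S = R1\<inverse> `` {\<zero>\<^bsub>Q1\<^esub>}"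
    and D: "Domain R = T" "Domain R1 = T" "Domain R2 = S"
    and Rg: "Range R = carrier Q" "Range R1 = carrier Q1" "Range R2 = carrier Q2"
    using R R1 R2 unfolding subquotient_def by simp_all
  note sv = grel_single_valued[OF mM mQ g(1,2)] and sv1 = grel_single_valued[OF mM mQ1 g(3,4)]
    and sv2 = grel_single_valued[OF mM mQ2 g(5,6)]
  have f1: "carrier Q2 \<subseteq> Domain (R2\<inverse> O R)"
    using Rg(3) D sub1(3) by blast
  have f2: "(R2\<inverse> O R) `` {\<zero>\<^bsub>Q2\<^esub>} \<subseteq> {\<zero>\<^bsub>Q\<^esub>}"
    using U sv by blast
  obtain f where f: "f \<in> ghom A Q2 Q" "R2\<inverse> O R = fgraph Q2 f"
    using total_grel_is_graph[OF mQ2 mQ grel_relcomp[OF grel_converse[OF g(5)] g(1)] f1 f2] by blast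
  have g1: "carrier Q \<subseteq> Domain (R\<inverse> O R1)"
    using Rg(1) D by blast
  have g2: "(R\<inverse> O R1) `` {\<zero>\<^bsub>Q\<^esub>} \<subseteq> {\<zero>\<^bsub>Q1\<^esub>}"
    using U(1) S sv1 sub2(3) by blast
  obtain h where h: "h \<in> ghom A Q Q1" "R\<inverse> O R1 = fgraph Q h"
    using total_grel_is_graph[OF mQ mQ1 grel_relcomp[OF grel_converse[OF g(1)] g(3)] g1 g2] by blast
  have mf: "y = f x \<longleftrightarrow> (x, y) \<in> R2\<inverse> O R" if "x \<in> carrier Q2" for x y
    unfolding f(2) using that by (simp add: mem_fgraph)
  have mh: "y = h x \<longleftrightarrow> (x, y) \<in> R\<inverse> O R1" if "x \<in> carrier Q" for x y
    unfolding h(2) using that by (simp add: mem_fgraph)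
  have "inj_on f (carrier Q2)"
  proof (rule inj_onI)
    fix x x' assume x: "x \<in> carrier Q2" "x' \<in> carrier Q2" "f x = f x'"
    obtain m where m: "(m, x) \<in> R2" "(m, f x) \<in> R" using mf[OF x(1), of "f x"] by blast
    obtain m' where m': "(m', x') \<in> R2" "(m', f x) \<in> R" using mf[OF x(2), of "f x"] x(3) by blast
    have "(m \<ominus>\<^bsub>M\<^esub> m', f x \<ominus>\<^bsub>Q\<^esub> f x) \<in> R" using grel_minus[OF mM mQ g(1) m(2) m'(2)] .
    moreover have "f x \<ominus>\<^bsub>Q\<^esub> f x = \<zero>\<^bsub>Q\<^esub>"
      using grelD(7)[OF g(1) m(2)] mQ
      by (simp add: graded_module_def graded_group_def abelian_group.minus_eq abelian_group.r_neg)
    ultimately have "m \<ominus>\<^bsub>M\<^esub> m' \<in> U" unfolding U(1) by auto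
    then have "(m \<ominus>\<^bsub>M\<^esub> m', \<zero>\<^bsub>Q2\<^esub>) \<in> R2" unfolding U(2) by auto
    moreover have "(m \<ominus>\<^bsub>M\<^esub> m', x \<ominus>\<^bsub>Q2\<^esub> x') \<in> R2" using grel_minus[OF mM mQ2 g(5) m(1) m'(1)] .
    ultimately have e: "x \<ominus>\<^bsub>Q2\<^esub> x' = \<zero>\<^bsub>Q2\<^esub>" using sv2 by blast
    interpret Q2: graded_module A Q2 by (rule mQ2)
    show "x = x'"
      using e x Q2.minus_eq_zero_iff by blast
  qed
  moreover have "f ` carrier Q2 = {x \<in> carrier Q. h x = \<zero>\<^bsub>Q1\<^esub>}"
  proof
    show "f ` carrier Q2 \<subseteq> {x \<in> carrier Q. h x = \<zero>\<^bsub>Q1\<^esub>}"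
    proof
      fix y assume "y \<in> f ` carrier Q2"
      then obtain x where x: "x \<in> carrier Q2" "y = f x" by auto
      then obtain m where m: "(m, x) \<in> R2" "(m, y) \<in> R" using mf by blast
      then have "(m, \<zero>\<^bsub>Q1\<^esub>) \<in> R1" using D(3) S by blast
      then have "(y, \<zero>\<^bsub>Q1\<^esub>) \<in> R\<inverse> O R1" using m by blast
      moreover have "y \<in> carrier Q" using grelD(7)[OF g(1) m(2)] .
      ultimately show "y \<in> {x \<in> carrier Q. h x = \<zero>\<^bsub>Q1\<^esub>}" using mh[of y "\<zero>\<^bsub>Q1\<^esub>"] by simp
    qed
    show "{x \<in> carrier Q. h x = \<zero>\<^bsub>Q1\<^esub>} \<subseteq> f ` carrier Q2"
    proof
      fix y assume "y \<in> {x \<in> carrier Q. h x = \<zero>\<^bsub>Q1\<^esub>}"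
      then have y: "y \<in> carrier Q" "(y, \<zero>\<^bsub>Q1\<^esub>) \<in> R\<inverse> O R1" using mh[of y "\<zero>\<^bsub>Q1\<^esub>"] by auto
      then obtain m where m: "(m, y) \<in> R" "m \<in> S" unfolding S by blast
      then obtain x where x: "(m, x) \<in> R2" using D(3) by blast
      then have "(x, y) \<in> R2\<inverse> O R" "x \<in> carrier Q2" using m grelD(7)[OF g(5)] by auto
      then show "y \<in> f ` carrier Q2" using mf by blast
    qed
  qed
  moreover have "h ` carrier Q = carrier Q1"
  proof
    show "h ` carrier Q \<subseteq> carrier Q1" using ghom_closed[OF h(1)] .
    show "carrier Q1 \<subseteq> h ` carrier Q"
    proof
      fix y assume "y \<in> carrier Q1"
      then obtain m where m: "(m, y) \<in> R1" using Rg(2) by blast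
      then obtain x where "(m, x) \<in> R" using D by blast
      then have "(x, y) \<in> R\<inverse> O R1" "x \<in> carrier Q" using m grelD(7)[OF g(1)] by auto
      then show "y \<in> h ` carrier Q" using mh by blast
    qed
  qed
  ultimately have "Q \<in> Tors A"
    using localizingD(4)[OF localizing_Tors Q2 Q1 Q f(1) h(1)] by blast
  then show ?thesis using R unfolding torsion_subquotient_def by blast
qed

end

section \<open>The quotient category\<close>

lemma
  fixes M :: "('a, 'm) gmod" (structure)
  assumes M: "graded_module A M" and S: "gsubmodule A M S"
  shows mem_coset: "x \<in> carrier M \<Longrightarrow> y \<in> S +> x \<longleftrightarrow> y \<in> carrier M \<and> y \<ominus> x \<in> S"
    and coset_eq: "x \<in> carrier M \<Longrightarrow> y \<in> carrier M \<Longrightarrow> S +> x = S +> y \<longleftrightarrow> x \<ominus> y \<in> S"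
    and coset_add: "x \<in> carrier M \<Longrightarrow> y \<in> carrier M \<Longrightarrow> (S +> x) <+> (S +> y) = S +> (x \<oplus> y)"
    and coset_zero: "S +> \<zero> = S"
    and coset_ract: "x \<in> carrier M \<Longrightarrow> a \<in> carrier A \<Longrightarrow> ract (gquot M S) (S +> x) a = S +> ract M x a"
proof -
  interpret graded_module A M by fact
  note S' = S[unfolded gsubmodule_iff[OF M]]
  interpret S: abelian_subgroup S M
    using S by (intro abelian_subgroupI3) (simp_all add: gsubmodule_def abelian_group_axioms)
  have Sc: "s \<in> carrier M" if "s \<in> S" for s using S' that by auto
  show mem: "y \<in> S +> x \<longleftrightarrow> y \<in> carrier M \<and> y \<ominus> x \<in> S" if x: "x \<in> carrier M" for x y
  proof
    assume "y \<in> S +> x"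
    then obtain s where s: "s \<in> S" "y = s \<oplus> x" unfolding a_r_coset_def' by blast
    then have "y \<ominus> x = s" using x Sc by (simp add: minus_eq a_assoc r_neg)
    then show "y \<in> carrier M \<and> y \<ominus> x \<in> S" using s x Sc by auto
  next
    assume y: "y \<in> carrier M \<and> y \<ominus> x \<in> S"
    then have "y = (y \<ominus> x) \<oplus> x" using x by (simp add: minus_eq a_assoc l_neg)
    then show "y \<in> S +> x" unfolding a_r_coset_def' using y by blast
  qed
  show eq: "S +> x = S +> y \<longleftrightarrow> x \<ominus> y \<in> S" if "x \<in> carrier M" "y \<in> carrier M" for x y
    using S.a_repr_independence'[of x y] S.a_rcos_self[of x] mem[of y x] that by metis
  show "(S +> x) <+> (S +> y) = S +> (x \<oplus> y)" if "x \<in> carrier M" "y \<in> carrier M" for x y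
    using S.a_rcos_sum that .
  show "S +> \<zero> = S"
    by (rule a_coset_add_zero) (use S' in blast)
  show "ract (gquot M S) (S +> x) a = S +> ract M x a" if x: "x \<in> carrier M" "a \<in> carrier A" for x a
  proof -
    have "S +> ract M y a = S +> ract M x a" if "y \<in> S +> x" for y
    proof -
      have y: "y \<in> carrier M" "y \<ominus> x \<in> S" using that mem x by auto
      have "ract M y a = ract M ((y \<ominus> x) \<oplus> x) a" using x y by (simp add: minus_eq a_assoc l_neg)
      also have "\<dots> = ract M (y \<ominus> x) a \<oplus> ract M x a" using x y by (simp add: ract_add_left)
      finally have "ract M y a \<ominus> ract M x a = ract M (y \<ominus> x) a" using x y by (simp add: minus_eq a_assoc r_neg)
      then show ?thesis using eq[of "ract M y a" "ract M x a"] x y S' by simp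
    qed
    moreover have "S +> x \<noteq> {}" using S.a_rcos_self[OF x(1)] by blast
    ultimately show ?thesis unfolding gquot_def by simp
  qed
qed

definition coset_rel :: "('m, 'y) ring_scheme \<Rightarrow> 'm set \<Rightarrow> ('m \<times> 'm) set" where
  "coset_rel M S = {(x, s \<oplus>\<^bsub>M\<^esub> x) | x s. x \<in> carrier M \<and> s \<in> S}"

text \<open>A morphism from \<open>M'\<close> to \<open>N/N'\<close> is encoded by its graph, a graded submodule of \<open>M \<times> N\<close>
  with domain \<open>M'\<close> and indeterminacy \<open>N'\<close>; Gabriel's composition of representatives becomes the
  composition of relations.\<close>

definition correspondence :: "('k, 'u) galgebra \<Rightarrow> ('u, 'u) gmod \<Rightarrow> ('u, 'u) gmod \<Rightarrow> ('u \<times> 'u) set \<Rightarrow> bool" where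
  "correspondence A M N R \<longleftrightarrow> grel A M N R \<and> torsion_subquotient A M (carrier M) (Domain R) \<and>
     torsion_subquotient A N (R `` {\<zero>\<^bsub>M\<^esub>}) {\<zero>\<^bsub>N\<^esub>}"

text \<open>The way back to Gabriel's representatives: domain, values over zero and fibres of a
  correspondence are the three entries of the triple.\<close>

definition qrep_of :: "('u, 'u) gmod \<Rightarrow> ('u \<times> 'u) set \<Rightarrow> 'u qrep" where
  "qrep_of M R = (Domain R, R `` {\<zero>\<^bsub>M\<^esub>}, \<lambda>m\<in>Domain R. R `` {m})"

lemma qrep_of_inject: "qrep_of M R = qrep_of M S \<longleftrightarrow> R = S"
proof
  assume e: "qrep_of M R = qrep_of M S"
  have D: "Domain R = Domain S" using e by (simp add: qrep_of_def)
  have "R `` {m} = S `` {m}" for m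
  proof (cases "m \<in> Domain R")
    case True
    have "snd (snd (qrep_of M R)) m = snd (snd (qrep_of M S)) m" using e by simp
    then show ?thesis using True D by (simp add: qrep_of_def)
  next
    case False
    then show ?thesis using D by blast
  qed
  then have "(m, n) \<in> R \<longleftrightarrow> (m, n) \<in> S" for m n by (metis Image_singleton_iff)
  then show "R = S" by auto
qed simp

section \<open>Torsion conditions expressed by relations\<close>

context graded_ring
begin

text \<open>An isomorphism \<open>\<phi>\<close> from the coset module to a torsion module, preceded
  by the projection onto cosets, is a relation as in \<open>subquotient\<close>. Conversely such a
  relation is constant on cosets and factors through them.\<close>

lemma cotorsion_sub_iff:
  assumes MO: "M \<in> Ob (Gr A)"
  shows "cotorsion_sub A M S \<longleftrightarrow> torsion_subquotient A M (carrier M) S"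
proof
  have mM: "graded_module A M" using Gr_module[OF MO] .
  interpret M: graded_module A M by fact
  {
    assume c: "cotorsion_sub A M S"
    then obtain Q \<phi> where S: "gsubmodule A M S" and Q: "Q \<in> Tors A" and \<phi>: "\<phi> \<in> ghom A (gquot M S) Q"
      "bij_betw \<phi> (carrier (gquot M S)) (carrier Q)"
      unfolding cotorsion_sub_def by blast
    have mQ: "graded_module A Q" using Gr_module[OF Tors_Ob[OF Q]] .
    interpret Q: graded_module A Q by fact
    have G: "carrier (gquot M S) = a_rcosets\<^bsub>M\<^esub> S" "add (gquot M S) = set_add M"
      "gr (gquot M S) n = (\<lambda>x. S +>\<^bsub>M\<^esub> x) ` gr M n" for n
      by (simp_all add: gquot_def)
    have cs: "S +>\<^bsub>M\<^esub> x \<in> a_rcosets\<^bsub>M\<^esub> S" if "x \<in> carrier M" for x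
      using that unfolding A_RCOSETS_def' by blast
    have cl: "\<phi> (S +>\<^bsub>M\<^esub> x) \<in> carrier Q" if "x \<in> carrier M" for x
      using \<phi> cs[OF that] by (auto simp: G bij_betw_def)
    have add: "\<phi> (S +>\<^bsub>M\<^esub> (x \<oplus>\<^bsub>M\<^esub> y)) = \<phi> (S +>\<^bsub>M\<^esub> x) \<oplus>\<^bsub>Q\<^esub> \<phi> (S +>\<^bsub>M\<^esub> y)"
      if "x \<in> carrier M" "y \<in> carrier M" for x y
      unfolding coset_add[OF mM S that, symmetric] using \<phi>(1) cs that unfolding ghom_def rhom_def G by auto
    have act: "\<phi> (S +>\<^bsub>M\<^esub> ract M x a) = ract Q (\<phi> (S +>\<^bsub>M\<^esub> x)) a"
      if "x \<in> carrier M" "a \<in> carrier A" for x a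
      unfolding coset_ract[OF mM S that, symmetric] using \<phi>(1) cs that unfolding ghom_def rhom_def G by auto
    have gr: "\<phi> (S +>\<^bsub>M\<^esub> x) \<in> gr Q n" if "x \<in> gr M n" for x n
      using \<phi>(1) that unfolding ghom_def G by auto
    have f: "(\<lambda>x\<in>carrier M. \<phi> (S +>\<^bsub>M\<^esub> x)) \<in> ghom A M Q" (is "?p \<in> _")
      unfolding ghom_def rhom_def using cl add act gr M.homog_carrier by auto
    have z: "?p \<zero>\<^bsub>M\<^esub> = \<zero>\<^bsub>Q\<^esub>"
      using add[of "\<zero>\<^bsub>M\<^esub>" "\<zero>\<^bsub>M\<^esub>"] cl[of "\<zero>\<^bsub>M\<^esub>"] Q.add.l_cancel_one[of "?p \<zero>\<^bsub>M\<^esub>" "?p \<zero>\<^bsub>M\<^esub>"] by simp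
    have inj: "\<phi> (S +>\<^bsub>M\<^esub> x) = \<phi> (S +>\<^bsub>M\<^esub> y) \<longleftrightarrow> S +>\<^bsub>M\<^esub> x = S +>\<^bsub>M\<^esub> y"
      if "x \<in> carrier M" "y \<in> carrier M" for x y
      using \<phi>(2) cs that unfolding bij_betw_def G by (metis inj_on_eq_iff)
    let ?R = "fgraph M ?p"
    have "grel A M Q ?R" using f ghom_iff_grel[OF mM mQ] by blast
    moreover have "Domain ?R = carrier M" by (auto simp: mem_fgraph)
    moreover have "?R `` {\<zero>\<^bsub>M\<^esub>} = {\<zero>\<^bsub>Q\<^esub>}" using z by (auto simp: mem_fgraph)
    moreover have "Range ?R = carrier Q"
    proof -
      have "Range ?R = \<phi> ` carrier (gquot M S)"
        unfolding G A_RCOSETS_def' by (auto simp: fgraph_def)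
      then show ?thesis using \<phi>(2) by (simp add: bij_betw_def)
    qed
    moreover have "?R\<inverse> `` {\<zero>\<^bsub>Q\<^esub>} = S"
    proof -
      have "x \<in> S \<longleftrightarrow> \<phi> (S +>\<^bsub>M\<^esub> x) = \<zero>\<^bsub>Q\<^esub>" if "x \<in> carrier M" for x
        using inj[OF that M.zero_closed] coset_eq[OF mM S that M.zero_closed] z that by simp
      then show ?thesis using S gsubmodule_iff[OF mM] by (auto simp: mem_fgraph)
    qed
    ultimately show "torsion_subquotient A M (carrier M) S"
      unfolding torsion_subquotient_def subquotient_def using Q by blast
  next
    assume t: "torsion_subquotient A M (carrier M) S"
    note S = torsion_subquotient_submodules(2)[OF MO t]
    obtain Q R where Q: "Q \<in> Tors A" and R: "grel A M Q R" "Domain R = carrier M" "R `` {\<zero>\<^bsub>M\<^esub>} = {\<zero>\<^bsub>Q\<^esub>}"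
      "Range R = carrier Q" "R\<inverse> `` {\<zero>\<^bsub>Q\<^esub>} = S"
      using t unfolding torsion_subquotient_def subquotient_def by blast
    have mQ: "graded_module A Q" using Gr_module[OF Tors_Ob[OF Q]] .
    interpret Q: graded_module A Q by fact
    obtain p where p: "p \<in> ghom A M Q" "R = fgraph M p"
      using total_grel_is_graph[OF mM mQ R(1)] R(2,3) by blast
    have pm: "(x, y) \<in> R \<longleftrightarrow> x \<in> carrier M \<and> y = p x" for x y unfolding p(2) mem_fgraph ..
    have pS: "p x = p y \<longleftrightarrow> x \<ominus>\<^bsub>M\<^esub> y \<in> S" if "x \<in> carrier M" "y \<in> carrier M" for x y
    proof -
      have "p (x \<ominus>\<^bsub>M\<^esub> y) = p x \<ominus>\<^bsub>Q\<^esub> p y"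
        using grel_minus[OF mM mQ R(1)] that pm by metis
      moreover have "x \<ominus>\<^bsub>M\<^esub> y \<in> S \<longleftrightarrow> p (x \<ominus>\<^bsub>M\<^esub> y) = \<zero>\<^bsub>Q\<^esub>"
        using R(5) pm that by auto
      moreover have "p x \<in> carrier Q" "p y \<in> carrier Q" using ghom_closed[OF p(1)] that by auto
      ultimately show ?thesis
        using Q.minus_eq_zero_iff by metis
    qed
    \<comment> \<open>Any element of the coset may be chosen, since \<open>p\<close> is constant on
      it.\<close>
    define \<phi> where "\<phi> = (\<lambda>C\<in>a_rcosets\<^bsub>M\<^esub> S. p (SOME x. x \<in> C))"
    have cs: "S +>\<^bsub>M\<^esub> x \<in> a_rcosets\<^bsub>M\<^esub> S" if "x \<in> carrier M" for x
      using that unfolding A_RCOSETS_def' by blast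
    have \<phi>: "\<phi> (S +>\<^bsub>M\<^esub> x) = p x" if x: "x \<in> carrier M" for x
    proof -
      have "x \<in> S +>\<^bsub>M\<^esub> x"
        using mem_coset[OF mM S x, of x] x S gsubmodule_iff[OF mM] by (simp add: M.minus_eq M.r_neg)
      then have "(SOME y. y \<in> S +>\<^bsub>M\<^esub> x) \<in> S +>\<^bsub>M\<^esub> x" by (rule someI)
      then have "p (SOME y. y \<in> S +>\<^bsub>M\<^esub> x) = p x"
        using mem_coset[OF mM S x] pS x by blast
      then show ?thesis unfolding \<phi>_def using cs[OF x] by simp
    qed
    have G: "carrier (gquot M S) = (\<lambda>x. S +>\<^bsub>M\<^esub> x) ` carrier M" "add (gquot M S) = set_add M"
      "gr (gquot M S) n = (\<lambda>x. S +>\<^bsub>M\<^esub> x) ` gr M n" for n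
      by (auto simp: gquot_def A_RCOSETS_def')
    have "\<phi> \<in> extensional (carrier (gquot M S))" by (simp add: \<phi>_def gquot_def)
    moreover have "p (x \<oplus>\<^bsub>M\<^esub> y) = p x \<oplus>\<^bsub>Q\<^esub> p y" if "x \<in> carrier M" "y \<in> carrier M" for x y
      using p(1) that by (auto simp: ghom_def rhom_def)
    moreover have "p (ract M x a) = ract Q (p x) a" if "x \<in> carrier M" "a \<in> carrier A" for x a
      using p(1) that by (auto simp: ghom_def rhom_def)
    moreover have "p x \<in> gr Q n" if "x \<in> gr M n" for x n
      using p(1) that by (auto simp: ghom_def)
    ultimately have "\<phi> \<in> ghom A (gquot M S) Q"
      unfolding ghom_def rhom_def PiE_def using ghom_closed[OF p(1)] M.homog_carrier
      by (auto simp: G coset_add[OF mM S] coset_ract[OF mM S] \<phi>)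
    moreover have "bij_betw \<phi> (carrier (gquot M S)) (carrier Q)"
    proof -
      have "inj_on \<phi> (carrier (gquot M S))"
        unfolding G inj_on_def using \<phi> pS coset_eq[OF mM S] by auto
      moreover have "\<phi> ` carrier (gquot M S) = carrier Q"
      proof -
        have "\<phi> ` carrier (gquot M S) = p ` carrier M" by (auto simp: G \<phi> image_iff)
        also have "\<dots> = Range R" using pm by auto
        finally show ?thesis using R(4) by simp
      qed
      ultimately show ?thesis by (simp add: bij_betw_def)
    qed
    ultimately show "cotorsion_sub A M S"
      unfolding cotorsion_sub_def using S Q by blast
  }
qed

text \<open>In one direction \<open>gsub N S\<close> itself serves as the quotient. In the other the
  relation is injective, so \<open>gsub N S\<close> embeds into the torsion module
  \<open>Q\<close>.\<close>

lemma torsion_sub_iff: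
  assumes NO: "N \<in> Ob (Gr A)"
  shows "torsion_sub A N S \<longleftrightarrow> torsion_subquotient A N S {\<zero>\<^bsub>N\<^esub>}"
proof
  have mN: "graded_module A N" using Gr_module[OF NO] .
  interpret N: graded_module A N by fact
  have c: "carrier (gsub N S) = S" "\<zero>\<^bsub>gsub N S\<^esub> = \<zero>\<^bsub>N\<^esub>" by (simp_all add: gsub_def)
  {
    assume t: "torsion_sub A N S"
    then have S: "gsubmodule A N S" "gsub N S \<in> Tors A" by (auto simp: torsion_sub_def)
    have "subquotient A N S {\<zero>\<^bsub>N\<^esub>} (gsub N S) (Id_on S)"
      unfolding subquotient_def
      using grel_converse[OF grel_gsub_inclusion[OF mN S(1)]] S(1) gsubmodule_iff[OF mN] by (auto simp: c)
    then show "torsion_subquotient A N S {\<zero>\<^bsub>N\<^esub>}"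
      unfolding torsion_subquotient_def using S(2) by blast
  next
    assume t: "torsion_subquotient A N S {\<zero>\<^bsub>N\<^esub>}"
    note S = torsion_subquotient_submodules(1)[OF NO t]
    obtain Q R where Q: "Q \<in> Tors A" and R: "grel A N Q R" "Domain R = S" "R `` {\<zero>\<^bsub>N\<^esub>} = {\<zero>\<^bsub>Q\<^esub>}"
      "Range R = carrier Q" "R\<inverse> `` {\<zero>\<^bsub>Q\<^esub>} = {\<zero>\<^bsub>N\<^esub>}"
      using t unfolding torsion_subquotient_def subquotient_def by blast
    have mQ: "graded_module A Q" using Gr_module[OF Tors_Ob[OF Q]] .
    have "S \<subseteq> carrier N" using S gsubmodule_iff[OF mN] by simp
    then have SO: "gsub N S \<in> Ob (Gr A)"
      using graded_rmodule_gsub[OF mN S] NO small_subset by (auto simp: c)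
    note mS = Gr_module[OF SO]
    have "grel A (gsub N S) Q (Id_on S O R)"
      by (rule grel_relcomp[OF grel_gsub_inclusion[OF mN S] R(1)])
    moreover have "carrier (gsub N S) \<subseteq> Domain (Id_on S O R)" using R(2) by (auto simp: c)
    moreover have "(Id_on S O R) `` {\<zero>\<^bsub>gsub N S\<^esub>} \<subseteq> {\<zero>\<^bsub>Q\<^esub>}" using R(3) by (auto simp: c)
    ultimately obtain f where f: "f \<in> ghom A (gsub N S) Q" "Id_on S O R = fgraph (gsub N S) f"
      using total_grel_is_graph[OF mS mQ] by blast
    have "inj_on f (carrier (gsub N S))"
    proof (rule inj_onI)
      fix x y assume xy: "x \<in> carrier (gsub N S)" "y \<in> carrier (gsub N S)" "f x = f y"
      have "(x, f x) \<in> R" "(y, f x) \<in> R"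
        using xy f(2) mem_fgraph[of x "f x" "gsub N S" f] mem_fgraph[of y "f x" "gsub N S" f] by auto
      then show "x = y"
        using grel_single_valued[OF mQ mN grel_converse[OF R(1)] R(5)] by blast
    qed
    then have "gsub N S \<in> Tors A"
      using localizingD(2)[OF localizing_Tors Q SO f(1)] by blast
    then show "torsion_sub A N S" using S by (simp add: torsion_sub_def)
  }
qed

lemma coset_rel_grel:
  assumes NO: "N \<in> Ob (Gr A)" and S: "gsubmodule A N S"
  shows "grel A N N (coset_rel N S)"
proof -
  have mN: "graded_module A N" using Gr_module[OF NO] .
  interpret N: graded_module A N by fact
  note S' = S[unfolded gsubmodule_iff[OF mN]]
  have Sc: "s \<in> carrier N" if "s \<in> S" for s using S' that by auto
  show ?thesis
  proof (rule grelI)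
    show "coset_rel N S \<subseteq> carrier N \<times> carrier N" using Sc by (auto simp: coset_rel_def)
    have "\<zero>\<^bsub>N\<^esub> \<in> S" "\<zero>\<^bsub>N\<^esub> = \<zero>\<^bsub>N\<^esub> \<oplus>\<^bsub>N\<^esub> \<zero>\<^bsub>N\<^esub>" using S' by auto
    then show "(\<zero>\<^bsub>N\<^esub>, \<zero>\<^bsub>N\<^esub>) \<in> coset_rel N S" unfolding coset_rel_def using N.zero_closed by blast
  next
    fix x y assume "(x, y) \<in> coset_rel N S"
    then obtain s where s: "x \<in> carrier N" "s \<in> S" "y = s \<oplus>\<^bsub>N\<^esub> x" by (auto simp: coset_rel_def)
    show "(ract N x a, ract N y a) \<in> coset_rel N S" if a: "a \<in> carrier A" for a
      using s a Sc S' N.ract_add_left[of s x a] unfolding coset_rel_def by auto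
    show "(hpart N (gr N) n x, hpart N (gr N) n y) \<in> coset_rel N S" for n
      using s Sc S' N.hpart_add[of s x n] unfolding coset_rel_def by auto
    fix x' y' assume "(x', y') \<in> coset_rel N S"
    then obtain s' where s': "x' \<in> carrier N" "s' \<in> S" "y' = s' \<oplus>\<^bsub>N\<^esub> x'" by (auto simp: coset_rel_def)
    have "y \<oplus>\<^bsub>N\<^esub> y' = (s \<oplus>\<^bsub>N\<^esub> s') \<oplus>\<^bsub>N\<^esub> (x \<oplus>\<^bsub>N\<^esub> x')"
      using s s' Sc by (simp add: N.a_ac)
    then show "(x \<oplus>\<^bsub>N\<^esub> x', y \<oplus>\<^bsub>N\<^esub> y') \<in> coset_rel N S"
      using s s' S' unfolding coset_rel_def by auto
  qed
qed

lemma coset_rel_comp: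
  assumes NO: "N \<in> Ob (Gr A)" and S: "gsubmodule A N S" and T: "gsubmodule A N T" "S \<subseteq> T"
  shows "coset_rel N S O coset_rel N T = coset_rel N T"
proof -
  have mN: "graded_module A N" using Gr_module[OF NO] .
  interpret N: graded_module A N by fact
  note S' = S[unfolded gsubmodule_iff[OF mN]] and T' = T(1)[unfolded gsubmodule_iff[OF mN]]
  show ?thesis
  proof (intro subset_antisym subrelI)
    fix x z assume "(x, z) \<in> coset_rel N S O coset_rel N T"
    then obtain s t where s: "x \<in> carrier N" "s \<in> S" "t \<in> T" "z = t \<oplus>\<^bsub>N\<^esub> (s \<oplus>\<^bsub>N\<^esub> x)"
      by (auto simp: coset_rel_def)
    have c: "s \<in> carrier N" "t \<in> carrier N" "s \<in> T" using s S' T' T(2) by auto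
    have "z = (t \<oplus>\<^bsub>N\<^esub> s) \<oplus>\<^bsub>N\<^esub> x" using s c by (simp add: N.a_assoc)
    moreover have "t \<oplus>\<^bsub>N\<^esub> s \<in> T" using s c T' by blast
    ultimately show "(x, z) \<in> coset_rel N T" using s(1) unfolding coset_rel_def by blast
  next
    fix x z assume xz: "(x, z) \<in> coset_rel N T"
    then have x: "x \<in> carrier N" by (auto simp: coset_rel_def)
    then have "x = \<zero>\<^bsub>N\<^esub> \<oplus>\<^bsub>N\<^esub> x" by simp
    then have "(x, x) \<in> coset_rel N S" using x S' unfolding coset_rel_def by blast
    then show "(x, z) \<in> coset_rel N S O coset_rel N T" using xz by blast
  qed
qed

lemma coset_rel_zero:
  assumes NO: "N \<in> Ob (Gr A)" and S: "gsubmodule A N S"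
  shows "coset_rel N S `` {\<zero>\<^bsub>N\<^esub>} = S" "Domain (coset_rel N S) = carrier N"
proof -
  have mN: "graded_module A N" using Gr_module[OF NO] .
  interpret N: graded_module A N by fact
  note S' = S[unfolded gsubmodule_iff[OF mN]]
  have [simp]: "s \<in> S \<Longrightarrow> s \<oplus>\<^bsub>N\<^esub> \<zero>\<^bsub>N\<^esub> = s" for s using S' by auto
  show "coset_rel N S `` {\<zero>\<^bsub>N\<^esub>} = S"
    by (auto simp: coset_rel_def) (metis N.zero_closed \<open>\<And>s. s \<in> S \<Longrightarrow> s \<oplus>\<^bsub>N\<^esub> \<zero>\<^bsub>N\<^esub> = s\<close>)
  show "Domain (coset_rel N S) = carrier N" using S' by (auto simp: coset_rel_def)
qed

text \<open>\<open>S/S\<close> is zero, hence annihilated by \<open>ideal_I A\<close>.\<close>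

lemma torsion_subquotient_refl:
  assumes NO: "N \<in> Ob (Gr A)" and S: "gsubmodule A N S"
  shows "torsion_subquotient A N S S"
proof -
  have mN: "graded_module A N" using Gr_module[OF NO] .
  interpret N: graded_module A N by fact
  obtain Q R where Q: "Q \<in> Ob (Gr A)" and R: "subquotient A N S S Q R"
    using subquotient_exists[OF graded_ring_axioms NO S S] by blast
  have mQ: "graded_module A Q" using Gr_module[OF Q] .
  interpret Q: graded_module A Q by fact
  have "carrier Q = {\<zero>\<^bsub>Q\<^esub>}"
    using R grel_single_valued[OF mN mQ, of R] unfolding subquotient_def by blast
  \<comment> \<open>The rule that zero times \<open>a\<close> is zero is available for
    \<open>a\<close> in the carrier.\<close>
  moreover have "ideal_I A \<subseteq> carrier A"
  proof -
    have c: "carrier A \<cdot>\<^bsub>A\<^esub> nonzero_degrees A \<subseteq> carrier A"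
    proof
      have d: "d \<in> carrier A" if "d \<in> nonzero_degrees A" for d
        using that homog_carrier unfolding nonzero_degrees_def by (auto intro!: finsum_closed)
      show "x \<in> carrier A" if "x \<in> carrier A \<cdot>\<^bsub>A\<^esub> nonzero_degrees A" for x
        using that by (induction rule: ideal_prod.induct) (auto simp: d)
    qed
    show ?thesis
    proof
      show "x \<in> carrier A" if "x \<in> ideal_I A" for x
        using that unfolding ideal_I_def by (induction rule: ideal_prod.induct) (use c in auto)
    qed
  qed
  ultimately have "Q \<in> Tors A"
    using Q by (intro Tors_annihilated) auto
  then show ?thesis using R unfolding torsion_subquotient_def by blast
qed

section \<open>Restricting domains and enlarging values\<close>

text \<open>\<open>S/(S \<inter> T)\<close> is the image of the quotient by \<open>T\<close> under
  the partial identity on \<open>S\<close>; then apply transitivity through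
  \<open>S\<close>.\<close>

lemma cotorsion_Int:
  assumes M: "M \<in> Ob (Gr A)" and 1: "torsion_subquotient A M (carrier M) S" and 2: "torsion_subquotient A M (carrier M) T"
  shows "torsion_subquotient A M (carrier M) (S \<inter> T)"
proof -
  note mM = Gr_module[OF M]
  have S: "gsubmodule A M S" "S \<subseteq> carrier M" using torsion_subquotient_submodules[OF M 1] by auto
  have "torsion_subquotient A M (Id_on S `` carrier M) (Id_on S `` T)"
    by (rule torsion_subquotient_Image[OF M M _ 2]) (use S gsubmodule_iff_grel[OF mM] in blast)
  moreover have "Id_on S `` carrier M = S" "Id_on S `` T = S \<inter> T" using S by auto
  ultimately show ?thesis using torsion_subquotient_trans[OF M 1] by simp
qed

text \<open>Take \<open>U = S + T\<close>, the image of \<open>S\<close> under congruence modulo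
  \<open>T\<close>; thus \<open>U/T\<close> is torsion, and so is \<open>T\<close>.\<close>

lemma torsion_sum:
  assumes N: "N \<in> Ob (Gr A)" and 1: "torsion_subquotient A N S {\<zero>\<^bsub>N\<^esub>}" and 2: "torsion_subquotient A N T {\<zero>\<^bsub>N\<^esub>}"
  obtains U where "torsion_subquotient A N U {\<zero>\<^bsub>N\<^esub>}" "S \<subseteq> U" "T \<subseteq> U"
proof -
  have mN: "graded_module A N" using Gr_module[OF N] .
  interpret N: graded_module A N by fact
  note S = torsion_subquotient_submodules(1)[OF N 1] and T = torsion_subquotient_submodules(1)[OF N 2]
  note S' = S[unfolded gsubmodule_iff[OF mN]] and T' = T[unfolded gsubmodule_iff[OF mN]]
  have "torsion_subquotient A N (coset_rel N T `` S) (coset_rel N T `` {\<zero>\<^bsub>N\<^esub>})"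
    by (rule torsion_subquotient_Image[OF N N coset_rel_grel[OF N T] 1])
  then have "torsion_subquotient A N (coset_rel N T `` S) T"
    unfolding coset_rel_zero[OF N T] .
  then have "torsion_subquotient A N (coset_rel N T `` S) {\<zero>\<^bsub>N\<^esub>}"
    using torsion_subquotient_trans[OF N _ 2] by blast
  moreover have "S \<subseteq> coset_rel N T `` S"
  proof
    fix s assume s: "s \<in> S"
    then have c: "s \<in> carrier N" using S' by auto
    then have "(s, \<zero>\<^bsub>N\<^esub> \<oplus>\<^bsub>N\<^esub> s) \<in> coset_rel N T" using T' unfolding coset_rel_def by blast
    then show "s \<in> coset_rel N T `` S" using s c by auto
  qed
  moreover have "T \<subseteq> coset_rel N T `` S"
    using coset_rel_zero(1)[OF N T] S' by blast
  ultimately show ?thesis using that by blast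
qed

text \<open>The domain of the composite is the preimage under \<open>R\<close> of
  \<open>Domain S\<close>; its values over zero are the image under \<open>S\<close> of those of
  \<open>R\<close>. Each half is one image of a torsion subquotient followed by
  transitivity.\<close>

lemma correspondence_comp:
  assumes M: "M \<in> Ob (Gr A)" and N: "N \<in> Ob (Gr A)" and P: "P \<in> Ob (Gr A)"
    and R: "correspondence A M N R" and S: "correspondence A N P S"
  shows "correspondence A M P (R O S)"
proof -
  have g: "grel A M N R" "grel A N P S" and t: "torsion_subquotient A M (carrier M) (Domain R)"
    "torsion_subquotient A N (R `` {\<zero>\<^bsub>M\<^esub>}) {\<zero>\<^bsub>N\<^esub>}" "torsion_subquotient A N (carrier N) (Domain S)"
    "torsion_subquotient A P (S `` {\<zero>\<^bsub>N\<^esub>}) {\<zero>\<^bsub>P\<^esub>}"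
    using R S by (auto simp: correspondence_def)
  have "torsion_subquotient A M (R\<inverse> `` carrier N) (R\<inverse> `` Domain S)"
    by (rule torsion_subquotient_Image[OF N M grel_converse[OF g(1)] t(3)])
  moreover have "R\<inverse> `` carrier N = Domain R" "R\<inverse> `` Domain S = Domain (R O S)"
    using grelD(7)[OF g(1)] by blast+
  ultimately have "torsion_subquotient A M (carrier M) (Domain (R O S))"
    using torsion_subquotient_trans[OF M t(1)] by simp
  moreover have "torsion_subquotient A P ((R O S) `` {\<zero>\<^bsub>M\<^esub>}) {\<zero>\<^bsub>P\<^esub>}"
  proof -
    have "torsion_subquotient A P (S `` (R `` {\<zero>\<^bsub>M\<^esub>})) (S `` {\<zero>\<^bsub>N\<^esub>})"
      by (rule torsion_subquotient_Image[OF N P g(2) t(2)])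
    then show ?thesis
      using torsion_subquotient_trans[OF P _ t(4)] by (simp add: relcomp_Image)
  qed
  ultimately show ?thesis
    unfolding correspondence_def using grel_relcomp[OF g] by blast
qed

text \<open>Restrictions and, next, congruences modulo torsion submodules represent identities in
  the quotient category; composing with them shrinks domains and enlarges values.\<close>

lemma correspondence_restriction:
  assumes M: "M \<in> Ob (Gr A)" and S: "torsion_subquotient A M (carrier M) S"
  shows "correspondence A M M (Id_on S)"
proof -
  note mM = Gr_module[OF M]
  note sub = torsion_subquotient_submodules[OF M S]
  have "Id_on S `` {\<zero>\<^bsub>M\<^esub>} = {\<zero>\<^bsub>M\<^esub>}"
    using sub(2)[unfolded gsubmodule_iff[OF mM]] by auto
  then show ?thesis
    unfolding correspondence_def
    using S sub gsubmodule_iff_grel[OF mM] torsion_subquotient_refl[OF M gsubmodule_zero[OF mM]] by simp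
qed

lemma correspondence_coset_rel:
  assumes N: "N \<in> Ob (Gr A)" and S: "torsion_subquotient A N S {\<zero>\<^bsub>N\<^esub>}"
  shows "correspondence A N N (coset_rel N S)"
by (metis torsion_subquotient_submodules N S correspondence_def coset_rel_zero coset_rel_grel torsion_subquotient_refl gsubmodule_carrier Gr_module)

lemma coset_relI:
  assumes N: "N \<in> Ob (Gr A)" and "x \<in> carrier N" "y \<in> carrier N" "y \<ominus>\<^bsub>N\<^esub> x \<in> S"
  shows "(x, y) \<in> coset_rel N S"
proof -
  interpret N: graded_module A N using Gr_module[OF N] .
  have "y = (y \<ominus>\<^bsub>N\<^esub> x) \<oplus>\<^bsub>N\<^esub> x" using assms by (simp add: N.minus_eq N.a_assoc N.l_neg)
  then show ?thesis using assms unfolding coset_rel_def by blast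
qed

section \<open>Gabriel's representatives as correspondences\<close>

text \<open>A homomorphism \<open>f\<close> to \<open>N/N'\<close> corresponds to the relation
  between \<open>x\<close> and the elements of the coset \<open>f x\<close>. Conversely the fibres
  of a correspondence are cosets of its values over zero, so they define such an
  \<open>f\<close>.\<close>

lemma qreps_iff:
  assumes M: "M \<in> Ob (Gr A)" and N: "N \<in> Ob (Gr A)"
  shows "t \<in> qreps A M N \<longleftrightarrow> (\<exists>R. correspondence A M N R \<and> t = qrep_of M R)"
proof
  have mM: "graded_module A M" and mN: "graded_module A N" using Gr_module M N by blast+
  interpret M: graded_module A M by fact
  interpret N: graded_module A N by fact
  {
    assume "t \<in> qreps A M N"
    then obtain M' N' f where t: "t = (M', N', f)" and M': "cotorsion_sub A M M'" and N': "torsion_sub A N N'"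
      and f: "f \<in> ghom A (gsub M M') (gquot N N')"
      unfolding qreps_def by auto
    have sM: "gsubmodule A M M'" and sN: "gsubmodule A N N'"
      using M' N' by (auto simp: cotorsion_sub_def torsion_sub_def)
    note sM' = sM[unfolded gsubmodule_iff[OF mM]] and sN' = sN[unfolded gsubmodule_iff[OF mN]]
    have G: "carrier (gsub M M') = M'" "add (gsub M M') = add M" "ract (gsub M M') = ract M"
      "gr (gsub M M') n = gr M n \<inter> M'"
      "carrier (gquot N N') = (\<lambda>x. N' +>\<^bsub>N\<^esub> x) ` carrier N" "add (gquot N N') = set_add N"
      "gr (gquot N N') n = (\<lambda>x. N' +>\<^bsub>N\<^esub> x) ` gr N n" for n
      by (auto simp: gsub_def gquot_def A_RCOSETS_def')
    have fcl: "\<exists>y\<in>carrier N. f x = N' +>\<^bsub>N\<^esub> y" if "x \<in> M'" for x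
    proof -
      have "f \<in> M' \<rightarrow>\<^sub>E (\<lambda>x. N' +>\<^bsub>N\<^esub> x) ` carrier N" using f unfolding ghom_def rhom_def G by simp
      from PiE_mem[OF this that] show ?thesis by blast
    qed
    have fadd: "f (x \<oplus>\<^bsub>M\<^esub> y) = f x <+>\<^bsub>N\<^esub> f y" if "x \<in> M'" "y \<in> M'" for x y
      using f that unfolding ghom_def rhom_def G by simp
    have fact': "f (ract M x a) = ract (gquot N N') (f x) a" if "x \<in> M'" "a \<in> carrier A" for x a
      using f that unfolding ghom_def rhom_def G by simp
    have fgr: "\<exists>y\<in>gr N n. f x = N' +>\<^bsub>N\<^esub> y" if "x \<in> gr M n" "x \<in> M'" for x n
      using f that unfolding ghom_def G by fastforce
    have fext: "f \<in> extensional M'"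
      using f unfolding ghom_def rhom_def G by (auto simp: PiE_def)
    have mem: "z \<in> N' +>\<^bsub>N\<^esub> y \<longleftrightarrow> z \<in> carrier N \<and> z \<ominus>\<^bsub>N\<^esub> y \<in> N'" if "y \<in> carrier N" for y z
      using mem_coset[OF mN sN that] .
    define R where "R = {(x, y). x \<in> M' \<and> y \<in> f x}"
    have coset: "f x = N' +>\<^bsub>N\<^esub> y" if "(x, y) \<in> R" for x y
    proof -
      have "x \<in> M'" using that by (simp add: R_def)
      from fcl[OF this] obtain z where z: "z \<in> carrier N" "f x = N' +>\<^bsub>N\<^esub> z" by (rule bexE) blast
      then have "y \<in> carrier N \<and> y \<ominus>\<^bsub>N\<^esub> z \<in> N'" using that mem by (auto simp: R_def)
      then show ?thesis using z coset_eq[OF mN sN, of y z] by simp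
    qed
    have self: "y \<in> N' +>\<^bsub>N\<^esub> y" if "y \<in> carrier N" for y
      using mem[OF that] that sN' by (simp add: N.minus_eq N.r_neg)
    have Rc: "x \<in> carrier M" "y \<in> carrier N" "x \<in> M'" if "(x, y) \<in> R" for x y
    proof -
      show "x \<in> M'" "x \<in> carrier M" using that sM' by (auto simp: R_def)
      have "x \<in> M'" using that by (simp add: R_def)
      from fcl[OF this] obtain z where z: "z \<in> carrier N" "f x = N' +>\<^bsub>N\<^esub> z" by (rule bexE) blast
      then show "y \<in> carrier N" using that mem by (auto simp: R_def)
    qed
    have RI: "(x, y) \<in> R" if "x \<in> M'" "f x = N' +>\<^bsub>N\<^esub> y" "y \<in> carrier N" for x y
      using that self by (simp add: R_def)
    have add: "(x \<oplus>\<^bsub>M\<^esub> x', y \<oplus>\<^bsub>N\<^esub> y') \<in> R" if "(x, y) \<in> R" "(x', y') \<in> R" for x y x' y'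
      using RI[of "x \<oplus>\<^bsub>M\<^esub> x'" "y \<oplus>\<^bsub>N\<^esub> y'"] fadd[of x x'] coset[OF that(1)] coset[OF that(2)] Rc[OF that(1)] Rc[OF that(2)]
        coset_add[OF mN sN, of y y'] sM' by simp
    have zero: "(\<zero>\<^bsub>M\<^esub>, \<zero>\<^bsub>N\<^esub>) \<in> R"
    proof -
      obtain y where y: "y \<in> carrier N" "f \<zero>\<^bsub>M\<^esub> = N' +>\<^bsub>N\<^esub> y" using fcl[of "\<zero>\<^bsub>M\<^esub>"] sM' by blast
      have "f \<zero>\<^bsub>M\<^esub> = f \<zero>\<^bsub>M\<^esub> <+>\<^bsub>N\<^esub> f \<zero>\<^bsub>M\<^esub>" using fadd[of "\<zero>\<^bsub>M\<^esub>" "\<zero>\<^bsub>M\<^esub>"] sM' by simp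
      then have "N' +>\<^bsub>N\<^esub> (y \<oplus>\<^bsub>N\<^esub> y) = N' +>\<^bsub>N\<^esub> y" using y coset_add[OF mN sN y(1) y(1)] by simp
      then have "(y \<oplus>\<^bsub>N\<^esub> y) \<ominus>\<^bsub>N\<^esub> y \<in> N'" using coset_eq[OF mN sN, of "y \<oplus>\<^bsub>N\<^esub> y" y] y by simp
      then have "y \<in> N'" using y by (simp add: N.minus_eq N.a_assoc N.r_neg)
      then have "y \<ominus>\<^bsub>N\<^esub> \<zero>\<^bsub>N\<^esub> \<in> N'" using y by simp
      then have "f \<zero>\<^bsub>M\<^esub> = N' +>\<^bsub>N\<^esub> \<zero>\<^bsub>N\<^esub>" using coset_eq[OF mN sN, of y "\<zero>\<^bsub>N\<^esub>"] y by simp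
      then show ?thesis using RI sM' by simp
    qed
    have dom: "Domain R = M'"
    proof -
      have "\<exists>y. (x, y) \<in> R" if "x \<in> M'" for x using fcl[OF that] RI[OF that] by blast
      then show ?thesis using Rc by blast
    qed
    have gR: "grel A M N R"
    proof (rule grelI[OF _ zero add])
      show "R \<subseteq> carrier M \<times> carrier N" using Rc by auto
      show "(ract M x a, ract N y a) \<in> R" if "(x, y) \<in> R" "a \<in> carrier A" for x y a
        using RI[of "ract M x a" "ract N y a"] fact'[of x a] Rc[OF that(1)] that sM' coset[OF that(1)]
          coset_ract[OF mN sN, of y a] by simp
      fix x y n assume xy: "(x, y) \<in> R"
      \<comment> \<open>Values of the components of \<open>x\<close> are chosen homogeneous of the
        same degree; their sum \<open>?y\<close> is then a value over \<open>x\<close> whose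
        components are known.\<close>
      have "\<forall>k. \<exists>z. z \<in> gr N k \<and> (hpart M (gr M) k x, z) \<in> R \<and> (hpart M (gr M) k x = \<zero>\<^bsub>M\<^esub> \<longrightarrow> z = \<zero>\<^bsub>N\<^esub>)"
      proof
        fix k
        have h: "hpart M (gr M) k x \<in> M'" "hpart M (gr M) k x \<in> gr M k" using Rc[OF xy] sM' by auto
        then obtain z where z: "z \<in> gr N k" "f (hpart M (gr M) k x) = N' +>\<^bsub>N\<^esub> z" using fgr by blast
        show "\<exists>z. z \<in> gr N k \<and> (hpart M (gr M) k x, z) \<in> R \<and> (hpart M (gr M) k x = \<zero>\<^bsub>M\<^esub> \<longrightarrow> z = \<zero>\<^bsub>N\<^esub>)"
        proof (cases "hpart M (gr M) k x = \<zero>\<^bsub>M\<^esub>")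
          case True
          then show ?thesis using zero by (intro exI[of _ "\<zero>\<^bsub>N\<^esub>"]) simp
        next
          case False
          then show ?thesis using z h RI N.homog_carrier by blast
        qed
      qed
      then obtain z where z: "\<And>k. z k \<in> gr N k" "\<And>k. (hpart M (gr M) k x, z k) \<in> R" by metis
      let ?F = "insert n {k. hpart M (gr M) k x \<noteq> \<zero>\<^bsub>M\<^esub>}"
      have F: "finite ?F" using Rc[OF xy] by simp
      have sub: "R \<subseteq> carrier M \<times> carrier N" using Rc by auto
      have "((\<Oplus>\<^bsub>M\<^esub>k\<in>?F. hpart M (gr M) k x), (\<Oplus>\<^bsub>N\<^esub>k\<in>?F. z k)) \<in> R"
        by (rule pair_finsum_closed[OF M.abelian_group_axioms N.abelian_group_axioms sub zero add F z(2)])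
      then have R1: "(x, (\<Oplus>\<^bsub>N\<^esub>k\<in>?F. z k)) \<in> R"
        using M.finsum_hpart_superset[OF Rc(1)[OF xy] F] by (simp add: subset_insertI)
      let ?y = "\<Oplus>\<^bsub>N\<^esub>k\<in>?F. z k"
      have yc: "?y \<in> carrier N" using Rc(2)[OF R1] .
      \<comment> \<open>Any other value \<open>y\<close> differs from \<open>?y\<close> by an
        element of \<open>N'\<close>, and \<open>N'\<close> contains the components of that
        difference.\<close>
      have "y \<in> N' +>\<^bsub>N\<^esub> ?y" using coset[OF R1] xy by (simp add: R_def)
      then have d: "y \<ominus>\<^bsub>N\<^esub> ?y \<in> N'" using mem[OF yc] by simp
      have "y = (y \<ominus>\<^bsub>N\<^esub> ?y) \<oplus>\<^bsub>N\<^esub> ?y" using Rc(2)[OF xy] yc by (simp add: N.minus_eq N.a_assoc N.l_neg)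
      then have "hpart N (gr N) n y = hpart N (gr N) n (y \<ominus>\<^bsub>N\<^esub> ?y) \<oplus>\<^bsub>N\<^esub> hpart N (gr N) n ?y"
        using N.hpart_add[of "y \<ominus>\<^bsub>N\<^esub> ?y" ?y n] Rc(2)[OF xy] yc by simp
      moreover have "hpart N (gr N) n ?y = z n" using N.hpart_finsum[OF F, of z n] z(1) by simp
      moreover have "hpart N (gr N) n (y \<ominus>\<^bsub>N\<^esub> ?y) \<in> N'" using d sN' by blast
      moreover have "z n \<in> carrier N" using z(1) N.homog_carrier by blast
      ultimately have "hpart N (gr N) n y \<in> N' +>\<^bsub>N\<^esub> z n" unfolding a_r_coset_def' by auto
      then show "(hpart M (gr M) n x, hpart N (gr N) n y) \<in> R"
        using coset[OF z(2)[of n]] z(2)[of n] by (simp add: R_def)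
    qed
    have R0: "R `` {\<zero>\<^bsub>M\<^esub>} = N'"
    proof -
      have "f \<zero>\<^bsub>M\<^esub> = N'" using coset[OF zero] coset_zero[OF mN sN] by simp
      then show ?thesis using sM' by (auto simp: R_def)
    qed
    have "correspondence A M N R"
      unfolding correspondence_def dom R0 using gR M' N' cotorsion_sub_iff[OF M] torsion_sub_iff[OF N] by blast
    moreover have "t = qrep_of M R"
    proof -
      have "f = (\<lambda>m\<in>M'. R `` {m})" using fext by (auto simp: R_def fun_eq_iff extensional_def)
      then show ?thesis by (simp add: qrep_of_def t dom R0)
    qed
    ultimately show "\<exists>R. correspondence A M N R \<and> t = qrep_of M R" by blast
  next
    assume "\<exists>R. correspondence A M N R \<and> t = qrep_of M R"
    then obtain R where R: "correspondence A M N R" and t: "t = qrep_of M R" by blast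
    define M' N' where "M' = Domain R" and "N' = R `` {\<zero>\<^bsub>M\<^esub>}"
    have gR: "grel A M N R" and tM: "torsion_subquotient A M (carrier M) M'" and tN: "torsion_subquotient A N N' {\<zero>\<^bsub>N\<^esub>}"
      using R by (auto simp: correspondence_def M'_def N'_def)
    have sM: "gsubmodule A M M'" and sN: "gsubmodule A N N'"
      using torsion_subquotient_submodules[OF M tM] torsion_subquotient_submodules[OF N tN] by auto
    note sM' = sM[unfolded gsubmodule_iff[OF mM]]
    \<comment> \<open>Two values over \<open>m\<close> differ by a value over zero, and adding a
      value over zero keeps a value over \<open>m\<close>.\<close>
    have coset: "R `` {m} = N' +>\<^bsub>N\<^esub> n" if "(m, n) \<in> R" for m n
    proof -
      have c: "m \<in> carrier M" "n \<in> carrier N" using grelD(6,7)[OF gR that] .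
      have "(m, y) \<in> R \<longleftrightarrow> y \<in> carrier N \<and> (\<zero>\<^bsub>M\<^esub>, y \<ominus>\<^bsub>N\<^esub> n) \<in> R" for y
      proof
        assume y: "(m, y) \<in> R"
        show "y \<in> carrier N \<and> (\<zero>\<^bsub>M\<^esub>, y \<ominus>\<^bsub>N\<^esub> n) \<in> R"
          using grel_minus[OF mM mN gR y that] grelD(7)[OF gR y] c by (simp add: M.minus_eq M.r_neg)
      next
        assume y: "y \<in> carrier N \<and> (\<zero>\<^bsub>M\<^esub>, y \<ominus>\<^bsub>N\<^esub> n) \<in> R"
        then have "(\<zero>\<^bsub>M\<^esub> \<oplus>\<^bsub>M\<^esub> m, (y \<ominus>\<^bsub>N\<^esub> n) \<oplus>\<^bsub>N\<^esub> n) \<in> R" using grelD(3)[OF gR] that by blast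
        then show "(m, y) \<in> R" using y c by (simp add: N.minus_eq N.a_assoc N.l_neg)
      qed
      then show ?thesis
        using mem_coset[OF mN sN c(2)] by (auto simp: N'_def)
    qed
    let ?f = "\<lambda>m\<in>M'. R `` {m}"
    have G: "carrier (gsub M M') = M'" "add (gsub M M') = add M" "ract (gsub M M') = ract M"
      "gr (gsub M M') n = gr M n \<inter> M'"
      "carrier (gquot N N') = (\<lambda>x. N' +>\<^bsub>N\<^esub> x) ` carrier N" "add (gquot N N') = set_add N"
      "gr (gquot N N') n = (\<lambda>x. N' +>\<^bsub>N\<^esub> x) ` gr N n" for n
      by (auto simp: gsub_def gquot_def A_RCOSETS_def')
    have val: "\<exists>y. (x, y) \<in> R \<and> y \<in> carrier N \<and> ?f x = N' +>\<^bsub>N\<^esub> y" if x: "x \<in> M'" for x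
    proof -
      obtain y where y: "(x, y) \<in> R" using x by (auto simp: M'_def)
      then show ?thesis using coset[OF y] x grelD(7)[OF gR y] by auto
    qed
    have "?f \<in> ghom A (gsub M M') (gquot N N')"
      unfolding ghom_def rhom_def
    proof (intro CollectI conjI ballI allI subsetI)
      show "?f \<in> carrier (gsub M M') \<rightarrow>\<^sub>E carrier (gquot N N')"
        using val by (fastforce simp: G)
    next
      fix x y assume xy: "x \<in> carrier (gsub M M')" "y \<in> carrier (gsub M M')"
      then obtain u v where u: "(x, u) \<in> R" "u \<in> carrier N" "?f x = N' +>\<^bsub>N\<^esub> u"
        and v: "(y, v) \<in> R" "v \<in> carrier N" "?f y = N' +>\<^bsub>N\<^esub> v"
        using val unfolding G by metis
      have xyM: "x \<oplus>\<^bsub>M\<^esub> y \<in> M'" using xy sM' by (simp add: G)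
      have "?f (x \<oplus>\<^bsub>M\<^esub> y) = N' +>\<^bsub>N\<^esub> (u \<oplus>\<^bsub>N\<^esub> v)"
        using xyM coset[OF grelD(3)[OF gR u(1) v(1)]] by simp
      then show "?f (x \<oplus>\<^bsub>gsub M M'\<^esub> y) = ?f x \<oplus>\<^bsub>gquot N N'\<^esub> ?f y"
        unfolding G u(3) v(3) coset_add[OF mN sN u(2) v(2)] .
    next
      fix x a assume x: "x \<in> carrier (gsub M M')" and a: "a \<in> carrier A"
      then obtain u where u: "(x, u) \<in> R" "u \<in> carrier N" "?f x = N' +>\<^bsub>N\<^esub> u"
        using val unfolding G by metis
      have "ract M x a \<in> M'" using x sM' a by (simp add: G)
      then have "?f (ract M x a) = N' +>\<^bsub>N\<^esub> ract N u a"
        using coset[OF grelD(4)[OF gR u(1) a]] by simp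
      then show "?f (ract (gsub M M') x a) = ract (gquot N N') (?f x) a"
        unfolding G u(3) coset_ract[OF mN sN u(2) a] .
    next
      fix n z assume "z \<in> ?f ` gr (gsub M M') n"
      then obtain x where x: "x \<in> gr M n" "x \<in> M'" "z = ?f x" by (auto simp: G)
      then obtain u where u: "(x, u) \<in> R" "u \<in> carrier N" using val by blast
      have "(x, hpart N (gr N) n u) \<in> R"
        using grelD(5)[OF gR u(1), of n] M.hpart_of_homog[OF x(1), of n] by simp
      then have "z = N' +>\<^bsub>N\<^esub> hpart N (gr N) n u" using coset x by simp
      then show "z \<in> gr (gquot N N') n" using u(2) by (simp add: G)
    qed
    then show "t \<in> qreps A M N"
      unfolding qreps_def t qrep_of_def using tM tN cotorsion_sub_iff[OF M] torsion_sub_iff[OF N]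
      by (simp add: M'_def N'_def)
  }
qed

end

section \<open>Equality of morphisms in the quotient category\<close>

text \<open>Agreement after restriction to a cotorsion \<open>U\<close> and enlargement by a torsion
  \<open>V\<close>. In contrast to \<open>qrel\<close>, no inclusion ties \<open>U\<close> to the
  domains or \<open>V\<close> to the indeterminacies, which simplifies transitivity and transport
  along functors.\<close>

definition corr_equiv :: "('k, 'u) galgebra \<Rightarrow> ('u, 'u) gmod \<Rightarrow> ('u, 'u) gmod \<Rightarrow>
    ('u \<times> 'u) set \<Rightarrow> ('u \<times> 'u) set \<Rightarrow> bool" where
  "corr_equiv A M N R S \<longleftrightarrow> correspondence A M N R \<and> correspondence A M N S \<and>
    (\<exists>U V. torsion_subquotient A M (carrier M) U \<and> torsion_subquotient A N V {\<zero>\<^bsub>N\<^esub>} \<and>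
       Id_on U O R O coset_rel N V = Id_on U O S O coset_rel N V)"

definition corr_class :: "('k, 'u) galgebra \<Rightarrow> ('u, 'u) gmod \<Rightarrow> ('u, 'u) gmod \<Rightarrow>
    ('u \<times> 'u) set \<Rightarrow> 'u qrep set" where
  "corr_class A M N R = qrel A M N `` {qrep_of M R}"

lemma QGr_simps [simp]:
  "Ob (QGr A) = Ob (Gr A)" "Hom (QGr A) M N = qreps A M N // qrel A M N"
  "Idt (QGr A) M = qrel A M M `` {rep_of M M (\<lambda>x\<in>carrier M. x)}"
  "Cmp (QGr A) M N P d c = qrel A M P `` {qrep_comp u t | u t. u \<in> d \<and> t \<in> c}"
  by (simp_all add: QGr_def)

lemma corr_equivD: "corr_equiv A M N R S \<Longrightarrow> correspondence A M N R" "corr_equiv A M N R S \<Longrightarrow> correspondence A M N S"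
  by (auto simp: corr_equiv_def)

lemma corr_equiv_sym: "corr_equiv A M N R S \<Longrightarrow> corr_equiv A M N S R"
  unfolding corr_equiv_def by metis

text \<open>The three entries of \<open>qrep_comp\<close> are precisely domain, values over zero and
  fibres of the composite relation.\<close>

lemma qrep_comp_qrep_of:
  "qrep_comp (qrep_of N S) (qrep_of M R) = qrep_of M (R O S)"
proof -
  have D: "{m \<in> Domain R. R `` {m} \<inter> Domain S \<noteq> {}} = Domain (R O S)" by blast
  have "{m \<in> Domain R. (\<lambda>m\<in>Domain R. R `` {m}) m \<inter> Domain S \<noteq> {}} = {m \<in> Domain R. R `` {m} \<inter> Domain S \<noteq> {}}"
    by auto
  moreover have "(\<Union>n\<in>Domain S \<inter> R `` {\<zero>\<^bsub>M\<^esub>}. (\<lambda>n\<in>Domain S. S `` {n}) n) = (R O S) `` {\<zero>\<^bsub>M\<^esub>}"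
    by auto
  moreover have "(\<lambda>m\<in>Domain (R O S). \<Union>n\<in>(\<lambda>m\<in>Domain R. R `` {m}) m \<inter> Domain S. (\<lambda>n\<in>Domain S. S `` {n}) n)
     = (\<lambda>m\<in>Domain (R O S). (R O S) `` {m})"
    by (rule restrict_ext) auto
  ultimately show ?thesis
    unfolding qrep_comp_def qrep_of_def by (simp add: D)
qed

context graded_ring
begin

lemma mem_saturation:
  assumes N: "N \<in> Ob (Gr A)" and R: "grel A M N R" and V: "gsubmodule A N V"
  shows "(m, n) \<in> Id_on U O R O coset_rel N V \<longleftrightarrow> m \<in> U \<and> n \<in> R `` {m} <+>\<^bsub>N\<^esub> V"
proof -
  have mN: "graded_module A N" using Gr_module[OF N] .
  interpret N: graded_module A N by fact
  have c: "V \<subseteq> carrier N" using V[unfolded gsubmodule_iff[OF mN]] by blast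
  have "(\<exists>r. (m, r) \<in> R \<and> (r, n) \<in> coset_rel N V) \<longleftrightarrow> n \<in> R `` {m} <+>\<^bsub>N\<^esub> V"
  proof
    assume "\<exists>r. (m, r) \<in> R \<and> (r, n) \<in> coset_rel N V"
    then obtain r v where r: "(m, r) \<in> R" "v \<in> V" "n = v \<oplus>\<^bsub>N\<^esub> r" by (auto simp: coset_rel_def)
    then have "n = r \<oplus>\<^bsub>N\<^esub> v" using grelD(7)[OF R] c by (simp add: N.a_comm subset_iff)
    then show "n \<in> R `` {m} <+>\<^bsub>N\<^esub> V" using r unfolding set_add_def' by blast
  next
    assume "n \<in> R `` {m} <+>\<^bsub>N\<^esub> V"
    then obtain r v where r: "(m, r) \<in> R" "v \<in> V" "n = r \<oplus>\<^bsub>N\<^esub> v" unfolding set_add_def' by blast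
    then have "n = v \<oplus>\<^bsub>N\<^esub> r" "r \<in> carrier N" using grelD(7)[OF R] c by (auto simp: N.a_comm subset_iff)
    then have "(r, n) \<in> coset_rel N V" using r(2) unfolding coset_rel_def by blast
    then show "\<exists>r. (m, r) \<in> R \<and> (r, n) \<in> coset_rel N V" using r(1) by blast
  qed
  then show ?thesis by blast
qed

text \<open>A smaller restriction absorbs a larger one, and a larger congruence absorbs a smaller
  one.\<close>

lemma saturation_shrink:
  assumes N: "N \<in> Ob (Gr A)" and V: "gsubmodule A N V" "gsubmodule A N V'" "V \<subseteq> V'" and U: "U' \<subseteq> U"
    and e: "Id_on U O R O coset_rel N V = Id_on U O S O coset_rel N V"
  shows "Id_on U' O R O coset_rel N V' = Id_on U' O S O coset_rel N V'"
proof -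
  have "Id_on U' O Id_on U = Id_on U'" using U by auto
  then have *: "Id_on U' O (Id_on U O X O coset_rel N V) O coset_rel N V' = Id_on U' O X O coset_rel N V'" for X
    using coset_rel_comp[OF N V] by (metis O_assoc)
  show ?thesis using *[of R] *[of S] e by metis
qed

text \<open>\<open>mem_saturation\<close> turns equality of the enlarged cosets over each point into
  equality of the restricted and enlarged relations.\<close>

lemma qrel_iff:
  assumes M: "M \<in> Ob (Gr A)" and N: "N \<in> Ob (Gr A)"
  shows "(qrep_of M R, qrep_of M S) \<in> qrel A M N \<longleftrightarrow> corr_equiv A M N R S"
proof
  have mN: "graded_module A N" using Gr_module[OF N] .
  interpret N: graded_module A N by fact
  {
    assume "(qrep_of M R, qrep_of M S) \<in> qrel A M N"
    then obtain U V where h: "qrep_of M R \<in> qreps A M N" "qrep_of M S \<in> qreps A M N"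
      "cotorsion_sub A M U" "torsion_sub A N V" "U \<subseteq> Domain R \<inter> Domain S"
      "\<forall>m\<in>U. (\<lambda>m\<in>Domain R. R `` {m}) m <+>\<^bsub>N\<^esub> V = (\<lambda>m\<in>Domain S. S `` {m}) m <+>\<^bsub>N\<^esub> V"
      unfolding qrel_def qrep_of_def by auto
    have RS: "correspondence A M N R" "correspondence A M N S"
      using h(1,2) qreps_iff[OF M N] qrep_of_inject by metis+
    then have g: "grel A M N R" "grel A M N S" by (auto simp: correspondence_def)
    have U: "torsion_subquotient A M (carrier M) U" and V: "torsion_subquotient A N V {\<zero>\<^bsub>N\<^esub>}"
      using h cotorsion_sub_iff[OF M] torsion_sub_iff[OF N] by auto
    note sV = torsion_subquotient_submodules(1)[OF N V]
    have "R `` {m} <+>\<^bsub>N\<^esub> V = S `` {m} <+>\<^bsub>N\<^esub> V" if "m \<in> U" for m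
    proof -
      have "m \<in> Domain R" "m \<in> Domain S" using that h(5) by auto
      then show ?thesis using h(6)[rule_format, OF that] by simp
    qed
    then have h': "(m, n) \<in> Id_on U O R O coset_rel N V \<longleftrightarrow> (m, n) \<in> Id_on U O S O coset_rel N V" for m n
      unfolding mem_saturation[OF N g(1) sV] mem_saturation[OF N g(2) sV] by auto
    have "Id_on U O R O coset_rel N V = Id_on U O S O coset_rel N V"
      by (intro subset_antisym subrelI) (simp_all only: h')
    then show "corr_equiv A M N R S" unfolding corr_equiv_def using RS U V by blast
  next
    assume "corr_equiv A M N R S"
    then obtain U V where RS: "correspondence A M N R" "correspondence A M N S"
      and U: "torsion_subquotient A M (carrier M) U" and V: "torsion_subquotient A N V {\<zero>\<^bsub>N\<^esub>}"
      and e: "Id_on U O R O coset_rel N V = Id_on U O S O coset_rel N V"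
      unfolding corr_equiv_def by blast
    have g: "grel A M N R" "grel A M N S" and d: "torsion_subquotient A M (carrier M) (Domain R)"
      "torsion_subquotient A M (carrier M) (Domain S)" and z: "torsion_subquotient A N (R `` {\<zero>\<^bsub>M\<^esub>}) {\<zero>\<^bsub>N\<^esub>}"
      "torsion_subquotient A N (S `` {\<zero>\<^bsub>M\<^esub>}) {\<zero>\<^bsub>N\<^esub>}"
      using RS by (auto simp: correspondence_def)
    \<comment> \<open>\<open>qrel\<close> wants its submodule inside both domains and its torsion
      submodule above both indeterminacies, so \<open>U\<close> is cut down and \<open>V\<close>
      enlarged.\<close>
    let ?U = "U \<inter> (Domain R \<inter> Domain S)"
    have U': "torsion_subquotient A M (carrier M) ?U" by (intro cotorsion_Int[OF M] U d)
    obtain W where W: "torsion_subquotient A N W {\<zero>\<^bsub>N\<^esub>}" "R `` {\<zero>\<^bsub>M\<^esub>} \<subseteq> W" "S `` {\<zero>\<^bsub>M\<^esub>} \<subseteq> W"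
      using torsion_sum[OF N z] by blast
    obtain V' where V': "torsion_subquotient A N V' {\<zero>\<^bsub>N\<^esub>}" "V \<subseteq> V'" "W \<subseteq> V'"
      using torsion_sum[OF N V W(1)] by blast
    note sV = torsion_subquotient_submodules(1)[OF N V] and sV' = torsion_subquotient_submodules(1)[OF N V'(1)]
    have e': "Id_on ?U O R O coset_rel N V' = Id_on ?U O S O coset_rel N V'"
      by (rule saturation_shrink[OF N sV sV' V'(2) _ e]) blast
    have "R `` {m} <+>\<^bsub>N\<^esub> V' = S `` {m} <+>\<^bsub>N\<^esub> V'" if "m \<in> ?U" for m
    by (metis Set.set_eqI mem_saturation N g sV' that e')
    then have "\<forall>m\<in>?U. (\<lambda>m\<in>Domain R. R `` {m}) m <+>\<^bsub>N\<^esub> V' = (\<lambda>m\<in>Domain S. S `` {m}) m <+>\<^bsub>N\<^esub> V'"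
      by simp
    moreover have "qrep_of M R \<in> qreps A M N" "qrep_of M S \<in> qreps A M N"
      using qreps_iff[OF M N] RS by blast+
    moreover have "cotorsion_sub A M ?U" "torsion_sub A N V'"
      using U' V' cotorsion_sub_iff[OF M] torsion_sub_iff[OF N] by auto
    moreover have "?U \<subseteq> Domain R \<inter> Domain S" "R `` {\<zero>\<^bsub>M\<^esub>} \<union> S `` {\<zero>\<^bsub>M\<^esub>} \<subseteq> V'"
      using W V' by auto
    ultimately show "(qrep_of M R, qrep_of M S) \<in> qrel A M N"
      unfolding qrel_def qrep_of_def by blast
  }
qed

text \<open>On the domain of \<open>R\<close>, a value of \<open>S\<close> differs from a value of
  \<open>R\<close> over the same point by a value of \<open>S\<close> over zero; enlarging by these
  makes the two agree.\<close>

lemma corr_equiv_subset: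
  assumes M: "M \<in> Ob (Gr A)" and N: "N \<in> Ob (Gr A)"
    and R: "correspondence A M N R" and S: "correspondence A M N S" and RS: "R \<subseteq> S"
  shows "corr_equiv A M N R S"
proof -
  note mM = Gr_module[OF M] and mN = Gr_module[OF N]
  interpret M: graded_module A M by fact
  interpret N: graded_module A N by fact
  have g: "grel A M N R" "grel A M N S" and d: "torsion_subquotient A M (carrier M) (Domain R)"
    and z: "torsion_subquotient A N (S `` {\<zero>\<^bsub>M\<^esub>}) {\<zero>\<^bsub>N\<^esub>}"
    using R S by (auto simp: correspondence_def)
  let ?V = "S `` {\<zero>\<^bsub>M\<^esub>}"
  note sV = torsion_subquotient_submodules(1)[OF N z]
  have "Id_on (Domain R) O S O coset_rel N ?V \<subseteq> Id_on (Domain R) O R O coset_rel N ?V"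
  proof (rule subrelI)
    fix m n assume "(m, n) \<in> Id_on (Domain R) O S O coset_rel N ?V"
    then obtain s r where s: "(m, s) \<in> S" "(s, n) \<in> coset_rel N ?V" "(m, r) \<in> R" by blast
    have c: "m \<in> carrier M" "r \<in> carrier N" "s \<in> carrier N" using s grelD(6,7)[OF g(2)] grelD(7)[OF g(1)] by auto
    have "(m \<ominus>\<^bsub>M\<^esub> m, s \<ominus>\<^bsub>N\<^esub> r) \<in> S" using grel_minus[OF mM mN g(2) s(1)] s(3) RS by blast
    then have "s \<ominus>\<^bsub>N\<^esub> r \<in> ?V" using c by (simp add: M.minus_eq M.r_neg)
    then have "(r, s) \<in> coset_rel N ?V" by (rule coset_relI[OF N c(2,3)])
    then have "(r, n) \<in> coset_rel N ?V O coset_rel N ?V" using s(2) by blast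
    then have "(r, n) \<in> coset_rel N ?V" using coset_rel_comp[OF N sV sV] by blast
    then show "(m, n) \<in> Id_on (Domain R) O R O coset_rel N ?V" using s(3) by blast
  qed
  then have "Id_on (Domain R) O R O coset_rel N ?V = Id_on (Domain R) O S O coset_rel N ?V"
    using RS by blast
  then show ?thesis unfolding corr_equiv_def using R S d z by blast
qed

lemma corr_equiv_trans:
  assumes M: "M \<in> Ob (Gr A)" and N: "N \<in> Ob (Gr A)"
    and RS: "corr_equiv A M N R S" and ST: "corr_equiv A M N S T"
  shows "corr_equiv A M N R T"
proof -
  obtain U V where U: "torsion_subquotient A M (carrier M) U" and V: "torsion_subquotient A N V {\<zero>\<^bsub>N\<^esub>}"
      and e: "Id_on U O R O coset_rel N V = Id_on U O S O coset_rel N V"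
    using RS unfolding corr_equiv_def by blast
  obtain U' V' where U': "torsion_subquotient A M (carrier M) U'" and V': "torsion_subquotient A N V' {\<zero>\<^bsub>N\<^esub>}"
      and e': "Id_on U' O S O coset_rel N V' = Id_on U' O T O coset_rel N V'"
    using ST unfolding corr_equiv_def by blast
  obtain W where W: "torsion_subquotient A N W {\<zero>\<^bsub>N\<^esub>}" "V \<subseteq> W" "V' \<subseteq> W"
    using torsion_sum[OF N V V'] by blast
  note s = torsion_subquotient_submodules(1)[OF N]
  have "Id_on (U \<inter> U') O R O coset_rel N W = Id_on (U \<inter> U') O S O coset_rel N W"
    by (rule saturation_shrink[OF N s[OF V] s[OF W(1)] W(2) _ e]) blast
  moreover have "Id_on (U \<inter> U') O S O coset_rel N W = Id_on (U \<inter> U') O T O coset_rel N W"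
    by (rule saturation_shrink[OF N s[OF V'] s[OF W(1)] W(3) _ e']) blast
  ultimately show ?thesis
    unfolding corr_equiv_def
    using cotorsion_Int[OF M U U'] W(1) corr_equivD(1)[OF RS] corr_equivD(2)[OF ST] by metis
qed

lemma corr_equiv_refl:
  "M \<in> Ob (Gr A) \<Longrightarrow> N \<in> Ob (Gr A) \<Longrightarrow> correspondence A M N R \<Longrightarrow> corr_equiv A M N R R"
  using corr_equiv_subset by blast

text \<open>Two equivalent correspondences \<open>R\<close> and \<open>S\<close> have a common lower bound up to enlarging once:
  \<open>R \<supseteq> R|U \<subseteq> W \<supseteq> S|U \<subseteq> S\<close>. As inclusions are preserved by composition, so is the equivalence.\<close>

lemma corr_equiv_zigzag:
  assumes M: "M \<in> Ob (Gr A)" and N: "N \<in> Ob (Gr A)" and RS: "corr_equiv A M N R S"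
  obtains P W P' where "correspondence A M N P" "correspondence A M N W" "correspondence A M N P'"
    "P \<subseteq> R" "P \<subseteq> W" "P' \<subseteq> W" "P' \<subseteq> S"
proof -
  obtain U V where U: "torsion_subquotient A M (carrier M) U" and V: "torsion_subquotient A N V {\<zero>\<^bsub>N\<^esub>}"
      and e: "Id_on U O R O coset_rel N V = Id_on U O S O coset_rel N V"
    using RS unfolding corr_equiv_def by blast
  note R = corr_equivD(1)[OF RS] and S = corr_equivD(2)[OF RS]
  have mN: "graded_module A N" using Gr_module[OF N] .
  interpret N: graded_module A N by fact
  note sV = torsion_subquotient_submodules(1)[OF N V]
  have z: "\<zero>\<^bsub>N\<^esub> \<in> V" using sV[unfolded gsubmodule_iff[OF mN]] by blast
  have sat: "X \<subseteq> X O coset_rel N V" if "correspondence A M N X" for X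
  proof (rule subrelI)
    fix m n assume mn: "(m, n) \<in> X"
    have "grel A M N X" using that by (simp add: correspondence_def)
    from grelD(7)[OF this mn] have n: "n \<in> carrier N" .
    have "(n, \<zero>\<^bsub>N\<^esub> \<oplus>\<^bsub>N\<^esub> n) \<in> coset_rel N V" using z n unfolding coset_rel_def by blast
    then show "(m, n) \<in> X O coset_rel N V" using mn n by auto
  qed
  note rU = correspondence_restriction[OF M U] and cV = correspondence_coset_rel[OF N V]
  have c: "correspondence A M N (Id_on U O X)" if "correspondence A M N X" for X
    by (rule correspondence_comp[OF M M N rU that])
  show ?thesis
  proof (rule that[of "Id_on U O R" "Id_on U O R O coset_rel N V" "Id_on U O S"])
    show "correspondence A M N (Id_on U O R)" "correspondence A M N (Id_on U O S)" using c R S by auto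
    show "correspondence A M N (Id_on U O R O coset_rel N V)"
      using correspondence_comp[OF M N N c[OF R] cV] by (simp add: O_assoc)
    show "Id_on U O R \<subseteq> R" "Id_on U O S \<subseteq> S" by auto
    show "Id_on U O R \<subseteq> Id_on U O R O coset_rel N V" using sat[OF c[OF R]] by (simp add: O_assoc)
    show "Id_on U O S \<subseteq> Id_on U O R O coset_rel N V" unfolding e using sat[OF c[OF S]] by (simp add: O_assoc)
  qed
qed

lemma corr_equiv_comp:
  assumes M: "M \<in> Ob (Gr A)" and N: "N \<in> Ob (Gr A)" and P: "P \<in> Ob (Gr A)"
    and R: "corr_equiv A M N R R'" and S: "corr_equiv A N P S S'"
  shows "corr_equiv A M P (R O S) (R' O S')"
proof -
  obtain X1 X2 X3 where X: "correspondence A M N X1" "correspondence A M N X2" "correspondence A M N X3"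
    "X1 \<subseteq> R" "X1 \<subseteq> X2" "X3 \<subseteq> X2" "X3 \<subseteq> R'"
    using corr_equiv_zigzag[OF M N R] .
  obtain Y1 Y2 Y3 where Y: "correspondence A N P Y1" "correspondence A N P Y2" "correspondence A N P Y3"
    "Y1 \<subseteq> S" "Y1 \<subseteq> Y2" "Y3 \<subseteq> Y2" "Y3 \<subseteq> S'"
    using corr_equiv_zigzag[OF N P S] .
  note c = correspondence_comp[OF M N P]
  have 1: "corr_equiv A M P (X1 O Y1) (R O S)"
    by (rule corr_equiv_subset[OF M P c[OF X(1) Y(1)] c[OF corr_equivD(1)[OF R] corr_equivD(1)[OF S]]])
      (use X Y in blast)
  have 2: "corr_equiv A M P (X1 O Y1) (X2 O Y2)"
    by (rule corr_equiv_subset[OF M P c[OF X(1) Y(1)] c[OF X(2) Y(2)]]) (use X Y in blast)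
  have 3: "corr_equiv A M P (X3 O Y3) (X2 O Y2)"
    by (rule corr_equiv_subset[OF M P c[OF X(3) Y(3)] c[OF X(2) Y(2)]]) (use X Y in blast)
  have 4: "corr_equiv A M P (X3 O Y3) (R' O S')"
    by (rule corr_equiv_subset[OF M P c[OF X(3) Y(3)] c[OF corr_equivD(2)[OF R] corr_equivD(2)[OF S]]])
      (use X Y in blast)
  note t = corr_equiv_trans[OF M P]
  show ?thesis
    by (rule t[OF t[OF corr_equiv_sym[OF 1] 2] t[OF corr_equiv_sym[OF 3] 4]])
qed

section \<open>Morphisms and composition in the quotient category\<close>

lemma mem_corr_class:
  assumes M: "M \<in> Ob (Gr A)" and N: "N \<in> Ob (Gr A)"
  shows "t \<in> corr_class A M N R \<longleftrightarrow> (\<exists>S. t = qrep_of M S \<and> corr_equiv A M N R S)"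
proof
  assume t: "t \<in> corr_class A M N R"
  then have "(qrep_of M R, t) \<in> qrel A M N" by (simp add: corr_class_def)
  moreover then have "t \<in> qreps A M N" by (auto simp: qrel_def)
  then obtain S where "t = qrep_of M S" using qreps_iff[OF M N] by blast
  ultimately show "\<exists>S. t = qrep_of M S \<and> corr_equiv A M N R S" using qrel_iff[OF M N] by blast
next
  assume "\<exists>S. t = qrep_of M S \<and> corr_equiv A M N R S"
  then show "t \<in> corr_class A M N R" using qrel_iff[OF M N] by (auto simp: corr_class_def)
qed

lemma corr_class_eq_iff:
  assumes M: "M \<in> Ob (Gr A)" and N: "N \<in> Ob (Gr A)" and S: "correspondence A M N S"
  shows "corr_class A M N R = corr_class A M N S \<longleftrightarrow> corr_equiv A M N R S"
proof
  assume "corr_class A M N R = corr_class A M N S"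
  moreover have "qrep_of M S \<in> corr_class A M N S"
    using mem_corr_class[OF M N] corr_equiv_refl[OF M N S] by blast
  ultimately have "qrep_of M S \<in> corr_class A M N R" by simp
  then show "corr_equiv A M N R S"
    unfolding mem_corr_class[OF M N] qrep_of_inject by blast
next
  assume e: "corr_equiv A M N R S"
  show "corr_class A M N R = corr_class A M N S"
    unfolding set_eq_iff mem_corr_class[OF M N]
    using corr_equiv_trans[OF M N e] corr_equiv_trans[OF M N corr_equiv_sym[OF e]] by blast
qed

lemma QGr_Hom:
  assumes M: "M \<in> Ob (Gr A)" and N: "N \<in> Ob (Gr A)"
  shows "c \<in> qreps A M N // qrel A M N \<longleftrightarrow> (\<exists>R. correspondence A M N R \<and> c = corr_class A M N R)"
proof -
  have "qreps A M N = qrep_of M ` {R. correspondence A M N R}"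
    by (intro Set.set_eqI) (simp add: qreps_iff[OF M N] image_iff)
  then show ?thesis
    unfolding quotient_def corr_class_def by auto
qed

text \<open>\<open>Cmp\<close> forms all composites of representatives and saturates. By invariance
  under equivalence they lie in a single class, that of the composite of any two
  representatives.\<close>

lemma QGr_Cmp:
  assumes M: "M \<in> Ob (Gr A)" and N: "N \<in> Ob (Gr A)" and P: "P \<in> Ob (Gr A)"
    and R: "correspondence A M N R" and S: "correspondence A N P S"
  shows "qrel A M P `` {qrep_comp u t | u t. u \<in> corr_class A N P S \<and> t \<in> corr_class A M N R}
    = corr_class A M P (R O S)"
proof -
  have "{qrep_comp u t | u t. u \<in> corr_class A N P S \<and> t \<in> corr_class A M N R}
    = {qrep_of M (R' O S') | R' S'. corr_equiv A M N R R' \<and> corr_equiv A N P S S'}" (is "_ = ?X")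
  proof (intro subset_antisym subsetI)
    fix v assume "v \<in> {qrep_comp u t | u t. u \<in> corr_class A N P S \<and> t \<in> corr_class A M N R}"
    then obtain R' S' where "corr_equiv A M N R R'" "corr_equiv A N P S S'" "v = qrep_comp (qrep_of N S') (qrep_of M R')"
      unfolding mem_corr_class[OF M N] mem_corr_class[OF N P] by blast
    then show "v \<in> ?X" unfolding qrep_comp_qrep_of by blast
  next
    fix v assume "v \<in> ?X"
    then obtain R' S' where e: "corr_equiv A M N R R'" "corr_equiv A N P S S'" and v: "v = qrep_of M (R' O S')"
      by blast
    have "v = qrep_comp (qrep_of N S') (qrep_of M R')" unfolding v qrep_comp_qrep_of ..
    moreover have "qrep_of N S' \<in> corr_class A N P S" "qrep_of M R' \<in> corr_class A M N R"
      unfolding mem_corr_class[OF M N] mem_corr_class[OF N P] using e by blast+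
    ultimately show "v \<in> {qrep_comp u t | u t. u \<in> corr_class A N P S \<and> t \<in> corr_class A M N R}" by blast
  qed
  moreover have "qrel A M P `` ?X = corr_class A M P (R O S)"
  proof
    show "qrel A M P `` ?X \<subseteq> corr_class A M P (R O S)"
    proof
      fix t assume "t \<in> qrel A M P `` ?X"
      then obtain R' S' where e: "corr_equiv A M N R R'" "corr_equiv A N P S S'"
        and t: "t \<in> corr_class A M P (R' O S')"
        unfolding corr_class_def by blast
      have "corr_equiv A M P (R O S) (R' O S')" by (rule corr_equiv_comp[OF M N P e])
      then show "t \<in> corr_class A M P (R O S)"
        using t corr_class_eq_iff[OF M P corr_equivD(2)] by blast
    qed
    have "qrep_of M (R O S) \<in> ?X"
      using corr_equiv_refl[OF M N R] corr_equiv_refl[OF N P S] by blast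
    then show "corr_class A M P (R O S) \<subseteq> qrel A M P `` ?X"
      unfolding corr_class_def by blast
  qed
  ultimately show ?thesis by simp
qed

lemma rep_of_eq:
  assumes M: "M \<in> Ob (Gr A)" and N: "N \<in> Ob (Gr A)" and f: "f \<in> ghom A M N"
  shows "rep_of M N f = qrep_of M (fgraph M f)"
proof -
  have mM: "graded_module A M" and mN: "graded_module A N" using Gr_module M N by blast+
  interpret M: graded_module A M by fact
  interpret N: graded_module A N by fact
  have g: "grel A M N (fgraph M f)" using f ghom_iff_grel[OF mM mN] by blast
  have z: "f \<zero>\<^bsub>M\<^esub> = \<zero>\<^bsub>N\<^esub>" using grelD(2)[OF g] by (simp add: mem_fgraph)
  have D: "Domain (fgraph M f) = carrier M" by (auto simp: mem_fgraph)
  have I: "fgraph M f `` {m} = {f m}" if "m \<in> carrier M" for m using that by (auto simp: mem_fgraph)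
  have "{\<zero>\<^bsub>N\<^esub>} +>\<^bsub>N\<^esub> f m = {f m}" if "m \<in> carrier M" for m
    using ghom_closed[OF f] that by (auto simp: a_r_coset_def' image_subset_iff)
  then show ?thesis
    unfolding rep_of_def qrep_of_def D using I z by (auto intro!: restrict_ext)
qed

lemma correspondence_fgraph:
  assumes M: "M \<in> Ob (Gr A)" and N: "N \<in> Ob (Gr A)" and f: "f \<in> ghom A M N"
  shows "correspondence A M N (fgraph M f)"
proof -
  have mM: "graded_module A M" and mN: "graded_module A N" using Gr_module M N by blast+
  interpret M: graded_module A M by fact
  have g: "grel A M N (fgraph M f)" using f ghom_iff_grel[OF mM mN] by blast
  have "fgraph M f `` {\<zero>\<^bsub>M\<^esub>} = {\<zero>\<^bsub>N\<^esub>}" "Domain (fgraph M f) = carrier M"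
    using grelD(2)[OF g] by (auto simp: mem_fgraph)
  then show ?thesis
    unfolding correspondence_def
    using g torsion_subquotient_refl[OF M gsubmodule_carrier[OF mM]] torsion_subquotient_refl[OF N gsubmodule_zero[OF mN]]
    by simp
qed

lemma ghom_id: "M \<in> Ob (Gr A) \<Longrightarrow> (\<lambda>x\<in>carrier M. x) \<in> ghom A M M"
  using category_idt[OF category_Gr[OF graded_ring_axioms], of M] by simp

lemma QGr_Idt: "M \<in> Ob (Gr A) \<Longrightarrow> qrel A M M `` {rep_of M M (\<lambda>x\<in>carrier M. x)} = corr_class A M M (Id_on (carrier M))"
  using rep_of_eq[OF _ _ ghom_id] by (simp add: corr_class_def fgraph_id)

lemma correspondence_Id: "M \<in> Ob (Gr A) \<Longrightarrow> correspondence A M M (Id_on (carrier M))"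
  using correspondence_fgraph[OF _ _ ghom_id] by (simp add: fgraph_id)

text \<open>On correspondences the laws are strict: composition of relations is associative, and the
  identity relation on the carrier is a unit. Passing to classes keeps them.\<close>

lemma category_QGr: "category (QGr A)"
proof -
  have unit: "Id_on (carrier M) O R = R" "R O Id_on (carrier N) = R" if "correspondence A M N R" for M N R
    using grelD(1) that unfolding correspondence_def by blast+
  show ?thesis
    unfolding category_def QGr_simps(1-2)
  proof (intro conjI ballI)
    fix M assume M: "M \<in> Ob (Gr A)"
    then show "Idt (QGr A) M \<in> qreps A M M // qrel A M M"
      unfolding QGr_simps QGr_Idt[OF M] QGr_Hom[OF M M] using correspondence_Id by blast
  next
    fix M N P f g assume M: "M \<in> Ob (Gr A)" and N: "N \<in> Ob (Gr A)" and P: "P \<in> Ob (Gr A)"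
      and "f \<in> qreps A M N // qrel A M N" "g \<in> qreps A N P // qrel A N P"
    then obtain R S where "correspondence A M N R" "f = corr_class A M N R"
      "correspondence A N P S" "g = corr_class A N P S" using QGr_Hom by metis
    then show "Cmp (QGr A) M N P g f \<in> qreps A M P // qrel A M P"
      unfolding QGr_simps QGr_Hom[OF M P] using QGr_Cmp[OF M N P] correspondence_comp[OF M N P] by blast
  next
    fix M N f assume M: "M \<in> Ob (Gr A)" and N: "N \<in> Ob (Gr A)" and "f \<in> qreps A M N // qrel A M N"
    then obtain R where R: "correspondence A M N R" "f = corr_class A M N R" using QGr_Hom by metis
    show "Cmp (QGr A) M M N f (Idt (QGr A) M) = f" "Cmp (QGr A) M N N (Idt (QGr A) N) f = f"
      unfolding QGr_simps QGr_Idt[OF M] QGr_Idt[OF N] R(2)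
      using QGr_Cmp[OF M M N correspondence_Id[OF M] R(1)] QGr_Cmp[OF M N N R(1) correspondence_Id[OF N]]
      by (simp_all add: unit[OF R(1)])
  next
    fix L M N P f g h assume L: "L \<in> Ob (Gr A)" and M: "M \<in> Ob (Gr A)" and N: "N \<in> Ob (Gr A)" and P: "P \<in> Ob (Gr A)"
      and "f \<in> qreps A L M // qrel A L M" "g \<in> qreps A M N // qrel A M N" "h \<in> qreps A N P // qrel A N P"
    then obtain R S T where R: "correspondence A L M R" "f = corr_class A L M R"
      and S: "correspondence A M N S" "g = corr_class A M N S"
      and T: "correspondence A N P T" "h = corr_class A N P T" using QGr_Hom by metis
    show "Cmp (QGr A) L M P (Cmp (QGr A) M N P h g) f = Cmp (QGr A) L N P h (Cmp (QGr A) L M N g f)"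
      unfolding QGr_simps(4) R(2) S(2) T(2) QGr_Cmp[OF M N P S(1) T(1)] QGr_Cmp[OF L M N R(1) S(1)]
        QGr_Cmp[OF L M P R(1) correspondence_comp[OF M N P S(1) T(1)]]
        QGr_Cmp[OF L N P correspondence_comp[OF L M N R(1) S(1)] T(1)]
      by (simp add: O_assoc)
  qed
qed

section \<open>The quotient functor\<close>

lemma quot_functor_fm:
  assumes M: "M \<in> Ob (Gr A)" and N: "N \<in> Ob (Gr A)" and f: "f \<in> ghom A M N"
  shows "fm (quot_functor A) M N f = corr_class A M N (fgraph M f)"
  unfolding quot_functor_def corr_class_def by (simp add: rep_of_eq[OF M N f])

lemma quot_functor_fo [simp]: "fo (quot_functor A) M = M"
  by (simp add: quot_functor_def)

lemma is_functor_quot_functor: "is_functor (Gr A) (QGr A) (quot_functor A)"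
proof (rule is_functorI[OF category_Gr[OF graded_ring_axioms] category_QGr])
  fix M assume "M \<in> Ob (Gr A)"
  then show "fo (quot_functor A) M \<in> Ob (QGr A)" by simp
  show "fm (quot_functor A) M M (Idt (Gr A) M) = Idt (QGr A) (fo (quot_functor A) M)"
    by (simp add: quot_functor_def)
next
  fix M N f assume M: "M \<in> Ob (Gr A)" and N: "N \<in> Ob (Gr A)" and f: "f \<in> Hom (Gr A) M N"
  then have f: "f \<in> ghom A M N" by simp
  show "fm (quot_functor A) M N f \<in> Hom (QGr A) (fo (quot_functor A) M) (fo (quot_functor A) N)"
    unfolding quot_functor_fm[OF M N f] QGr_simps quot_functor_fo QGr_Hom[OF M N]
    using correspondence_fgraph[OF M N f] by blast
next
  fix M N P f g assume M: "M \<in> Ob (Gr A)" and N: "N \<in> Ob (Gr A)" and P: "P \<in> Ob (Gr A)"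
    and "f \<in> Hom (Gr A) M N" "g \<in> Hom (Gr A) N P"
  then have f: "f \<in> ghom A M N" and g: "g \<in> ghom A N P" by simp_all
  have gf: "compose (carrier M) g f \<in> ghom A M P"
    using category_cmp[OF category_Gr[OF graded_ring_axioms] M N P, of f g] f g by simp
  show "fm (quot_functor A) M P (Cmp (Gr A) M N P g f) =
         Cmp (QGr A) (fo (quot_functor A) M) (fo (quot_functor A) N) (fo (quot_functor A) P)
          (fm (quot_functor A) N P g) (fm (quot_functor A) M N f)"
    unfolding QGr_simps quot_functor_fo Gr_simps quot_functor_fm[OF M N f] quot_functor_fm[OF N P g]
      quot_functor_fm[OF M P gf] QGr_Cmp[OF M N P correspondence_fgraph[OF M N f] correspondence_fgraph[OF N P g]]
    by (simp add: fgraph_compose[OF ghom_closed[OF f]])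
qed

text \<open>The converse of the graph is again a graded relation, so the inverse map is
  automatically a graded homomorphism.\<close>

lemma ghom_bij_inverse:
  assumes M: "M \<in> Ob (Gr A)" and N: "N \<in> Ob (Gr A)" and f: "f \<in> ghom A M N" and b: "bij_betw f (carrier M) (carrier N)"
  shows "inverse_arrows (Gr A) M N f (restrict (inv_into (carrier M) f) (carrier N))" (is "inverse_arrows _ _ _ _ ?g")
proof -
  note mM = Gr_module[OF M] and mN = Gr_module[OF N]
  have "fgraph N ?g = (fgraph M f)\<inverse>"
    using b by (auto simp: mem_fgraph bij_betw_def inv_into_into inv_into_f_f f_inv_into_f)
  moreover have "grel A M N (fgraph M f)" using f ghom_iff_grel[OF mM mN] by blast
  ultimately have g: "?g \<in> ghom A N M"
    using ghom_iff_grel[OF mN mM, of ?g] grel_converse[of A M N "fgraph M f"] by simp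
  show ?thesis
    using f g b ghom_closed[OF f]
    by (auto simp: inverse_arrows_def compose_def fun_eq_iff restrict_def bij_betw_inv_into_left bij_betw_inv_into_right image_subset_iff)
qed

end

section \<open>Functors that change neither sets nor maps\<close>

text \<open>Common ground for the shift and the twists. The substance lies in \<open>F_grel\<close>
  and \<open>F_annihilated\<close>: graded relations determine Hom-sets, submodules and
  subquotients, and annihilated modules determine torsion, so whatever is built from these is
  carried over.\<close>

locale relabelling = A: graded_ring A + B: graded_ring B
  for A :: "('k, 'u) galgebra" and B :: "('k, 'u) galgebra" +
  fixes F :: "(('u, 'u) gmod, 'u \<Rightarrow> 'u, ('u, 'u) gmod, 'u \<Rightarrow> 'u) fnc"
  assumes fm_F [simp]: "fm F M N f = f"
    and F_Ob: "M \<in> Ob (Gr A) \<Longrightarrow> fo F M \<in> Ob (Gr B)"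
    and F_carrier [simp]: "carrier (fo F M) = carrier M"
    and F_zero [simp]: "\<zero>\<^bsub>fo F M\<^esub> = \<zero>\<^bsub>M\<^esub>"
    and F_add [simp]: "add (fo F M) = add M"
    and F_grel: "M \<in> Ob (Gr A) \<Longrightarrow> N \<in> Ob (Gr A) \<Longrightarrow> grel B (fo F M) (fo F N) R \<longleftrightarrow> grel A M N R"
    and F_annihilated: "M \<in> Ob (Gr A) \<Longrightarrow> \<forall>m\<in>carrier M. \<forall>a\<in>ideal_I A. ract M m a = \<zero>\<^bsub>M\<^esub> \<Longrightarrow>
      \<forall>m\<in>carrier M. \<forall>a\<in>ideal_I B. ract (fo F M) m a = \<zero>\<^bsub>M\<^esub>"
begin

lemma F_finsum [simp]: "finsum (fo F M) = finsum M"
  by (simp add: finsum_def fun_eq_iff)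

lemma F_fgraph [simp]: "fgraph (fo F M) f = fgraph M f"
  by (simp add: fgraph_def)

lemma F_ghom:
  assumes "M \<in> Ob (Gr A)" "N \<in> Ob (Gr A)"
  shows "ghom B (fo F M) (fo F N) = ghom A M N"
  using ghom_iff_grel[OF A.Gr_module A.Gr_module, OF assms]
    ghom_iff_grel[OF B.Gr_module B.Gr_module, OF F_Ob F_Ob, OF assms] F_grel[OF assms]
  by (intro Set.set_eqI) simp

lemma is_functor_F: "is_functor (Gr A) (Gr B) F"
  by (rule is_functorI[OF category_Gr[OF A.graded_ring_axioms] category_Gr[OF B.graded_ring_axioms] F_Ob])
    (simp_all add: F_ghom del: Gr_simps(1))

lemma fully_faithful_F: "fully_faithful (Gr A) (Gr B) F"
  unfolding fully_faithful_def by (simp add: F_ghom bij_betw_def inj_on_def del: Gr_simps(1))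

text \<open>The closure conditions mention only homomorphisms and underlying sets and maps, which
  \<open>F\<close> leaves as they are.\<close>

lemma localizing_preimage:
  assumes T: "localizing B T"
  shows "localizing A {M \<in> Ob (Gr A). fo F M \<in> T}"
proof (rule localizingI)
  show "{M \<in> Ob (Gr A). fo F M \<in> T} \<subseteq> Ob (Gr A)" by blast
next
  fix M N f assume h: "M \<in> {M \<in> Ob (Gr A). fo F M \<in> T}" "N \<in> Ob (Gr A)" "f \<in> ghom A N M" "inj_on f (carrier N)"
  have "f \<in> ghom B (fo F N) (fo F M)" using h F_ghom[of N M] by blast
  then show "N \<in> {M \<in> Ob (Gr A). fo F M \<in> T}"
    using localizingD(2)[OF T _ F_Ob[OF h(2)]] h by auto
next
  fix M N f assume h: "M \<in> {M \<in> Ob (Gr A). fo F M \<in> T}" "N \<in> Ob (Gr A)" "f \<in> ghom A M N" "f ` carrier M = carrier N"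
  have "f \<in> ghom B (fo F M) (fo F N)" using h F_ghom[of M N] by blast
  then show "N \<in> {M \<in> Ob (Gr A). fo F M \<in> T}"
    using localizingD(3)[OF T _ F_Ob[OF h(2)]] h by auto
next
  fix L M N f g assume h: "L \<in> {M \<in> Ob (Gr A). fo F M \<in> T}" "N \<in> {M \<in> Ob (Gr A). fo F M \<in> T}"
    "M \<in> Ob (Gr A)" "f \<in> ghom A L M" "g \<in> ghom A M N" "inj_on f (carrier L)"
    "f ` carrier L = {x \<in> carrier M. g x = \<zero>\<^bsub>N\<^esub>}" "g ` carrier M = carrier N"
  have "f \<in> ghom B (fo F L) (fo F M)" "g \<in> ghom B (fo F M) (fo F N)"
    using h F_ghom[of L M] F_ghom[of M N] by blast+
  then show "M \<in> {M \<in> Ob (Gr A). fo F M \<in> T}"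
    using localizingD(4)[OF T _ _ F_Ob[OF h(3)], of "fo F L" "fo F N" f g] h by auto
next
  fix J Y \<iota> S assume h: "S \<in> Ob (Gr A)" "small J" "\<And>j. j \<in> J \<Longrightarrow> Y j \<in> {M \<in> Ob (Gr A). fo F M \<in> T}"
    "is_direct_sum A J Y S \<iota>"
  have "is_direct_sum B J (\<lambda>j. fo F (Y j)) (fo F S) \<iota>"
    using h(4) F_ghom[OF _ h(1)] h(3) unfolding is_direct_sum_def by (simp del: Gr_simps(1))
  from localizingD(5)[OF T F_Ob[OF h(1)] h(2) _ this]
  have "fo F S \<in> T" using h(3) by simp
  then show "S \<in> {M \<in> Ob (Gr A). fo F M \<in> T}" using h(1) by simp
qed

text \<open>The preimage of \<open>Tors B\<close> is localizing and contains the modules annihilated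
  over \<open>A\<close>, so minimality of \<open>Tors A\<close> applies.\<close>

lemma F_Tors: "M \<in> Tors A \<Longrightarrow> fo F M \<in> Tors B"
proof -
  have "Tors A \<subseteq> {M \<in> Ob (Gr A). fo F M \<in> Tors B}"
  proof (rule Tors_least[OF localizing_preimage[OF localizing_Tors]])
    fix M assume "M \<in> Ob (Gr A)" "\<forall>m\<in>carrier M. \<forall>a\<in>ideal_I A. ract M m a = \<zero>\<^bsub>M\<^esub>"
    then show "M \<in> {M \<in> Ob (Gr A). fo F M \<in> Tors B}"
      using F_annihilated[of M] Tors_annihilated[OF F_Ob, of M] by simp
  qed
  then show "M \<in> Tors A \<Longrightarrow> fo F M \<in> Tors B" by blast
qed

lemma F_subquotient:
  "M \<in> Ob (Gr A) \<Longrightarrow> Q \<in> Ob (Gr A) \<Longrightarrow> subquotient B (fo F M) T S (fo F Q) R \<longleftrightarrow> subquotient A M T S Q R"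
  by (simp add: subquotient_def F_grel del: Gr_simps(1))

end

section \<open>Pairs of mutually inverse relabellings\<close>

text \<open>The round trips may alter the \<open>ract\<close> field outside the carriers, so they
  are compared with the identity through relations and not by equality of records.\<close>

locale relabelling_pair = F: relabelling A B F + G: relabelling B A G for A B F G +
  assumes unit: "M \<in> Ob (Gr A) \<Longrightarrow> grel A M (fo G (fo F M)) (Id_on (carrier M))"
    and counit: "N \<in> Ob (Gr B) \<Longrightarrow> grel B N (fo F (fo G N)) (Id_on (carrier N))"
begin

lemma Gr_isomorphic:
  assumes N: "N \<in> Ob (Gr B)"
  shows "isomorphic_in (Gr B) (fo F (fo G N)) N"
proof -
  have N': "fo F (fo G N) \<in> Ob (Gr B)" using F.F_Ob G.F_Ob N by blast
  let ?i = "\<lambda>x\<in>carrier N. x"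
  have "?i \<in> ghom B N (fo F (fo G N))"
    using ghom_iff_grel[OF F.B.Gr_module[OF N] F.B.Gr_module[OF N'], of ?i] counit[OF N] by (simp add: fgraph_id)
  moreover have "bij_betw ?i (carrier N) (carrier (fo F (fo G N)))" by (auto simp: bij_betw_def inj_on_def)
  ultimately have "inverse_arrows (Gr B) N (fo F (fo G N)) ?i (restrict (inv_into (carrier N) ?i) (carrier (fo F (fo G N))))"
    by (rule F.B.ghom_bij_inverse[OF N N'])
  from inverse_arrows_sym[OF this] show ?thesis
    unfolding isomorphic_in_iff using N N' by blast
qed

lemma equivalence_Gr: "cat_equivalence (Gr A) (Gr B) F"
by (metis cat_equivalenceI F.is_functor_F F.fully_faithful_F ess_surjective_def Gr_isomorphic G.F_Ob)

lemma Tors_counit: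
  assumes N: "N \<in> Tors B"
  shows "fo F (fo G N) \<in> Tors B"
  using F.F_Tors G.F_Tors N by blast

lemma equivalence_Tors: "cat_equivalence (full_subcat (Gr A) (Tors A)) (full_subcat (Gr B) (Tors B)) F"
proof (rule cat_equivalenceI)
  have TA: "Tors A \<subseteq> Ob (Gr A)" and TB: "Tors B \<subseteq> Ob (Gr B)" using Tors_Ob by blast+
  show "is_functor (full_subcat (Gr A) (Tors A)) (full_subcat (Gr B) (Tors B)) F"
    by (rule is_functor_full_subcat[OF F.is_functor_F TA TB F.F_Tors])
  show "fully_faithful (full_subcat (Gr A) (Tors A)) (full_subcat (Gr B) (Tors B)) F"
    by (rule fully_faithful_full_subcat[OF F.fully_faithful_F TA])
  show "ess_surjective (full_subcat (Gr A) (Tors A)) (full_subcat (Gr B) (Tors B)) F"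
    unfolding ess_surjective_def
  proof
    fix N assume "N \<in> Ob (full_subcat (Gr B) (Tors B))"
    then have N: "N \<in> Tors B" by (simp add: full_subcat_def)
    have "isomorphic_in (full_subcat (Gr B) (Tors B)) (fo F (fo G N)) N"
      using Gr_isomorphic[OF Tors_Ob[OF N]] Tors_counit[OF N] N
      unfolding isomorphic_in_iff inverse_arrows_def full_subcat_def by simp
    then show "\<exists>M\<in>Ob (full_subcat (Gr A) (Tors A)). isomorphic_in (full_subcat (Gr B) (Tors B)) (fo F M) N"
      using G.F_Tors[OF N] by (auto simp: full_subcat_def)
  qed
qed

text \<open>In the reverse direction the torsion module \<open>Q\<close> over \<open>B\<close> may
  fail to be a value of \<open>F\<close>; by \<open>counit\<close> it is replaced by its copy
  \<open>fo F (fo G Q)\<close>, after which the relation can be read over \<open>A\<close>.\<close>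

lemma torsion_subquotient_iff:
  assumes M: "M \<in> Ob (Gr A)"
  shows "torsion_subquotient B (fo F M) T S \<longleftrightarrow> torsion_subquotient A M T S"
proof
  assume "torsion_subquotient A M T S"
  then obtain Q R where "Q \<in> Tors A" "subquotient A M T S Q R" unfolding torsion_subquotient_def by blast
  then show "torsion_subquotient B (fo F M) T S"
    unfolding torsion_subquotient_def using F.F_subquotient[OF M Tors_Ob] F.F_Tors by blast
next
  assume "torsion_subquotient B (fo F M) T S"
  then obtain Q R where Q: "Q \<in> Tors B" and R: "subquotient B (fo F M) T S Q R" unfolding torsion_subquotient_def by blast
  have QO: "Q \<in> Ob (Gr B)" using Tors_Ob[OF Q] .
  have "grel B (fo F M) (fo F (fo G Q)) (R O Id_on (carrier Q))"
    by (rule grel_relcomp[OF _ counit[OF QO]]) (use R in \<open>simp add: subquotient_def\<close>)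
  moreover have "y \<in> carrier Q" if "(x, y) \<in> R" for x y
    using R that grelD(7)[of B "fo F M" Q R] by (simp add: subquotient_def)
  then have "R O Id_on (carrier Q) = R" by auto
  ultimately have "subquotient B (fo F M) T S (fo F (fo G Q)) R"
    using R by (simp add: subquotient_def)
  then have "subquotient A M T S (fo G Q) R"
    using F.F_subquotient[OF M G.F_Ob[OF QO]] by blast
  then show "torsion_subquotient A M T S"
    unfolding torsion_subquotient_def using G.F_Tors[OF Q] by blast
qed

section \<open>The functor induced on quotient categories\<close>

lemma correspondence_iff:
  "M \<in> Ob (Gr A) \<Longrightarrow> N \<in> Ob (Gr A) \<Longrightarrow> correspondence B (fo F M) (fo F N) R \<longleftrightarrow> correspondence A M N R"
  by (simp add: correspondence_def torsion_subquotient_iff F.F_grel del: Gr_simps(1))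

lemma corr_equiv_iff:
  "M \<in> Ob (Gr A) \<Longrightarrow> N \<in> Ob (Gr A) \<Longrightarrow> corr_equiv B (fo F M) (fo F N) R S \<longleftrightarrow> corr_equiv A M N R S"
  by (simp add: corr_equiv_def torsion_subquotient_iff correspondence_iff coset_rel_def del: Gr_simps(1))

lemma qrep_of_F [simp]: "qrep_of (fo F M) R = qrep_of M R"
  by (simp add: qrep_of_def)

lemma corr_class_F:
  assumes "M \<in> Ob (Gr A)" "N \<in> Ob (Gr A)"
  shows "corr_class B (fo F M) (fo F N) R = corr_class A M N R"
  by (rule Set.set_eqI) (simp add: F.B.mem_corr_class[OF F.F_Ob F.F_Ob, OF assms] F.A.mem_corr_class[OF assms] corr_equiv_iff[OF assms])

lemma qreps_F:
  assumes "M \<in> Ob (Gr A)" "N \<in> Ob (Gr A)"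
  shows "qreps B (fo F M) (fo F N) = qreps A M N"
  by (rule Set.set_eqI) (simp add: F.B.qreps_iff[OF F.F_Ob F.F_Ob, OF assms] F.A.qreps_iff[OF assms] correspondence_iff[OF assms])

lemma qrel_F:
  assumes "M \<in> Ob (Gr A)" "N \<in> Ob (Gr A)"
  shows "qrel B (fo F M) (fo F N) = qrel A M N"
proof (intro subset_antisym subrelI)
  note o = assms F.F_Ob[OF assms(1)] F.F_Ob[OF assms(2)]
  fix t u
  have *: "(qrep_of M R, qrep_of M S) \<in> qrel B (fo F M) (fo F N) \<longleftrightarrow> (qrep_of M R, qrep_of M S) \<in> qrel A M N" for R S
    using F.B.qrel_iff[OF o(3,4), of R S] F.A.qrel_iff[OF o(1,2)] corr_equiv_iff[OF o(1,2)] by simp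
  {
    assume tu: "(t, u) \<in> qrel B (fo F M) (fo F N)"
    then have "t \<in> qreps A M N" "u \<in> qreps A M N" using qreps_F[OF assms] unfolding qrel_def by auto
    then show "(t, u) \<in> qrel A M N" using F.A.qreps_iff[OF o(1,2)] * tu by metis
  next
    assume tu: "(t, u) \<in> qrel A M N"
    then have "t \<in> qreps A M N" "u \<in> qreps A M N" unfolding qrel_def by auto
    then show "(t, u) \<in> qrel B (fo F M) (fo F N)" using F.A.qreps_iff[OF o(1,2)] * tu by metis
  }
qed

lemma QGr_Hom_F:
  "M \<in> Ob (Gr A) \<Longrightarrow> N \<in> Ob (Gr A) \<Longrightarrow> Hom (QGr B) (fo F M) (fo F N) = Hom (QGr A) M N"
  unfolding QGr_simps by (simp only: qreps_F qrel_F)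

text \<open>\<open>induced\<close> saturates a class under the equivalence of the target; a class is
  already saturated.\<close>

lemma qrel_Image_corr_class:
  assumes M: "M \<in> Ob (Gr A)" and N: "N \<in> Ob (Gr A)" and R: "correspondence A M N R"
  shows "qrel A M N `` corr_class A M N R = corr_class A M N R"
proof (rule Set.set_eqI)
  fix t
  have "t \<in> qrel A M N `` corr_class A M N R \<longleftrightarrow> (\<exists>S. corr_equiv A M N R S \<and> t \<in> corr_class A M N S)"
  proof
    assume "t \<in> qrel A M N `` corr_class A M N R"
    then obtain u where u: "u \<in> corr_class A M N R" "(u, t) \<in> qrel A M N" by (rule ImageE)
    then obtain S where "u = qrep_of M S" "corr_equiv A M N R S" using F.A.mem_corr_class[OF M N] by metis
    then show "\<exists>S. corr_equiv A M N R S \<and> t \<in> corr_class A M N S"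
      using u(2) unfolding corr_class_def by (metis Image_singleton_iff)
  next
    assume "\<exists>S. corr_equiv A M N R S \<and> t \<in> corr_class A M N S"
    then obtain S where S: "corr_equiv A M N R S" "(qrep_of M S, t) \<in> qrel A M N"
      unfolding corr_class_def by (metis Image_singleton_iff)
    then have "qrep_of M S \<in> corr_class A M N R" using F.A.mem_corr_class[OF M N] by metis
    then show "t \<in> qrel A M N `` corr_class A M N R" by (rule ImageI[OF S(2)])
  qed
  also have "\<dots> \<longleftrightarrow> t \<in> corr_class A M N R"
    unfolding F.A.mem_corr_class[OF M N]
    using F.A.corr_equiv_trans[OF M N] F.A.corr_equiv_refl[OF M N R] by blast
  finally show "t \<in> qrel A M N `` corr_class A M N R \<longleftrightarrow> t \<in> corr_class A M N R" .
qed

lemma induced_fo [simp]: "fo (induced B F) M = fo F M"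
  by (simp add: induced_def)

text \<open>\<open>qrel\<close> is the same set over \<open>A\<close> and over \<open>B\<close>, so
  saturating a morphism changes nothing.\<close>

lemma induced_fm:
  assumes M: "M \<in> Ob (Gr A)" and N: "N \<in> Ob (Gr A)" and c: "c \<in> Hom (QGr A) M N"
  shows "fm (induced B F) M N c = c"
proof -
  obtain R where "correspondence A M N R" "c = corr_class A M N R"
    using c F.A.QGr_Hom[OF M N] unfolding QGr_simps by blast
  then show ?thesis
    using qrel_Image_corr_class[OF M N] by (simp add: induced_def qrel_F[OF M N])
qed

lemma is_functor_induced: "is_functor (QGr A) (QGr B) (induced B F)"
proof (rule is_functorI[OF F.A.category_QGr F.B.category_QGr])
  fix M assume M': "M \<in> Ob (QGr A)"
  then have M: "M \<in> Ob (Gr A)" by simp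
  show "fo (induced B F) M \<in> Ob (QGr B)" using F.F_Ob[OF M] by simp
  have "fm (induced B F) M M (Idt (QGr A) M) = Idt (QGr A) M"
    by (rule induced_fm[OF M M category_idt[OF F.A.category_QGr M']])
  also have "\<dots> = Idt (QGr B) (fo F M)"
    unfolding QGr_simps F.A.QGr_Idt[OF M] F.B.QGr_Idt[OF F.F_Ob[OF M]]
    using corr_class_F[OF M M] by simp
  finally show "fm (induced B F) M M (Idt (QGr A) M) = Idt (QGr B) (fo (induced B F) M)" by simp
next
  fix M N f assume "M \<in> Ob (QGr A)" "N \<in> Ob (QGr A)" and f: "f \<in> Hom (QGr A) M N"
  then have M: "M \<in> Ob (Gr A)" and N: "N \<in> Ob (Gr A)" by simp_all
  show "fm (induced B F) M N f \<in> Hom (QGr B) (fo (induced B F) M) (fo (induced B F) N)"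
    unfolding induced_fm[OF M N f] induced_fo QGr_Hom_F[OF M N] by (rule f)
next
  fix M N P f g assume o: "M \<in> Ob (QGr A)" "N \<in> Ob (QGr A)" "P \<in> Ob (QGr A)"
    and fg: "f \<in> Hom (QGr A) M N" "g \<in> Hom (QGr A) N P"
  then have M: "M \<in> Ob (Gr A)" and N: "N \<in> Ob (Gr A)" and P: "P \<in> Ob (Gr A)" by simp_all
  have "Cmp (QGr B) (fo F M) (fo F N) (fo F P) g f = Cmp (QGr A) M N P g f"
    by (simp add: qrel_F[OF M P])
  then show "fm (induced B F) M P (Cmp (QGr A) M N P g f) =
     Cmp (QGr B) (fo (induced B F) M) (fo (induced B F) N) (fo (induced B F) P) (fm (induced B F) N P g) (fm (induced B F) M N f)"
    unfolding induced_fo induced_fm[OF M N fg(1)] induced_fm[OF N P fg(2)]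
      induced_fm[OF M P category_cmp[OF F.A.category_QGr o fg]] by simp
qed

text \<open>Hom-sets coincide, so full faithfulness is immediate; essential surjectivity is
  inherited from \<open>Gr\<close> through the quotient functor.\<close>

lemma equivalence_QGr: "cat_equivalence (QGr A) (QGr B) (induced B F)"
proof (rule cat_equivalenceI[OF is_functor_induced])
  show "fully_faithful (QGr A) (QGr B) (induced B F)"
    unfolding fully_faithful_def
  proof (intro ballI)
    fix M N assume "M \<in> Ob (QGr A)" "N \<in> Ob (QGr A)"
    then have M: "M \<in> Ob (Gr A)" and N: "N \<in> Ob (Gr A)" by simp_all
    have "bij_betw (\<lambda>f. f) (Hom (QGr A) M N) (Hom (QGr A) M N)" by (simp add: bij_betw_def)
    then have "bij_betw (fm (induced B F) M N) (Hom (QGr A) M N) (Hom (QGr A) M N)"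
      by (rule bij_betw_cong[THEN iffD1, rotated]) (use induced_fm[OF M N] in simp)
    then show "bij_betw (fm (induced B F) M N) (Hom (QGr A) M N) (Hom (QGr B) (fo (induced B F) M) (fo (induced B F) N))"
      unfolding induced_fo QGr_Hom_F[OF M N] .
  qed
  show "ess_surjective (QGr A) (QGr B) (induced B F)"
    unfolding ess_surjective_def
  proof
    fix N assume "N \<in> Ob (QGr B)"
    then have N: "N \<in> Ob (Gr B)" by simp
    have "isomorphic_in (QGr B) (fo F (fo G N)) N"
      using functor_isomorphic_in[OF F.B.is_functor_quot_functor Gr_isomorphic[OF N]] by simp
    then show "\<exists>M\<in>Ob (QGr A). isomorphic_in (QGr B) (fo (induced B F) M) N"
      using G.F_Ob[OF N] by auto
  qed
qed

lemma induced_quot_functor: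
  "functor_eq (Gr A) (induced B F \<circ>\<^sub>F quot_functor A) (quot_functor B \<circ>\<^sub>F F)"
  unfolding functor_eq_def
proof (intro conjI ballI)
  fix M N f assume M: "M \<in> Ob (Gr A)" and N: "N \<in> Ob (Gr A)" and "f \<in> Hom (Gr A) M N"
  then have f: "f \<in> ghom A M N" by simp
  have "fm (quot_functor A) M N f \<in> Hom (QGr A) M N"
    using is_functorD(4)[OF F.A.is_functor_quot_functor M N] f by simp
  then have "fm (induced B F \<circ>\<^sub>F quot_functor A) M N f = fm (quot_functor A) M N f"
    using induced_fm[OF M N] by simp
  also have "\<dots> = fm (quot_functor B) (fo F M) (fo F N) f"
    using F.A.quot_functor_fm[OF M N f] F.B.quot_functor_fm[OF F.F_Ob[OF M] F.F_Ob[OF N], of f] F.F_ghom[OF M N] f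
      corr_class_F[OF M N] by simp
  finally show "fm (induced B F \<circ>\<^sub>F quot_functor A) M N f = fm (quot_functor B \<circ>\<^sub>F F) M N f" by simp
qed simp

end

section \<open>The shift\<close>

text \<open>An arbitrary integer \<open>c\<close> keeps the shift and its inverse in one
  construction.\<close>

definition regrade :: "int \<Rightarrow> ('a, 'm) gmod \<Rightarrow> ('a, 'm) gmod" where
  "regrade c M = M\<lparr>gr := (\<lambda>n. gr M (n + c))\<rparr>"

lemma regrade_simps [simp]:
  "carrier (regrade c M) = carrier M" "\<zero>\<^bsub>regrade c M\<^esub> = \<zero>\<^bsub>M\<^esub>" "add (regrade c M) = add M"
  "ract (regrade c M) = ract M" "gr (regrade c M) n = gr M (n + c)"
  by (simp_all add: regrade_def)

lemma finsum_regrade [simp]: "finsum (regrade c M) = finsum M"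
  by (simp add: finsum_def fun_eq_iff regrade_def)

lemma
  fixes M :: "('a, 'm) gmod" (structure)
  assumes M: "graded_module A M"
  shows graded_module_regrade: "graded_module A (regrade c M)"
    and hpart_regrade: "x \<in> carrier M \<Longrightarrow> hpart (regrade c M) (gr (regrade c M)) n x = hpart M (gr M) (n + c) x"
proof -
  interpret graded_module A M by fact
  have shift_sum: "(\<Oplus>n\<in>F. f (n + c)) = (\<Oplus>n\<in>(\<lambda>n. n + c) ` F. f n)" if "\<And>n. f n \<in> carrier M" for f F
    by (rule finsum_reindex[symmetric]) (use that in \<open>auto simp: inj_on_def\<close>)
  have ab: "abelian_group (regrade c M)"
    by (rule abelian_groupI) (auto simp: a_ac intro: bexI[of _ "\<ominus> x" for x] l_neg r_neg)
  have rm: "rmodule A (regrade c M)"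
    using rmodule ab by (simp add: rmodule_def)
  have gb: "graded_by (regrade c M) (gr (regrade c M))"
  proof (rule graded_byI[OF ab])
    fix n
    have "subgroup (gr M (n + c)) (add_monoid M)"
      using homog_additive_subgroup by (rule additive_subgroup.a_subgroup)
    then show "additive_subgroup (gr (regrade c M) n) (regrade c M)"
      by (intro additive_subgroupI) (simp add: regrade_def)
  next
    fix x assume x: "x \<in> carrier (regrade c M)"
    let ?S = "{n. hpart M (gr M) n x \<noteq> \<zero>}"
    \<comment> \<open>Degree \<open>n\<close> of the regraded module is degree \<open>n + c\<close>
      of \<open>M\<close>, so the support moves down by \<open>c\<close>.\<close>
    let ?F = "(\<lambda>n. n - c) ` ?S"
    have "(\<lambda>n. n + c) ` ?F = ?S" by (auto simp: image_iff)
    then have "x = (\<Oplus>n\<in>?F. hpart M (gr M) (n + c) x)"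
      using x finsum_hpart[of x] shift_sum[of "\<lambda>n. hpart M (gr M) n x" ?F] by simp
    moreover have "hpart M (gr M) (n + c) x = \<zero>" if "n \<notin> ?F" for n
    proof (rule ccontr)
      assume "hpart M (gr M) (n + c) x \<noteq> \<zero>"
      then have "n + c \<in> ?S" by simp
      then have "(n + c) - c \<in> ?F" by (rule imageI)
      then show False using that by simp
    qed
    ultimately show "\<exists>d F. finite F \<and> (\<forall>n. d n \<in> gr (regrade c M) n) \<and> (\<forall>n. n \<notin> F \<longrightarrow> d n = \<zero>\<^bsub>regrade c M\<^esub>) \<and>
        x = (\<Oplus>\<^bsub>regrade c M\<^esub>n\<in>F. d n)"
      using x by (intro exI[of _ "\<lambda>n. hpart M (gr M) (n + c) x"] exI[of _ ?F]) simp
  next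
    fix d F assume F: "finite F" and d: "\<forall>n. d n \<in> gr (regrade c M) n"
      and s: "(\<Oplus>\<^bsub>regrade c M\<^esub>n\<in>F. d n) = \<zero>\<^bsub>regrade c M\<^esub>"
    have d': "d (n - c) \<in> gr M n" for n using d by (metis regrade_simps(5) diff_add_cancel)
    have "(\<Oplus>n\<in>(\<lambda>n. n + c) ` F. d (n - c)) = \<zero>"
      using s shift_sum[of "\<lambda>n. d (n - c)" F, OF homog_carrier[OF d']] by simp
    then have "d (k - c) = \<zero>" if "k \<in> (\<lambda>n. n + c) ` F" for k
      using hpart_finsum[of "(\<lambda>n. n + c) ` F" "\<lambda>n. d (n - c)" k] d' F that by simp
    then show "\<forall>n\<in>F. d n = \<zero>\<^bsub>regrade c M\<^esub>" by force
  qed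
  have "ract M m a \<in> gr M (n + k + c)" if "m \<in> gr M (n + c)" "a \<in> homog A k" for m a n k
    using ract_homog[OF that] by (simp add: ac_simps)
  then have "graded_rmodule A (regrade c M)"
    using rm gb by (simp add: graded_rmodule_def)
  then show gm: "graded_module A (regrade c M)"
    using A.graded_ring_axioms by (simp add: graded_module_iff)
  interpret R: graded_module A "regrade c M" by (rule gm)
  have "hpart (regrade c M) (gr (regrade c M)) n x = hpart M (gr M) (n + c) x" if x: "x \<in> carrier M" for n x
  proof -
    let ?S = "{n. hpart M (gr M) n x \<noteq> \<zero>}"
    let ?F = "{n. hpart M (gr M) (n + c) x \<noteq> \<zero>}"
    have i: "(\<lambda>n. n + c) ` ?F = ?S"
    proof (intro subset_antisym subsetI)
      fix k assume "k \<in> ?S"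
      then have "k - c \<in> ?F" by simp
      then have "(k - c) + c \<in> (\<lambda>n. n + c) ` ?F" by (rule imageI)
      then show "k \<in> (\<lambda>n. n + c) ` ?F" by simp
    qed auto
    have "finite ((\<lambda>n. n + c) ` ?F)" unfolding i using x by simp
    then have "finite ?F" by (rule finite_imageD) (auto simp: inj_on_def)
    moreover have "x = (\<Oplus>n\<in>?F. hpart M (gr M) (n + c) x)"
      using x finsum_hpart[of x] shift_sum[of "\<lambda>n. hpart M (gr M) n x" ?F] i by simp
    ultimately show ?thesis
      by (intro R.hpart_unique) (use x in simp_all)
  qed
  then show "x \<in> carrier M \<Longrightarrow> hpart (regrade c M) (gr (regrade c M)) n x = hpart M (gr M) (n + c) x" .
qed

lemma grel_regrade:
  assumes M: "graded_module A M" and N: "graded_module A N"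
  shows "grel A (regrade c M) (regrade d N) R \<longleftrightarrow> R \<subseteq> carrier M \<times> carrier N \<and> (\<zero>\<^bsub>M\<^esub>, \<zero>\<^bsub>N\<^esub>) \<in> R \<and>
    (\<forall>x y x' y'. (x, y) \<in> R \<longrightarrow> (x', y') \<in> R \<longrightarrow> (x \<oplus>\<^bsub>M\<^esub> x', y \<oplus>\<^bsub>N\<^esub> y') \<in> R) \<and>
    (\<forall>x y a. (x, y) \<in> R \<longrightarrow> a \<in> carrier A \<longrightarrow> (ract M x a, ract N y a) \<in> R) \<and>
    (\<forall>x y n. (x, y) \<in> R \<longrightarrow> (hpart M (gr M) (n + c) x, hpart N (gr N) (n + d) y) \<in> R)"
proof -
  have "(hpart (regrade c M) (gr (regrade c M)) n x, hpart (regrade d N) (gr (regrade d N)) n y)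
    = (hpart M (gr M) (n + c) x, hpart N (gr N) (n + d) y)"
    if "R \<subseteq> carrier M \<times> carrier N" "(x, y) \<in> R" for x y n
    using hpart_regrade[OF M, of x c n] hpart_regrade[OF N, of y d n] that by auto
  then show ?thesis
    unfolding grel_def regrade_simps(1-4) by (intro iffI; simp)
qed

definition regrade_functor :: "int \<Rightarrow> (('a, 'm) gmod, 'm \<Rightarrow> 'm, ('a, 'm) gmod, 'm \<Rightarrow> 'm) fnc" where
  "regrade_functor c = \<lparr>fo = regrade c, fm = (\<lambda>M N f. f)\<rparr>"

lemma shift_eq_regrade: "shift = regrade_functor 1"
  by (simp add: shift_def regrade_functor_def regrade_def fun_eq_iff)

lemma (in graded_ring) relabelling_regrade: "relabelling A A (regrade_functor c)"
proof -
  have "grel A (regrade c M) (regrade c N) R \<longleftrightarrow> grel A M N R" if "M \<in> Ob (Gr A)" "N \<in> Ob (Gr A)" for M N R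
  proof -
    have "(\<forall>x y n. (x, y) \<in> R \<longrightarrow> (hpart M (gr M) (n + c) x, hpart N (gr N) (n + c) y) \<in> R) \<longleftrightarrow>
      (\<forall>x y n. (x, y) \<in> R \<longrightarrow> (hpart M (gr M) n x, hpart N (gr N) n y) \<in> R)"
      by (metis diff_add_cancel)
    then show ?thesis
      unfolding grel_regrade[OF Gr_module[OF that(1)] Gr_module[OF that(2)]] unfolding grel_def by simp
  qed
  moreover have "regrade c M \<in> Ob (Gr A)" if "M \<in> Ob (Gr A)" for M
    using graded_module_regrade[OF Gr_module[OF that]] that by (simp add: graded_module_iff)
  ultimately show ?thesis
    using graded_ring_axioms
    by (simp add: relabelling_def relabelling_axioms_def regrade_functor_def del: Gr_simps(1))
qed

lemma (in graded_ring) relabelling_pair_shift: "relabelling_pair A A shift (regrade_functor (- 1))"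
proof -
  have "grel A M (regrade c (regrade d M)) (Id_on (carrier M))" if "M \<in> Ob (Gr A)" "c + d = 0" for M c d
  proof -
    have "regrade c (regrade d M) = M"
      using that(2) by (simp add: regrade_def add.assoc)
    then show ?thesis
      using gsubmodule_carrier[OF Gr_module[OF that(1)]] gsubmodule_iff_grel[OF Gr_module[OF that(1)]] by simp
  qed
  then show ?thesis
    unfolding shift_eq_regrade relabelling_pair_def relabelling_pair_axioms_def
    using relabelling_regrade by (simp add: regrade_functor_def del: Gr_simps(1))
qed

section \<open>Zhang twists\<close>

lemma finsum_eqI:
  fixes G :: "('a, 'x) ring_scheme" and G' :: "('a, 'y) ring_scheme"
  assumes "carrier G = carrier G'" "\<zero>\<^bsub>G\<^esub> = \<zero>\<^bsub>G'\<^esub>" "add G = add G'"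
  shows "finsum G = finsum G'"
  by (intro ext) (simp only: finsum_def finprod_def assms partial_object.simps monoid.simps)

lemma finsum_reg: "finsum (reg_gmod A) = finsum A"
  by (rule finsum_eqI) (simp_all add: reg_gmod_def)

lemma (in graded_ring) graded_module_reg: "graded_module A (reg_gmod A)"
proof -
  have ab: "abelian_group (reg_gmod A)"
    by (rule abelian_groupI) (auto simp: a_ac reg_gmod_def intro: bexI[of _ "\<ominus> x" for x] l_neg r_neg)
  have "graded_by (reg_gmod A) (homog A)"
    using graded unfolding graded_by_def finsum_reg additive_subgroup_def subgroup_def m_inv_def by (simp add: reg_gmod_def)
  then show ?thesis
    unfolding graded_module_iff graded_rmodule_def rmodule_def
    using ab ring_axioms graded_ring_axioms mult_homog by (simp add: reg_gmod_def l_distr r_distr m_assoc)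
qed

lemma hpart_reg: "hpart (reg_gmod A) = hpart A"
  by (rule ext, rule hpart_cong[OF finsum_reg]) (simp add: reg_gmod_def)

section \<open>Twisting modules by a family of maps\<close>

text \<open>A family \<open>\<tau>\<close> in place of the powers of \<open>\<sigma>\<close> covers
  both the twist, with \<open>zpower A \<sigma> n\<close>, and the untwist, with
  \<open>zpower A \<sigma> (- n)\<close>.\<close>

definition twist_mod :: "(int \<Rightarrow> 'a \<Rightarrow> 'a) \<Rightarrow> ('a, 'm) gmod \<Rightarrow> ('a, 'm) gmod" where
  "twist_mod \<tau> M = M\<lparr>ract := (\<lambda>m a.
     \<Oplus>\<^bsub>M\<^esub>n\<in>{n. hpart M (gr M) n m \<noteq> \<zero>\<^bsub>M\<^esub>}. ract M (hpart M (gr M) n m) (\<tau> n a))\<rparr>"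

lemma twist_mod_simps [simp]:
  "carrier (twist_mod \<tau> M) = carrier M" "\<zero>\<^bsub>twist_mod \<tau> M\<^esub> = \<zero>\<^bsub>M\<^esub>" "add (twist_mod \<tau> M) = add M"
  "gr (twist_mod \<tau> M) = gr M"
  by (simp_all add: twist_mod_def)

lemma finsum_twist_mod [simp]: "finsum (twist_mod \<tau> M) = finsum M"
  by (simp add: finsum_def fun_eq_iff)

lemma hpart_twist_mod [simp]: "hpart (twist_mod \<tau> M) = hpart M"
  using hpart_cong[of "twist_mod \<tau> M" M] by auto

locale twisting_family = graded_ring A for A :: "('k, 'u) galgebra" (structure) +
  fixes \<tau> :: "int \<Rightarrow> 'u \<Rightarrow> 'u"
  assumes \<tau>_bij: "bij_betw (\<tau> n) (carrier A) (carrier A)"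
    and \<tau>_add: "a \<in> carrier A \<Longrightarrow> b \<in> carrier A \<Longrightarrow> \<tau> n (a \<oplus> b) = \<tau> n a \<oplus> \<tau> n b"
    and \<tau>_homog: "a \<in> homog A k \<Longrightarrow> \<tau> n a \<in> homog A k"
    and \<tau>_one [simp]: "\<tau> n \<one> = \<one>"
begin

lemma \<tau>_closed [simp]: "a \<in> carrier A \<Longrightarrow> \<tau> n a \<in> carrier A"
  using \<tau>_bij[of n] by (auto simp: bij_betw_def)

lemma
  assumes M: "graded_module A M" and a: "a \<in> carrier A"
  shows twist_ract_homog: "m \<in> gr M n \<Longrightarrow> ract (twist_mod \<tau> M) m a = ract M m (\<tau> n a)"
    and twist_ract_closed: "m \<in> carrier M \<Longrightarrow> ract (twist_mod \<tau> M) m a \<in> carrier M"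
    and twist_ract_add_left: "m \<in> carrier M \<Longrightarrow> m' \<in> carrier M \<Longrightarrow>
      ract (twist_mod \<tau> M) (m \<oplus>\<^bsub>M\<^esub> m') a = ract (twist_mod \<tau> M) m a \<oplus>\<^bsub>M\<^esub> ract (twist_mod \<tau> M) m' a"
proof -
  interpret M: graded_module A M by fact
  have def: "ract (twist_mod \<tau> M) m a =
     (\<Oplus>\<^bsub>M\<^esub>n\<in>{n. hpart M (gr M) n m \<noteq> \<zero>\<^bsub>M\<^esub>}. ract M (hpart M (gr M) n m) (\<tau> n a))" for m
    by (simp add: twist_mod_def)
  \<comment> \<open>Any finite index set containing the support may be used, so that sums for
    different elements can be combined.\<close>
  have sup: "ract (twist_mod \<tau> M) m a = (\<Oplus>\<^bsub>M\<^esub>n\<in>F. ract M (hpart M (gr M) n m) (\<tau> n a))"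
    if "m \<in> carrier M" "finite F" "{n. hpart M (gr M) n m \<noteq> \<zero>\<^bsub>M\<^esub>} \<subseteq> F" for m F
    unfolding def by (rule M.add.finprod_mono_neutral_cong_left) (use that a in auto)
  show "ract (twist_mod \<tau> M) m a = ract M m (\<tau> n a)" if m: "m \<in> gr M n" for m n
  proof -
    have c: "m \<in> carrier M" using M.homog_carrier[OF m] .
    have "ract (twist_mod \<tau> M) m a = (\<Oplus>\<^bsub>M\<^esub>k\<in>{n}. ract M (hpart M (gr M) k m) (\<tau> k a))"
      by (rule sup[OF c]) (auto simp: M.hpart_of_homog[OF m])
    then show ?thesis using c a by (simp add: M.hpart_of_homog[OF m])
  qed
  show "ract (twist_mod \<tau> M) m a \<in> carrier M" if m: "m \<in> carrier M" for m
    unfolding def using m a by (intro M.finsum_closed) auto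
  show "ract (twist_mod \<tau> M) (m \<oplus>\<^bsub>M\<^esub> m') a = ract (twist_mod \<tau> M) m a \<oplus>\<^bsub>M\<^esub> ract (twist_mod \<tau> M) m' a"
    if m: "m \<in> carrier M" "m' \<in> carrier M" for m m'
  proof -
    let ?F = "{n. hpart M (gr M) n m \<noteq> \<zero>\<^bsub>M\<^esub>} \<union> {n. hpart M (gr M) n m' \<noteq> \<zero>\<^bsub>M\<^esub>}"
    have F: "finite ?F" using m by simp
    have s: "{n. hpart M (gr M) n (m \<oplus>\<^bsub>M\<^esub> m') \<noteq> \<zero>\<^bsub>M\<^esub>} \<subseteq> ?F"
      using m by (auto simp: M.hpart_add)
    have "ract (twist_mod \<tau> M) (m \<oplus>\<^bsub>M\<^esub> m') a = (\<Oplus>\<^bsub>M\<^esub>n\<in>?F. ract M (hpart M (gr M) n (m \<oplus>\<^bsub>M\<^esub> m')) (\<tau> n a))"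
      by (rule sup[OF _ F s]) (use m in simp)
    also have "\<dots> = (\<Oplus>\<^bsub>M\<^esub>n\<in>?F. ract M (hpart M (gr M) n m) (\<tau> n a) \<oplus>\<^bsub>M\<^esub> ract M (hpart M (gr M) n m') (\<tau> n a))"
      by (rule M.finsum_cong') (use m a in \<open>auto simp: M.hpart_add M.ract_add_left\<close>)
    also have "\<dots> = (\<Oplus>\<^bsub>M\<^esub>n\<in>?F. ract M (hpart M (gr M) n m) (\<tau> n a)) \<oplus>\<^bsub>M\<^esub> (\<Oplus>\<^bsub>M\<^esub>n\<in>?F. ract M (hpart M (gr M) n m') (\<tau> n a))"
      by (rule M.finsum_addf) (use m a in auto)
    also have "\<dots> = ract (twist_mod \<tau> M) m a \<oplus>\<^bsub>M\<^esub> ract (twist_mod \<tau> M) m' a"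
      using sup[OF m(1) F] sup[OF m(2) F] by simp
    finally show ?thesis .
  qed
qed

lemma twist_ract_add_right:
  assumes M: "graded_module A M" and a: "a \<in> carrier A" "b \<in> carrier A" and m: "m \<in> carrier M"
  shows "ract (twist_mod \<tau> M) m (a \<oplus> b) = ract (twist_mod \<tau> M) m a \<oplus>\<^bsub>M\<^esub> ract (twist_mod \<tau> M) m b"
proof -
  interpret M: graded_module A M by fact
  show ?thesis
    using m
  proof (induction m rule: M.graded_induct)
    case (homog n x)
    then show ?case using a M.homog_carrier[OF homog]
      by (simp add: twist_ract_homog[OF M] \<tau>_add M.ract_add_right)
  next
    case (add x y)
    then show ?case using a
      by (simp add: twist_ract_add_left[OF M] twist_ract_closed[OF M] M.a_ac)
  qed
qed

lemma twist_ract_one: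
  assumes M: "graded_module A M" and m: "m \<in> carrier M"
  shows "ract (twist_mod \<tau> M) m \<one> = m"
proof -
  interpret M: graded_module A M by fact
  show ?thesis
    using m
  proof (induction m rule: M.graded_induct)
    case (homog n x)
    then show ?case using M.homog_carrier[OF homog] by (simp add: twist_ract_homog[OF M])
  next
    case (add x y)
    then show ?case by (simp add: twist_ract_add_left[OF M])
  qed
qed

end

text \<open>\<open>\<tau>_mult\<close> is the compatibility that makes the twisted action
  associative over \<open>B\<close>: after \<open>a\<close> of degree \<open>l\<close> has acted on
  degree \<open>n\<close>, the next element acts through \<open>\<tau> (n + l)\<close>. The locale
  stops short of assuming that \<open>B\<close> is a ring, because the associativity of the twisted
  algebra will be obtained from it.\<close>

locale twisting_system = twisting_family A \<tau> for A :: "('k, 'u) galgebra" and \<tau> +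
  fixes B :: "('k, 'u) galgebra"
  assumes B_simps [simp]: "carrier B = carrier A" "\<zero>\<^bsub>B\<^esub> = \<zero>\<^bsub>A\<^esub>" "\<one>\<^bsub>B\<^esub> = \<one>\<^bsub>A\<^esub>" "add B = add A" "homog B = homog A"
    and B_mult_closed: "a \<in> carrier A \<Longrightarrow> b \<in> carrier A \<Longrightarrow> a \<otimes>\<^bsub>B\<^esub> b \<in> carrier A"
    and B_mult_add_left: "a \<in> carrier A \<Longrightarrow> a' \<in> carrier A \<Longrightarrow> b \<in> carrier A \<Longrightarrow>
      (a \<oplus>\<^bsub>A\<^esub> a') \<otimes>\<^bsub>B\<^esub> b = a \<otimes>\<^bsub>B\<^esub> b \<oplus>\<^bsub>A\<^esub> a' \<otimes>\<^bsub>B\<^esub> b"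
    and \<tau>_mult: "a \<in> homog A l \<Longrightarrow> b \<in> carrier A \<Longrightarrow> \<tau> n (a \<otimes>\<^bsub>B\<^esub> b) = \<tau> n a \<otimes>\<^bsub>A\<^esub> \<tau> (n + l) b"
begin

text \<open>Both sides are additive in \<open>m\<close> and in \<open>a\<close>; for homogeneous
  \<open>m\<close> and \<open>a\<close> the claim is \<open>\<tau>_mult\<close>.\<close>

lemma twist_ract_mult:
  assumes M: "graded_module A M" and a: "a \<in> carrier A" "b \<in> carrier A" and m: "m \<in> carrier M"
  shows "ract (twist_mod \<tau> M) m (a \<otimes>\<^bsub>B\<^esub> b) = ract (twist_mod \<tau> M) (ract (twist_mod \<tau> M) m a) b"
proof -
  interpret M: graded_module A M by fact
  show ?thesis
    using m
  proof (induction m rule: M.graded_induct)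
    case (homog k x)
    note xc = M.homog_carrier[OF homog]
    show ?case
      using a(1)
    proof (induction a rule: graded_induct)
      case (homog l c)
      note c = homog_carrier[OF homog]
      have "ract M x (\<tau> k c) \<in> gr M (k + l)" using M.ract_homog[OF \<open>x \<in> gr M k\<close> \<tau>_homog[OF homog]] .
      then show ?case
        using c a(2) xc B_mult_closed
        by (simp add: twist_ract_homog[OF M _ \<open>x \<in> gr M k\<close>] twist_ract_homog[OF M a(2)] \<tau>_mult[OF homog] M.ract_mult)
    next
      case (add c d)
      then show ?case
        using a(2) xc by (simp add: B_mult_add_left B_mult_closed twist_ract_add_right[OF M] twist_ract_add_left[OF M] twist_ract_closed[OF M])
    qed
  next
    case (add x y)
    then show ?case using a
      by (simp add: twist_ract_add_left[OF M] twist_ract_closed[OF M] B_mult_closed)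
  qed
qed

lemma graded_module_twist:
  assumes M: "graded_module A M" and B: "graded_ring B"
  shows "graded_module B (twist_mod \<tau> M)"
proof -
  interpret M: graded_module A M by fact
  have ab: "abelian_group (twist_mod \<tau> M)"
    by (rule abelian_groupI) (auto simp: M.a_ac intro: bexI[of _ "\<ominus>\<^bsub>M\<^esub> x" for x] M.l_neg M.r_neg)
  have "rmodule B (twist_mod \<tau> M)"
    unfolding rmodule_def using ab B
    by (simp add: graded_ring_def twist_ract_closed[OF M] twist_ract_add_left[OF M] twist_ract_add_right[OF M]
        twist_ract_mult[OF M] twist_ract_one[OF M])
  moreover have "graded_by (twist_mod \<tau> M) (gr M)"
    using M.graded unfolding graded_by_def by (simp add: additive_subgroup_def)
  moreover have "ract (twist_mod \<tau> M) m a \<in> gr M (n + k)" if "m \<in> gr M n" "a \<in> homog A k" for m n a k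
    using twist_ract_homog[OF M homog_carrier[OF that(2)] that(1)] M.ract_homog[OF that(1) \<tau>_homog[OF that(2)]] by simp
  ultimately show ?thesis
    using B by (simp add: graded_module_iff graded_rmodule_def)
qed

text \<open>On a pair of common degree \<open>n\<close> the element \<open>a\<close> acts in the
  twist as \<open>\<tau> n a\<close> did before, on both entries, and \<open>\<tau> n a\<close> runs
  through the whole ring.\<close>

lemma grel_twist:
  assumes M: "graded_module A M" and N: "graded_module A N" and B: "graded_ring B"
  shows "grel B (twist_mod \<tau> M) (twist_mod \<tau> N) R \<longleftrightarrow> grel A M N R"
proof -
  have "(\<forall>n x y a. (x, y) \<in> R \<longrightarrow> x \<in> gr M n \<longrightarrow> y \<in> gr N n \<longrightarrow> a \<in> carrier A \<longrightarrow> (ract M x a, ract N y a) \<in> R)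
    \<longleftrightarrow> (\<forall>n x y a. (x, y) \<in> R \<longrightarrow> x \<in> gr M n \<longrightarrow> y \<in> gr N n \<longrightarrow> a \<in> carrier A \<longrightarrow>
       (ract (twist_mod \<tau> M) x a, ract (twist_mod \<tau> N) y a) \<in> R)" (is "?l \<longleftrightarrow> ?r")
  proof
    assume ?l
    then show ?r using twist_ract_homog[OF M] twist_ract_homog[OF N] \<tau>_closed by simp
  next
    assume r: ?r
    show ?l
    proof (intro allI impI)
      fix n x y a assume h: "(x, y) \<in> R" "x \<in> gr M n" "y \<in> gr N n" "a \<in> carrier A"
      then obtain b where b: "b \<in> carrier A" "a = \<tau> n b" using \<tau>_bij[of n] unfolding bij_betw_def by blast
      then show "(ract M x a, ract N y a) \<in> R"
        using r h twist_ract_homog[OF M b(1) h(2)] twist_ract_homog[OF N b(1) h(3)] by metis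
    qed
  qed
  then show ?thesis
    unfolding grel_iff_homogeneous[OF M N] grel_iff_homogeneous[OF graded_module_twist[OF M B] graded_module_twist[OF N B]]
    by simp
qed

text \<open>On degree \<open>n\<close> an element of \<open>ideal_I B\<close> acts as its image
  under \<open>\<tau> n\<close>, which lies in \<open>ideal_I A\<close>; so modules annihilated over
  \<open>A\<close> stay annihilated over \<open>B\<close>.\<close>

lemma relabelling_twist:
  assumes B: "graded_ring B" and I: "\<And>n. \<tau> n ` ideal_I B \<subseteq> ideal_I A" "ideal_I B \<subseteq> carrier A"
    and F: "F = \<lparr>fo = twist_mod \<tau>, fm = (\<lambda>M N f. f)\<rparr>"
  shows "relabelling A B F"
proof -
  have "ract (twist_mod \<tau> M) m a = \<zero>\<^bsub>M\<^esub>"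
    if M: "M \<in> Ob (Gr A)" and z: "\<forall>m\<in>carrier M. \<forall>a\<in>ideal_I A. ract M m a = \<zero>\<^bsub>M\<^esub>"
      and "m \<in> carrier M" and a: "a \<in> ideal_I B" for M m a
  proof -
    note mM = Gr_module[OF M]
    interpret M: graded_module A M by fact
    show ?thesis
      using \<open>m \<in> carrier M\<close>
    proof (induction m rule: M.graded_induct)
      case (homog n x)
      have "\<tau> n a \<in> ideal_I A" "a \<in> carrier A" using I a by auto
      then show ?case using twist_ract_homog[OF mM _ homog] z M.homog_carrier[OF homog] by simp
    next
      case (add x y)
      then show ?case using twist_ract_add_left[OF mM _ add(1,2)] I(2) a by auto
    qed
  qed
  moreover have "twist_mod \<tau> M \<in> Ob (Gr B)" if "M \<in> Ob (Gr A)" for M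
    using graded_module_twist[OF Gr_module[OF that] B] that by (simp add: graded_module_iff)
  moreover have "grel B (twist_mod \<tau> M) (twist_mod \<tau> N) R \<longleftrightarrow> grel A M N R"
    if "M \<in> Ob (Gr A)" "N \<in> Ob (Gr A)" for M N R
    using grel_twist[OF Gr_module Gr_module B, OF that] .
  ultimately show ?thesis
    unfolding F using graded_ring_axioms B
    by (simp add: relabelling_def relabelling_axioms_def del: Gr_simps(1))
qed

end

section \<open>The ideal generated by the components of nonzero degree\<close>

text \<open>A rule for negatives is omitted: the generators to which the span is applied are closed
  under negation.\<close>

inductive_set add_span :: "('a, 'x) ring_scheme \<Rightarrow> 'a set \<Rightarrow> 'a set" for G H where
  zero: "\<zero>\<^bsub>G\<^esub> \<in> add_span G H"
| base: "h \<in> H \<Longrightarrow> h \<in> add_span G H"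
| add: "x \<in> add_span G H \<Longrightarrow> y \<in> add_span G H \<Longrightarrow> x \<oplus>\<^bsub>G\<^esub> y \<in> add_span G H"

definition nonzero_products :: "('k, 'u) galgebra \<Rightarrow> 'u set" where
  "nonzero_products A = {a \<otimes>\<^bsub>A\<^esub> d \<otimes>\<^bsub>A\<^esub> b | a d b i j k. a \<in> homog A i \<and> d \<in> homog A j \<and> b \<in> homog A k \<and> j \<noteq> 0}"

context graded_ring
begin

lemma add_span_closed: "H \<subseteq> carrier A \<Longrightarrow> x \<in> add_span A H \<Longrightarrow> x \<in> carrier A"
  by (rotate_tac, induction rule: add_span.induct) auto

lemma nonzero_products_closed: "nonzero_products A \<subseteq> carrier A"
  unfolding nonzero_products_def using homog_carrier by auto

lemma nonzero_degrees_closed: "d \<in> nonzero_degrees A \<Longrightarrow> d \<in> carrier A"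
  unfolding nonzero_degrees_def using homog_carrier by (auto intro!: finsum_closed)

text \<open>\<open>ideal_I\<close> is an iterated product whose outer factors are arbitrary
  elements. Expanding all three factors into components leaves homogeneous products, for which the
  effect of a twist is explicit.\<close>

lemma ideal_I_eq_span: "ideal_I A = add_span A (nonzero_products A)"
proof
  let ?S = "add_span A (nonzero_products A)"
  have d: "a \<otimes> d \<otimes> b \<in> ?S" if ac: "a \<in> carrier A" and dN: "d \<in> nonzero_degrees A" and bc: "b \<in> carrier A" for a d b
    using ac
  proof (induction a rule: graded_induct)
    case (homog i a)
    note a = homog_carrier[OF homog]
    show ?case
      using bc
    proof (induction b rule: graded_induct)
      case (homog k b)
      note b = homog_carrier[OF homog]
      obtain c S where S: "d = (\<Oplus>n\<in>S. c n)" "finite S" "0 \<notin> S" "\<forall>n\<in>S. c n \<in> homog A n"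
        using dN unfolding nonzero_degrees_def by blast
      have cc: "c n \<in> carrier A" if "n \<in> S" for n using S(4) that homog_carrier by blast
      show ?case
        unfolding S(1)
      proof (rule finsum_induct[where P = "\<lambda>d. a \<otimes> d \<otimes> b \<in> ?S"])
        show "a \<otimes> c n \<otimes> b \<in> ?S" if n: "n \<in> S" for n
        proof -
          have "n \<noteq> 0" using n S(3) by blast
          then have "a \<otimes> c n \<otimes> b \<in> nonzero_products A"
            unfolding nonzero_products_def using \<open>a \<in> homog A i\<close> homog S(4) n by blast
          then show ?thesis by (rule add_span.base)
        qed
        show "a \<otimes> \<zero> \<otimes> b \<in> ?S" using a b add_span.zero[of A] by simp
        show "a \<otimes> (x \<oplus> y) \<otimes> b \<in> ?S" if "x \<in> carrier A" "y \<in> carrier A" "a \<otimes> x \<otimes> b \<in> ?S" "a \<otimes> y \<otimes> b \<in> ?S" for x y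
          using add_span.add[OF that(3,4)] that(1,2) a b by (simp add: l_distr r_distr)
      qed (use S cc in auto)
    next
      case (add x y)
      then show ?case using add_span.add[OF add(3,4)] a nonzero_degrees_closed[OF dN]
        by (simp add: r_distr)
    qed
  next
    case (add x y)
    then show ?case using add_span.add[OF add(3,4)] bc nonzero_degrees_closed[OF dN]
      by (simp add: l_distr)
  qed
  have J: "x \<in> carrier A \<and> (\<forall>b\<in>carrier A. x \<otimes> b \<in> ?S)" if "x \<in> carrier A \<cdot>\<^bsub>A\<^esub> nonzero_degrees A" for x
    using that
  proof (induction rule: ideal_prod.induct)
    case (prod a e)
    then show ?case using d nonzero_degrees_closed by auto
  next
    case (sum x y)
    then show ?case using add_span.add[of _ A "nonzero_products A"] by (simp add: l_distr)
  qed
  show "ideal_I A \<subseteq> ?S"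
  proof
    show "x \<in> ?S" if "x \<in> ideal_I A" for x
      using that unfolding ideal_I_def
    proof (induction rule: ideal_prod.induct)
      case (sum x y)
      then show ?case by (intro add_span.add)
    qed (use J in blast)
  qed
  \<comment> \<open>The empty sum; zero enters \<open>ideal_I A\<close> as a product of three
    zeros.\<close>
  have z: "\<zero> \<in> nonzero_degrees A"
    unfolding nonzero_degrees_def by (intro CollectI exI[of _ "\<lambda>_. \<zero>"] exI[of _ "{}"]) auto
  have h: "e \<in> nonzero_degrees A" if "e \<in> homog A j" "j \<noteq> 0" for e j
    unfolding nonzero_degrees_def
    using that homog_carrier by (intro CollectI exI[of _ "\<lambda>_. e"] exI[of _ "{j}"]) auto
  show "?S \<subseteq> ideal_I A"
  proof
    show "x \<in> ideal_I A" if "x \<in> ?S" for x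
      using that
    proof (induction rule: add_span.induct)
      case zero
      have "\<zero> \<otimes> \<zero> \<otimes> \<zero> \<in> ideal_I A"
        unfolding ideal_I_def by (intro ideal_prod.prod z) auto
      then show ?case by simp
    next
      case (base h')
      then obtain a e b i j k where "h' = a \<otimes> e \<otimes> b" "a \<in> homog A i" "e \<in> homog A j" "b \<in> homog A k" "j \<noteq> 0"
        unfolding nonzero_products_def by blast
      then show ?case
        using h homog_carrier unfolding ideal_I_def by (auto intro!: ideal_prod.prod)
    next
      case (add x y)
      then show ?case unfolding ideal_I_def by (intro ideal_prod.sum)
    qed
  qed
qed

lemma ideal_I_closed: "ideal_I A \<subseteq> carrier A"
  unfolding ideal_I_eq_span using add_span_closed[OF nonzero_products_closed] by blast

end

text \<open>Checked on generators: signs and scalars are absorbed into the left factor, and each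
  generator is homogeneous.\<close>

lemma graded_subspace_ideal_I:
  fixes A :: "('k, 'u) galgebra" (structure)
  assumes A: "graded_algebra K A"
  shows "graded_subspace K A (ideal_I A)"
proof -
  interpret graded_ring A by (rule graded_algebra_graded_ring[OF A])
  interpret K: module K A using A by (simp add: graded_algebra_def)
  note S = ideal_I_eq_span
  have hd: "h \<in> nonzero_products A \<Longrightarrow> \<exists>n. h \<in> homog A n" for h
    unfolding nonzero_products_def using mult_homog by blast
  have "\<zero> \<in> ideal_I A" unfolding S by (rule add_span.zero)
  moreover have add: "x \<oplus> y \<in> ideal_I A" if "x \<in> ideal_I A" "y \<in> ideal_I A" for x y
    using that unfolding S by (rule add_span.add)
  moreover have "\<ominus> x \<in> ideal_I A" if "x \<in> ideal_I A" for x
    using that unfolding S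
  proof (induction rule: add_span.induct)
    case zero
    then show ?case using add_span.zero[of A] by (simp add: add.inv_one)
  next
    case (base h)
    then obtain a e b i j k where h: "h = a \<otimes> e \<otimes> b" "a \<in> homog A i" "e \<in> homog A j" "b \<in> homog A k" "j \<noteq> 0"
      unfolding nonzero_products_def by blast
    have "\<ominus> h = (\<ominus> a) \<otimes> e \<otimes> b" using h homog_carrier by (simp add: l_minus)
    then have "\<ominus> h \<in> nonzero_products A"
      unfolding nonzero_products_def using h homog_a_inv[of a i] by blast
    then show ?case by (rule add_span.base)
  next
    case (add x y)
    have "x \<in> carrier A" "y \<in> carrier A" using add add_span_closed[OF nonzero_products_closed] by auto
    then show ?case using add_span.add[OF add(3,4)] by (simp add: minus_add)
  qed
  moreover have "k \<odot>\<^bsub>A\<^esub> x \<in> ideal_I A" if k: "k \<in> carrier K" and "x \<in> ideal_I A" for k x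
    using that(2) unfolding S
  proof (induction rule: add_span.induct)
    case zero
    then show ?case using add_span.zero[of A] k by (simp add: K.smult_r_null)
  next
    case (base h)
    then obtain a e b i j l where h: "h = a \<otimes> e \<otimes> b" "a \<in> homog A i" "e \<in> homog A j" "b \<in> homog A l" "j \<noteq> 0"
      unfolding nonzero_products_def by blast
    have "k \<odot>\<^bsub>A\<^esub> h = (k \<odot>\<^bsub>A\<^esub> a) \<otimes> e \<otimes> b"
      using A h homog_carrier k unfolding graded_algebra_def by (simp add: homog_carrier)
    moreover have "k \<odot>\<^bsub>A\<^esub> a \<in> homog A i" using A h k unfolding graded_algebra_def by blast
    ultimately have "k \<odot>\<^bsub>A\<^esub> h \<in> nonzero_products A"
      unfolding nonzero_products_def using h by blast
    then show ?case by (rule add_span.base)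
  next
    case (add x y)
    have "x \<in> carrier A" "y \<in> carrier A" using add add_span_closed[OF nonzero_products_closed] by auto
    then show ?case using add_span.add[OF add(3,4)] k by (simp add: K.smult_r_distr)
  qed
  moreover have "hpart A (homog A) n x \<in> ideal_I A" if "x \<in> ideal_I A" for x n
    using that unfolding S
  proof (induction rule: add_span.induct)
    case zero
    then show ?case using add_span.zero[of A] by simp
  next
    case (base h)
    then obtain k where "h \<in> homog A k" using hd by blast
    then show ?case using add_span.zero[of A] add_span.base[OF base, of A] by (simp add: hpart_of_homog)
  next
    case (add x y)
    have "x \<in> carrier A" "y \<in> carrier A" using add add_span_closed[OF nonzero_products_closed] by auto
    then show ?case using add_span.add[OF add(3,4)] by (simp add: hpart_add)
  qed
  ultimately show ?thesis
    unfolding graded_subspace_def using ideal_I_closed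
    by (auto intro!: additive_subgroupI add.subgroupI)
qed

section \<open>Integer powers of the automorphism\<close>

locale zhang_setup =
  fixes K :: "('k, 'x) ring_scheme" and A :: "('k, 'u) galgebra" (structure) and \<sigma> :: "'u \<Rightarrow> 'u"
  assumes A: "graded_algebra K A" and \<sigma>: "graded_automorphism K A \<sigma>"
begin

sublocale graded_ring A by (rule graded_algebra_graded_ring[OF A])

text \<open>These conditions are stable under composition and inversion, hence pass to all integer
  powers; compatibility with scalars is treated where the twisted algebra is built.\<close>

definition automorphic :: "('u \<Rightarrow> 'u) \<Rightarrow> bool" where
  "automorphic f \<longleftrightarrow> bij_betw f (carrier A) (carrier A) \<and> f \<one> = \<one> \<and>
     (\<forall>a\<in>carrier A. \<forall>b\<in>carrier A. f (a \<oplus> b) = f a \<oplus> f b \<and> f (a \<otimes> b) = f a \<otimes> f b) \<and>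
     (\<forall>n. f ` homog A n = homog A n)"

lemma automorphic_\<sigma>: "automorphic \<sigma>"
  using \<sigma> by (auto simp: automorphic_def graded_automorphism_def ring_iso_def ring_hom_def)

lemma automorphic_inv: "automorphic (inv_into (carrier A) \<sigma>)"
proof -
  note s = automorphic_\<sigma>[unfolded automorphic_def]
  then have b: "bij_betw \<sigma> (carrier A) (carrier A)" by simp
  let ?t = "inv_into (carrier A) \<sigma>"
  have ts: "?t (\<sigma> a) = a" if "a \<in> carrier A" for a using b that by (simp add: bij_betw_def)
  have st: "\<sigma> (?t a) = a" if "a \<in> carrier A" for a using b that by (simp add: bij_betw_def f_inv_into_f)
  have tc: "?t a \<in> carrier A" if "a \<in> carrier A" for a using b that by (metis bij_betw_def inv_into_into)
  have "?t (a \<oplus> b) = ?t a \<oplus> ?t b \<and> ?t (a \<otimes> b) = ?t a \<otimes> ?t b" if "a \<in> carrier A" "b \<in> carrier A" for a b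
  proof -
    have "\<sigma> (?t a \<oplus> ?t b) = a \<oplus> b" "\<sigma> (?t a \<otimes> ?t b) = a \<otimes> b" using s tc st that by auto
    then show ?thesis using ts tc that by (metis add.m_closed m_closed)
  qed
  moreover have "?t ` homog A n = homog A n" for n
  proof -
    have "?t ` (\<sigma> ` homog A n) = homog A n"
      using ts homog_carrier by (force simp: image_image)
    then show ?thesis using s by simp
  qed
  moreover have "?t \<one> = \<one>" using ts[of \<one>] s by simp
  ultimately show ?thesis using bij_betw_inv_into[OF b] by (simp add: automorphic_def)
qed

lemma automorphic_comp:
  assumes f: "automorphic f" and g: "automorphic g"
  shows "automorphic (f \<circ> g)"
proof -
  note f' = f[unfolded automorphic_def] and g' = g[unfolded automorphic_def]
  have gc: "g a \<in> carrier A" if "a \<in> carrier A" for a using g' that by (auto simp: bij_betw_def)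
  have "(f \<circ> g) ` homog A n = homog A n" for n
  by (metis f' g' image_comp)
  moreover have "bij_betw (f \<circ> g) (carrier A) (carrier A)"
    by (rule bij_betw_trans[OF g'[THEN conjunct1] f'[THEN conjunct1]])
  moreover have "(f \<circ> g) (a \<oplus> b) = (f \<circ> g) a \<oplus> (f \<circ> g) b \<and> (f \<circ> g) (a \<otimes> b) = (f \<circ> g) a \<otimes> (f \<circ> g) b"
    if ab: "a \<in> carrier A" "b \<in> carrier A" for a b
  by (auto simp: f' g' ab gc)
  moreover have "f \<one> = \<one>" "g \<one> = \<one>" using f' g' by blast+
  then have "(f \<circ> g) \<one> = \<one>" by simp
  ultimately show ?thesis
    unfolding automorphic_def by blast
qed

lemma automorphic_funpow: "automorphic f \<Longrightarrow> automorphic (f ^^ n)"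
proof (induction n)
  case 0
  show ?case by (simp add: automorphic_def bij_betw_def)
next
  case (Suc n)
  then show ?case unfolding funpow.simps(2) by (intro automorphic_comp Suc.prems Suc.IH)
qed

lemma automorphic_zpower: "automorphic (zpower A \<sigma> n)"
  unfolding zpower_def by (simp add: automorphic_funpow automorphic_\<sigma> automorphic_inv)

lemma zpower_zero: "zpower A \<sigma> 0 a = a"
  by (simp add: zpower_def)

lemma zpower_closed [simp]: "a \<in> carrier A \<Longrightarrow> zpower A \<sigma> n a \<in> carrier A"
  using automorphic_zpower[of n] by (auto simp: automorphic_def bij_betw_def)

lemma zpower_homog: "a \<in> homog A k \<Longrightarrow> zpower A \<sigma> n a \<in> homog A k"
  using automorphic_zpower[of n] unfolding automorphic_def by blast

lemma zpower_homog_image: "zpower A \<sigma> n ` homog A k = homog A k"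
  using automorphic_zpower[of n] by (auto simp: automorphic_def)

lemma zpower_add_mult:
  "a \<in> carrier A \<Longrightarrow> b \<in> carrier A \<Longrightarrow> zpower A \<sigma> n (a \<oplus> b) = zpower A \<sigma> n a \<oplus> zpower A \<sigma> n b"
  "a \<in> carrier A \<Longrightarrow> b \<in> carrier A \<Longrightarrow> zpower A \<sigma> n (a \<otimes> b) = zpower A \<sigma> n a \<otimes> zpower A \<sigma> n b"
  "zpower A \<sigma> n \<one> = \<one>"
  using automorphic_zpower[of n] by (auto simp: automorphic_def)

lemma zpower_Suc: "a \<in> carrier A \<Longrightarrow> zpower A \<sigma> (n + 1) a = \<sigma> (zpower A \<sigma> n a)"
proof (cases "0 \<le> n")
  case True
  then show ?thesis by (simp add: zpower_def nat_add_distrib)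
next
  case False
  assume a: "a \<in> carrier A"
  let ?t = "inv_into (carrier A) \<sigma>"
  obtain k where k: "nat (- n) = Suc k" using False by (metis nat_eq_iff2 not0_implies_Suc zero_less_nat_eq neg_0_less_iff_less not_le less_irrefl_nat)
  have c: "(?t ^^ k) a \<in> carrier A"
    using automorphic_funpow[OF automorphic_inv, of k] a by (auto simp: automorphic_def bij_betw_def)
  have "\<sigma> ((?t ^^ Suc k) a) = (?t ^^ k) a"
    using automorphic_\<sigma> c by (simp add: automorphic_def bij_betw_def f_inv_into_f)
  moreover have "zpower A \<sigma> (n + 1) a = (?t ^^ k) a"
  \<comment> \<open>At \<open>-1\<close> the successor is \<open>0\<close>, where
    \<open>zpower\<close> switches from powers of the inverse to powers of
    \<open>\<sigma>\<close>.\<close>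
  proof (cases "n = -1")
    case True
    then show ?thesis using k by (simp add: zpower_def)
  next
    case False
    then have "\<not> 0 \<le> n + 1" "nat (- (n + 1)) = k" using k \<open>\<not> 0 \<le> n\<close> by auto
    then show ?thesis by (simp add: zpower_def)
  qed
  ultimately show ?thesis using False k by (simp add: zpower_def)
qed

text \<open>Induction in both directions; the downward step cancels \<open>\<sigma>\<close> by
  injectivity.\<close>

lemma zpower_add: "a \<in> carrier A \<Longrightarrow> zpower A \<sigma> (m + n) a = zpower A \<sigma> m (zpower A \<sigma> n a)"
proof (induction m rule: int_induct[where k = 0])
  case base
  then show ?case by (simp add: zpower_zero)
next
  case (step1 m)
  then show ?case using zpower_Suc[of a "m + n"] zpower_Suc[of "zpower A \<sigma> n a" m] by (simp add: ac_simps)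
next
  case (step2 m)
  have "\<sigma> (zpower A \<sigma> (m - 1 + n) a) = \<sigma> (zpower A \<sigma> (m - 1) (zpower A \<sigma> n a))"
    using step2 zpower_Suc[of a "m - 1 + n"] zpower_Suc[of "zpower A \<sigma> n a" "m - 1"] by (simp add: ac_simps)
  moreover have "inj_on \<sigma> (carrier A)" using automorphic_\<sigma> by (simp add: automorphic_def bij_betw_def)
  ultimately show ?case using step2(3) by (simp add: inj_on_eq_iff)
qed

lemma zpower_inverse: "a \<in> carrier A \<Longrightarrow> zpower A \<sigma> n (zpower A \<sigma> (- n) a) = a"
  "a \<in> carrier A \<Longrightarrow> zpower A \<sigma> (- n) (zpower A \<sigma> n a) = a"
  using zpower_add[of a n "- n"] zpower_add[of a "- n" n] by (simp_all add: zpower_zero)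

section \<open>The twisted algebra\<close>

abbreviation B where "B \<equiv> zhang_twist A \<sigma>"

lemma B_simps [simp]:
  "carrier B = carrier A" "\<zero>\<^bsub>B\<^esub> = \<zero>" "\<one>\<^bsub>B\<^esub> = \<one>" "add B = add A" "homog B = homog A" "smult B = smult A"
  by (simp_all add: zhang_twist_def)

text \<open>The multiplication of the twist is the twisted action on the regular module. So ring
  laws of the twisted algebra are instances of module laws, and Zhang's functor sends one regular
  module to the other.\<close>

lemma reg_gmod_B: "reg_gmod B = twist_mod (zpower A \<sigma>) (reg_gmod A)"
  unfolding twist_mod_def finsum_reg hpart_reg
  by (simp add: reg_gmod_def zhang_twist_def)

sublocale tf: twisting_family A "zpower A \<sigma>"
  using automorphic_zpower
  by unfold_locales (auto simp: zpower_add_mult zpower_homog automorphic_def)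

lemma B_mult: "a \<otimes>\<^bsub>B\<^esub> b = ract (twist_mod (zpower A \<sigma>) (reg_gmod A)) a b"
  unfolding reg_gmod_B[symmetric] by (simp add: reg_gmod_def)

lemma reg_simps [simp]: "carrier (reg_gmod A) = carrier A" "gr (reg_gmod A) = homog A" "add (reg_gmod A) = add A"
  "ract (reg_gmod A) = monoid.mult A"
  by (simp_all add: reg_gmod_def)

lemma B_mult_homog: "a \<in> homog A l \<Longrightarrow> b \<in> carrier A \<Longrightarrow> a \<otimes>\<^bsub>B\<^esub> b = a \<otimes> zpower A \<sigma> l b"
  unfolding B_mult using tf.twist_ract_homog[OF graded_module_reg, of b a l] by simp

sublocale ts: twisting_system A "zpower A \<sigma>" B
proof unfold_locales
  show "a \<otimes>\<^bsub>B\<^esub> b \<in> carrier A" if "a \<in> carrier A" "b \<in> carrier A" for a b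
    unfolding B_mult using tf.twist_ract_closed[OF graded_module_reg] that by simp
  show "(a \<oplus> a') \<otimes>\<^bsub>B\<^esub> b = a \<otimes>\<^bsub>B\<^esub> b \<oplus> a' \<otimes>\<^bsub>B\<^esub> b" if "a \<in> carrier A" "a' \<in> carrier A" "b \<in> carrier A" for a a' b
    unfolding B_mult using tf.twist_ract_add_left[OF graded_module_reg] that by simp
  show "zpower A \<sigma> n (a \<otimes>\<^bsub>B\<^esub> b) = zpower A \<sigma> n a \<otimes> zpower A \<sigma> (n + l) b" if "a \<in> homog A l" "b \<in> carrier A" for a l b n
    using that homog_carrier[OF that(1)] by (simp add: B_mult_homog zpower_add_mult zpower_add)
qed simp_all

text \<open>Associativity is that of the twisted action on the regular module; the left unit law
  uses that degree zero acts through the zeroth power of \<open>\<sigma>\<close>.\<close>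

lemma ring_B: "ring B"
proof (rule ringI)
  note r = graded_module_reg
  show "abelian_group B"
    by (rule abelian_groupI) (auto simp: a_ac intro: bexI[of _ "\<ominus> x" for x] l_neg r_neg)
  show "monoid B"
  proof (rule monoidI)
    show "a \<otimes>\<^bsub>B\<^esub> b \<otimes>\<^bsub>B\<^esub> c = a \<otimes>\<^bsub>B\<^esub> (b \<otimes>\<^bsub>B\<^esub> c)" if "a \<in> carrier B" "b \<in> carrier B" "c \<in> carrier B" for a b c
      using ts.twist_ract_mult[OF r, of b c a] that unfolding B_mult by simp
    show "\<one>\<^bsub>B\<^esub> \<otimes>\<^bsub>B\<^esub> a = a" if "a \<in> carrier B" for a
      using that B_mult_homog[OF one_homog, of a] by (simp add: zpower_zero)
    show "a \<otimes>\<^bsub>B\<^esub> \<one>\<^bsub>B\<^esub> = a" if "a \<in> carrier B" for a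
      using that tf.twist_ract_one[OF r, of a] unfolding B_mult by simp
  qed (simp_all add: ts.B_mult_closed)
  show "(a \<oplus>\<^bsub>B\<^esub> b) \<otimes>\<^bsub>B\<^esub> c = a \<otimes>\<^bsub>B\<^esub> c \<oplus>\<^bsub>B\<^esub> b \<otimes>\<^bsub>B\<^esub> c" if "a \<in> carrier B" "b \<in> carrier B" "c \<in> carrier B" for a b c
    using ts.B_mult_add_left that by simp
  show "c \<otimes>\<^bsub>B\<^esub> (a \<oplus>\<^bsub>B\<^esub> b) = c \<otimes>\<^bsub>B\<^esub> a \<oplus>\<^bsub>B\<^esub> c \<otimes>\<^bsub>B\<^esub> b" if "a \<in> carrier B" "b \<in> carrier B" "c \<in> carrier B" for a b c
    using tf.twist_ract_add_right[OF r, of a b c] that unfolding B_mult by simp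
qed

lemma finsum_B: "finsum B = finsum A"
  by (rule finsum_eqI) simp_all

lemma graded_by_B: "graded_by B (homog A)"
  using graded unfolding graded_by_def finsum_B additive_subgroup_def by simp

lemma graded_algebra_B: "graded_algebra K B"
proof -
  interpret K: module K A using A by (simp add: graded_algebra_def)
  have sm: "k \<odot>\<^bsub>A\<^esub> a \<in> homog A n" if "k \<in> carrier K" "a \<in> homog A n" for k a n
    using A that by (auto simp: graded_algebra_def)
  have smA: "(k \<odot>\<^bsub>A\<^esub> a) \<otimes> b = k \<odot>\<^bsub>A\<^esub> (a \<otimes> b)" "a \<otimes> (k \<odot>\<^bsub>A\<^esub> b) = k \<odot>\<^bsub>A\<^esub> (a \<otimes> b)"
    if "k \<in> carrier K" "a \<in> carrier A" "b \<in> carrier A" for k a b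
    using A that by (auto simp: graded_algebra_def)
  \<comment> \<open>Linearity of \<open>\<sigma>\<close> extends to all integer powers; negative
    ones are reached by cancelling \<open>\<sigma>\<close>.\<close>
  have smz: "zpower A \<sigma> n (k \<odot>\<^bsub>A\<^esub> b) = k \<odot>\<^bsub>A\<^esub> zpower A \<sigma> n b" if k: "k \<in> carrier K" and b: "b \<in> carrier A" for n k b
  proof -
    have s: "\<sigma> (k \<odot>\<^bsub>A\<^esub> c) = k \<odot>\<^bsub>A\<^esub> \<sigma> c" if "c \<in> carrier A" for c
      using \<sigma> k that by (auto simp: graded_automorphism_def)
    have inj: "inj_on \<sigma> (carrier A)" using automorphic_\<sigma> by (simp add: automorphic_def bij_betw_def)
    show ?thesis
    proof (induction n rule: int_induct[where k = 0])
      case base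
      then show ?case by (simp add: zpower_zero)
    next
      case (step1 n)
      then show ?case using zpower_Suc[of _ n] b k s by simp
    next
      case (step2 n)
      have "\<sigma> (zpower A \<sigma> (n - 1) (k \<odot>\<^bsub>A\<^esub> b)) = \<sigma> (k \<odot>\<^bsub>A\<^esub> zpower A \<sigma> (n - 1) b)"
        using zpower_Suc[of _ "n - 1"] b k s step2 by simp
      then show ?case using inj b k by (simp add: inj_on_eq_iff)
    qed
  qed
  have "cring K" using A by (simp add: graded_algebra_def field_def domain_def)
  then have "module K B"
    by (rule moduleI)
      (simp_all add: ring.is_abelian_group[OF ring_B] K.smult_l_distr K.smult_r_distr K.smult_assoc1)
  moreover have "(k \<odot>\<^bsub>A\<^esub> a) \<otimes>\<^bsub>B\<^esub> b = k \<odot>\<^bsub>A\<^esub> (a \<otimes>\<^bsub>B\<^esub> b) \<and> a \<otimes>\<^bsub>B\<^esub> (k \<odot>\<^bsub>A\<^esub> b) = k \<odot>\<^bsub>A\<^esub> (a \<otimes>\<^bsub>B\<^esub> b)"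
    if k: "k \<in> carrier K" and a: "a \<in> carrier A" and b: "b \<in> carrier A" for k a b
    using a
  proof (induction a rule: graded_induct)
    case (homog n x)
    then show ?case using k b homog_carrier[OF homog]
      by (simp add: B_mult_homog[OF homog] B_mult_homog[OF sm[OF k homog]] smA smz)
  next
    case (add x y)
    then show ?case using k b
      by (simp add: ts.B_mult_add_left K.smult_r_distr ts.B_mult_closed)
  qed
  moreover have "a \<otimes>\<^bsub>B\<^esub> b \<in> homog A (n + m)" if "a \<in> homog A n" "b \<in> homog A m" for a b n m
    using B_mult_homog[OF that(1) homog_carrier[OF that(2)]] mult_homog[OF that(1) zpower_homog[OF that(2)]] by simp
  ultimately show ?thesis
    using A ring_B graded_by_B by (simp add: graded_algebra_def)
qed

lemma graded_ring_B: "graded_ring B"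
  by (rule graded_algebra_graded_ring[OF graded_algebra_B])

text \<open>For \<open>a\<close>, \<open>d\<close>, \<open>b\<close> of degrees \<open>i\<close>,
  \<open>j\<close>, \<open>k\<close>, the twisted product applies the power \<open>i\<close> of
  \<open>\<sigma>\<close> to \<open>d\<close> and the power \<open>i + j\<close> to
  \<open>b\<close>, because the product of \<open>a\<close> and \<open>d\<close> has degree
  \<open>i + j\<close>. For the converse, \<open>d\<close> and \<open>b\<close> are replaced by
  their preimages under these powers.\<close>

lemma nonzero_products_B: "nonzero_products B = nonzero_products A"
proof (intro subset_antisym subsetI)
  fix h assume "h \<in> nonzero_products B"
  then obtain a d b i j k where h: "h = a \<otimes>\<^bsub>B\<^esub> d \<otimes>\<^bsub>B\<^esub> b" "a \<in> homog A i" "d \<in> homog A j" "b \<in> homog A k" "j \<noteq> 0"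
    unfolding nonzero_products_def by auto
  have 1: "a \<otimes>\<^bsub>B\<^esub> d = a \<otimes> zpower A \<sigma> i d" using B_mult_homog[OF h(2) homog_carrier[OF h(3)]] .
  have "h = a \<otimes> zpower A \<sigma> i d \<otimes> zpower A \<sigma> (i + j) b"
    unfolding h(1) 1 by (rule B_mult_homog[OF mult_homog[OF h(2) zpower_homog[OF h(3)]] homog_carrier[OF h(4)]])
  then show "h \<in> nonzero_products A"
    unfolding nonzero_products_def using h zpower_homog[OF h(3)] zpower_homog[OF h(4)] by blast
next
  fix h assume "h \<in> nonzero_products A"
  then obtain a d b i j k where h: "h = a \<otimes> d \<otimes> b" "a \<in> homog A i" "d \<in> homog A j" "b \<in> homog A k" "j \<noteq> 0"
    unfolding nonzero_products_def by auto
  obtain d' where d: "d' \<in> homog A j" "d = zpower A \<sigma> i d'" using h(3) zpower_homog_image[of i j] by blast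
  obtain b' where b: "b' \<in> homog A k" "b = zpower A \<sigma> (i + j) b'" using h(4) zpower_homog_image[of "i + j" k] by blast
  have 1: "a \<otimes>\<^bsub>B\<^esub> d' = a \<otimes> d" using B_mult_homog[OF h(2) homog_carrier[OF d(1)]] d by simp
  have "h = a \<otimes>\<^bsub>B\<^esub> d' \<otimes>\<^bsub>B\<^esub> b'"
    unfolding h(1) 1 b(2) by (rule B_mult_homog[OF mult_homog[OF h(2,3)] homog_carrier[OF b(1)], symmetric])
  then show "h \<in> nonzero_products B"
    unfolding nonzero_products_def B_simps using h(2,5) d(1) b(1) by blast
qed

lemma ideal_I_B: "ideal_I B = ideal_I A"
proof -
  have "add_span B H = add_span A H" for H
  proof (intro subset_antisym subsetI)
    show "x \<in> add_span A H" if "x \<in> add_span B H" for x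
      using that by (induction rule: add_span.induct) (auto intro: add_span.intros)
    show "x \<in> add_span B H" if "x \<in> add_span A H" for x
      using that
    proof (induction rule: add_span.induct)
      case zero
      then show ?case using add_span.zero[of B H] by simp
    next
      case (add x y)
      then show ?case using add_span.add[of x B H y] by simp
    qed (rule add_span.base)
  qed
  then show ?thesis
    unfolding ideal_I_eq_span graded_ring.ideal_I_eq_span[OF graded_ring_B] nonzero_products_B .
qed

text \<open>Serves the transport of annihilated modules: a twisted action applies powers of
  \<open>\<sigma>\<close> to elements of the ideal.\<close>

lemma zpower_ideal_I: "zpower A \<sigma> n ` ideal_I A \<subseteq> ideal_I A"
proof
  fix y assume "y \<in> zpower A \<sigma> n ` ideal_I A"
  then obtain x where x: "x \<in> ideal_I A" "y = zpower A \<sigma> n x" by auto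
  have "zpower A \<sigma> n x \<in> add_span A (nonzero_products A)"
    using x(1) unfolding ideal_I_eq_span
  proof (induction rule: add_span.induct)
    case zero
    have "zpower A \<sigma> n \<zero> = \<zero>"
      using zpower_add_mult(1)[of \<zero> \<zero> n] add.l_cancel_one[of "zpower A \<sigma> n \<zero>" "zpower A \<sigma> n \<zero>"] by simp
    then show ?case using add_span.zero[of A] by simp
  next
    case (base h)
    then obtain a d b i j k where h: "h = a \<otimes> d \<otimes> b" "a \<in> homog A i" "d \<in> homog A j" "b \<in> homog A k" "j \<noteq> 0"
      unfolding nonzero_products_def by auto
    have "zpower A \<sigma> n h = zpower A \<sigma> n a \<otimes> zpower A \<sigma> n d \<otimes> zpower A \<sigma> n b"
      using h homog_carrier by (simp add: zpower_add_mult)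
    then have "zpower A \<sigma> n h \<in> nonzero_products A"
      unfolding nonzero_products_def using h zpower_homog by blast
    then show ?case by (rule add_span.base)
  next
    case (add u v)
    have "u \<in> carrier A" "v \<in> carrier A" using add add_span_closed[OF nonzero_products_closed] by auto
    then show ?case using add_span.add[OF add(3,4)] by (simp add: zpower_add_mult)
  qed
  then show "y \<in> ideal_I A" unfolding x(2) ideal_I_eq_span .
qed

section \<open>Zhang's equivalence and its inverse\<close>

definition untwist :: "(('u, 'u) gmod, 'u \<Rightarrow> 'u, ('u, 'u) gmod, 'u \<Rightarrow> 'u) fnc" where
  "untwist = \<lparr>fo = twist_mod (\<lambda>n. zpower A \<sigma> (- n)), fm = (\<lambda>M N f. f)\<rparr>"

lemma zhang_functor_eq: "zhang_functor A \<sigma> = \<lparr>fo = twist_mod (zpower A \<sigma>), fm = (\<lambda>M N f. f)\<rparr>"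
  unfolding zhang_functor_def twist_mod_def ..

lemma relabelling_zhang: "relabelling A B (zhang_functor A \<sigma>)"
  by (rule ts.relabelling_twist[OF graded_ring_B _ _ zhang_functor_eq])
    (use zpower_ideal_I ideal_I_B ideal_I_closed in auto)

text \<open>The original algebra is a twist of the twisted one: multiplying in \<open>B\<close> by
  an element of degree \<open>l\<close> on the left raises the exponent \<open>- (n + l)\<close> on
  \<open>b\<close> to \<open>- n\<close>, and what remains is multiplicativity of the power
  \<open>- n\<close> in \<open>A\<close>.\<close>

lemma twisting_system_inverse: "twisting_system B (\<lambda>n. zpower A \<sigma> (- n)) A"
proof -
  interpret B: graded_ring B by (rule graded_ring_B)
  show ?thesis
  proof unfold_locales
    show "bij_betw (zpower A \<sigma> (- n)) (carrier B) (carrier B)" for n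
      using tf.\<tau>_bij[of "- n"] by simp
    show "zpower A \<sigma> (- n) (a \<otimes> b) = zpower A \<sigma> (- n) a \<otimes>\<^bsub>B\<^esub> zpower A \<sigma> (- (n + l)) b"
      if "a \<in> homog B l" "b \<in> carrier B" for a b l n
    proof -
      have a: "a \<in> homog A l" "a \<in> carrier A" "b \<in> carrier A" using that homog_carrier by auto
      have "zpower A \<sigma> (- n) a \<otimes>\<^bsub>B\<^esub> zpower A \<sigma> (- (n + l)) b = zpower A \<sigma> (- n) a \<otimes> zpower A \<sigma> l (zpower A \<sigma> (- (n + l)) b)"
        by (rule B_mult_homog[OF zpower_homog[OF a(1)]]) (use a in simp)
      also have "zpower A \<sigma> l (zpower A \<sigma> (- (n + l)) b) = zpower A \<sigma> (- n) b"
        using zpower_add[of b l "- (n + l)"] a by simp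
      finally show ?thesis using a by (simp add: zpower_add_mult)
    qed
  qed (simp_all add: zpower_add_mult zpower_homog l_distr)
qed

lemma relabelling_untwist: "relabelling B A untwist"
  by (rule twisting_system.relabelling_twist[OF twisting_system_inverse graded_ring_axioms _ _ untwist_def])
    (use zpower_ideal_I ideal_I_B ideal_I_closed in auto)

lemma twist_twist_grel:
  assumes C: "graded_ring C" "carrier C = carrier A" and M: "graded_module C M" "graded_module C (twist_mod \<tau>' (twist_mod \<tau> M))"
    and eq: "\<And>n x a. x \<in> gr M n \<Longrightarrow> a \<in> carrier A \<Longrightarrow> ract (twist_mod \<tau>' (twist_mod \<tau> M)) x a = ract M x a"
  shows "grel C M (twist_mod \<tau>' (twist_mod \<tau> M)) (Id_on (carrier M))"
proof -
  interpret M: graded_module C M by (rule M(1))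
  show ?thesis
    unfolding grel_iff_homogeneous[OF M] using eq C(2) by auto
qed

lemma relabelling_pair_zhang: "relabelling_pair A B (zhang_functor A \<sigma>) untwist"
proof -
  interpret F: relabelling A B "zhang_functor A \<sigma>" by (rule relabelling_zhang)
  interpret G: relabelling B A untwist by (rule relabelling_untwist)
  note tract' = twisting_family.twist_ract_homog[OF twisting_system.axioms(1)[OF twisting_system_inverse]]
  show ?thesis
  proof unfold_locales
    fix M assume M: "M \<in> Ob (Gr A)"
    note mM = Gr_module[OF M] and mF = F.B.Gr_module[OF F.F_Ob[OF M], unfolded zhang_functor_eq fnc.simps]
    note mG = Gr_module[OF G.F_Ob[OF F.F_Ob[OF M]], unfolded zhang_functor_eq untwist_def fnc.simps]
    show "grel A M (fo untwist (fo (zhang_functor A \<sigma>) M)) (Id_on (carrier M))"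
      unfolding zhang_functor_eq untwist_def fnc.simps
      by (auto simp: twist_twist_grel graded_ring_axioms mM mG tract' mF tf.twist_ract_homog zpower_inverse)
  next
    fix N assume N: "N \<in> Ob (Gr B)"
    note mN = F.B.Gr_module[OF N] and mG = Gr_module[OF G.F_Ob[OF N], unfolded untwist_def fnc.simps]
    note mF = F.B.Gr_module[OF F.F_Ob[OF G.F_Ob[OF N]], unfolded zhang_functor_eq untwist_def fnc.simps]
    show "grel B N (fo (zhang_functor A \<sigma>) (fo untwist N)) (Id_on (carrier N))"
      unfolding zhang_functor_eq untwist_def fnc.simps
      by (auto simp: twist_twist_grel graded_ring_B mN mF tf.twist_ract_homog mG tract' zpower_inverse)
  qed
qed

lemma zhang_reg: "fo (zhang_functor A \<sigma>) (reg_gmod A) = reg_gmod B"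
  unfolding zhang_functor_eq reg_gmod_B by simp

end

section \<open>Modules over the degree zero part\<close>

lemma RMod_simps [simp]:
  "Ob (RMod R) = {M. rmodule R M \<and> small (carrier M)}" "Hom (RMod R) = rhom R"
  "Idt (RMod R) M = (\<lambda>x\<in>carrier M. x)" "Cmp (RMod R) L M N g f = compose (carrier L) g f"
  by (simp_all add: RMod_def)

lemma rhomD:
  assumes "f \<in> rhom R M N"
  shows "f \<in> extensional (carrier M)" "\<And>x. x \<in> carrier M \<Longrightarrow> f x \<in> carrier N"
    "\<And>x y. x \<in> carrier M \<Longrightarrow> y \<in> carrier M \<Longrightarrow> f (x \<oplus>\<^bsub>M\<^esub> y) = f x \<oplus>\<^bsub>N\<^esub> f y"
    "\<And>x a. x \<in> carrier M \<Longrightarrow> a \<in> carrier R \<Longrightarrow> f (ract M x a) = ract N (f x) a"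
  using assms by (auto simp: rhom_def PiE_def)

lemma rhomI:
  assumes "f \<in> extensional (carrier M)" "\<And>x. x \<in> carrier M \<Longrightarrow> f x \<in> carrier N"
    "\<And>x y. x \<in> carrier M \<Longrightarrow> y \<in> carrier M \<Longrightarrow> f (x \<oplus>\<^bsub>M\<^esub> y) = f x \<oplus>\<^bsub>N\<^esub> f y"
    "\<And>x a. x \<in> carrier M \<Longrightarrow> a \<in> carrier R \<Longrightarrow> f (ract M x a) = ract N (f x) a"
  shows "f \<in> rhom R M N"
  using assms by (auto simp: rhom_def PiE_def)

lemma rhom_zero:
  assumes "rmodule R M" "rmodule R N" "f \<in> rhom R M N"
  shows "f \<zero>\<^bsub>M\<^esub> = \<zero>\<^bsub>N\<^esub>"
proof -
  interpret M: right_module R M by (rule right_moduleI[OF assms(1)])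
  interpret N: right_module R N by (rule right_moduleI[OF assms(2)])
  show ?thesis
    using rhomD(3)[OF assms(3), of "\<zero>\<^bsub>M\<^esub>" "\<zero>\<^bsub>M\<^esub>"] rhomD(2)[OF assms(3), of "\<zero>\<^bsub>M\<^esub>"]
      N.add.l_cancel_one[of "f \<zero>\<^bsub>M\<^esub>" "f \<zero>\<^bsub>M\<^esub>"] by simp
qed

lemma ghom_rhom: "f \<in> ghom A M N \<longleftrightarrow> f \<in> rhom A M N \<and> (\<forall>n. \<forall>x\<in>gr M n. f x \<in> gr N n)"
  by (auto simp: ghom_def)

lemma category_RMod: "category (RMod R)"
proof -
  have c: "compose (carrier M) g f \<in> rhom R M P" if "rmodule R M" "f \<in> rhom R M N" "g \<in> rhom R N P" for M N P f g
  proof -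
    interpret right_module R M by (rule right_moduleI[OF that(1)])
    show ?thesis
      by (rule rhomI) (simp_all add: compose_eq rhomD[OF that(2)] rhomD[OF that(3)])
  qed
  have i: "(\<lambda>x\<in>carrier M. x) \<in> rhom R M M" if "rmodule R M" for M
  proof -
    interpret right_module R M by (rule right_moduleI[OF that])
    show ?thesis by (rule rhomI) simp_all
  qed
  show ?thesis
    unfolding category_def
  proof (intro conjI ballI)
    fix M N f assume "f \<in> Hom (RMod R) M N"
    then have f: "f \<in> rhom R M N" by simp
    then have "f \<in> carrier M \<rightarrow> carrier N" "f \<in> extensional (carrier M)"
      using rhomD(1)[OF f] rhomD(2)[OF f] by auto
    then show "Cmp (RMod R) M M N f (Idt (RMod R) M) = f" "Cmp (RMod R) M N N (Idt (RMod R) N) f = f"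
      by (auto simp: fun_eq_iff compose_def extensional_def)
  next
    fix L M N P f g h assume "f \<in> Hom (RMod R) L M"
    then show "Cmp (RMod R) L M P (Cmp (RMod R) M N P h g) f = Cmp (RMod R) L N P h (Cmp (RMod R) L M N g f)"
      using rhomD(2)[of f R L M] by (auto simp: compose_def fun_eq_iff)
  qed (auto intro: c i)
qed

lemma rhom_bij_inverse:
  assumes M: "rmodule R M" and N: "rmodule R N" and f: "f \<in> rhom R M N" and b: "bij_betw f (carrier M) (carrier N)"
  shows "inverse_arrows (RMod R) M N f (restrict (inv_into (carrier M) f) (carrier N))"
proof -
  interpret M: right_module R M by (rule right_moduleI[OF M])
  interpret N: right_module R N by (rule right_moduleI[OF N])
  define g where "g = restrict (inv_into (carrier M) f) (carrier N)"
  have gc: "g y \<in> carrier M" "f (g y) = y" if "y \<in> carrier N" for y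
    using b that by (auto simp: g_def bij_betw_def inv_into_into f_inv_into_f)
  have gf: "g (f x) = x" if "x \<in> carrier M" for x
    using b that rhomD(2)[OF f] by (auto simp: g_def bij_betw_def)
  have "g \<in> rhom R N M"
  proof (rule rhomI)
    show "g \<in> extensional (carrier N)" by (simp add: g_def)
    show "g y \<in> carrier M" if "y \<in> carrier N" for y using gc that by blast
    show "g (x \<oplus>\<^bsub>N\<^esub> y) = g x \<oplus>\<^bsub>M\<^esub> g y" if "x \<in> carrier N" "y \<in> carrier N" for x y
      using gf[of "g x \<oplus>\<^bsub>M\<^esub> g y"] gc[OF that(1)] gc[OF that(2)] rhomD(3)[OF f gc(1) gc(1), OF that] by simp
    show "g (ract N x a) = ract M (g x) a" if "x \<in> carrier N" "a \<in> carrier R" for x a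
      using gf[of "ract M (g x) a"] gc[OF that(1)] rhomD(4)[OF f gc(1), OF that] that by simp
  qed
  then show ?thesis
    unfolding g_def[symmetric] using f gc gf rhomD(2)[OF f]
    by (auto simp: inverse_arrows_def compose_def fun_eq_iff)
qed

lemma deg0_simps [simp]:
  "carrier (deg0 A) = homog A 0" "add (deg0 A) = add A" "monoid.mult (deg0 A) = monoid.mult A"
  "\<zero>\<^bsub>deg0 A\<^esub> = \<zero>\<^bsub>A\<^esub>" "\<one>\<^bsub>deg0 A\<^esub> = \<one>\<^bsub>A\<^esub>" "smult (deg0 A) = smult A"
  by (simp_all add: deg0_def)

lemma deg0_functor_simps [simp]:
  "carrier (fo (deg0_functor A) M) = gr M 0" "\<zero>\<^bsub>fo (deg0_functor A) M\<^esub> = \<zero>\<^bsub>M\<^esub>"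
  "add (fo (deg0_functor A) M) = add M"
  "ract (fo (deg0_functor A) M) = (\<lambda>m\<in>gr M 0. \<lambda>a\<in>homog A 0. ract M m a)"
  "fm (deg0_functor A) M N f = restrict f (gr M 0)"
  by (simp_all add: deg0_functor_def)

section \<open>The functor of degree zero parts\<close>

context graded_ring
begin

lemma deg0_mult: "a \<in> homog A 0 \<Longrightarrow> b \<in> homog A 0 \<Longrightarrow> a \<otimes> b \<in> homog A 0"
  using mult_homog[of a 0 b 0] by simp

lemma ring_deg0: "ring (deg0 A)"
proof (rule ringI)
  have "\<exists>y\<in>homog A 0. x \<oplus> y = \<zero>" if "x \<in> homog A 0" for x
    using r_neg[OF homog_carrier[OF that]] homog_a_inv[OF that] by blast
  then show "abelian_group (deg0 A)"
    by (intro abelian_groupI) (auto simp: homog_add homog_carrier a_ac)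
  show "monoid (deg0 A)"
    by (rule monoidI) (auto simp: deg0_mult homog_carrier m_assoc)
qed (auto simp: homog_carrier l_distr r_distr)

lemma rmodule_deg0:
  assumes M: "graded_module A M"
  shows "rmodule (deg0 A) (fo (deg0_functor A) M)"
proof -
  interpret M: graded_module A M by fact
  have "\<exists>y\<in>gr M 0. x \<oplus>\<^bsub>M\<^esub> y = \<zero>\<^bsub>M\<^esub>" if "x \<in> gr M 0" for x
    using M.r_neg[OF M.homog_carrier[OF that]] M.homog_a_inv[OF that] by blast
  then have ab: "abelian_group (fo (deg0_functor A) M)"
    by (intro abelian_groupI) (auto simp: M.homog_add M.homog_carrier M.a_ac)
  have "ract M m a \<in> gr M 0" if "m \<in> gr M 0" "a \<in> homog A 0" for m a
    using M.ract_homog[OF that] by simp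
  then show ?thesis
    unfolding rmodule_def using ab ring_deg0
    by (simp add: M.homog_add homog_add deg0_mult M.homog_carrier homog_carrier M.ract_add_left M.ract_add_right M.ract_mult)
qed

lemma deg0_functor_Ob: "M \<in> Ob (Gr A) \<Longrightarrow> fo (deg0_functor A) M \<in> Ob (RMod (deg0 A))"
proof -
  assume M: "M \<in> Ob (Gr A)"
  interpret M: graded_module A M by (rule Gr_module[OF M])
  have "small (gr M 0)" using M small_subset[of "carrier M" "gr M 0"] M.homog_carrier by auto
  then show ?thesis using rmodule_deg0[OF Gr_module[OF M]] by simp
qed

lemma deg0_functor_Hom:
  assumes M: "graded_module A M" and f: "f \<in> ghom A M N"
  shows "restrict f (gr M 0) \<in> rhom (deg0 A) (fo (deg0_functor A) M) (fo (deg0_functor A) N)"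
proof -
  interpret M: graded_module A M by fact
  have r: "f \<in> rhom A M N" and g: "\<And>n x. x \<in> gr M n \<Longrightarrow> f x \<in> gr N n" using f by (auto simp: ghom_rhom)
  have "ract M m a \<in> gr M 0" if "m \<in> gr M 0" "a \<in> homog A 0" for m a
    using M.ract_homog[OF that] by simp
  then show ?thesis
    by (intro rhomI) (simp_all add: g M.homog_add rhomD[OF r] M.homog_carrier homog_carrier)
qed

lemma is_functor_deg0: "is_functor (Gr A) (RMod (deg0 A)) (deg0_functor A)"
proof (rule is_functorI[OF category_Gr[OF graded_ring_axioms] category_RMod deg0_functor_Ob])
  fix M assume "M \<in> Ob (Gr A)"
  then interpret M: graded_module A M by (rule Gr_module)
  show "fm (deg0_functor A) M M (Idt (Gr A) M) = Idt (RMod (deg0 A)) (fo (deg0_functor A) M)"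
    using M.homog_carrier by (auto simp: fun_eq_iff)
next
  fix M N f assume "M \<in> Ob (Gr A)" "N \<in> Ob (Gr A)" "f \<in> Hom (Gr A) M N"
  then show "fm (deg0_functor A) M N f \<in> Hom (RMod (deg0 A)) (fo (deg0_functor A) M) (fo (deg0_functor A) N)"
    using deg0_functor_Hom[OF Gr_module] by simp
next
  fix M N P f g assume "M \<in> Ob (Gr A)" and f: "f \<in> Hom (Gr A) M N"
  then interpret M: graded_module A M by (intro Gr_module)
  have "f x \<in> gr N 0" if "x \<in> gr M 0" for x using f that by (auto simp: ghom_rhom)
  then show "fm (deg0_functor A) M P (Cmp (Gr A) M N P g f) =
    Cmp (RMod (deg0 A)) (fo (deg0_functor A) M) (fo (deg0_functor A) N) (fo (deg0_functor A) P)
     (fm (deg0_functor A) N P g) (fm (deg0_functor A) M N f)"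
    using M.homog_carrier by (auto simp: fun_eq_iff compose_def)
qed

end

section \<open>Strongly graded rings\<close>

locale strongly_graded_ring = graded_ring A for A :: "('k, 'u) galgebra" (structure) +
  assumes strong: "homog A n \<cdot>\<^bsub>A\<^esub> homog A m = homog A (n + m)"
begin

text \<open>As \<open>1\<close> is a sum of products of elements of degrees \<open>-n\<close> and \<open>n\<close>, additive statements about
  \<open>1\<close> can be checked on such products.\<close>

lemma one_induct [case_names mult add]:
  assumes "\<And>u v. u \<in> homog A (- n) \<Longrightarrow> v \<in> homog A n \<Longrightarrow> P (u \<otimes> v)"
    "\<And>a b. a \<in> homog A 0 \<Longrightarrow> b \<in> homog A 0 \<Longrightarrow> P a \<Longrightarrow> P b \<Longrightarrow> P (a \<oplus> b)"
  shows "P \<one>"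
proof -
  have "\<one> \<in> homog A (- n) \<cdot>\<^bsub>A\<^esub> homog A n" using strong[of "- n" n] by simp
  then have "\<one> \<in> homog A 0 \<and> P \<one>"
  proof (induction rule: ideal_prod.induct)
    case (prod u v)
    then show ?case using assms(1) mult_homog[of u "- n" v n] by simp
  next
    case (sum a b)
    then show ?case using assms(2) homog_add by blast
  qed
  then show ?thesis by simp
qed

lemma one_in_ideal_I: "\<one> \<in> ideal_I A"
  unfolding ideal_I_eq_span
proof (induction rule: one_induct[of 1])
  case (mult u v)
  \<comment> \<open>The middle factor \<open>u\<close> has the nonzero degree
    \<open>-1\<close>.\<close>
  then have "u \<otimes> v = \<one> \<otimes> u \<otimes> v" using homog_carrier by simp
  then have "u \<otimes> v \<in> nonzero_products A"
    unfolding nonzero_products_def using mult one_homog by (metis (mono_tags, lifting) mem_Collect_eq one_neq_neg_one zero_neq_neg_one)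
  then show ?case by (rule add_span.base)
qed (rule add_span.add)

section \<open>Vanishing of torsion\<close>

text \<open>Zero modules form a localizing class, and a module annihilated by the ideal is zero
  because the ideal contains \<open>\<one>\<close>.\<close>

lemma Tors_zero: "M \<in> Tors A \<Longrightarrow> carrier M = {\<zero>\<^bsub>M\<^esub>}"
proof -
  let ?T = "{M \<in> Ob (Gr A). carrier M = {\<zero>\<^bsub>M\<^esub>}}"
  have z: "\<zero>\<^bsub>M\<^esub> \<in> carrier M" if "M \<in> Ob (Gr A)" for M
  proof -
    interpret M: graded_module A M by (rule Gr_module[OF that])
    show ?thesis by simp
  qed
  have "localizing A ?T"
  proof (rule localizingI)
    show "?T \<subseteq> Ob (Gr A)" by blast
  next
    fix M N f assume h: "M \<in> ?T" "N \<in> Ob (Gr A)" "f \<in> ghom A N M" "inj_on f (carrier N)"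
    have "f x = \<zero>\<^bsub>M\<^esub>" if "x \<in> carrier N" for x using ghom_closed[OF h(3)] h(1) that by auto
    then have "carrier N = {\<zero>\<^bsub>N\<^esub>}" using inj_onD[OF h(4)] z[OF h(2)] by (metis (no_types, opaque_lifting) is_singletonI' is_singleton_def singletonD empty_iff)
    then show "N \<in> ?T" using h by simp
  next
    fix M N f assume h: "M \<in> ?T" "N \<in> Ob (Gr A)" "f \<in> ghom A M N" "f ` carrier M = carrier N"
    have "carrier N = {f \<zero>\<^bsub>M\<^esub>}" using h(1,4) by auto
    then show "N \<in> ?T" using h(2) z[OF h(2)] by simp
  next
    fix L M N f g assume h: "L \<in> ?T" "N \<in> ?T" "M \<in> Ob (Gr A)" "f \<in> ghom A L M" "g \<in> ghom A M N"
      "f ` carrier L = {x \<in> carrier M. g x = \<zero>\<^bsub>N\<^esub>}"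
    have "g x = \<zero>\<^bsub>N\<^esub>" if "x \<in> carrier M" for x using ghom_closed[OF h(5)] h(2) that by auto
    then have "carrier M = f ` carrier L" using h(6) by auto
    then have "carrier M = {f \<zero>\<^bsub>L\<^esub>}" using h(1) by auto
    then show "M \<in> ?T" using h(3) z[OF h(3)] by simp
  next
    fix J Y \<iota> S assume h: "S \<in> Ob (Gr A)" "\<And>j. j \<in> J \<Longrightarrow> Y j \<in> ?T" "is_direct_sum A J Y S \<iota>"
    interpret S: graded_module A S by (rule Gr_module[OF h(1)])
    have "x = \<zero>\<^bsub>S\<^esub>" if "x \<in> carrier S" for x
    proof -
      obtain c where c: "c \<in> (\<Pi>\<^sub>E j\<in>J. carrier (Y j))"
        "x = (\<Oplus>\<^bsub>S\<^esub>j\<in>{j\<in>J. c j \<noteq> \<zero>\<^bsub>Y j\<^esub>}. \<iota> j (c j))"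
        using h(3) \<open>x \<in> carrier S\<close> unfolding is_direct_sum_def by blast
      have "c j = \<zero>\<^bsub>Y j\<^esub>" if "j \<in> J" for j
        using PiE_mem[OF c(1) that] h(2)[OF that] by auto
      then have "{j\<in>J. c j \<noteq> \<zero>\<^bsub>Y j\<^esub>} = {}" by blast
      then show ?thesis using c(2) by (metis S.finsum_empty)
    qed
    then show "S \<in> ?T" using h(1) z[OF h(1)] by auto
  qed
  moreover have "M \<in> ?T" if M: "M \<in> Ob (Gr A)" "\<forall>m\<in>carrier M. \<forall>a\<in>ideal_I A. ract M m a = \<zero>\<^bsub>M\<^esub>" for M
  proof -
    interpret M: graded_module A M by (rule Gr_module[OF M(1)])
    have "m = \<zero>\<^bsub>M\<^esub>" if "m \<in> carrier M" for m using M(2) that one_in_ideal_I M.ract_one[OF that] by metis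
    then show ?thesis using M(1) z[OF M(1)] by auto
  qed
  ultimately have "Tors A \<subseteq> ?T" by (rule Tors_least)
  then show "M \<in> Tors A \<Longrightarrow> carrier M = {\<zero>\<^bsub>M\<^esub>}" by blast
qed

text \<open>The projection from \<open>T\<close> takes only the value zero, so its kernel
  \<open>S\<close> is all of \<open>T\<close>.\<close>

lemma torsion_subquotient_trivial:
  assumes M: "M \<in> Ob (Gr A)" and t: "torsion_subquotient A M T S"
  shows "T = S"
proof -
  obtain Q R where Q: "Q \<in> Tors A" and R: "subquotient A M T S Q R"
    using t unfolding torsion_subquotient_def by blast
  have "T = Domain R" "S = R\<inverse> `` {\<zero>\<^bsub>Q\<^esub>}" using R by (simp_all add: subquotient_def)
  moreover have "q = \<zero>\<^bsub>Q\<^esub>" if "(t, q) \<in> R" for t q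
    using R Tors_zero[OF Q] that unfolding subquotient_def by blast
  ultimately show ?thesis by auto
qed

text \<open>Full domain and trivial indeterminacy are forced, so only graphs of homomorphisms
  remain.\<close>

lemma correspondence_is_graph:
  assumes M: "M \<in> Ob (Gr A)" and N: "N \<in> Ob (Gr A)" and R: "correspondence A M N R"
  obtains f where "f \<in> ghom A M N" "R = fgraph M f"
proof -
  have g: "grel A M N R" and "Domain R = carrier M" "R `` {\<zero>\<^bsub>M\<^esub>} = {\<zero>\<^bsub>N\<^esub>}"
    using R torsion_subquotient_trivial[OF M] torsion_subquotient_trivial[OF N] unfolding correspondence_def by blast+
  then show ?thesis
    using total_grel_is_graph[OF Gr_module[OF M] Gr_module[OF N] g] that by blast
qed

text \<open>The restriction is to the whole module and the enlargement is by zero, and neither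
  changes a relation.\<close>

lemma corr_equiv_trivial:
  assumes M: "M \<in> Ob (Gr A)" and N: "N \<in> Ob (Gr A)" and e: "corr_equiv A M N R S"
  shows "R = S"
proof -
  interpret N: graded_module A N by (rule Gr_module[OF N])
  obtain U V where U: "torsion_subquotient A M (carrier M) U" and V: "torsion_subquotient A N V {\<zero>\<^bsub>N\<^esub>}"
    and eq: "Id_on U O R O coset_rel N V = Id_on U O S O coset_rel N V"
    using e unfolding corr_equiv_def by blast
  have UV: "U = carrier M" "V = {\<zero>\<^bsub>N\<^esub>}"
    using torsion_subquotient_trivial[OF M U] torsion_subquotient_trivial[OF N V] by auto
  have "coset_rel N {\<zero>\<^bsub>N\<^esub>} = Id_on (carrier N)" by (auto simp: coset_rel_def)
  then have "Id_on U O X O coset_rel N V = X" if "grel A M N X" for X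
    using grelD(1)[OF that] UV by auto
  then show ?thesis
    using eq corr_equivD[OF e] unfolding correspondence_def by metis
qed

lemma quot_functor_isomorphism: "cat_isomorphism (Gr A) (QGr A) (quot_functor A)"
  unfolding cat_isomorphism_def
proof (intro conjI ballI)
  show "is_functor (Gr A) (QGr A) (quot_functor A)" by (rule is_functor_quot_functor)
  show "bij_betw (fo (quot_functor A)) (Ob (Gr A)) (Ob (QGr A))"
    by (simp add: quot_functor_def bij_betw_def)
  fix M N assume M: "M \<in> Ob (Gr A)" and N: "N \<in> Ob (Gr A)"
  have "bij_betw (fm (quot_functor A) M N) (ghom A M N) (Hom (QGr A) M N)"
    unfolding bij_betw_def
  proof
    show "inj_on (fm (quot_functor A) M N) (ghom A M N)"
    proof (rule inj_onI)
      fix f g assume f: "f \<in> ghom A M N" and g: "g \<in> ghom A M N"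
        and e: "fm (quot_functor A) M N f = fm (quot_functor A) M N g"
      have "corr_equiv A M N (fgraph M f) (fgraph M g)"
        using e corr_class_eq_iff[OF M N correspondence_fgraph[OF M N g]]
        unfolding quot_functor_fm[OF M N f] quot_functor_fm[OF M N g] by blast
      then have "fgraph M f = fgraph M g" by (rule corr_equiv_trivial[OF M N])
      then have "f x = g x" if "x \<in> carrier M" for x using that mem_fgraph[of x "f x" M f] mem_fgraph[of x "f x" M g] by simp
      then show "f = g"
        using f g by (intro extensionalityI[of f "carrier M" g]) (auto simp: ghom_rhom dest: rhomD(1))
    qed
    show "fm (quot_functor A) M N ` ghom A M N = Hom (QGr A) M N"
    proof
      show "fm (quot_functor A) M N ` ghom A M N \<subseteq> Hom (QGr A) M N"
        using is_functorD(4)[OF is_functor_quot_functor M N] by auto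
      show "Hom (QGr A) M N \<subseteq> fm (quot_functor A) M N ` ghom A M N"
      proof
        fix c assume "c \<in> Hom (QGr A) M N"
        then obtain R where R: "correspondence A M N R" "c = corr_class A M N R"
          unfolding QGr_simps QGr_Hom[OF M N] by blast
        obtain f where "f \<in> ghom A M N" "R = fgraph M f" using correspondence_is_graph[OF M N R(1)] .
        then show "c \<in> fm (quot_functor A) M N ` ghom A M N" using quot_functor_fm[OF M N] R(2) by auto
      qed
    qed
  qed
  then show "bij_betw (fm (quot_functor A) M N) (Hom (Gr A) M N) (Hom (QGr A) (fo (quot_functor A) M) (fo (quot_functor A) N))"
    by simp
qed

section \<open>Full faithfulness of the degree zero functor\<close>

text \<open>Write \<open>\<one>\<close> as a sum of products of \<open>u\<close> in degree
  \<open>n\<close> and \<open>v\<close> in degree \<open>- n\<close>; then \<open>x\<close> is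
  recovered from the elements \<open>ract M x u\<close>.\<close>

lemma ract_cancel:
  assumes M: "graded_module A M" and x: "x \<in> carrier M" "y \<in> carrier M"
    and e: "\<And>u. u \<in> homog A n \<Longrightarrow> ract M x u = ract M y u"
  shows "x = y"
proof -
  interpret M: graded_module A M by fact
  have "ract M x \<one> = ract M y \<one>"
  proof (induction rule: one_induct[of "- n"])
    case (mult u v)
    then show ?case using e[of u] x by (simp add: homog_carrier M.ract_mult)
  next
    case (add a b)
    then show ?case using x by (simp add: homog_carrier M.ract_add_right)
  qed
  then show ?thesis using x by simp
qed

lemma hpart_ract:
  assumes M: "graded_module A M" and x: "x \<in> gr M k" and a: "a \<in> carrier A"
  shows "hpart M (gr M) n (ract M x a) = ract M x (hpart A (homog A) (n - k) a)"
proof -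
  interpret M: graded_module A M by fact
  note xc = M.homog_carrier[OF x]
  show ?thesis
    using a
  proof (induction a rule: graded_induct)
    case (homog l a)
    then show ?case using xc M.hpart_of_homog[OF M.ract_homog[OF x homog]] hpart_of_homog[OF homog] by auto
  next
    case (add a b)
    then show ?case using xc by (simp add: M.ract_add_right M.hpart_add hpart_add)
  qed
qed

text \<open>Elements of degree \<open>n\<close> are moved to degree \<open>0\<close> by acting with
  degree \<open>- n\<close>, where \<open>f\<close> and \<open>g\<close> agree; then cancel.\<close>

lemma deg0_faithful:
  assumes M: "graded_module A M" and N: "graded_module A N" and f: "f \<in> ghom A M N" and g: "g \<in> ghom A M N"
    and e: "\<And>x. x \<in> gr M 0 \<Longrightarrow> f x = g x"
  shows "f = g"
proof -
  interpret M: graded_module A M by fact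
  interpret N: graded_module A N by fact
  have r: "f \<in> rhom A M N" "g \<in> rhom A M N" using f g by (auto simp: ghom_rhom)
  have "f x = g x" if "x \<in> carrier M" for x
    using that
  proof (induction x rule: M.graded_induct)
    case (homog n x)
    note xc = M.homog_carrier[OF homog]
    show ?case
    proof (rule ract_cancel[OF N, of _ _ "- n"])
      show "f x \<in> carrier N" "g x \<in> carrier N" using rhomD(2)[OF r(1) xc] rhomD(2)[OF r(2) xc] by simp_all
      fix u assume u: "u \<in> homog A (- n)"
      then have "ract M x u \<in> gr M 0" using M.ract_homog[OF homog u] by simp
      then show "ract N (f x) u = ract N (g x) u"
        using e rhomD(4)[OF r(1) xc] rhomD(4)[OF r(2) xc] homog_carrier[OF u] by metis
    qed
  next
    case (add x y)
    then show ?case using rhomD(3)[OF r(1)] rhomD(3)[OF r(2)] by simp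
  qed
  then show ?thesis
    using rhomD(1)[OF r(1)] rhomD(1)[OF r(2)] by (rule extensionalityI[rotated 2])
qed

text \<open>The extension \<open>f\<close> must satisfy \<open>f(x) b = f0(x b)\<close> for
  \<open>x\<close> of degree \<open>n\<close> and \<open>b\<close> of degree \<open>- n\<close>.
  Taken as a definition this is a graded relation \<open>R\<close>. It is total because, for
  \<open>\<one>\<close> a sum of products \<open>u v\<close>, the sum of the elements
  \<open>f0(x u) v\<close> is a value over \<open>x\<close>; it relates zero only to zero by
  cancellation.\<close>

lemma deg0_full:
  assumes M: "graded_module A M" and N: "graded_module A N"
    and f0: "f0 \<in> rhom (deg0 A) (fo (deg0_functor A) M) (fo (deg0_functor A) N)"
  obtains f where "f \<in> ghom A M N" "restrict f (gr M 0) = f0"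
proof -
  interpret M: graded_module A M by fact
  interpret N: graded_module A N by fact
  have fc: "f0 x \<in> gr N 0" if "x \<in> gr M 0" for x using rhomD(2)[OF f0] that by simp
  have fadd: "f0 (x \<oplus>\<^bsub>M\<^esub> y) = f0 x \<oplus>\<^bsub>N\<^esub> f0 y" if "x \<in> gr M 0" "y \<in> gr M 0" for x y
    using rhomD(3)[OF f0] that by simp
  have fact0: "f0 (ract M x a) = ract N (f0 x) a" if "x \<in> gr M 0" "a \<in> homog A 0" for x a
    using rhomD(4)[OF f0] that fc by simp
  have fz: "f0 \<zero>\<^bsub>M\<^esub> = \<zero>\<^bsub>N\<^esub>"
    using rhom_zero[OF rmodule_deg0[OF M] rmodule_deg0[OF N] f0] by simp
  have to0: "ract M x b \<in> gr M 0" if "x \<in> gr M n" "b \<in> homog A (- n)" for x b n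
    using M.ract_homog[OF that] by simp
  have to0h: "ract M (hpart M (gr M) n x) b \<in> gr M 0" if "x \<in> carrier M" "b \<in> homog A (- n)" for x b n
    using to0[OF M.hpart_homog[OF that(1)] that(2)] .
  define R where "R = {(x, y). x \<in> carrier M \<and> y \<in> carrier N \<and>
    (\<forall>n. \<forall>b\<in>homog A (- n). f0 (ract M (hpart M (gr M) n x) b) = ract N (hpart N (gr N) n y) b)}"
  have gR: "grel A M N R"
    unfolding grel_iff_homogeneous[OF M N]
  proof (intro conjI allI impI)
    show "R \<subseteq> carrier M \<times> carrier N" by (auto simp: R_def)
    show "(\<zero>\<^bsub>M\<^esub>, \<zero>\<^bsub>N\<^esub>) \<in> R" using fz by (simp add: R_def homog_carrier)
  next
    fix x y x' y' assume "(x, y) \<in> R" "(x', y') \<in> R"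
    then show "(x \<oplus>\<^bsub>M\<^esub> x', y \<oplus>\<^bsub>N\<^esub> y') \<in> R"
      unfolding R_def
      by (simp add: M.hpart_add N.hpart_add M.ract_add_left N.ract_add_left homog_carrier fadd to0h)
  next
    fix k x y a assume h: "(x, y) \<in> R" "x \<in> gr M k" "y \<in> gr N k" "a \<in> carrier A"
    have xy: "f0 (ract M x b) = ract N y b" if "b \<in> homog A (- k)" for b
    proof -
      have "f0 (ract M (hpart M (gr M) k x) b) = ract N (hpart N (gr N) k y) b" using h(1) that by (simp add: R_def)
      then show ?thesis using h(2,3) by (simp add: M.hpart_of_homog N.hpart_of_homog)
    qed
    have c: "x \<in> carrier M" "y \<in> carrier N" using M.homog_carrier[OF h(2)] N.homog_carrier[OF h(3)] .
    have "f0 (ract M (ract M x (hpart A (homog A) (n - k) a)) b) = ract N (ract N y (hpart A (homog A) (n - k) a)) b"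
      if b: "b \<in> homog A (- n)" for n b
    proof -
      have "hpart A (homog A) (n - k) a \<otimes> b \<in> homog A (- k)"
        using mult_homog[OF hpart_homog[OF h(4), of "n - k"] b] by simp
      then show ?thesis using xy c h(4) homog_carrier[OF b] by (simp add: M.ract_mult[symmetric] N.ract_mult[symmetric])
    qed
    then show "(ract M x a, ract N y a) \<in> R"
      unfolding R_def using c h(4) by (simp add: hpart_ract[OF M h(2)] hpart_ract[OF N h(3)])
  next
    fix x y k assume h: "(x, y) \<in> R"
    then have c: "x \<in> carrier M" "y \<in> carrier N" by (auto simp: R_def)
    have "hpart M (gr M) n (hpart M (gr M) k x) = (if n = k then hpart M (gr M) k x else \<zero>\<^bsub>M\<^esub>)"
      "hpart N (gr N) n (hpart N (gr N) k y) = (if n = k then hpart N (gr N) k y else \<zero>\<^bsub>N\<^esub>)" for n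
      using M.hpart_of_homog[OF M.hpart_homog[OF c(1)]] N.hpart_of_homog[OF N.hpart_homog[OF c(2)]] by auto
    then show "(hpart M (gr M) k x, hpart N (gr N) k y) \<in> R"
      using h c fz unfolding R_def by (simp add: homog_carrier)
  qed
  have tot: "\<exists>y. (x, y) \<in> R" if "x \<in> carrier M" for x
    using that
  proof (induction x rule: M.graded_induct)
    case (homog k x)
    note xc = M.homog_carrier[OF homog]
    \<comment> \<open>Keeping \<open>\<one>\<close> in the formula makes the statement additive in
      it, ready for \<open>one_induct\<close>.\<close>
    have "\<exists>y\<in>gr N k. \<forall>b\<in>homog A (- k). f0 (ract M x (\<one> \<otimes> b)) = ract N y b"
    proof (induction rule: one_induct[of k])
      case (mult u v)
      note uv = homog_carrier[OF mult(1)] homog_carrier[OF mult(2)]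
      have xu: "ract M x u \<in> gr M 0" using to0[OF homog mult(1)] .
      note fxu = fc[OF xu]
      show ?case
      proof (intro bexI ballI)
        show "ract N (f0 (ract M x u)) v \<in> gr N k" using N.ract_homog[OF fxu mult(2)] by simp
        fix b assume b: "b \<in> homog A (- k)"
        then have "v \<otimes> b \<in> homog A 0" using mult_homog[OF mult(2) b] by simp
        then have "f0 (ract M (ract M x u) (v \<otimes> b)) = ract N (f0 (ract M x u)) (v \<otimes> b)" by (rule fact0[OF xu])
        then show "f0 (ract M x (u \<otimes> v \<otimes> b)) = ract N (ract N (f0 (ract M x u)) v) b"
          using uv xc homog_carrier[OF b] N.homog_carrier[OF fxu] by (simp add: M.ract_mult N.ract_mult)
      qed
    next
      case (add a c)
      then obtain y z where y: "y \<in> gr N k" "\<forall>b\<in>homog A (- k). f0 (ract M x (a \<otimes> b)) = ract N y b"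
        and z: "z \<in> gr N k" "\<forall>b\<in>homog A (- k). f0 (ract M x (c \<otimes> b)) = ract N z b" by blast
      show ?case
      proof (intro bexI ballI)
        show "y \<oplus>\<^bsub>N\<^esub> z \<in> gr N k" using y z N.homog_add by blast
        fix b assume b: "b \<in> homog A (- k)"
        have 0: "ract M x (d \<otimes> b) \<in> gr M 0" if "d \<in> homog A 0" for d
          by (rule to0[OF homog]) (use mult_homog[OF that b] in simp)
        have "f0 (ract M x ((a \<oplus> c) \<otimes> b)) = f0 (ract M x (a \<otimes> b) \<oplus>\<^bsub>M\<^esub> ract M x (c \<otimes> b))"
          using add(1,2) xc homog_carrier b by (simp add: l_distr M.ract_add_right)
        also have "\<dots> = f0 (ract M x (a \<otimes> b)) \<oplus>\<^bsub>N\<^esub> f0 (ract M x (c \<otimes> b))"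
          by (rule fadd[OF 0 0]) (use add in auto)
        also have "\<dots> = ract N (y \<oplus>\<^bsub>N\<^esub> z) b"
          using y z b N.homog_carrier homog_carrier by (simp add: N.ract_add_left)
        finally show "f0 (ract M x ((a \<oplus> c) \<otimes> b)) = ract N (y \<oplus>\<^bsub>N\<^esub> z) b" .
      qed
    qed
    then obtain y where y: "y \<in> gr N k" "\<forall>b\<in>homog A (- k). f0 (ract M x (\<one> \<otimes> b)) = ract N y b" by blast
    then have "(x, y) \<in> R"
      unfolding R_def using fz xc N.homog_carrier[OF y(1)] homog_carrier
      by (simp add: M.hpart_of_homog[OF homog] N.hpart_of_homog[OF y(1)])
    then show ?case by blast
  next
    case (add x x')
    then show ?case using grelD(3)[OF gR] by blast
  qed
  have "y = \<zero>\<^bsub>N\<^esub>" if "(\<zero>\<^bsub>M\<^esub>, y) \<in> R" for y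
  proof (rule N.eq_if_hpart_eq)
    show y: "y \<in> carrier N" "\<zero>\<^bsub>N\<^esub> \<in> carrier N" using that by (auto simp: R_def)
    fix n
    show "hpart N (gr N) n y = hpart N (gr N) n \<zero>\<^bsub>N\<^esub>"
    proof (rule ract_cancel[OF N, of _ _ "- n"])
      fix u assume u: "u \<in> homog A (- n)"
      then have "ract N (hpart N (gr N) n y) u = f0 (ract M (hpart M (gr M) n \<zero>\<^bsub>M\<^esub>) u)"
        using that unfolding R_def by simp
      also have "\<dots> = ract N (hpart N (gr N) n \<zero>\<^bsub>N\<^esub>) u"
        using fz homog_carrier[OF u] by simp
      finally show "ract N (hpart N (gr N) n y) u = ract N (hpart N (gr N) n \<zero>\<^bsub>N\<^esub>) u" .
    qed (use y in simp_all)
  qed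
  then obtain f where f: "f \<in> ghom A M N" "R = fgraph M f"
    using total_grel_is_graph[OF M N gR] tot by blast
  have "f x = f0 x" if x: "x \<in> gr M 0" for x
  proof -
    have "(x, f x) \<in> R" unfolding f(2) mem_fgraph using M.homog_carrier[OF x] by simp
    then have "\<forall>n. \<forall>b\<in>homog A (- n). f0 (ract M (hpart M (gr M) n x) b) = ract N (hpart N (gr N) n (f x)) b"
      by (simp add: R_def)
    \<comment> \<open>Degree \<open>0\<close> and \<open>b = \<one>\<close> show that
      \<open>f\<close> extends \<open>f0\<close>.\<close>
    from this[rule_format, of \<one> 0] have "f0 (ract M (hpart M (gr M) 0 x) \<one>) = ract N (hpart N (gr N) 0 (f x)) \<one>"
      by simp
    moreover have "f x \<in> gr N 0" using f(1) x by (auto simp: ghom_rhom)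
    ultimately show ?thesis
      using M.homog_carrier[OF x] N.homog_carrier by (simp add: M.hpart_of_homog[OF x] N.hpart_of_homog)
  qed
  then have "restrict f (gr M 0) = f0"
    using rhomD(1)[OF f0] by (auto simp: fun_eq_iff extensional_def)
  with f(1) that show ?thesis by blast
qed

lemma fully_faithful_deg0: "fully_faithful (Gr A) (RMod (deg0 A)) (deg0_functor A)"
  unfolding fully_faithful_def
proof (intro ballI)
  fix M N assume M: "M \<in> Ob (Gr A)" and N: "N \<in> Ob (Gr A)"
  note m = Gr_module[OF M] Gr_module[OF N]
  show "bij_betw (fm (deg0_functor A) M N) (Hom (Gr A) M N)
      (Hom (RMod (deg0 A)) (fo (deg0_functor A) M) (fo (deg0_functor A) N))"
    unfolding bij_betw_def
  proof
    show "inj_on (fm (deg0_functor A) M N) (Hom (Gr A) M N)"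
    proof (rule inj_onI)
      fix f g assume fg: "f \<in> Hom (Gr A) M N" "g \<in> Hom (Gr A) M N" "fm (deg0_functor A) M N f = fm (deg0_functor A) M N g"
      then have "f x = g x" if "x \<in> gr M 0" for x using that by (auto simp: fun_eq_iff restrict_def) metis
      then show "f = g" using deg0_faithful[OF m] fg by simp
    qed
    show "fm (deg0_functor A) M N ` Hom (Gr A) M N = Hom (RMod (deg0 A)) (fo (deg0_functor A) M) (fo (deg0_functor A) N)"
    proof
      show "fm (deg0_functor A) M N ` Hom (Gr A) M N \<subseteq> Hom (RMod (deg0 A)) (fo (deg0_functor A) M) (fo (deg0_functor A) N)"
        using deg0_functor_Hom[OF m(1)] by auto
      show "Hom (RMod (deg0 A)) (fo (deg0_functor A) M) (fo (deg0_functor A) N) \<subseteq> fm (deg0_functor A) M N ` Hom (Gr A) M N"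
      proof
        fix h assume "h \<in> Hom (RMod (deg0 A)) (fo (deg0_functor A) M) (fo (deg0_functor A) N)"
        then have "h \<in> rhom (deg0 A) (fo (deg0_functor A) M) (fo (deg0_functor A) N)" by simp
        from deg0_full[OF m this] obtain f where "f \<in> ghom A M N" "restrict f (gr M 0) = h" .
        then show "h \<in> fm (deg0_functor A) M N ` Hom (Gr A) M N" by auto
      qed
    qed
  qed
qed

end

section \<open>Essential surjectivity of the degree zero functor\<close>

lemma infinite_universe: "natLeq <o |UNIV :: 'u set| \<Longrightarrow> infinite (UNIV :: 'u set)"
  using card_of_ordLeq_infinite[OF ordLess_imp_ordLeq[OF ordIso_ordLess_trans[OF card_of_nat]]] infinite_UNIV_nat
  by blast

text \<open>Each length contributes at most \<open>|?X|\<close> lists, and there are countably many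
  lengths. Uncountability of the universe is what keeps \<open>?X\<close>, which contains a copy of
  the natural numbers, strictly below it.\<close>

lemma lists_ordLess:
  fixes S :: "'a set"
  assumes U: "natLeq <o |UNIV :: 'u set|" and S: "|S| <o |UNIV :: 'u set|"
  shows "|lists S| <o |UNIV :: 'u set|"
proof -
  \<comment> \<open>The added copy of \<open>nat\<close> makes the bound infinite, so that products
    and countable unions do not exceed it.\<close>
  let ?X = "S <+> (UNIV :: nat set)"
  have X: "|?X| <o |UNIV :: 'u set|"
    by (rule card_of_Plus_ordLess_infinite[OF infinite_universe[OF U] S ordIso_ordLess_trans[OF card_of_nat U]])
  have Xinf: "infinite ?X" by (simp add: infinite_UNIV_nat)
  have L: "|{l \<in> lists S. length l = k}| \<le>o |?X|" for k
  proof (induction k)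
    case 0
    have "{l \<in> lists S. length l = 0} = {[]}" by auto
    then show ?case using card_of_singl_ordLeq[of ?X "[] :: 'a list"] Xinf by auto
  next
    case (Suc k)
    have "{l \<in> lists S. length l = Suc k} \<subseteq> (\<lambda>(x, l). x # l) ` (S \<times> {l \<in> lists S. length l = k})"
      by (auto simp: image_iff length_Suc_conv)
    then have "|{l \<in> lists S. length l = Suc k}| \<le>o |S \<times> {l \<in> lists S. length l = k}|"
      by (rule ordLeq_transitive[OF card_of_mono1 card_of_image])
    also have "|S \<times> {l \<in> lists S. length l = k}| \<le>o |?X|"
      by (rule card_of_Sigma_ordLeq_infinite[OF Xinf card_of_Plus1]) (use Suc in blast)
    finally show ?case .
  qed
  have "lists S = (\<Union>k. {l \<in> lists S. length l = k})" by auto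
  moreover have "|\<Union>k. {l \<in> lists S. length l = k}| \<le>o |?X|"
    by (rule card_of_UNION_ordLeq_infinite[OF Xinf card_of_Plus2]) (use L in auto)
  ultimately have "|lists S| \<le>o |?X|" by simp
  then show ?thesis using X by (rule ordLeq_ordLess_trans)
qed

lemma lists_Times_ordLess:
  fixes X Y :: "'u set"
  assumes U: "natLeq <o |UNIV :: 'u set|" and "small X" "small Y"
  shows "|lists (X \<times> Y)| <o |UNIV :: 'u set|"
proof (rule lists_ordLess[OF U])
  show "|X \<times> Y| <o |UNIV :: 'u set|"
    using assms card_of_Times_ordLess_infinite[OF infinite_universe[OF U]] unfolding small_def by blast
qed

lemma injection_exists:
  fixes S :: "'m set"
  assumes "|S| <o |UNIV :: 'u set|"
  obtains e :: "'m \<Rightarrow> 'u" where "inj_on e S" "small (e ` S)"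
proof -
  obtain e :: "'m \<Rightarrow> 'u" where e: "inj_on e S"
    using ordLess_imp_ordLeq[OF assms] unfolding card_of_ordLeq[symmetric] by blast
  have "small (e ` S)"
    unfolding small_def using card_of_image assms ordLeq_ordLess_trans by blast
  with e that show ?thesis by blast
qed

text \<open>The part of degree \<open>n\<close> is \<open>Hom(A\<^sub>-\<^sub>n, N)\<close>, which is \<open>N \<otimes> A\<^sub>n\<close> when \<open>A\<close> is strongly graded.
  This avoids a construction of \<open>N \<otimes> A\<close>.\<close>

definition coind :: "('k, 'a) galgebra \<Rightarrow> ('a, 'n) rmod \<Rightarrow> ('a, 'a \<Rightarrow> 'n) gmod" where
  "coind A N = \<lparr>carrier = {\<phi> \<in> extensional (carrier A).
       (\<forall>a\<in>carrier A. \<phi> a \<in> carrier N) \<and>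
       (\<forall>a\<in>carrier A. \<forall>b\<in>carrier A. \<phi> (a \<oplus>\<^bsub>A\<^esub> b) = \<phi> a \<oplus>\<^bsub>N\<^esub> \<phi> b) \<and>
       (\<forall>a\<in>carrier A. \<forall>r\<in>homog A 0. \<phi> (a \<otimes>\<^bsub>A\<^esub> r) = ract N (\<phi> a) r) \<and>
       (\<exists>F. finite F \<and> (\<forall>k. k \<notin> F \<longrightarrow> (\<forall>a\<in>homog A k. \<phi> a = \<zero>\<^bsub>N\<^esub>)))},
     monoid.mult = undefined, monoid.one = undefined,
     ring.zero = (\<lambda>a\<in>carrier A. \<zero>\<^bsub>N\<^esub>),
     ring.add = (\<lambda>\<phi> \<psi>. \<lambda>a\<in>carrier A. \<phi> a \<oplus>\<^bsub>N\<^esub> \<psi> a),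
     ract = (\<lambda>\<phi> a. \<lambda>b\<in>carrier A. \<phi> (a \<otimes>\<^bsub>A\<^esub> b)),
     gr = (\<lambda>n. {\<phi> \<in> extensional (carrier A).
       (\<forall>a\<in>carrier A. \<phi> a \<in> carrier N) \<and>
       (\<forall>a\<in>carrier A. \<forall>b\<in>carrier A. \<phi> (a \<oplus>\<^bsub>A\<^esub> b) = \<phi> a \<oplus>\<^bsub>N\<^esub> \<phi> b) \<and>
       (\<forall>a\<in>carrier A. \<forall>r\<in>homog A 0. \<phi> (a \<otimes>\<^bsub>A\<^esub> r) = ract N (\<phi> a) r) \<and>
       (\<forall>k. k \<noteq> - n \<longrightarrow> (\<forall>a\<in>homog A k. \<phi> a = \<zero>\<^bsub>N\<^esub>))})\<rparr>"

section \<open>The coinduced graded module\<close>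

locale coinduction = graded_ring A + N: right_module "deg0 A" N
  for A :: "('k, 'u) galgebra" (structure) and N :: "('u, 'n) rmod"
begin

abbreviation C where "C \<equiv> coind A N"

definition linear :: "('u \<Rightarrow> 'n) \<Rightarrow> bool" where
  "linear \<phi> \<longleftrightarrow> \<phi> \<in> extensional (carrier A) \<and> (\<forall>a\<in>carrier A. \<phi> a \<in> carrier N) \<and>
       (\<forall>a\<in>carrier A. \<forall>b\<in>carrier A. \<phi> (a \<oplus> b) = \<phi> a \<oplus>\<^bsub>N\<^esub> \<phi> b) \<and>
       (\<forall>a\<in>carrier A. \<forall>r\<in>homog A 0. \<phi> (a \<otimes> r) = ract N (\<phi> a) r)"

lemma C_carrier: "\<phi> \<in> carrier C \<longleftrightarrow> linear \<phi> \<and> (\<exists>F. finite F \<and> (\<forall>k. k \<notin> F \<longrightarrow> (\<forall>a\<in>homog A k. \<phi> a = \<zero>\<^bsub>N\<^esub>)))"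
  by (auto simp: coind_def linear_def)

text \<open>The sign comes from the action, which turns \<open>\<phi>\<close> into
  \<open>\<lambda>b. \<phi> (a \<otimes> b)\<close>: multiplying by degree \<open>k\<close> lowers
  the degrees of the support by \<open>k\<close>, so support in degree \<open>- n\<close> must count
  as degree \<open>n\<close>.\<close>

lemma C_gr: "\<phi> \<in> gr C n \<longleftrightarrow> linear \<phi> \<and> (\<forall>k. k \<noteq> - n \<longrightarrow> (\<forall>a\<in>homog A k. \<phi> a = \<zero>\<^bsub>N\<^esub>))"
  by (auto simp: coind_def linear_def)

lemma C_ops: "\<zero>\<^bsub>C\<^esub> = (\<lambda>a\<in>carrier A. \<zero>\<^bsub>N\<^esub>)" "\<phi> \<oplus>\<^bsub>C\<^esub> \<psi> = (\<lambda>a\<in>carrier A. \<phi> a \<oplus>\<^bsub>N\<^esub> \<psi> a)"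
  "ract C \<phi> a = (\<lambda>b\<in>carrier A. \<phi> (a \<otimes> b))"
  by (simp_all add: coind_def)

lemma linearD:
  assumes "linear \<phi>"
  shows "\<phi> \<in> extensional (carrier A)" "a \<in> carrier A \<Longrightarrow> \<phi> a \<in> carrier N"
    "a \<in> carrier A \<Longrightarrow> b \<in> carrier A \<Longrightarrow> \<phi> (a \<oplus> b) = \<phi> a \<oplus>\<^bsub>N\<^esub> \<phi> b"
    "a \<in> carrier A \<Longrightarrow> r \<in> homog A 0 \<Longrightarrow> \<phi> (a \<otimes> r) = ract N (\<phi> a) r" "\<phi> \<zero> = \<zero>\<^bsub>N\<^esub>"
proof -
  show "\<phi> \<in> extensional (carrier A)" "a \<in> carrier A \<Longrightarrow> \<phi> a \<in> carrier N"
    "a \<in> carrier A \<Longrightarrow> b \<in> carrier A \<Longrightarrow> \<phi> (a \<oplus> b) = \<phi> a \<oplus>\<^bsub>N\<^esub> \<phi> b"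
    "a \<in> carrier A \<Longrightarrow> r \<in> homog A 0 \<Longrightarrow> \<phi> (a \<otimes> r) = ract N (\<phi> a) r"
    using assms by (auto simp: linear_def)
  have "\<phi> (\<zero> \<oplus> \<zero>) = \<phi> \<zero> \<oplus>\<^bsub>N\<^esub> \<phi> \<zero>" "\<phi> \<zero> \<in> carrier N" using assms unfolding linear_def by blast+
  then show "\<phi> \<zero> = \<zero>\<^bsub>N\<^esub>" using N.add.l_cancel_one[of "\<phi> \<zero>" "\<phi> \<zero>"] by simp
qed

lemma linear_eqI:
  assumes "linear \<phi>" "linear \<psi>" "\<And>k a. a \<in> homog A k \<Longrightarrow> \<phi> a = \<psi> a"
  shows "\<phi> = \<psi>"
proof (rule extensionalityI[OF linearD(1)[OF assms(1)] linearD(1)[OF assms(2)]])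
  show "\<phi> a = \<psi> a" if "a \<in> carrier A" for a
    using that
  proof (induction a rule: graded_induct)
    case (add a b)
    then show ?case by (simp add: linearD(3)[OF assms(1)] linearD(3)[OF assms(2)])
  qed (rule assms(3))
qed

lemma linear_zero: "linear \<zero>\<^bsub>C\<^esub>"
  by (auto simp: linear_def C_ops homog_carrier)

lemma linear_add:
  assumes \<phi>: "linear \<phi>" and \<psi>: "linear \<psi>"
  shows "linear (\<phi> \<oplus>\<^bsub>C\<^esub> \<psi>)"
  unfolding linear_def
  by (auto simp: C_ops linearD[OF \<phi>] linearD[OF \<psi>] homog_carrier N.a_ac N.ract_add_left)

lemma linear_ract:
  assumes \<phi>: "linear \<phi>" and a: "a \<in> carrier A"
  shows "linear (ract C \<phi> a)"
  unfolding linear_def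
  using a by (auto simp: C_ops linearD[OF \<phi>] homog_carrier r_distr m_assoc[symmetric])

lemma gr_subset: "gr C n \<subseteq> carrier C"
proof
  fix \<phi> assume "\<phi> \<in> gr C n"
  then show "\<phi> \<in> carrier C"
    unfolding C_gr C_carrier by (intro conjI exI[of _ "{- n}"]) auto
qed

lemma C_add_closed: "\<phi> \<in> carrier C \<Longrightarrow> \<psi> \<in> carrier C \<Longrightarrow> \<phi> \<oplus>\<^bsub>C\<^esub> \<psi> \<in> carrier C"
proof -
  assume "\<phi> \<in> carrier C" "\<psi> \<in> carrier C"
  then obtain F G where F: "finite F" "\<forall>k. k \<notin> F \<longrightarrow> (\<forall>a\<in>homog A k. \<phi> a = \<zero>\<^bsub>N\<^esub>)"
    and G: "finite G" "\<forall>k. k \<notin> G \<longrightarrow> (\<forall>a\<in>homog A k. \<psi> a = \<zero>\<^bsub>N\<^esub>)"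
    and l: "linear \<phi>" "linear \<psi>"
    unfolding C_carrier by blast
  show ?thesis
    unfolding C_carrier using linear_add[OF l] F G
    by (intro conjI exI[of _ "F \<union> G"]) (auto simp: C_ops homog_carrier)
qed

lemma C_ract_closed:
  assumes "\<phi> \<in> carrier C" and a: "a \<in> carrier A"
  shows "ract C \<phi> a \<in> carrier C"
proof -
  obtain F where F: "finite F" "\<forall>k. k \<notin> F \<longrightarrow> (\<forall>a\<in>homog A k. \<phi> a = \<zero>\<^bsub>N\<^esub>)" and l: "linear \<phi>"
    using assms unfolding C_carrier by blast
  let ?S = "{i. hpart A (homog A) i a \<noteq> \<zero>}"
  \<comment> \<open>If \<open>\<phi> (a \<otimes> b)\<close> is nonzero for some \<open>b\<close> of
    degree \<open>k\<close>, then \<open>i + k\<close> lies in \<open>F\<close> for some degree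
    \<open>i\<close> occurring in \<open>a\<close>; hence \<open>k\<close> is one of these
    differences.\<close>
  let ?G = "(\<lambda>(f, i). f - i) ` (F \<times> ?S)"
  have "\<phi> (a \<otimes> b) = \<zero>\<^bsub>N\<^esub>" if k: "k \<notin> ?G" and b: "b \<in> homog A k" for k b
  proof -
    have bc: "b \<in> carrier A" using homog_carrier[OF b] .
    have "\<phi> ((\<Oplus>i\<in>?S. hpart A (homog A) i a) \<otimes> b) = \<zero>\<^bsub>N\<^esub>"
    proof (rule finsum_induct[where P = "\<lambda>x. \<phi> (x \<otimes> b) = \<zero>\<^bsub>N\<^esub>"])
      fix i assume i: "i \<in> ?S"
      have "i + k \<notin> F"
      proof
        assume "i + k \<in> F"
        then have "(\<lambda>(f, i). f - i) (i + k, i) \<in> ?G" using i by blast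
        then show False using k by simp
      qed
      moreover have "hpart A (homog A) i a \<otimes> b \<in> homog A (i + k)" by (rule mult_homog) (use a b in simp_all)
      ultimately show "\<phi> (hpart A (homog A) i a \<otimes> b) = \<zero>\<^bsub>N\<^esub>" using F(2) by blast
    next
      show "\<phi> ((x \<oplus> y) \<otimes> b) = \<zero>\<^bsub>N\<^esub>" if "x \<in> carrier A" "y \<in> carrier A" "\<phi> (x \<otimes> b) = \<zero>\<^bsub>N\<^esub>" "\<phi> (y \<otimes> b) = \<zero>\<^bsub>N\<^esub>" for x y
        using that bc by (simp add: l_distr linearD(3)[OF l])
    qed (use a bc linearD(5)[OF l] in simp_all)
    then show ?thesis using finsum_hpart[OF a] by simp
  qed
  then show ?thesis
    unfolding C_carrier using linear_ract[OF l a] F(1) a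
    by (intro conjI exI[of _ ?G]) (auto simp: C_ops homog_carrier)
qed

lemma C_zero_closed: "\<zero>\<^bsub>C\<^esub> \<in> carrier C"
  unfolding C_carrier using linear_zero by (auto simp: C_ops homog_carrier)

lemma C_neg:
  assumes "\<phi> \<in> carrier C"
  shows "\<phi> \<oplus>\<^bsub>C\<^esub> ract C \<phi> (\<ominus> \<one>) = \<zero>\<^bsub>C\<^esub>"
proof -
  have l: "linear \<phi>" using assms by (simp add: C_carrier)
  have "\<phi> b \<oplus>\<^bsub>N\<^esub> \<phi> (\<ominus> \<one> \<otimes> b) = \<zero>\<^bsub>N\<^esub>" if b: "b \<in> carrier A" for b
    using linearD(3)[OF l, of b "\<ominus> \<one> \<otimes> b"] b linearD(5)[OF l] by (simp add: l_minus r_neg)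
  then show ?thesis by (auto simp: C_ops)
qed

lemma C_abelian_group: "abelian_group C"
proof (rule abelian_groupI)
  fix \<phi> \<psi> \<chi> assume "\<phi> \<in> carrier C" "\<psi> \<in> carrier C" "\<chi> \<in> carrier C"
  then have l: "linear \<phi>" "linear \<psi>" "linear \<chi>" by (auto simp: C_carrier)
  show "\<phi> \<oplus>\<^bsub>C\<^esub> \<psi> \<oplus>\<^bsub>C\<^esub> \<chi> = \<phi> \<oplus>\<^bsub>C\<^esub> (\<psi> \<oplus>\<^bsub>C\<^esub> \<chi>)"
    by (auto simp: C_ops l[THEN linearD(2)] N.a_assoc)
next
  fix \<phi> \<psi> assume "\<phi> \<in> carrier C" "\<psi> \<in> carrier C"
  then have l: "linear \<phi>" "linear \<psi>" by (auto simp: C_carrier)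
  show "\<phi> \<oplus>\<^bsub>C\<^esub> \<psi> = \<psi> \<oplus>\<^bsub>C\<^esub> \<phi>"
    by (auto simp: C_ops l[THEN linearD(2)] N.a_comm)
next
  fix \<phi> assume p: "\<phi> \<in> carrier C"
  then have l: "linear \<phi>" by (auto simp: C_carrier)
  show "\<zero>\<^bsub>C\<^esub> \<oplus>\<^bsub>C\<^esub> \<phi> = \<phi>"
    using linearD(1,2)[OF l] by (auto simp: C_ops fun_eq_iff extensional_def)
  have m: "ract C \<phi> (\<ominus> \<one>) \<in> carrier C" using C_ract_closed[OF p] by simp
  then have "linear (ract C \<phi> (\<ominus> \<one>))" by (simp add: C_carrier)
  then have "ract C \<phi> (\<ominus> \<one>) \<oplus>\<^bsub>C\<^esub> \<phi> = \<phi> \<oplus>\<^bsub>C\<^esub> ract C \<phi> (\<ominus> \<one>)"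
    using linearD(2)[OF l] N.a_comm[OF linearD(2)[OF \<open>linear (ract C \<phi> (\<ominus> \<one>))\<close>] linearD(2)[OF l]]
    by (auto simp: C_ops fun_eq_iff restrict_def)
  then show "\<exists>\<psi>\<in>carrier C. \<psi> \<oplus>\<^bsub>C\<^esub> \<phi> = \<zero>\<^bsub>C\<^esub>" using C_neg[OF p] m by auto
qed (use C_zero_closed C_add_closed in auto)

lemma C_rmodule: "rmodule A C"
  unfolding rmodule_def
proof (intro conjI ballI ring_axioms C_abelian_group C_ract_closed)
  fix \<phi> \<psi> a assume "\<phi> \<in> carrier C" "\<psi> \<in> carrier C" and a: "a \<in> carrier A"
  show "ract C (\<phi> \<oplus>\<^bsub>C\<^esub> \<psi>) a = ract C \<phi> a \<oplus>\<^bsub>C\<^esub> ract C \<psi> a"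
    using a by (auto simp: C_ops)
next
  fix \<phi> a b assume "\<phi> \<in> carrier C" and ab: "a \<in> carrier A" "b \<in> carrier A"
  then have l: "linear \<phi>" by (auto simp: C_carrier)
  show "ract C \<phi> (a \<oplus> b) = ract C \<phi> a \<oplus>\<^bsub>C\<^esub> ract C \<phi> b"
    using ab by (auto simp: C_ops l_distr linearD(3)[OF l])
  show "ract C \<phi> (a \<otimes> b) = ract C (ract C \<phi> a) b"
    using ab by (auto simp: C_ops m_assoc)
next
  fix \<phi> assume "\<phi> \<in> carrier C"
  then have l: "linear \<phi>" by (auto simp: C_carrier)
  show "ract C \<phi> \<one> = \<phi>"
    using linearD(1)[OF l] by (auto simp: C_ops fun_eq_iff extensional_def)
qed

lemma C_finsum:
  assumes "finite F" "\<And>n. n \<in> F \<Longrightarrow> c n \<in> carrier C" "b \<in> carrier A"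
  shows "(\<Oplus>\<^bsub>C\<^esub>n\<in>F. c n) b = (\<Oplus>\<^bsub>N\<^esub>n\<in>F. c n b)"
proof -
  interpret C: abelian_group C by (rule C_abelian_group)
  show ?thesis
    using assms(1,2)
  proof (induction F rule: finite_induct)
    case empty
    then show ?case using assms(3) by (simp add: C_ops)
  next
    case (insert n F)
    have l: "c k b \<in> carrier N" if "k \<in> insert n F" for k
      using insert.prems[OF that] assms(3) linearD(2) by (simp add: C_carrier)
    have "(\<Oplus>\<^bsub>C\<^esub>k\<in>insert n F. c k) = c n \<oplus>\<^bsub>C\<^esub> (\<Oplus>\<^bsub>C\<^esub>k\<in>F. c k)"
      using insert by (simp add: C.finsum_insert Pi_def)
    moreover have "(\<Oplus>\<^bsub>N\<^esub>k\<in>insert n F. c k b) = c n b \<oplus>\<^bsub>N\<^esub> (\<Oplus>\<^bsub>N\<^esub>k\<in>F. c k b)"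
      using insert l by (simp add: N.finsum_insert Pi_def)
    ultimately show ?case using insert assms(3) by (simp add: C_ops)
  qed
qed

lemma hpart_mult_left:
  assumes "a \<in> homog A k" "b \<in> carrier A"
  shows "hpart A (homog A) n (a \<otimes> b) = a \<otimes> hpart A (homog A) (n - k) b"
  using assms(2)
proof (induction b rule: graded_induct)
  case (homog l b)
  then show ?case
    using hpart_of_homog[OF homog, of "n - k"] hpart_of_homog[OF mult_homog[OF assms(1) homog], of n] homog_carrier[OF assms(1)] by auto
next
  case (add x y)
  then show ?case using homog_carrier[OF assms(1)] by (simp add: r_distr hpart_add)
qed

lemma hpart_mult_right:
  assumes "b \<in> carrier A" "r \<in> homog A 0"
  shows "hpart A (homog A) n (b \<otimes> r) = hpart A (homog A) n b \<otimes> r"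
  using assms(1)
proof (induction b rule: graded_induct)
  case (homog k b)
  then show ?case
    using hpart_of_homog[OF homog, of n] hpart_of_homog[OF mult_homog[OF homog assms(2)], of n] homog_carrier[OF assms(2)] by simp
next
  case (add x y)
  then show ?case using homog_carrier[OF assms(2)] by (simp add: l_distr hpart_add)
qed

text \<open>The component of \<open>\<phi>\<close> in degree \<open>n\<close> is
  \<open>\<phi>\<close> preceded by the projection of \<open>A\<close> onto degree
  \<open>- n\<close>; finite support makes almost all of these vanish. Independence follows by
  evaluating at homogeneous elements.\<close>

lemma graded_module_coind: "graded_module A C"
proof -
  interpret C: abelian_group C by (rule C_abelian_group)
  have gadd: "\<phi> \<oplus>\<^bsub>C\<^esub> \<psi> \<in> gr C n" if "\<phi> \<in> gr C n" "\<psi> \<in> gr C n" for \<phi> \<psi> n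
    using that linear_add[of \<phi> \<psi>] unfolding C_gr by (auto simp: C_ops homog_carrier)
  have gract: "ract C \<phi> a \<in> gr C (n + k)" if "\<phi> \<in> gr C n" "a \<in> homog A k" for \<phi> a n k
    unfolding C_gr
  proof (intro conjI allI impI ballI)
    show "linear (ract C \<phi> a)" using that linear_ract homog_carrier by (simp add: C_gr)
    fix l b assume l: "l \<noteq> - (n + k)" and b: "b \<in> homog A l"
    then have "k + l \<noteq> - n" by simp
    moreover have "a \<otimes> b \<in> homog A (k + l)" using mult_homog[OF that(2) b] .
    ultimately have "\<phi> (a \<otimes> b) = \<zero>\<^bsub>N\<^esub>" using that(1) unfolding C_gr by blast
    then show "ract C \<phi> a b = \<zero>\<^bsub>N\<^esub>" using homog_carrier[OF b] by (simp add: C_ops)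
  qed
  have gneg: "\<ominus>\<^bsub>C\<^esub> \<phi> \<in> gr C n" if p: "\<phi> \<in> gr C n" for \<phi> n
  proof -
    have pc: "\<phi> \<in> carrier C" using p gr_subset by blast
    have mc: "ract C \<phi> (\<ominus> \<one>) \<in> carrier C" using C_ract_closed[OF pc] by simp
    have "\<ominus>\<^bsub>C\<^esub> \<phi> = ract C \<phi> (\<ominus> \<one>)"
      using C.minus_equality[of "ract C \<phi> (\<ominus> \<one>)" \<phi>] C_neg[OF pc] C.a_comm[OF pc mc] mc pc by simp
    then show ?thesis using gract[OF p homog_a_inv[OF one_homog]] by simp
  qed
  have "graded_by C (gr C)"
  proof (rule graded_byI[OF C_abelian_group])
    fix n
    have "\<zero>\<^bsub>C\<^esub> \<in> gr C n" using linear_zero unfolding C_gr by (auto simp: C_ops homog_carrier)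
    then show "additive_subgroup (gr C n) C"
      by (intro additive_subgroupI C.add.subgroupI) (use gr_subset gadd gneg in auto)
  next
    fix \<phi> assume p: "\<phi> \<in> carrier C"
    then obtain F where F: "finite F" "\<forall>k. k \<notin> F \<longrightarrow> (\<forall>a\<in>homog A k. \<phi> a = \<zero>\<^bsub>N\<^esub>)" and l: "linear \<phi>"
      unfolding C_carrier by blast
    define c where "c n = (\<lambda>b\<in>carrier A. \<phi> (hpart A (homog A) (- n) b))" for n
    have c: "c n \<in> gr C n" for n
      unfolding C_gr
    proof (intro conjI allI impI ballI)
      show "linear (c n)"
        unfolding linear_def c_def by (auto simp: linearD[OF l] hpart_add hpart_mult_right homog_carrier)
      show "c n a = \<zero>\<^bsub>N\<^esub>" if "k \<noteq> - n" "a \<in> homog A k" for k a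
        using that hpart_of_homog[OF that(2)] homog_carrier linearD(5)[OF l] by (simp add: c_def)
    qed
    have cz: "c n = \<zero>\<^bsub>C\<^esub>" if "n \<notin> uminus ` F" for n
    proof (rule linear_eqI[OF _ linear_zero])
      show "linear (c n)" using c by (simp add: C_gr)
      fix k a assume a: "a \<in> homog A k"
      have "- n \<notin> F" using that by force
      then show "c n a = \<zero>\<^bsub>C\<^esub> a"
        using F(2) a hpart_of_homog[OF a] homog_carrier[OF a] linearD(5)[OF l] by (simp add: c_def C_ops)
    qed
    have cc: "c n \<in> carrier C" for n using c gr_subset by blast
    have "\<phi> = (\<Oplus>\<^bsub>C\<^esub>n\<in>uminus ` F. c n)"
    proof (rule linear_eqI[OF l])
      have "(\<Oplus>\<^bsub>C\<^esub>n\<in>uminus ` F. c n) \<in> carrier C" using cc by (intro C.finsum_closed) auto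
      then show "linear (\<Oplus>\<^bsub>C\<^esub>n\<in>uminus ` F. c n)" by (simp add: C_carrier)
      fix k a assume a: "a \<in> homog A k"
      note ac = homog_carrier[OF a]
      have e: "c n a = (if n = - k then \<phi> a else \<zero>\<^bsub>N\<^esub>)" for n
        using hpart_of_homog[OF a, of "- n"] ac linearD(5)[OF l] by (auto simp: c_def)
      have "(\<Oplus>\<^bsub>C\<^esub>n\<in>uminus ` F. c n) a = (\<Oplus>\<^bsub>N\<^esub>n\<in>uminus ` F. c n a)"
        by (rule C_finsum) (use F cc ac in auto)
      also have "\<dots> = (\<Oplus>\<^bsub>N\<^esub>n\<in>uminus ` F. if - k = n then \<phi> a else \<zero>\<^bsub>N\<^esub>)"
        using linearD(2)[OF l ac] by (intro N.finsum_cong') (auto simp: e)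
      also have "\<dots> = \<phi> a"
      proof (cases "k \<in> F")
        case True
        then have "- k \<in> uminus ` F" by simp
        then show ?thesis
          using N.add.finprod_singleton[of "- k" "uminus ` F" "\<lambda>_. \<phi> a"] F(1) linearD(2)[OF l ac] by simp
      next
        case False
        then have "(\<Oplus>\<^bsub>N\<^esub>n\<in>uminus ` F. if - k = n then \<phi> a else \<zero>\<^bsub>N\<^esub>) = (\<Oplus>\<^bsub>N\<^esub>n\<in>uminus ` F. \<zero>\<^bsub>N\<^esub>)"
          by (intro N.finsum_cong') auto
        then show ?thesis using False F(2) a by (simp add: N.finsum_zero)
      qed
      finally show "\<phi> a = (\<Oplus>\<^bsub>C\<^esub>n\<in>uminus ` F. c n) a" by simp
    qed
    then show "\<exists>c F. finite F \<and> (\<forall>n. c n \<in> gr C n) \<and> (\<forall>n. n \<notin> F \<longrightarrow> c n = \<zero>\<^bsub>C\<^esub>) \<and> \<phi> = (\<Oplus>\<^bsub>C\<^esub>n\<in>F. c n)"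
      using F(1) c cz by (intro exI[of _ c] exI[of _ "uminus ` F"]) auto
  next
    fix c F assume F: "finite F" and c: "\<forall>n. c n \<in> gr C n" and s: "(\<Oplus>\<^bsub>C\<^esub>n\<in>F. c n) = \<zero>\<^bsub>C\<^esub>"
    show "\<forall>n\<in>F. c n = \<zero>\<^bsub>C\<^esub>"
    proof
      fix m assume m: "m \<in> F"
      have l: "linear (c n)" for n using c by (simp add: C_gr)
      show "c m = \<zero>\<^bsub>C\<^esub>"
      proof (rule linear_eqI[OF l linear_zero])
        fix k a assume a: "a \<in> homog A k"
        note ac = homog_carrier[OF a]
        show "c m a = \<zero>\<^bsub>C\<^esub> a"
        proof (cases "k = - m")
          case False
          then have "c m a = \<zero>\<^bsub>N\<^esub>" using c a unfolding C_gr by blast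
          then show ?thesis using ac by (simp add: C_ops)
        next
          case True
          \<comment> \<open>At an element of degree \<open>- m\<close> all summands but
            \<open>c m\<close> vanish.\<close>
          have e: "c n a = (if m = n then c n a else \<zero>\<^bsub>N\<^esub>)" for n
          proof (cases "m = n")
            case False
            then have "k \<noteq> - n" using True by simp
            then show ?thesis using c a False unfolding C_gr by auto
          qed simp
          have "\<zero>\<^bsub>N\<^esub> = (\<Oplus>\<^bsub>N\<^esub>n\<in>F. c n a)"
            using C_finsum[where c = c, OF F subsetD[OF gr_subset c[rule_format]] ac] ac s by (simp add: C_ops)
          also have "\<dots> = (\<Oplus>\<^bsub>N\<^esub>n\<in>F. if m = n then c n a else \<zero>\<^bsub>N\<^esub>)"
            using linearD(2)[OF l ac] e by (intro N.finsum_cong') auto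
          also have "\<dots> = c m a"
            using N.add.finprod_singleton[OF m F, of "\<lambda>n. c n a"] linearD(2)[OF l ac] by simp
          finally show ?thesis using ac by (simp add: C_ops)
        qed
      qed
    qed
  qed
  then show ?thesis
    using C_rmodule gract graded_ring_axioms by (simp add: graded_module_iff graded_rmodule_def)
qed

section \<open>Degree zero part and generators of the coinduced module\<close>

text \<open>The homomorphism from the degree zero part to \<open>N\<close> with value
  \<open>v\<close> at \<open>\<one>\<close>, extended by zero to all of \<open>A\<close>.\<close>

definition unit where "unit v = (\<lambda>b\<in>carrier A. ract N v (hpart A (homog A) 0 b))"

lemma unit_gr:
  assumes v: "v \<in> carrier N"
  shows "unit v \<in> gr C 0"
  unfolding C_gr
proof (intro conjI allI impI ballI)
  note [simp] = hpart_homog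
  show "linear (unit v)"
    unfolding linear_def unit_def using v N.ract_mult[OF v]
    by (auto simp: hpart_add hpart_mult_right homog_carrier N.ract_add_right[simplified] N.ract_closed[simplified])
  show "unit v a = \<zero>\<^bsub>N\<^esub>" if "k \<noteq> - 0" "a \<in> homog A k" for k a
    using that hpart_of_homog[OF that(2), of 0] homog_carrier[OF that(2)] N.ract_zero_right[OF v] by (simp add: unit_def)
qed

lemma unit_add: "v \<in> carrier N \<Longrightarrow> w \<in> carrier N \<Longrightarrow> unit (v \<oplus>\<^bsub>N\<^esub> w) = unit v \<oplus>\<^bsub>C\<^esub> unit w"
  by (auto simp: C_ops unit_def N.ract_add_left hpart_homog)

lemma unit_ract: "v \<in> carrier N \<Longrightarrow> r \<in> homog A 0 \<Longrightarrow> unit (ract N v r) = ract C (unit v) r"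
  using N.ract_mult[of v r] by (auto simp: C_ops unit_def homog_carrier hpart_mult_left hpart_homog)

text \<open>The inverse is evaluation at \<open>\<one>\<close>.\<close>

lemma unit_bij: "bij_betw (unit) (carrier N) (gr C 0)"
  unfolding bij_betw_def
proof
  have 1: "unit v \<one> = v" if "v \<in> carrier N" for v
    using that N.ract_one[OF that] by (simp add: unit_def hpart_of_homog[OF one_homog])
  show "inj_on (unit) (carrier N)"
    by (rule inj_onI) (metis 1)
  have "\<phi> \<in> unit ` carrier N" if p: "\<phi> \<in> gr C 0" for \<phi>
  proof -
    have l: "linear \<phi>" using p by (simp add: C_gr)
    have c: "\<phi> \<one> \<in> carrier N" by (rule linearD(2)[OF l]) simp
    note u = unit_gr[OF c]
    have "\<phi> = unit (\<phi> \<one>)"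
    proof (rule linear_eqI[OF l])
      show "linear (unit (\<phi> \<one>))" using u by (simp add: C_gr)
      fix k a assume a: "a \<in> homog A k"
      show "\<phi> a = unit (\<phi> \<one>) a"
      proof (cases "k = 0")
        case True
        then have a0: "a \<in> homog A 0" using a by simp
        then show ?thesis
          using linearD(4)[OF l one_closed a0] homog_carrier[OF a] by (simp add: unit_def hpart_of_homog[OF a0])
      next
        case False
        then show ?thesis using p u a unfolding C_gr by simp
      qed
    qed
    then show ?thesis using c by blast
  qed
  then show "unit ` carrier N = gr C 0" using unit_gr by auto
qed

text \<open>Finite sums of elements \<open>ract C (unit v) a\<close>, indexed by lists so that the
  coinduced module can be bounded in size by the lists over
  \<open>carrier N \<times> carrier A\<close>.\<close>

definition unit_sum where "unit_sum l = foldr (\<lambda>(v, a) \<phi>. ract C (unit v) a \<oplus>\<^bsub>C\<^esub> \<phi>) l \<zero>\<^bsub>C\<^esub>"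

lemma unit_sum_simps:
  "unit_sum [] = \<zero>\<^bsub>C\<^esub>" "unit_sum ((v, a) # l) = ract C (unit v) a \<oplus>\<^bsub>C\<^esub> unit_sum l"
  by (simp_all add: unit_sum_def)

lemma unit_sum_closed: "l \<in> lists (carrier N \<times> carrier A) \<Longrightarrow> unit_sum l \<in> carrier C"
proof (induction l)
  case Nil
  then show ?case by (simp add: unit_sum_simps C_zero_closed)
next
  case (Cons p l)
  then obtain v a where "p = (v, a)" "v \<in> carrier N" "a \<in> carrier A" by auto
  then show ?case
    using Cons unit_gr[of v] gr_subset[of 0] C_add_closed C_ract_closed by (auto simp: unit_sum_simps)
qed

lemma unit_sum_append:
  assumes "l \<in> lists (carrier N \<times> carrier A)" "l' \<in> lists (carrier N \<times> carrier A)"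
  shows "unit_sum (l @ l') = unit_sum l \<oplus>\<^bsub>C\<^esub> unit_sum l'"
  using assms(1)
proof (induction l)
  interpret C: abelian_group C by (rule C_abelian_group)
  case Nil
  then show ?case using unit_sum_closed[OF assms(2)] by (simp add: unit_sum_simps)
next
  interpret C: abelian_group C by (rule C_abelian_group)
  case (Cons p l)
  then obtain v a where p: "p = (v, a)" "v \<in> carrier N" "a \<in> carrier A" by auto
  have "ract C (unit v) a \<in> carrier C" using unit_gr[OF p(2)] gr_subset C_ract_closed[OF _ p(3)] by blast
  then show ?case
    using Cons p unit_sum_closed[OF assms(2)] unit_sum_closed[of l] by (simp add: unit_sum_simps C.a_assoc)
qed

end

context strongly_graded_ring
begin

text \<open>Let \<open>\<phi>\<close> have degree \<open>n\<close>, and let \<open>\<one>\<close> be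
  a sum of products of \<open>u\<close> in degree \<open>- n\<close> and \<open>v\<close> in degree
  \<open>n\<close>. Then \<open>\<phi>\<close> is the sum of the elements
  \<open>ract C (unit (\<phi> u)) v\<close>, since \<open>\<phi>(u v b) = \<phi>(u) (v b)\<close>
  for \<open>b\<close> of degree \<open>- n\<close>. So strong grading bounds the size of the
  coinduced module.\<close>

lemma coind_generated:
  assumes N: "rmodule (deg0 A) N" and p: "\<phi> \<in> carrier (coind A N)"
  shows "\<phi> \<in> coinduction.unit_sum A N ` lists (carrier N \<times> carrier A)"
proof -
  interpret coinduction A N
    by (intro coinduction.intro right_moduleI[OF N] graded_ring_axioms)
  interpret CG: graded_module A C by (rule graded_module_coind)
  let ?W = "unit_sum ` lists (carrier N \<times> carrier A)"
  have Wadd: "\<phi> \<oplus>\<^bsub>C\<^esub> \<psi> \<in> ?W" if "\<phi> \<in> ?W" "\<psi> \<in> ?W" for \<phi> \<psi>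
  proof -
    obtain l where l: "\<phi> = unit_sum l" "l \<in> lists (carrier N \<times> carrier A)" using \<open>\<phi> \<in> ?W\<close> by (rule imageE)
    obtain l' where l': "\<psi> = unit_sum l'" "l' \<in> lists (carrier N \<times> carrier A)" using \<open>\<psi> \<in> ?W\<close> by (rule imageE)
    have "\<phi> \<oplus>\<^bsub>C\<^esub> \<psi> = unit_sum (l @ l')" using unit_sum_append l l' by simp
    moreover have "l @ l' \<in> lists (carrier N \<times> carrier A)" using l(2) l'(2) by simp
    ultimately show ?thesis by (rule image_eqI)
  qed
  have Wc: "\<phi> \<in> carrier C" if "\<phi> \<in> ?W" for \<phi> using that unit_sum_closed by blast
  show ?thesis
    using p
  proof (induction \<phi> rule: CG.graded_induct)
    case (homog n \<phi>)
    have l: "linear \<phi>" using homog by (simp add: C_gr)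
    \<comment> \<open>Projecting \<open>b\<close> to degree \<open>- n\<close> changes nothing for
      \<open>\<phi>\<close> itself, but keeps \<open>v b\<close> in degree zero for each factor
      \<open>v\<close>.\<close>
    have "(\<lambda>b\<in>carrier A. \<phi> (\<one> \<otimes> hpart A (homog A) (- n) b)) \<in> ?W"
    proof (induction rule: one_induct[of n])
      case (mult u v)
      note uv = homog_carrier[OF mult(1)] homog_carrier[OF mult(2)]
      have c: "\<phi> u \<in> carrier N" using linearD(2)[OF l uv(1)] .
      have r: "ract C (unit (\<phi> u)) v \<in> carrier C" using unit_gr[OF c] gr_subset C_ract_closed[OF _ uv(2)] by blast
      have "\<phi> (u \<otimes> v \<otimes> hpart A (homog A) (- n) b) = unit (\<phi> u) (v \<otimes> b)" if b: "b \<in> carrier A" for b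
        using linearD(4)[OF l uv(1) hpart_homog, of "v \<otimes> b"] uv b hpart_mult_left[OF mult(2) b, of 0]
        by (simp add: unit_def m_assoc)
      then have "(\<lambda>b\<in>carrier A. \<phi> (u \<otimes> v \<otimes> hpart A (homog A) (- n) b)) = ract C (unit (\<phi> u)) v"
        by (auto simp: C_ops)
      also have "\<dots> = unit_sum [(\<phi> u, v)]" using r by (simp add: unit_sum_simps)
      finally show ?case using c uv by (intro image_eqI[of _ _ "[(\<phi> u, v)]"]) auto
    next
      case (add a c)
      have "(\<lambda>b\<in>carrier A. \<phi> ((a \<oplus> c) \<otimes> hpart A (homog A) (- n) b))
        = (\<lambda>b\<in>carrier A. \<phi> (a \<otimes> hpart A (homog A) (- n) b)) \<oplus>\<^bsub>C\<^esub> (\<lambda>b\<in>carrier A. \<phi> (c \<otimes> hpart A (homog A) (- n) b))"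
        using add(1,2) by (auto simp: C_ops l_distr linearD(3)[OF l] homog_carrier)
      then show ?case using Wadd[OF add(3,4)] by (rule ssubst[where P = "\<lambda>x. x \<in> ?W"])
    qed
    moreover have "\<phi> = (\<lambda>b\<in>carrier A. \<phi> (\<one> \<otimes> hpart A (homog A) (- n) b))" (is "_ = ?\<psi>")
    proof (rule linear_eqI[OF l])
      show "linear ?\<psi>" using Wc[OF calculation] by (simp add: C_carrier)
      fix k a assume a: "a \<in> homog A k"
      have "\<phi> a = \<zero>\<^bsub>N\<^esub>" if "k \<noteq> - n" using homog a that unfolding C_gr by blast
      then show "\<phi> a = ?\<psi> a"
        using homog_carrier[OF a] linearD(5)[OF l] by (auto simp: hpart_of_homog[OF a])
    qed
    ultimately show ?case by (rule ssubst[where P = "\<lambda>x. x \<in> ?W", rotated])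
  next
    case (add \<phi> \<psi>)
    then show ?case using Wadd by blast
  qed
qed

text \<open>The elements of the coinduced module are functions, so it is copied into
  \<open>'u\<close> along an injection, which exists because lists index its elements. The map
  \<open>unit\<close> identifies \<open>N\<close> with the degree zero part of the copy.\<close>

lemma ess_surjective_deg0:
  assumes U: "natLeq <o |UNIV :: 'u set|" and A: "small (carrier A)"
  shows "ess_surjective (Gr A) (RMod (deg0 A)) (deg0_functor A)"
  unfolding ess_surjective_def
proof
  fix N assume N: "N \<in> Ob (RMod (deg0 A))"
  then have N': "rmodule (deg0 A) N" "small (carrier N)" by simp_all
  interpret coinduction A N
    by (intro coinduction.intro right_moduleI[OF N'(1)] graded_ring_axioms)
  interpret CG: graded_module A C by (rule graded_module_coind)
  have "carrier C \<subseteq> unit_sum ` lists (carrier N \<times> carrier A)" using coind_generated[OF N'(1)] by blast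
  then have "|carrier C| <o |UNIV :: 'u set|"
    using lists_Times_ordLess[OF U N'(2) A] card_of_mono1 card_of_image ordLeq_ordLess_trans ordLeq_transitive by metis
  then obtain e :: "('u \<Rightarrow> 'u) \<Rightarrow> 'u" where e: "inj_on e (carrier C)" "small (e ` carrier C)"
    by (rule injection_exists)
  define d where "d = inv_into (carrier C) e"
  have de [simp]: "d (e \<phi>) = \<phi>" if "\<phi> \<in> carrier C" for \<phi> using e(1) that by (simp add: d_def)
  define M :: "('u, 'u) gmod" where "M = \<lparr>carrier = e ` carrier C, monoid.mult = undefined, monoid.one = undefined,
    ring.zero = e \<zero>\<^bsub>C\<^esub>, ring.add = (\<lambda>x y. e (d x \<oplus>\<^bsub>C\<^esub> d y)), ract = (\<lambda>x a. e (ract C (d x) a)), gr = (\<lambda>n. e ` gr C n)\<rparr>"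
  have M_simps: "carrier M = e ` carrier C" "\<zero>\<^bsub>M\<^esub> = e \<zero>\<^bsub>C\<^esub>" "gr M n = e ` gr C n"
    "\<phi> \<in> carrier C \<Longrightarrow> \<psi> \<in> carrier C \<Longrightarrow> e \<phi> \<oplus>\<^bsub>M\<^esub> e \<psi> = e (\<phi> \<oplus>\<^bsub>C\<^esub> \<psi>)"
    "\<phi> \<in> carrier C \<Longrightarrow> ract M (e \<phi>) a = e (ract C \<phi> a)" for n \<phi> \<psi> a
    by (simp_all add: M_def)
  have "graded_rmodule A M"
  proof (rule graded_rmodule_image[OF graded_module_coind, of e])
    show "e (hpart C (gr C) n x) = \<zero>\<^bsub>M\<^esub>" if "x \<in> carrier C" "e x = \<zero>\<^bsub>M\<^esub>" for x n
      using that inj_onD[OF e(1), of x "\<zero>\<^bsub>C\<^esub>"] by (simp add: M_simps)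
  qed (simp_all add: M_simps)
  then have M: "M \<in> Ob (Gr A)" using e(2) by (simp add: M_simps)
  have gc: "\<phi> \<in> carrier C" if "\<phi> \<in> gr C n" for \<phi> n using that gr_subset by blast
  let ?f = "\<lambda>v\<in>carrier N. e (unit v)"
  have f: "?f \<in> rhom (deg0 A) N (fo (deg0_functor A) M)"
    by (rule rhomI) (auto simp: M_simps gc[OF unit_gr] unit_add unit_ract[symmetric] unit_gr N.ract_closed[simplified])
  have "inj_on e (unit ` carrier N)" by (rule inj_on_subset[OF e(1)]) (use gc unit_gr in blast)
  then have "inj_on (e \<circ> unit) (carrier N)" using unit_bij comp_inj_on unfolding bij_betw_def by blast
  moreover have "?f ` carrier N = e ` (unit ` carrier N)" by (auto simp: image_image)
  ultimately have "bij_betw ?f (carrier N) (gr M 0)"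
    using unit_bij by (simp add: bij_betw_def M_simps inj_on_def)
  then have "inverse_arrows (RMod (deg0 A)) N (fo (deg0_functor A) M) ?f (restrict (inv_into (carrier N) ?f) (gr M 0))"
    using rhom_bij_inverse[OF N'(1) _ f] deg0_functor_Ob[OF M] by (simp add: M_simps)
  then show "\<exists>M\<in>Ob (Gr A). isomorphic_in (RMod (deg0 A)) (fo (deg0_functor A) M) N"
    unfolding isomorphic_in_iff
    by (intro bexI[OF _ M] conjI N deg0_functor_Ob[OF M] exI) (rule inverse_arrows_sym)
qed

lemma cat_equivalence_deg0:
  assumes "natLeq <o |UNIV :: 'u set|" and "small (carrier A)"
  shows "cat_equivalence (Gr A) (RMod (deg0 A)) (deg0_functor A)"
  unfolding cat_equivalence_iff using is_functor_deg0 fully_faithful_deg0 ess_surjective_deg0[OF assms] by blast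

end

section \<open>Tensoring with the degree one part\<close>

definition tensor_relators :: "('k, 'u) galgebra \<Rightarrow> ('u, 'u) rmod \<Rightarrow> ('u \<times> 'u \<Rightarrow>\<^sub>0 int) set" where
  "tensor_relators A N =
    {frag_of (x \<oplus>\<^bsub>N\<^esub> y, b) - frag_of (x, b) - frag_of (y, b) | x y b.
        x \<in> carrier N \<and> y \<in> carrier N \<and> b \<in> homog A 1} \<union>
    {frag_of (x, b \<oplus>\<^bsub>A\<^esub> c) - frag_of (x, b) - frag_of (x, c) | x b c.
        x \<in> carrier N \<and> b \<in> homog A 1 \<and> c \<in> homog A 1} \<union>
    {frag_of (ract N x r, b) - frag_of (x, r \<otimes>\<^bsub>A\<^esub> b) | x r b.
        x \<in> carrier N \<and> r \<in> homog A 0 \<and> b \<in> homog A 1}"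

definition tensor_class :: "('k, 'u) galgebra \<Rightarrow> ('u, 'u) rmod \<Rightarrow> ('u \<times> 'u \<Rightarrow>\<^sub>0 int) \<Rightarrow> ('u \<times> 'u \<Rightarrow>\<^sub>0 int) set" where
  "tensor_class A N c = tensor_rel A N #>\<^bsub>tensor_free A N\<^esub> c"

definition tens :: "('k, 'u) galgebra \<Rightarrow> ('u, 'u) rmod \<Rightarrow> 'u \<Rightarrow> 'u \<Rightarrow> ('u \<times> 'u \<Rightarrow>\<^sub>0 int) set" where
  "tens A N x b = tensor_class A N (frag_of (x, b))"

locale tensoring = graded_ring A + N: right_module "deg0 A" N
  for A :: "('k, 'u) galgebra" (structure) and N :: "('u, 'u) rmod"
begin

abbreviation S where "S \<equiv> carrier N \<times> homog A 1"
abbreviation T where "T \<equiv> tensor_rel A N"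
abbreviation cls where "cls \<equiv> tensor_class A N"
abbreviation TN where "TN \<equiv> tensor_mod A N"

lemma mult_degree_one [simp]:
  "r \<in> homog A 0 \<Longrightarrow> b \<in> homog A 1 \<Longrightarrow> r \<otimes> b \<in> homog A 1"
  "r \<in> homog A 0 \<Longrightarrow> b \<in> homog A 1 \<Longrightarrow> b \<otimes> r \<in> homog A 1"
  using mult_homog[of r 0 b 1] mult_homog[of b 1 r 0] by simp_all

lemma relators_keys: "c \<in> tensor_relators A N \<Longrightarrow> Poly_Mapping.keys c \<subseteq> S"
proof -
  have d: "Poly_Mapping.keys (c - d) \<subseteq> S" if "Poly_Mapping.keys c \<subseteq> S" "Poly_Mapping.keys d \<subseteq> S" for c d
    using that keys_diff[of c d] by blast
  show "c \<in> tensor_relators A N \<Longrightarrow> Poly_Mapping.keys c \<subseteq> S"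
    unfolding tensor_relators_def
    by (elim UnE CollectE exE conjE; hypsubst; intro d; simp add: homog_add)
qed

lemma tensor_rel_def': "T = generate (free_Abelian_group S) (tensor_relators A N)"
  by (simp add: tensor_rel_def tensor_relators_def tensor_free_def)

lemma T_subgroup: "subgroup T (free_Abelian_group S)"
  unfolding tensor_rel_def'
  by (rule group.generate_is_subgroup[OF group_free_Abelian_group]) (use relators_keys in \<open>auto simp: free_Abelian_group_def\<close>)

lemma T_keys: "c \<in> T \<Longrightarrow> Poly_Mapping.keys c \<subseteq> S"
  using subgroup.subset[OF T_subgroup] by (auto simp: free_Abelian_group_def)

lemma T_zero [simp]: "0 \<in> T"
  using subgroup.one_closed[OF T_subgroup] by simp

lemma T_add: "c \<in> T \<Longrightarrow> d \<in> T \<Longrightarrow> c + d \<in> T"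
  using subgroup.m_closed[OF T_subgroup] by simp

lemma T_uminus: "c \<in> T \<Longrightarrow> - c \<in> T"
  using subgroup.m_inv_closed[OF T_subgroup] T_keys by (metis inv_free_Abelian_group)

lemma T_diff: "c \<in> T \<Longrightarrow> d \<in> T \<Longrightarrow> c - d \<in> T"
  using T_add[OF _ T_uminus] by (metis diff_conv_add_uminus)

lemma T_relator: "c \<in> tensor_relators A N \<Longrightarrow> c \<in> T"
  unfolding tensor_rel_def' by (rule generate.incl)

text \<open>Inverses occur in \<open>generate\<close> only at generators, so the case of negatives
  is limited to relators.\<close>

lemma T_induct [consumes 1, case_names zero relator add uminus]:
  assumes "c \<in> T" "P 0" "\<And>c. c \<in> tensor_relators A N \<Longrightarrow> P c"
    "\<And>c d. c \<in> T \<Longrightarrow> d \<in> T \<Longrightarrow> P c \<Longrightarrow> P d \<Longrightarrow> P (c + d)" "\<And>c. c \<in> tensor_relators A N \<Longrightarrow> P (- c)"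
  shows "P c"
proof -
  have "c \<in> T \<and> P c"
    using assms(1) unfolding tensor_rel_def'
  proof (induction rule: generate.induct)
    case (inv h)
    then show ?case using assms(5) T_uminus[OF T_relator] relators_keys unfolding tensor_rel_def' by simp
  next
    case (eng c d)
    then show ?case using assms(4) T_add unfolding tensor_rel_def' by simp
  qed (use assms T_relator T_zero in \<open>auto simp: tensor_rel_def'\<close>)
  then show ?thesis by blast
qed

lemma mem_cls: "d \<in> cls c \<longleftrightarrow> d - c \<in> T"
proof
  assume "d \<in> cls c"
  then show "d - c \<in> T" by (auto simp: tensor_class_def r_coset_def tensor_free_def)
next
  assume "d - c \<in> T"
  then show "d \<in> cls c"
    unfolding tensor_class_def r_coset_def tensor_free_def by (auto intro!: bexI[of _ "d - c"])
qed

lemma cls_eq_iff: "cls c = cls d \<longleftrightarrow> c - d \<in> T"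
proof
  have "c \<in> cls c" by (simp add: mem_cls)
  then show "c - d \<in> T" if "cls c = cls d" using that mem_cls by blast
next
  assume cd: "c - d \<in> T"
  have "x - c \<in> T \<longleftrightarrow> x - d \<in> T" for x
    using T_add[OF _ cd, of "x - c"] T_diff[OF _ cd, of "x - d"] by (auto simp: algebra_simps)
  then show "cls c = cls d" by (auto simp: mem_cls)
qed

lemma TN_carrier: "carrier TN = cls ` {c. Poly_Mapping.keys c \<subseteq> S}"
  by (auto simp: tensor_mod_def FactGroup_def RCOSETS_def tensor_class_def tensor_free_def)

lemma TN_zero: "\<zero>\<^bsub>TN\<^esub> = cls 0"
by (auto simp: mem_cls tensor_mod_def)

lemma TN_add: "cls c \<oplus>\<^bsub>TN\<^esub> cls d = cls (c + d)"
proof -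
  have "cls c <#>\<^bsub>tensor_free A N\<^esub> cls d = cls (c + d)"
  proof (rule Set.set_eqI)
    fix x
    have "x \<in> cls c <#>\<^bsub>tensor_free A N\<^esub> cls d \<longleftrightarrow> (\<exists>y z. y - c \<in> T \<and> z - d \<in> T \<and> x = y + z)"
      unfolding mem_cls[symmetric] by (auto simp: set_mult_def tensor_free_def)
    also have "\<dots> \<longleftrightarrow> x - (c + d) \<in> T"
    proof
      assume "\<exists>y z. y - c \<in> T \<and> z - d \<in> T \<and> x = y + z"
      then obtain y z where "y - c \<in> T" "z - d \<in> T" "x = y + z" by blast
      then show "x - (c + d) \<in> T" using T_add[of "y - c" "z - d"] by (simp add: algebra_simps)
    next
      assume "x - (c + d) \<in> T"
      then have "(x - d) - c \<in> T" "d - d \<in> T" "x = (x - d) + d" by (simp_all add: algebra_simps)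
      then show "\<exists>y z. y - c \<in> T \<and> z - d \<in> T \<and> x = y + z" by blast
    qed
    finally show "x \<in> cls c <#>\<^bsub>tensor_free A N\<^esub> cls d \<longleftrightarrow> x \<in> cls (c + d)" by (simp add: mem_cls)
  qed
  then show ?thesis by (simp add: tensor_mod_def FactGroup_def)
qed

lemma TN_cases:
  assumes "z \<in> carrier TN"
  obtains c where "Poly_Mapping.keys c \<subseteq> S" "z = cls c"
  using assms unfolding TN_carrier by blast

lemma cls_closed: "Poly_Mapping.keys c \<subseteq> S \<Longrightarrow> cls c \<in> carrier TN"
  unfolding TN_carrier by blast

lemma TN_abelian_group: "abelian_group TN"
proof (rule abelian_groupI)
  fix x y assume "x \<in> carrier TN" "y \<in> carrier TN"
  then show "x \<oplus>\<^bsub>TN\<^esub> y \<in> carrier TN"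
    by (elim TN_cases) (use keys_add in \<open>fastforce simp: TN_add intro: cls_closed\<close>)
  show "x \<oplus>\<^bsub>TN\<^esub> y = y \<oplus>\<^bsub>TN\<^esub> x"
    using \<open>x \<in> carrier TN\<close> \<open>y \<in> carrier TN\<close> by (elim TN_cases) (simp add: TN_add add.commute)
next
  fix x y z assume "x \<in> carrier TN" "y \<in> carrier TN" "z \<in> carrier TN"
  then show "x \<oplus>\<^bsub>TN\<^esub> y \<oplus>\<^bsub>TN\<^esub> z = x \<oplus>\<^bsub>TN\<^esub> (y \<oplus>\<^bsub>TN\<^esub> z)"
    by (elim TN_cases) (simp add: TN_add add.assoc)
next
  fix x assume "x \<in> carrier TN"
  then obtain c where c: "Poly_Mapping.keys c \<subseteq> S" "x = cls c" by (rule TN_cases)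
  then show "\<zero>\<^bsub>TN\<^esub> \<oplus>\<^bsub>TN\<^esub> x = x" by (simp add: TN_add TN_zero)
  show "\<exists>y\<in>carrier TN. y \<oplus>\<^bsub>TN\<^esub> x = \<zero>\<^bsub>TN\<^esub>"
    using c by (intro bexI[of _ "cls (- c)"] cls_closed) (simp_all add: TN_add TN_zero)
qed (simp add: TN_zero cls_closed)

sublocale TN: abelian_group TN by (rule TN_abelian_group)

lemma tens_closed [simp]: "x \<in> carrier N \<Longrightarrow> b \<in> homog A 1 \<Longrightarrow> tens A N x b \<in> carrier TN"
  unfolding tens_def by (rule cls_closed) simp

lemma tens_add_left:
  assumes "x \<in> carrier N" "y \<in> carrier N" "b \<in> homog A 1"
  shows "tens A N (x \<oplus>\<^bsub>N\<^esub> y) b = tens A N x b \<oplus>\<^bsub>TN\<^esub> tens A N y b"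
proof -
  have "frag_of (x \<oplus>\<^bsub>N\<^esub> y, b) - frag_of (x, b) - frag_of (y, b) \<in> T"
    by (rule T_relator) (use assms in \<open>auto simp: tensor_relators_def\<close>)
  then show ?thesis unfolding tens_def TN_add cls_eq_iff by (simp add: diff_diff_eq)
qed

lemma tens_add_right:
  assumes "x \<in> carrier N" "b \<in> homog A 1" "c \<in> homog A 1"
  shows "tens A N x (b \<oplus> c) = tens A N x b \<oplus>\<^bsub>TN\<^esub> tens A N x c"
proof -
  have "frag_of (x, b \<oplus> c) - frag_of (x, b) - frag_of (x, c) \<in> T"
    by (rule T_relator) (use assms in \<open>auto simp: tensor_relators_def\<close>)
  then show ?thesis unfolding tens_def TN_add cls_eq_iff by (simp add: diff_diff_eq)
qed

lemma tens_balanced: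
  assumes "x \<in> carrier N" "r \<in> homog A 0" "b \<in> homog A 1"
  shows "tens A N (ract N x r) b = tens A N x (r \<otimes> b)"
  unfolding tens_def cls_eq_iff
  by (rule T_relator) (use assms in \<open>auto simp: tensor_relators_def\<close>)

lemma tens_zero_left: "b \<in> homog A 1 \<Longrightarrow> tens A N \<zero>\<^bsub>N\<^esub> b = \<zero>\<^bsub>TN\<^esub>"
  using tens_add_left[of "\<zero>\<^bsub>N\<^esub>" "\<zero>\<^bsub>N\<^esub>" b] TN.add.l_cancel_one[of "tens A N \<zero>\<^bsub>N\<^esub> b" "tens A N \<zero>\<^bsub>N\<^esub> b"] by simp

text \<open>A negated generator is again an elementary tensor, so the latter generate the tensor
  product under addition alone.\<close>

lemma tens_minus:
  assumes "x \<in> carrier N" "b \<in> homog A 1"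
  shows "cls (- frag_of (x, b)) = tens A N (\<ominus>\<^bsub>N\<^esub> x) b"
proof -
  have "tens A N x b \<oplus>\<^bsub>TN\<^esub> tens A N (\<ominus>\<^bsub>N\<^esub> x) b = \<zero>\<^bsub>TN\<^esub>"
    using assms tens_add_left[of x "\<ominus>\<^bsub>N\<^esub> x" b] tens_zero_left by (simp add: N.r_neg)
  moreover have "tens A N x b \<oplus>\<^bsub>TN\<^esub> cls (- frag_of (x, b)) = \<zero>\<^bsub>TN\<^esub>"
    by (simp add: tens_def TN_add TN_zero)
  moreover have "cls (- frag_of (x, b)) \<in> carrier TN" using assms by (intro cls_closed) simp
  ultimately show ?thesis
    using assms TN.minus_equality[of _ "tens A N x b"] TN.a_comm[of "tens A N x b"] tens_closed by (metis N.a_inv_closed)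
qed

lemma tensor_induct [consumes 1, case_names tens add]:
  assumes z: "z \<in> carrier TN" and tens: "\<And>x b. x \<in> carrier N \<Longrightarrow> b \<in> homog A 1 \<Longrightarrow> P (tens A N x b)"
    and add: "\<And>z w. z \<in> carrier TN \<Longrightarrow> w \<in> carrier TN \<Longrightarrow> P z \<Longrightarrow> P w \<Longrightarrow> P (z \<oplus>\<^bsub>TN\<^esub> w)"
  shows "P z"
proof -
  obtain c where c: "Poly_Mapping.keys c \<subseteq> S" "z = cls c" using z by (rule TN_cases)
  have add': "P (cls (c + d))" if "cls c \<in> carrier TN" "cls d \<in> carrier TN" "P (cls c)" "P (cls d)" for c d
    using add[OF that] by (simp add: TN_add)
  \<comment> \<open>\<open>frag_induction\<close> proceeds through differences, so the claim is
    proved for \<open>c\<close> and \<open>- c\<close> together.\<close>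
  have "(cls c \<in> carrier TN \<and> P (cls c)) \<and> (cls (- c) \<in> carrier TN \<and> P (cls (- c)))"
    using c(1)
  proof (induction c rule: frag_induction)
    case zero
    have "\<zero>\<^bsub>TN\<^esub> = tens A N \<zero>\<^bsub>N\<^esub> \<zero>" by (simp add: tens_zero_left)
    then show ?case using tens[of "\<zero>\<^bsub>N\<^esub>" \<zero>] TN_zero by simp
  next
    case (one p)
    then obtain x b where "p = (x, b)" "x \<in> carrier N" "b \<in> homog A 1" by blast
    then show ?case using tens[of x b] tens[of "\<ominus>\<^bsub>N\<^esub> x" b] tens_closed[of x b] tens_closed[of "\<ominus>\<^bsub>N\<^esub> x" b]
      by (simp add: tens_minus tens_def[symmetric])
  next
    case (diff a b)
    have "cls (a - b) = cls a \<oplus>\<^bsub>TN\<^esub> cls (- b)" "cls (- (a - b)) = cls b \<oplus>\<^bsub>TN\<^esub> cls (- a)"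
      by (simp_all add: TN_add)
    then show ?case using diff add TN.a_closed by metis
  qed
  then show ?thesis using c(2) by blast
qed

text \<open>In \<open>tensor_mod\<close> and \<open>tensor_map\<close> an operation on classes is a
  union over the elements of a class. If \<open>g\<close> maps relators into the relations of the
  target, all members of the union coincide.\<close>

lemma induced_on_classes:
  assumes "\<And>c. c \<in> tensor_relators A N \<Longrightarrow> frag_extend g c \<in> tensor_rel A N'" and "tensoring A N'"
  shows "(\<Union>d\<in>cls c. tensor_rel A N' #>\<^bsub>tensor_free A N'\<^esub> frag_extend g d) = tensor_class A N' (frag_extend g c)"
proof -
  interpret N': tensoring A N' by fact
  have T: "frag_extend g c \<in> tensor_rel A N'" if "c \<in> T" for c
    using that
    by (induction rule: T_induct) (simp_all add: assms(1) frag_extend_add frag_extend_minus N'.T_add N'.T_uminus)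
  have "tensor_class A N' (frag_extend g d) = tensor_class A N' (frag_extend g c)" if "d \<in> cls c" for d
    using T[of "d - c"] that by (simp add: mem_cls N'.cls_eq_iff frag_extend_diff)
  moreover have "c \<in> cls c" by (simp add: mem_cls)
  ultimately show ?thesis unfolding tensor_class_def[symmetric] by blast
qed

section \<open>Module structure, size and universal property\<close>

lemma TN_ract_cls:
  assumes a: "a \<in> homog A 0"
  shows "ract TN (cls c) a = cls (frag_extend (\<lambda>(x, b). frag_of (x, b \<otimes> a)) c)"
proof -
  have "frag_extend (\<lambda>(x, b). frag_of (x, b \<otimes> a)) c \<in> T" if "c \<in> tensor_relators A N" for c
  proof (rule T_relator)
    show "frag_extend (\<lambda>(x, b). frag_of (x, b \<otimes> a)) c \<in> tensor_relators A N"
      using that a unfolding tensor_relators_def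
      by (elim UnE; clarsimp simp: frag_extend_diff l_distr homog_carrier m_assoc) (metis mult_degree_one(2))+
  qed
  then show ?thesis
    using induced_on_classes[OF _ tensoring_axioms] by (simp add: tensor_mod_def)
qed

lemma TN_ract_add:
  assumes "z \<in> carrier TN" "w \<in> carrier TN" "a \<in> homog A 0"
  shows "ract TN (z \<oplus>\<^bsub>TN\<^esub> w) a = ract TN z a \<oplus>\<^bsub>TN\<^esub> ract TN w a"
  using assms by (elim TN_cases) (simp add: TN_add TN_ract_cls frag_extend_add)

lemma TN_ract_tens: "a \<in> homog A 0 \<Longrightarrow> ract TN (tens A N x b) a = tens A N x (b \<otimes> a)"
  by (simp add: tens_def TN_ract_cls)

lemma TN_ract_closed: "z \<in> carrier TN \<Longrightarrow> a \<in> homog A 0 \<Longrightarrow> ract TN z a \<in> carrier TN"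
  by (induction rule: tensor_induct) (simp_all add: TN_ract_tens TN_ract_add)

lemma TN_rmodule: "rmodule (deg0 A) TN"
  unfolding rmodule_def
proof (intro conjI ballI ring_deg0 TN_abelian_group)
  fix z a b assume z: "z \<in> carrier TN" and ab: "a \<in> carrier (deg0 A)" "b \<in> carrier (deg0 A)"
  have ab': "a \<oplus> b \<in> homog A 0" "a \<otimes> b \<in> homog A 0" using ab homog_add deg0_mult by simp_all
  show "ract TN z (a \<oplus>\<^bsub>deg0 A\<^esub> b) = ract TN z a \<oplus>\<^bsub>TN\<^esub> ract TN z b"
    using z
  proof (induction rule: tensor_induct)
    case (add z w)
    then show ?case using ab ab' by (simp add: TN_ract_add TN_ract_closed TN.a_ac)
  qed (use ab ab' in \<open>simp add: TN_ract_tens r_distr homog_carrier tens_add_right\<close>)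
  show "ract TN z (a \<otimes>\<^bsub>deg0 A\<^esub> b) = ract TN (ract TN z a) b"
    using z
  proof (induction rule: tensor_induct)
    case (add z w)
    then show ?case using ab ab' by (simp add: TN_ract_add TN_ract_closed)
  qed (use ab ab' in \<open>simp add: TN_ract_tens m_assoc homog_carrier\<close>)
next
  fix z assume "z \<in> carrier TN"
  then show "ract TN z \<one>\<^bsub>deg0 A\<^esub> = z"
    by (induction rule: tensor_induct) (simp_all add: TN_ract_tens TN_ract_add homog_carrier)
qed (simp_all add: TN_ract_closed TN_ract_add)

text \<open>Every element is a finite sum of elementary tensors, hence given by a list of
  pairs.\<close>

lemma TN_ordLess:
  assumes U: "natLeq <o |UNIV :: 'u set|" and s: "small (carrier A)" "small (carrier N)"
  shows "|carrier TN| <o |UNIV :: 'u set|"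
proof -
  define f where "f l = foldr (\<lambda>(x, b) z. tens A N x b \<oplus>\<^bsub>TN\<^esub> z) l \<zero>\<^bsub>TN\<^esub>" for l
  have f: "f [] = \<zero>\<^bsub>TN\<^esub>" "f ((x, b) # l) = tens A N x b \<oplus>\<^bsub>TN\<^esub> f l" for x b l
    by (simp_all add: f_def)
  have fc: "f l \<in> carrier TN" if "l \<in> lists S" for l
    using that by (induction l) (auto simp: f)
  have fa: "f (l @ l') = f l \<oplus>\<^bsub>TN\<^esub> f l'" if "l \<in> lists S" "l' \<in> lists S" for l l'
    using that(1)
  proof (induction l)
    case (Cons p l)
    obtain x b where p: "p = (x, b)" by (cases p)
    have c: "x \<in> carrier N" "b \<in> homog A 1" "l \<in> lists S" using Cons.hyps p by auto
    then show ?case using Cons.IH TN.a_assoc[OF tens_closed[OF c(1,2)] fc[OF c(3)] fc[OF that(2)]] by (simp add: p f)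
  qed (simp add: f fc[OF that(2)])
  have "z \<in> f ` lists S" if "z \<in> carrier TN" for z
    using that
  proof (induction rule: tensor_induct)
    case (tens x b)
    then have "tens A N x b = f [(x, b)]" by (simp add: f)
    then show ?case using tens by (intro image_eqI[of _ _ "[(x, b)]"]) auto
  next
    case (add z w)
    obtain l where l: "z = f l" "l \<in> lists S" using add(3) by (rule imageE)
    obtain l' where l': "w = f l'" "l' \<in> lists S" using add(4) by (rule imageE)
    have "z \<oplus>\<^bsub>TN\<^esub> w = f (l @ l')" using fa l l' by simp
    moreover have "l @ l' \<in> lists S" using l(2) l'(2) by simp
    ultimately show ?case by (rule image_eqI)
  qed
  then have "|carrier TN| \<le>o |lists S|"
    using ordLeq_transitive[OF card_of_mono1 card_of_image, of "carrier TN" f "lists S"] by blast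
  moreover have "small (homog A 1)" using s(1) by (rule small_subset) (auto simp: homog_carrier)
  ultimately show ?thesis
    using lists_Times_ordLess[OF U s(2)] ordLeq_ordLess_trans by blast
qed

text \<open>\<open>g\<close> extends to the free abelian group; the extension \<open>k\<close> kills
  the relators, hence all relations, and so is well defined on classes.\<close>

lemma tensor_universal:
  assumes Q: "abelian_group Q" and g: "\<And>x b. x \<in> carrier N \<Longrightarrow> b \<in> homog A 1 \<Longrightarrow> g x b \<in> carrier Q"
    and l: "\<And>x y b. x \<in> carrier N \<Longrightarrow> y \<in> carrier N \<Longrightarrow> b \<in> homog A 1 \<Longrightarrow> g (x \<oplus>\<^bsub>N\<^esub> y) b = g x b \<oplus>\<^bsub>Q\<^esub> g y b"
    and r: "\<And>x b c. x \<in> carrier N \<Longrightarrow> b \<in> homog A 1 \<Longrightarrow> c \<in> homog A 1 \<Longrightarrow> g x (b \<oplus> c) = g x b \<oplus>\<^bsub>Q\<^esub> g x c"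
    and bal: "\<And>x r b. x \<in> carrier N \<Longrightarrow> r \<in> homog A 0 \<Longrightarrow> b \<in> homog A 1 \<Longrightarrow> g (ract N x r) b = g x (r \<otimes> b)"
  obtains h where "\<And>z. z \<in> carrier TN \<Longrightarrow> h z \<in> carrier Q"
    "\<And>z w. z \<in> carrier TN \<Longrightarrow> w \<in> carrier TN \<Longrightarrow> h (z \<oplus>\<^bsub>TN\<^esub> w) = h z \<oplus>\<^bsub>Q\<^esub> h w"
    "\<And>x b. x \<in> carrier N \<Longrightarrow> b \<in> homog A 1 \<Longrightarrow> h (tens A N x b) = g x b"
proof -
  interpret Q: abelian_group Q by fact
  have "(\<lambda>(x, b). g x b) ` S \<subseteq> carrier (add_monoid Q)" using g by auto
  then obtain k where k: "k \<in> hom (free_Abelian_group S) (add_monoid Q)" and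
    k1: "\<And>s. s \<in> S \<Longrightarrow> k (frag_of s) = (\<lambda>(x, b). g x b) s"
    using comm_group.free_Abelian_group_universal[OF Q.a_comm_group] by blast
  have kc: "k c \<in> carrier Q" if "Poly_Mapping.keys c \<subseteq> S" for c
    using hom_in_carrier[OF k, of c] that by simp
  have kadd: "k (c + d) = k c \<oplus>\<^bsub>Q\<^esub> k d" if "Poly_Mapping.keys c \<subseteq> S" "Poly_Mapping.keys d \<subseteq> S" for c d
    using hom_mult[OF k, of c d] that by simp
  have k0: "k 0 = \<zero>\<^bsub>Q\<^esub>" using kadd[of 0 0] kc[of 0] Q.add.l_cancel_one[of "k 0" "k 0"] by simp
  have kd: "k (c - d) = k c \<ominus>\<^bsub>Q\<^esub> k d" if "Poly_Mapping.keys c \<subseteq> S" "Poly_Mapping.keys d \<subseteq> S" for c d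
  proof -
    have "Poly_Mapping.keys (c - d) \<subseteq> S" using that keys_diff by fastforce
    then have "k c = k (c - d) \<oplus>\<^bsub>Q\<^esub> k d" using kadd[of "c - d" d] that by simp
    then show ?thesis using kc that \<open>Poly_Mapping.keys (c - d) \<subseteq> S\<close> by (simp add: a_minus_def Q.a_assoc Q.r_neg)
  qed
  have ks: "Poly_Mapping.keys (frag_of p - c) \<subseteq> S" if "p \<in> S" "Poly_Mapping.keys c \<subseteq> S" for p c
    using that keys_diff[of "frag_of p" c] by fastforce
  have cancel: "u \<oplus>\<^bsub>Q\<^esub> v \<ominus>\<^bsub>Q\<^esub> u \<ominus>\<^bsub>Q\<^esub> v = \<zero>\<^bsub>Q\<^esub>" if "u \<in> carrier Q" "v \<in> carrier Q" for u v
    using that by (simp add: a_minus_def Q.a_assoc Q.minus_add[symmetric]) (simp add: Q.a_assoc[symmetric] Q.r_neg)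
  have krel: "k c = \<zero>\<^bsub>Q\<^esub>" if "c \<in> tensor_relators A N" for c
    using that unfolding tensor_relators_def
  proof (elim UnE)
    assume "c \<in> {frag_of (x \<oplus>\<^bsub>N\<^esub> y, b) - frag_of (x, b) - frag_of (y, b) |x y b.
      x \<in> carrier N \<and> y \<in> carrier N \<and> b \<in> homog A 1}"
    then obtain x y b where c: "c = frag_of (x \<oplus>\<^bsub>N\<^esub> y, b) - frag_of (x, b) - frag_of (y, b)"
      and h: "x \<in> carrier N" "y \<in> carrier N" "b \<in> homog A 1" by blast
    have "k c = k (frag_of (x \<oplus>\<^bsub>N\<^esub> y, b)) \<ominus>\<^bsub>Q\<^esub> k (frag_of (x, b)) \<ominus>\<^bsub>Q\<^esub> k (frag_of (y, b))"
      using h ks unfolding c by (simp add: kd)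
    then show ?thesis
      using h g[of x b] g[of y b] by (simp add: k1 l cancel)
  next
    assume "c \<in> {frag_of (x, b \<oplus> d) - frag_of (x, b) - frag_of (x, d) |x b d.
      x \<in> carrier N \<and> b \<in> homog A 1 \<and> d \<in> homog A 1}"
    then obtain x b d where c: "c = frag_of (x, b \<oplus> d) - frag_of (x, b) - frag_of (x, d)"
      and h: "x \<in> carrier N" "b \<in> homog A 1" "d \<in> homog A 1" by blast
    have "k c = k (frag_of (x, b \<oplus> d)) \<ominus>\<^bsub>Q\<^esub> k (frag_of (x, b)) \<ominus>\<^bsub>Q\<^esub> k (frag_of (x, d))"
      using h ks homog_add unfolding c by (simp add: kd)
    then show ?thesis
      using h g[of x b] g[of x d] homog_add by (simp add: k1 r cancel)
  next
    assume "c \<in> {frag_of (ract N x s, b) - frag_of (x, s \<otimes> b) |x s b.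
      x \<in> carrier N \<and> s \<in> homog A 0 \<and> b \<in> homog A 1}"
    then obtain x s b where c: "c = frag_of (ract N x s, b) - frag_of (x, s \<otimes> b)"
      and h: "x \<in> carrier N" "s \<in> homog A 0" "b \<in> homog A 1" by blast
    then show ?thesis using g[of x "s \<otimes> b"] by (simp add: kd k1 bal Q.r_neg a_minus_def)
  qed
  have kT: "k c = \<zero>\<^bsub>Q\<^esub>" if "c \<in> T" for c
    using that
  proof (induction rule: T_induct)
    case (add c d)
    then show ?case using kadd T_keys by simp
  next
    case (uminus c)
    then show ?case using kd[of 0 c] relators_keys krel k0 by (simp add: a_minus_def)
  qed (simp_all add: krel k0)
  define h where "h z = k (SOME c. Poly_Mapping.keys c \<subseteq> S \<and> z = cls c)" for z
  have h: "h (cls c) = k c" if c: "Poly_Mapping.keys c \<subseteq> S" for c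
  proof -
    let ?d = "SOME d. Poly_Mapping.keys d \<subseteq> S \<and> cls c = cls d"
    have d: "Poly_Mapping.keys ?d \<subseteq> S \<and> cls c = cls ?d" by (rule someI[of _ c]) (use c in simp)
    then have t: "c - ?d \<in> T" by (simp add: cls_eq_iff)
    have "k ((c - ?d) + ?d) = k (c - ?d) \<oplus>\<^bsub>Q\<^esub> k ?d" by (rule kadd) (use T_keys[OF t] d in blast)+
    then show ?thesis using kT[OF t] kc[of ?d] d by (simp add: h_def)
  qed
  show ?thesis
  proof (rule that[of h])
    fix z w assume z: "z \<in> carrier TN" and w: "w \<in> carrier TN"
    obtain c where c: "Poly_Mapping.keys c \<subseteq> S" "z = cls c" using z by (rule TN_cases)
    obtain d where d: "Poly_Mapping.keys d \<subseteq> S" "w = cls d" using w by (rule TN_cases)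
    show "h z \<in> carrier Q" using c h kc by simp
    have "Poly_Mapping.keys (c + d) \<subseteq> S" using c(1) d(1) keys_add by fastforce
    then show "h (z \<oplus>\<^bsub>TN\<^esub> w) = h z \<oplus>\<^bsub>Q\<^esub> h w" using c d h kadd by (simp add: TN_add)
  next
    show "h (tens A N x b) = g x b" if "x \<in> carrier N" "b \<in> homog A 1" for x b
      using h[of "frag_of (x, b)"] k1[of "(x, b)"] that by (simp add: tens_def)
  qed
qed

end

lemma tensor_functor_fo: "fo (tensor_functor A) N = copy_mod (tensor_mod A N)"
  by (simp add: tensor_functor_def)

section \<open>Copies of tensor products inside the universe\<close>

definition ctens :: "('k, 'u) galgebra \<Rightarrow> ('u, 'u) rmod \<Rightarrow> 'u \<Rightarrow> 'u \<Rightarrow> 'u" where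
  "ctens A N x b = copy_map (tensor_mod A N) (tens A N x b)"

text \<open>\<open>copy_map\<close> is given by a choice operator and is injective as soon as some
  injection into \<open>'u\<close> exists; this is assumed here and established later by
  counting.\<close>

locale copied_tensoring = tensoring A N for A :: "('k, 'u) galgebra" (structure) and N +
  assumes copy_inj: "inj_on (copy_map (tensor_mod A N) :: _ \<Rightarrow> 'u) (carrier (tensor_mod A N))"
begin

abbreviation CN where "CN \<equiv> fo (tensor_functor A) N"
abbreviation e where "e \<equiv> copy_map TN :: _ \<Rightarrow> 'u"

lemma uncopy [simp]: "z \<in> carrier TN \<Longrightarrow> uncopy_map TN (e z) = z"
  using copy_inj by (simp add: uncopy_map_def)

lemma CN_simps:
  "carrier CN = e ` carrier TN" "\<zero>\<^bsub>CN\<^esub> = e \<zero>\<^bsub>TN\<^esub>"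
  "z \<in> carrier TN \<Longrightarrow> w \<in> carrier TN \<Longrightarrow> e z \<oplus>\<^bsub>CN\<^esub> e w = e (z \<oplus>\<^bsub>TN\<^esub> w)"
  "z \<in> carrier TN \<Longrightarrow> ract CN (e z) a = e (ract TN z a)"
  by (simp_all add: copy_mod_def tensor_functor_fo)

lemma CN_rhomI:
  assumes "f \<in> extensional (carrier CN)" "\<And>z. z \<in> carrier TN \<Longrightarrow> f (e z) \<in> carrier Q"
    "\<And>z w. z \<in> carrier TN \<Longrightarrow> w \<in> carrier TN \<Longrightarrow> f (e (z \<oplus>\<^bsub>TN\<^esub> w)) = f (e z) \<oplus>\<^bsub>Q\<^esub> f (e w)"
    "\<And>z a. z \<in> carrier TN \<Longrightarrow> a \<in> homog A 0 \<Longrightarrow> f (e (ract TN z a)) = ract Q (f (e z)) a"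
  shows "f \<in> rhom (deg0 A) CN Q"
  by (rule rhomI) (use assms in \<open>auto simp: CN_simps\<close>)

lemma CN_rmodule: "rmodule (deg0 A) CN"
  by (rule rmodule_image[OF TN_rmodule, of e]) (simp_all add: CN_simps)

sublocale CN: right_module "deg0 A" CN by (rule right_moduleI[OF CN_rmodule])

lemma ctens_closed [simp]: "x \<in> carrier N \<Longrightarrow> b \<in> homog A 1 \<Longrightarrow> ctens A N x b \<in> carrier CN"
  by (simp add: ctens_def CN_simps)

lemma ctens_add:
  "x \<in> carrier N \<Longrightarrow> y \<in> carrier N \<Longrightarrow> b \<in> homog A 1 \<Longrightarrow>
    ctens A N (x \<oplus>\<^bsub>N\<^esub> y) b = ctens A N x b \<oplus>\<^bsub>CN\<^esub> ctens A N y b"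
  "x \<in> carrier N \<Longrightarrow> b \<in> homog A 1 \<Longrightarrow> c \<in> homog A 1 \<Longrightarrow>
    ctens A N x (b \<oplus> c) = ctens A N x b \<oplus>\<^bsub>CN\<^esub> ctens A N x c"
  by (simp_all add: ctens_def CN_simps tens_add_left tens_add_right)

lemma ctens_balanced:
  "x \<in> carrier N \<Longrightarrow> r \<in> homog A 0 \<Longrightarrow> b \<in> homog A 1 \<Longrightarrow> ctens A N (ract N x r) b = ctens A N x (r \<otimes> b)"
  by (simp add: ctens_def tens_balanced)

lemma ract_ctens:
  "x \<in> carrier N \<Longrightarrow> b \<in> homog A 1 \<Longrightarrow> a \<in> homog A 0 \<Longrightarrow> ract CN (ctens A N x b) a = ctens A N x (b \<otimes> a)"
  by (simp add: ctens_def CN_simps TN_ract_tens)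

lemma ctens_induct [consumes 1, case_names ctens add]:
  assumes "y \<in> carrier CN" "\<And>x b. x \<in> carrier N \<Longrightarrow> b \<in> homog A 1 \<Longrightarrow> P (ctens A N x b)"
    "\<And>y y'. y \<in> carrier CN \<Longrightarrow> y' \<in> carrier CN \<Longrightarrow> P y \<Longrightarrow> P y' \<Longrightarrow> P (y \<oplus>\<^bsub>CN\<^esub> y')"
  shows "P y"
proof -
  obtain z where z: "z \<in> carrier TN" "y = e z" using assms(1) by (auto simp: CN_simps)
  have "P (e z)"
    using z(1)
  proof (induction rule: tensor_induct)
    case (add z w)
    then show ?case using assms(3)[of "e z" "e w"] by (simp add: CN_simps)
  qed (use assms(2) in \<open>simp add: ctens_def\<close>)
  then show ?thesis using z by simp
qed

lemma ctens_universal: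
  assumes Q: "rmodule (deg0 A) Q" and g: "\<And>x b. x \<in> carrier N \<Longrightarrow> b \<in> homog A 1 \<Longrightarrow> g x b \<in> carrier Q"
    and l: "\<And>x y b. x \<in> carrier N \<Longrightarrow> y \<in> carrier N \<Longrightarrow> b \<in> homog A 1 \<Longrightarrow> g (x \<oplus>\<^bsub>N\<^esub> y) b = g x b \<oplus>\<^bsub>Q\<^esub> g y b"
    and r: "\<And>x b c. x \<in> carrier N \<Longrightarrow> b \<in> homog A 1 \<Longrightarrow> c \<in> homog A 1 \<Longrightarrow> g x (b \<oplus> c) = g x b \<oplus>\<^bsub>Q\<^esub> g x c"
    and bal: "\<And>x r b. x \<in> carrier N \<Longrightarrow> r \<in> homog A 0 \<Longrightarrow> b \<in> homog A 1 \<Longrightarrow> g (ract N x r) b = g x (r \<otimes> b)"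
    and act: "\<And>x b a. x \<in> carrier N \<Longrightarrow> b \<in> homog A 1 \<Longrightarrow> a \<in> homog A 0 \<Longrightarrow> g x (b \<otimes> a) = ract Q (g x b) a"
  obtains h where "h \<in> rhom (deg0 A) CN Q" "\<And>x b. x \<in> carrier N \<Longrightarrow> b \<in> homog A 1 \<Longrightarrow> h (ctens A N x b) = g x b"
proof -
  interpret Q: right_module "deg0 A" Q by (rule right_moduleI[OF Q])
  obtain k where k: "\<And>z. z \<in> carrier TN \<Longrightarrow> k z \<in> carrier Q"
    "\<And>z w. z \<in> carrier TN \<Longrightarrow> w \<in> carrier TN \<Longrightarrow> k (z \<oplus>\<^bsub>TN\<^esub> w) = k z \<oplus>\<^bsub>Q\<^esub> k w"
    "\<And>x b. x \<in> carrier N \<Longrightarrow> b \<in> homog A 1 \<Longrightarrow> k (tens A N x b) = g x b"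
    using tensor_universal[OF Q.abelian_group_axioms g l r bal] by blast
  let ?h = "\<lambda>y\<in>carrier CN. k (uncopy_map TN y)"
  have kact: "k (ract TN z a) = ract Q (k z) a" if "z \<in> carrier TN" "a \<in> homog A 0" for z a
    using that(1)
  proof (induction rule: tensor_induct)
    case (tens x b)
    then show ?case using that(2) by (simp add: TN_ract_tens k act)
  next
    case (add z w)
    then show ?case using that(2) Q.ract_add_left[of "k z" "k w" a] by (simp add: TN_ract_add TN_ract_closed k)
  qed
  have h: "?h (e z) = k z" if "z \<in> carrier TN" for z using that by (simp add: CN_simps)
  have "?h \<in> rhom (deg0 A) CN Q"
  proof (rule CN_rhomI)
    show "?h \<in> extensional (carrier CN)" by simp
  qed (simp_all add: h k kact TN_ract_closed del: restrict_apply)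
  moreover have "?h (ctens A N x b) = g x b" if "x \<in> carrier N" "b \<in> homog A 1" for x b
    using that k by (simp add: ctens_def CN_simps)
  ultimately show ?thesis by (rule that)
qed

text \<open>Through this the functor laws and the naturality of the multiplication maps are verified
  on elementary tensors.\<close>

lemma ctens_rhom_eqI:
  assumes f: "f \<in> rhom (deg0 A) CN Q" and g: "g \<in> rhom (deg0 A) CN Q"
    and e: "\<And>x b. x \<in> carrier N \<Longrightarrow> b \<in> homog A 1 \<Longrightarrow> f (ctens A N x b) = g (ctens A N x b)"
  shows "f = g"
proof (rule extensionalityI[OF rhomD(1)[OF f] rhomD(1)[OF g]])
  show "f y = g y" if "y \<in> carrier CN" for y
    using that
  proof (induction rule: ctens_induct)
    case (add y y')
    then show ?case by (simp add: rhomD(3)[OF f] rhomD(3)[OF g])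
  qed (rule e)
qed

text \<open>A homomorphism carries relators for \<open>N\<close> to relators for \<open>N'\<close>,
  so \<open>tensor_map\<close> can be computed on representatives.\<close>

lemma tensor_functor_map:
  assumes N': "copied_tensoring A N'" and f: "f \<in> rhom (deg0 A) N N'"
  shows "fm (tensor_functor A) N N' f \<in> rhom (deg0 A) CN (fo (tensor_functor A) N')"
    and "\<And>x b. x \<in> carrier N \<Longrightarrow> b \<in> homog A 1 \<Longrightarrow> fm (tensor_functor A) N N' f (ctens A N x b) = ctens A N' (f x) b"
proof -
  interpret N': copied_tensoring A N' by fact
  note fD = rhomD[OF f]
  let ?g = "\<lambda>(x, b). frag_of (f x, b)"
  have rel: "frag_extend ?g c \<in> tensor_rel A N'" if "c \<in> tensor_relators A N" for c
  proof (rule N'.T_relator)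
    show "frag_extend ?g c \<in> tensor_relators A N'"
      using that unfolding tensor_relators_def
      by (elim UnE; clarsimp simp: frag_extend_diff fD(3) fD(4)[simplified]) (metis fD(2))+
  qed
  have map: "tensor_map A N N' f (cls c) = tensor_class A N' (frag_extend ?g c)" if "cls c \<in> carrier TN" for c
    using that induced_on_classes[OF rel N'.tensoring_axioms, of c] by (simp add: tensor_map_def)
  have t: "tensor_map A N N' f (tens A N x b) = tens A N' (f x) b" if "x \<in> carrier N" "b \<in> homog A 1" for x b
    using that map[of "frag_of (x, b)"] tens_closed[OF that] by (simp add: tens_def)
  have add: "tensor_map A N N' f (z \<oplus>\<^bsub>TN\<^esub> w) = tensor_map A N N' f z \<oplus>\<^bsub>tensor_mod A N'\<^esub> tensor_map A N N' f w"
    if z: "z \<in> carrier TN" and w: "w \<in> carrier TN" for z w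
  proof -
    obtain c where c: "z = cls c" using z by (rule TN_cases)
    obtain d where d: "w = cls d" using w by (rule TN_cases)
    have "cls (c + d) \<in> carrier TN" using TN.a_closed[OF z w] c d by (simp add: TN_add)
    then show ?thesis using z w unfolding c d by (simp add: map TN_add N'.TN_add frag_extend_add)
  qed
  have closed: "tensor_map A N N' f z \<in> carrier (tensor_mod A N')" if "z \<in> carrier TN" for z
    using that by (induction rule: tensor_induct) (simp_all add: t add fD(2))
  have act: "tensor_map A N N' f (ract TN z a) = ract (tensor_mod A N') (tensor_map A N N' f z) a"
    if "z \<in> carrier TN" "a \<in> homog A 0" for z a
    using that(1)
  proof (induction rule: tensor_induct)
    case (tens x b)
    then show ?case using that(2) by (simp add: TN_ract_tens N'.TN_ract_tens t)
  next
    case (add z w)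
    then show ?case using that(2) \<open>\<And>z w. z \<in> carrier TN \<Longrightarrow> w \<in> carrier TN \<Longrightarrow> _ z w\<close>
      by (simp add: TN_ract_add TN_ract_closed N'.TN_ract_add closed)
  qed
  have fm: "fm (tensor_functor A) N N' f (e z) = N'.e (tensor_map A N N' f z)" if "z \<in> carrier TN" for z
    using that by (simp add: tensor_functor_def CN_simps[unfolded tensor_functor_fo])
  show "fm (tensor_functor A) N N' f \<in> rhom (deg0 A) CN (fo (tensor_functor A) N')"
  proof (rule CN_rhomI)
    show "fm (tensor_functor A) N N' f \<in> extensional (carrier CN)" by (simp add: tensor_functor_def)
  qed (simp_all add: fm add act closed TN_ract_closed N'.CN_simps)
  show "fm (tensor_functor A) N N' f (ctens A N x b) = ctens A N' (f x) b" if "x \<in> carrier N" "b \<in> homog A 1" for x b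
    using that t fm by (simp add: ctens_def)
qed

end

section \<open>Tensoring as an endofunctor\<close>

locale small_graded_ring = graded_ring A for A :: "('k, 'u) galgebra" (structure) +
  assumes universe: "natLeq <o |UNIV :: 'u set|" and small_ring: "small (carrier A)"
begin

text \<open>By counting lists the tensor product is small enough to admit an injection into
  \<open>'u\<close>, so the chosen \<open>copy_map\<close> is one.\<close>

lemma copied_tensoringI:
  assumes "N \<in> Ob (RMod (deg0 A))"
  shows "copied_tensoring A N"
proof -
  interpret tensoring A N
    using assms by (intro tensoring.intro right_moduleI graded_ring_axioms) simp
  have "|carrier TN| <o |UNIV :: 'u set|" using TN_ordLess universe small_ring assms by simp
  then have "\<exists>e :: _ \<Rightarrow> 'u. inj_on e (carrier TN)" by (meson injection_exists)
  then have "inj_on (copy_map TN :: _ \<Rightarrow> 'u) (carrier TN)" unfolding copy_map_def by (rule someI_ex)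
  then show ?thesis by (intro copied_tensoring.intro tensoring_axioms) (simp add: copied_tensoring_axioms_def)
qed

lemma tensor_functor_Ob:
  assumes "N \<in> Ob (RMod (deg0 A))"
  shows "fo (tensor_functor A) N \<in> Ob (RMod (deg0 A))"
proof -
  interpret copied_tensoring A N by (rule copied_tensoringI[OF assms])
  have "|carrier TN| <o |UNIV :: 'u set|" using TN_ordLess universe small_ring assms by simp
  then have "small (carrier CN)"
    unfolding small_def CN_simps using card_of_image ordLeq_ordLess_trans by blast
  then show ?thesis using CN_rmodule by simp
qed

lemma is_functor_tensor: "is_functor (RMod (deg0 A)) (RMod (deg0 A)) (tensor_functor A)"
proof (rule is_functorI[OF category_RMod category_RMod tensor_functor_Ob])
  fix L M f assume L: "L \<in> Ob (RMod (deg0 A))" and M: "M \<in> Ob (RMod (deg0 A))" and f: "f \<in> Hom (RMod (deg0 A)) L M"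
  show "fm (tensor_functor A) L M f \<in> Hom (RMod (deg0 A)) (fo (tensor_functor A) L) (fo (tensor_functor A) M)"
    using copied_tensoring.tensor_functor_map(1)[OF copied_tensoringI[OF L] copied_tensoringI[OF M]] f by simp
next
  fix L assume L: "L \<in> Ob (RMod (deg0 A))"
  interpret copied_tensoring A L by (rule copied_tensoringI[OF L])
  have i: "(\<lambda>x\<in>carrier L. x) \<in> rhom (deg0 A) L L" using category_idt[OF category_RMod L] by simp
  have "fm (tensor_functor A) L L (\<lambda>x\<in>carrier L. x) = (\<lambda>x\<in>carrier CN. x)"
  proof (rule ctens_rhom_eqI)
    show "fm (tensor_functor A) L L (\<lambda>x\<in>carrier L. x) \<in> rhom (deg0 A) CN CN"
      using tensor_functor_map(1)[OF copied_tensoring_axioms i] .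
    show "(\<lambda>x\<in>carrier CN. x) \<in> rhom (deg0 A) CN CN"
      using category_idt[OF category_RMod tensor_functor_Ob[OF L]] by simp
  qed (simp add: tensor_functor_map(2)[OF copied_tensoring_axioms i])
  then show "fm (tensor_functor A) L L (Idt (RMod (deg0 A)) L) = Idt (RMod (deg0 A)) (fo (tensor_functor A) L)" by simp
next
  fix L M N f g
  assume L: "L \<in> Ob (RMod (deg0 A))" and M: "M \<in> Ob (RMod (deg0 A))" and N: "N \<in> Ob (RMod (deg0 A))"
    and "f \<in> Hom (RMod (deg0 A)) L M" and "g \<in> Hom (RMod (deg0 A)) M N"
  then have f: "f \<in> rhom (deg0 A) L M" and g: "g \<in> rhom (deg0 A) M N" by simp_all
  interpret L: copied_tensoring A L by (rule copied_tensoringI[OF L])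
  interpret M: copied_tensoring A M by (rule copied_tensoringI[OF M])
  note N' = copied_tensoringI[OF N]
  have gf: "compose (carrier L) g f \<in> rhom (deg0 A) L N"
    using category_cmp[OF category_RMod L M N] f g by simp
  note Lf = L.tensor_functor_map[OF M.copied_tensoring_axioms f] and Mg = M.tensor_functor_map[OF N' g]
    and Lgf = L.tensor_functor_map[OF N' gf]
  have "fm (tensor_functor A) L N (compose (carrier L) g f)
    = compose (carrier L.CN) (fm (tensor_functor A) M N g) (fm (tensor_functor A) L M f)"
  proof (rule L.ctens_rhom_eqI[OF Lgf(1)])
    show "compose (carrier L.CN) (fm (tensor_functor A) M N g) (fm (tensor_functor A) L M f)
      \<in> rhom (deg0 A) L.CN (fo (tensor_functor A) N)"
      using category_cmp[OF category_RMod tensor_functor_Ob[OF L] tensor_functor_Ob[OF M] tensor_functor_Ob[OF N]] Lf(1) Mg(1) by simp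
  qed (use rhomD(2)[OF f] in \<open>simp add: Lf(2) Mg(2) Lgf(2) compose_eq\<close>)
  then show "fm (tensor_functor A) L N (Cmp (RMod (deg0 A)) L M N g f) =
    Cmp (RMod (deg0 A)) (fo (tensor_functor A) L) (fo (tensor_functor A) M) (fo (tensor_functor A) N)
      (fm (tensor_functor A) M N g) (fm (tensor_functor A) L M f)"
    by simp
qed

end

section \<open>Multiplication from the tensor product to the degree one part\<close>

locale small_strongly_graded_ring = small_graded_ring + strongly_graded_ring
begin

text \<open>For \<open>u\<close> of degree \<open>-1\<close> and \<open>v\<close> of degree
  \<open>1\<close>, acting on \<open>z\<close> with \<open>u v\<close> gives the tensor of
  \<open>\<mu>(z) u\<close> with \<open>v\<close>. As \<open>\<one>\<close> is a sum of such
  products, \<open>\<mu> z\<close> determines \<open>z\<close>. Conversely \<open>y u v\<close> is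
  the value of \<open>\<mu>\<close> at the tensor of \<open>y u\<close> with \<open>v\<close>, so
  \<open>\<mu>\<close> is onto.\<close>

lemma multiplication:
  assumes M: "M \<in> Ob (Gr A)"
  obtains \<mu> where "\<mu> \<in> rhom (deg0 A) (fo (tensor_functor A) (fo (deg0_functor A) M)) (fo (deg0_functor A) (fo shift M))"
    "bij_betw \<mu> (carrier (fo (tensor_functor A) (fo (deg0_functor A) M))) (gr M 1)"
    "\<And>x b. x \<in> gr M 0 \<Longrightarrow> b \<in> homog A 1 \<Longrightarrow> \<mu> (ctens A (fo (deg0_functor A) M) x b) = ract M x b"
proof -
  interpret M: graded_module A M by (rule Gr_module[OF M])
  let ?N = "fo (deg0_functor A) M" and ?Q = "fo (deg0_functor A) (fo shift M)"
  interpret N: copied_tensoring A ?N by (rule copied_tensoringI[OF deg0_functor_Ob[OF M]])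
  have sM: "fo shift M \<in> Ob (Gr A)"
    using is_functorD(3)[OF relabelling_pair.equivalence_Gr[OF relabelling_pair_shift, unfolded cat_equivalence_def, THEN conjunct1] M] .
  have s: "gr (fo shift M) 0 = gr M 1" "add (fo shift M) = add M" "\<zero>\<^bsub>fo shift M\<^esub> = \<zero>\<^bsub>M\<^esub>" "ract (fo shift M) = ract M"
    by (simp_all add: shift_def)
  have deg: "ract M x b \<in> gr M 1" if "x \<in> gr M 0" "b \<in> homog A 1" for x b
    using M.ract_homog[OF that] by simp
  have deg0: "ract M x b \<in> gr M 0" if "x \<in> gr M 0" "b \<in> homog A 0" for x b
    using M.ract_homog[OF that] by simp
  obtain \<mu> where \<mu>: "\<mu> \<in> rhom (deg0 A) N.CN ?Q"
    and \<mu>t: "\<And>x b. x \<in> gr M 0 \<Longrightarrow> b \<in> homog A 1 \<Longrightarrow> \<mu> (ctens A ?N x b) = ract M x b"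
  proof (rule N.ctens_universal[of ?Q "ract M"])
    show "rmodule (deg0 A) ?Q" using deg0_functor_Ob[OF sM] by simp
  qed (simp_all add: s deg deg0 M.homog_carrier homog_carrier M.ract_add_left M.ract_add_right M.ract_mult)
  note \<mu>D = rhomD[OF \<mu>]
  have \<mu>c: "\<mu> z \<in> gr M 1" if "z \<in> carrier N.CN" for z using \<mu>D(2)[OF that] by (simp add: s)
  have down: "ract M y u \<in> gr M 0" if "y \<in> gr M 1" "u \<in> homog A (- 1)" for y u
    using M.ract_homog[OF that] by simp
  have m0: "u \<otimes> v \<in> homog A 0" if "u \<in> homog A (- 1)" "v \<in> homog A 1" for u v
    using mult_homog[OF that] by simp
  have m0': "v \<otimes> u \<in> homog A 0" if "u \<in> homog A (- 1)" "v \<in> homog A 1" for u v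
    using mult_homog[OF that(2,1)] by simp
  \<comment> \<open>Balancing moves \<open>b u\<close>, which has degree zero, across the tensor
    sign.\<close>
  have mid: "ract N.CN z (u \<otimes> v) = ctens A ?N (ract M (\<mu> z) u) v"
    if z: "z \<in> carrier N.CN" and u: "u \<in> homog A (- 1)" and v: "v \<in> homog A 1" for z u v
    using z
  proof (induction rule: N.ctens_induct)
    case (ctens x b)
    then have x: "x \<in> gr M 0" by simp
    have bu: "b \<otimes> u \<in> homog A 0" using m0'[OF u ctens(2)] .
    have "ract N.CN (ctens A ?N x b) (u \<otimes> v) = ctens A ?N x (b \<otimes> u \<otimes> v)"
      using ctens m0[OF u v] u v by (simp add: N.ract_ctens m_assoc homog_carrier)
    also have "\<dots> = ctens A ?N (ract M x (b \<otimes> u)) v"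
      using N.ctens_balanced[OF ctens(1) bu v] x bu by simp
    also have "ract M x (b \<otimes> u) = ract M (ract M x b) u"
      using M.homog_carrier[OF x] ctens u by (simp add: M.ract_mult homog_carrier)
    finally show ?case using \<mu>t[OF x ctens(2)] by simp
  next
    case (add y z)
    have "ract M (\<mu> (y \<oplus>\<^bsub>N.CN\<^esub> z)) u = ract M (\<mu> y) u \<oplus>\<^bsub>M\<^esub> ract M (\<mu> z) u"
      using add(1,2) \<mu>c u by (simp add: \<mu>D(3) s M.ract_add_left M.homog_carrier[OF \<mu>c] homog_carrier)
    moreover have "ract N.CN (y \<oplus>\<^bsub>N.CN\<^esub> z) (u \<otimes> v) = ract N.CN y (u \<otimes> v) \<oplus>\<^bsub>N.CN\<^esub> ract N.CN z (u \<otimes> v)"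
      using add(1,2) m0[OF u v] by (simp add: N.CN.ract_add_left)
    ultimately show ?case
      using N.ctens_add(1)[of "ract M (\<mu> y) u" "ract M (\<mu> z) u" v] down[OF \<mu>c u] add v by simp
  qed
  have "bij_betw \<mu> (carrier N.CN) (gr M 1)"
    unfolding bij_betw_def
  proof
    show "inj_on \<mu> (carrier N.CN)"
    proof (rule inj_onI)
      fix z w assume z: "z \<in> carrier N.CN" and w: "w \<in> carrier N.CN" and eq: "\<mu> z = \<mu> w"
      have "ract N.CN z \<one> = ract N.CN w \<one>"
      proof (induction rule: one_induct[of 1])
        case (mult u v)
        then show ?case using mid z w eq by simp
      next
        case (add a b)
        then show ?case using z w N.CN.ract_add_right[of z a b] N.CN.ract_add_right[of w a b] by simp
      qed
      then show "z = w" using N.CN.ract_one[OF z] N.CN.ract_one[OF w] by simp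
    qed
    have "y \<in> \<mu> ` carrier N.CN" if y: "y \<in> gr M 1" for y
    proof -
      note yc = M.homog_carrier[OF y]
      have "ract M y \<one> \<in> \<mu> ` carrier N.CN"
      proof (induction rule: one_induct[of 1])
        case (mult u v)
        have "ract M y (u \<otimes> v) = \<mu> (ctens A ?N (ract M y u) v)"
          using \<mu>t[OF down[OF y mult(1)] mult(2)] yc mult by (simp add: M.ract_mult homog_carrier)
        then show ?case using N.ctens_closed[of "ract M y u" v] down[OF y mult(1)] mult(2) by simp
      next
        case (add a b)
        obtain z where z: "ract M y a = \<mu> z" "z \<in> carrier N.CN" using add(3) by (rule imageE)
        obtain w where w: "ract M y b = \<mu> w" "w \<in> carrier N.CN" using add(4) by (rule imageE)
        have "ract M y (a \<oplus> b) = \<mu> (z \<oplus>\<^bsub>N.CN\<^esub> w)"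
          using z w add(1,2) yc by (simp add: \<mu>D(3) s M.ract_add_right homog_carrier)
        then show ?case using z w by simp
      qed
      then show ?thesis using yc by simp
    qed
    then show "\<mu> ` carrier N.CN = gr M 1" using \<mu>c by blast
  qed
  then show ?thesis by (rule that[OF \<mu> _ \<mu>t])
qed

text \<open>The degree zero part of the shifted module is the degree one part of \<open>M\<close>,
  which multiplication identifies with the tensor product. The maps point towards the shift, so the
  isomorphism is constructed in the opposite direction and then inverted.\<close>

lemma deg0_shift: "naturally_isomorphic (Gr A) (RMod (deg0 A)) (deg0_functor A \<circ>\<^sub>F shift) (tensor_functor A \<circ>\<^sub>F deg0_functor A)"
proof (rule naturally_isomorphic_sym)
  let ?T = "\<lambda>M. fo (tensor_functor A) (fo (deg0_functor A) M)" and ?Q = "\<lambda>M. fo (deg0_functor A) (fo shift M)"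
  have fshift: "is_functor (Gr A) (Gr A) shift"
    using relabelling_pair.equivalence_Gr[OF relabelling_pair_shift] by (simp add: cat_equivalence_def)
  have "\<exists>\<mu>. \<forall>M\<in>Ob (Gr A). \<mu> M \<in> rhom (deg0 A) (?T M) (?Q M) \<and> bij_betw (\<mu> M) (carrier (?T M)) (gr M 1) \<and>
    (\<forall>x\<in>gr M 0. \<forall>b\<in>homog A 1. \<mu> M (ctens A (fo (deg0_functor A) M) x b) = ract M x b)"
  proof (rule bchoice, rule ballI)
    fix M assume M: "M \<in> Ob (Gr A)"
    show "\<exists>\<mu>. \<mu> \<in> rhom (deg0 A) (?T M) (?Q M) \<and> bij_betw \<mu> (carrier (?T M)) (gr M 1) \<and>
      (\<forall>x\<in>gr M 0. \<forall>b\<in>homog A 1. \<mu> (ctens A (fo (deg0_functor A) M) x b) = ract M x b)"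
      by (rule multiplication[OF M]) blast
  qed
  then obtain \<mu> where \<mu>: "\<And>M. M \<in> Ob (Gr A) \<Longrightarrow> \<mu> M \<in> rhom (deg0 A) (?T M) (?Q M)"
    and bij: "\<And>M. M \<in> Ob (Gr A) \<Longrightarrow> bij_betw (\<mu> M) (carrier (?T M)) (gr M 1)"
    and \<mu>t: "\<And>M x b. M \<in> Ob (Gr A) \<Longrightarrow> x \<in> gr M 0 \<Longrightarrow> b \<in> homog A 1 \<Longrightarrow> \<mu> M (ctens A (fo (deg0_functor A) M) x b) = ract M x b"
    by blast
  have TM: "?T M \<in> Ob (RMod (deg0 A))" and QM: "?Q M \<in> Ob (RMod (deg0 A))" if "M \<in> Ob (Gr A)" for M
    using tensor_functor_Ob[OF deg0_functor_Ob[OF that]] deg0_functor_Ob[OF is_functorD(3)[OF fshift that]] .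
  show "naturally_isomorphic (Gr A) (RMod (deg0 A)) (tensor_functor A \<circ>\<^sub>F deg0_functor A) (deg0_functor A \<circ>\<^sub>F shift)"
  proof (rule naturally_isomorphicI)
    show "is_functor (Gr A) (RMod (deg0 A)) (tensor_functor A \<circ>\<^sub>F deg0_functor A)"
      by (rule is_functor_comp[OF is_functor_deg0 is_functor_tensor])
    show "is_functor (Gr A) (RMod (deg0 A)) (deg0_functor A \<circ>\<^sub>F shift)"
      by (rule is_functor_comp[OF fshift is_functor_deg0])
  next
    fix M assume M: "M \<in> Ob (Gr A)"
    have "carrier (?Q M) = gr M 1" by (simp add: shift_def)
    then show "inverse_arrows (RMod (deg0 A)) (fo (tensor_functor A \<circ>\<^sub>F deg0_functor A) M) (fo (deg0_functor A \<circ>\<^sub>F shift) M)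
      (\<mu> M) (restrict (inv_into (carrier (?T M)) (\<mu> M)) (carrier (?Q M)))"
      using rhom_bij_inverse[OF _ _ \<mu>[OF M]] TM[OF M] QM[OF M] bij[OF M] by (simp add: fcomp_simps del: deg0_functor_simps)
  next
    fix M M' f assume M: "M \<in> Ob (Gr A)" and M': "M' \<in> Ob (Gr A)" and "f \<in> Hom (Gr A) M M'"
    then have f: "f \<in> ghom A M M'" by simp
    interpret M: graded_module A M by (rule Gr_module[OF M])
    interpret N: copied_tensoring A "fo (deg0_functor A) M" by (rule copied_tensoringI[OF deg0_functor_Ob[OF M]])
    let ?f0 = "restrict f (gr M 0)" and ?f1 = "restrict f (gr M 1)"
    have f0: "?f0 \<in> rhom (deg0 A) (fo (deg0_functor A) M) (fo (deg0_functor A) M')"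
      by (rule deg0_functor_Hom[OF Gr_module[OF M] f])
    have f1: "?f1 \<in> rhom (deg0 A) (?Q M) (?Q M')"
      using is_functorD(4)[OF is_functor_comp[OF fshift is_functor_deg0] M M', of f] f by (simp add: fcomp_simps shift_def)
    note Tf = N.tensor_functor_map[OF copied_tensoringI[OF deg0_functor_Ob[OF M']] f0]
    have "compose (carrier (?T M)) (\<mu> M') (fm (tensor_functor A) (fo (deg0_functor A) M) (fo (deg0_functor A) M') ?f0)
      = compose (carrier (?T M)) ?f1 (\<mu> M)"
    proof (rule N.ctens_rhom_eqI)
      show "compose (carrier (?T M)) (\<mu> M') (fm (tensor_functor A) (fo (deg0_functor A) M) (fo (deg0_functor A) M') ?f0)
        \<in> rhom (deg0 A) N.CN (?Q M')"
        using category_cmp[OF category_RMod TM[OF M] TM[OF M'] QM[OF M']] Tf(1) \<mu>[OF M'] by simp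
      show "compose (carrier (?T M)) ?f1 (\<mu> M) \<in> rhom (deg0 A) N.CN (?Q M')"
        using category_cmp[OF category_RMod TM[OF M] QM[OF M] QM[OF M']] f1 \<mu>[OF M] by simp
      fix x b assume x: "x \<in> carrier (fo (deg0_functor A) M)" and b: "b \<in> homog A 1"
      then have x: "x \<in> gr M 0" by simp
      have xb: "ract M x b \<in> gr M 1" using M.ract_homog[OF x b] by simp
      have fx: "f x \<in> gr M' 0" using f x by (auto simp: ghom_rhom)
      have "f (ract M x b) = ract M' (f x) b"
        using f rhomD(4)[of f A M M' x b] M.homog_carrier[OF x] homog_carrier[OF b] by (simp add: ghom_rhom)
      then show "compose (carrier (?T M)) (\<mu> M') (fm (tensor_functor A) (fo (deg0_functor A) M) (fo (deg0_functor A) M') ?f0) (ctens A (fo (deg0_functor A) M) x b)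
        = compose (carrier (?T M)) ?f1 (\<mu> M) (ctens A (fo (deg0_functor A) M) x b)"
        using x b xb fx N.ctens_closed[of x b] \<mu>t[OF M x b] \<mu>t[OF M' fx b] by (simp add: compose_eq Tf(2))
    qed
    then show "Cmp (RMod (deg0 A)) (fo (tensor_functor A \<circ>\<^sub>F deg0_functor A) M) (fo (tensor_functor A \<circ>\<^sub>F deg0_functor A) M')
         (fo (deg0_functor A \<circ>\<^sub>F shift) M') (\<mu> M') (fm (tensor_functor A \<circ>\<^sub>F deg0_functor A) M M' f) =
       Cmp (RMod (deg0 A)) (fo (tensor_functor A \<circ>\<^sub>F deg0_functor A) M) (fo (deg0_functor A \<circ>\<^sub>F shift) M)
         (fo (deg0_functor A \<circ>\<^sub>F shift) M') (fm (deg0_functor A \<circ>\<^sub>F shift) M M' f) (\<mu> M)"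
      by (simp add: fcomp_simps shift_def)
  qed
qed

end

section \<open>Comparison of the triples\<close>

text \<open>Object and autoequivalence of a triple matter only up to isomorphism; this absorbs the
  difference between records that agree on their carriers.\<close>

lemma triple_equivalence_cong:
  assumes P: "triple_equivalence P (D, U, T) G" and U: "isomorphic_in D U U'" and T: "naturally_isomorphic D D T T'"
  shows "triple_equivalence P (D, U', T') G"
proof -
  obtain C V s where P': "P = (C, V, s)" by (cases P)
  have p: "is_triple (C, V, s)" "is_triple (D, U, T)" "cat_equivalence C D G" "isomorphic_in D (fo G V) U"
    "naturally_isomorphic C D (G \<circ>\<^sub>F s) (T \<circ>\<^sub>F G)"
    using P by (auto simp: triple_equivalence_def P')
  have G: "is_functor C D G" using p(3) by (simp add: cat_equivalence_def)
  have "is_triple (D, U', T')"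
    using p(2) U cat_equivalence_naturally_isomorphic[OF _ T] by (simp add: is_triple_def isomorphic_in_def)
  moreover have "isomorphic_in D (fo G V) U'" using isomorphic_in_trans[OF is_functorD(2)[OF G] p(4) U] .
  moreover have "naturally_isomorphic C D (G \<circ>\<^sub>F s) (T' \<circ>\<^sub>F G)"
    using naturally_isomorphic_trans[OF p(5) naturally_isomorphic_whisker_right[OF T G]] .
  ultimately show ?thesis using p by (simp add: triple_equivalence_def P')
qed

section \<open>Descent along an isomorphism of categories\<close>

text \<open>On morphisms this is \<open>F\<close> after the inverse of \<open>Q\<close>. Composing
  back with \<open>Q\<close> returns \<open>F\<close> itself and not just an isomorphic functor, as
  an identification of categories requires.\<close>

definition descended :: "('o, 'm) cat \<Rightarrow> ('o, 'm, 'o, 'n) fnc \<Rightarrow> ('o, 'm, 'p, 'l) fnc \<Rightarrow> ('o, 'n, 'p, 'l) fnc" where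
  "descended C Q F = \<lparr>fo = fo F, fm = (\<lambda>x y c. fm F x y (inv_into (Hom C x y) (fm Q x y) c))\<rparr>"

locale object_identity =
  fixes C :: "('o, 'm) cat" and D :: "('o, 'n) cat" and Q :: "('o, 'm, 'o, 'n) fnc"
  assumes isomorphism: "cat_isomorphism C D Q" and fo_Q [simp]: "fo Q x = x"
begin

lemma Ob_D [simp]: "Ob D = Ob C"
  using isomorphism by (auto simp: cat_isomorphism_def bij_betw_def)

lemma Q: "is_functor C D Q"
  using isomorphism by (simp add: cat_isomorphism_def)

lemma bij: "x \<in> Ob C \<Longrightarrow> y \<in> Ob C \<Longrightarrow> bij_betw (fm Q x y) (Hom C x y) (Hom D x y)"
  using isomorphism by (simp add: cat_isomorphism_def)

lemma Hom_D_cases: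
  assumes "x \<in> Ob C" "y \<in> Ob C" "c \<in> Hom D x y"
  obtains f where "f \<in> Hom C x y" "c = fm Q x y f"
  using bij[OF assms(1,2)] assms(3) unfolding bij_betw_def by blast

lemma descended_simps:
  "fo (descended C Q F) = fo F"
  "x \<in> Ob C \<Longrightarrow> y \<in> Ob C \<Longrightarrow> f \<in> Hom C x y \<Longrightarrow> fm (descended C Q F) x y (fm Q x y f) = fm F x y f"
  using bij[of x y] by (simp_all add: descended_def bij_betw_inv_into_left)

lemma is_functor_descended:
  assumes F: "is_functor C E F"
  shows "is_functor D E (descended C Q F)"
proof (rule is_functorI)
  show "category D" "category E" using is_functorD(2)[OF Q] is_functorD(2)[OF F] .
  show "fo (descended C Q F) x \<in> Ob E" if "x \<in> Ob D" for x
    using is_functorD(3)[OF F] that by (simp add: descended_simps)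
next
  fix x y c assume xy: "x \<in> Ob D" "y \<in> Ob D" and c: "c \<in> Hom D x y"
  obtain f where f: "f \<in> Hom C x y" "c = fm Q x y f" by (rule Hom_D_cases[OF _ _ c]) (use xy in simp_all)
  then show "fm (descended C Q F) x y c \<in> Hom E (fo (descended C Q F) x) (fo (descended C Q F) y)"
    using is_functorD(4)[OF F _ _ f(1)] xy by (simp add: descended_simps)
next
  fix x assume x: "x \<in> Ob D"
  then have "Idt D x = fm Q x x (Idt C x)" using is_functorD(5)[OF Q] by simp
  moreover have "Idt C x \<in> Hom C x x" using x category_idt[OF is_functorD(1)[OF Q]] by simp
  ultimately show "fm (descended C Q F) x x (Idt D x) = Idt E (fo (descended C Q F) x)"
    using x is_functorD(5)[OF F] by (simp add: descended_simps)
next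
  fix x y z c d assume xyz: "x \<in> Ob D" "y \<in> Ob D" "z \<in> Ob D" and c: "c \<in> Hom D x y" and d: "d \<in> Hom D y z"
  then have xyz': "x \<in> Ob C" "y \<in> Ob C" "z \<in> Ob C" by simp_all
  obtain f where f: "f \<in> Hom C x y" "c = fm Q x y f" by (rule Hom_D_cases[OF xyz'(1,2) c])
  obtain g where g: "g \<in> Hom C y z" "d = fm Q y z g" by (rule Hom_D_cases[OF xyz'(2,3) d])
  have "Cmp D x y z d c = fm Q x z (Cmp C x y z g f)"
    using is_functorD(6)[OF Q xyz' f(1) g(1)] f g by simp
  moreover have "Cmp C x y z g f \<in> Hom C x z" using category_cmp[OF is_functorD(1)[OF Q] xyz' f(1) g(1)] .
  ultimately show "fm (descended C Q F) x z (Cmp D x y z d c) =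
      Cmp E (fo (descended C Q F) x) (fo (descended C Q F) y) (fo (descended C Q F) z)
        (fm (descended C Q F) y z d) (fm (descended C Q F) x y c)"
    using is_functorD(6)[OF F xyz' f(1) g(1)] xyz' f g by (simp add: descended_simps)
qed

lemma descended_comp: "functor_eq C (descended C Q F \<circ>\<^sub>F Q) F"
  by (simp add: functor_eq_def descended_simps)

lemma cat_equivalence_descended:
  assumes "cat_equivalence C E F"
  shows "cat_equivalence D E (descended C Q F)"
proof -
  have F: "is_functor C E F" "fully_faithful C E F" "ess_surjective C E F"
    using assms by (simp_all add: cat_equivalence_iff)
  have "bij_betw (fm (descended C Q F) x y) (Hom D x y) (Hom E (fo F x) (fo F y))" if "x \<in> Ob C" "y \<in> Ob C" for x y
    using bij_betw_trans[OF bij_betw_inv_into[OF bij[OF that]] F(2)[unfolded fully_faithful_def, rule_format, OF that]]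
    by (simp add: descended_def comp_def)
  then have "fully_faithful D E (descended C Q F)" by (simp add: fully_faithful_def descended_simps)
  moreover have "ess_surjective D E (descended C Q F)" using F(3) by (simp add: ess_surjective_def descended_simps)
  ultimately show ?thesis using is_functor_descended[OF F(1)] by (simp add: cat_equivalence_iff)
qed

text \<open>Arrows of \<open>D\<close> are images under \<open>Q\<close>, and \<open>t\<close> acts
  on them as \<open>s\<close> acts on their preimages, so the components for \<open>F\<close> serve
  unchanged.\<close>

lemma naturally_isomorphic_descended:
  assumes n: "naturally_isomorphic C E (F \<circ>\<^sub>F s) (T \<circ>\<^sub>F F)" and s: "is_functor C C s" and t: "is_functor D D t"
    and ts: "functor_eq C (t \<circ>\<^sub>F Q) (Q \<circ>\<^sub>F s)" and F: "is_functor C E F" and T: "is_functor E E T"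
  shows "naturally_isomorphic D E (descended C Q F \<circ>\<^sub>F t) (T \<circ>\<^sub>F descended C Q F)"
proof -
  have fo_t: "fo t x = fo s x" if "x \<in> Ob C" for x using ts that by (simp add: functor_eq_def)
  have fm_t: "fm t x y (fm Q x y f) = fm Q (fo s x) (fo s y) (fm s x y f)" if "x \<in> Ob C" "y \<in> Ob C" "f \<in> Hom C x y" for x y f
    using ts that by (simp add: functor_eq_def)
  obtain \<eta> \<theta> where i: "\<And>x. x \<in> Ob C \<Longrightarrow> inverse_arrows E (fo (F \<circ>\<^sub>F s) x) (fo (T \<circ>\<^sub>F F) x) (\<eta> x) (\<theta> x)"
    and nat: "\<And>x y f. x \<in> Ob C \<Longrightarrow> y \<in> Ob C \<Longrightarrow> f \<in> Hom C x y \<Longrightarrow>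
         Cmp E (fo (F \<circ>\<^sub>F s) x) (fo (F \<circ>\<^sub>F s) y) (fo (T \<circ>\<^sub>F F) y) (\<eta> y) (fm (F \<circ>\<^sub>F s) x y f) =
         Cmp E (fo (F \<circ>\<^sub>F s) x) (fo (T \<circ>\<^sub>F F) x) (fo (T \<circ>\<^sub>F F) y) (fm (T \<circ>\<^sub>F F) x y f) (\<eta> x)"
    using naturally_isomorphicE[OF n] by metis
  show ?thesis
  proof (rule naturally_isomorphicI)
    show "is_functor D E (descended C Q F \<circ>\<^sub>F t)" by (rule is_functor_comp[OF t is_functor_descended[OF F]])
    show "is_functor D E (T \<circ>\<^sub>F descended C Q F)" by (rule is_functor_comp[OF is_functor_descended[OF F] T])
    show "inverse_arrows E (fo (descended C Q F \<circ>\<^sub>F t) x) (fo (T \<circ>\<^sub>F descended C Q F) x) (\<eta> x) (\<theta> x)" if "x \<in> Ob D" for x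
      using i[of x] that by (simp add: descended_simps fo_t)
  next
    fix x y c assume xy: "x \<in> Ob D" "y \<in> Ob D" and c: "c \<in> Hom D x y"
    then have xy': "x \<in> Ob C" "y \<in> Ob C" by simp_all
    obtain f where f: "f \<in> Hom C x y" "c = fm Q x y f" by (rule Hom_D_cases[OF xy' c])
    have "fo s x \<in> Ob C" "fo s y \<in> Ob C" "fm s x y f \<in> Hom C (fo s x) (fo s y)"
      using is_functorD(3,4)[OF s] xy' f(1) by simp_all
    then show "Cmp E (fo (descended C Q F \<circ>\<^sub>F t) x) (fo (descended C Q F \<circ>\<^sub>F t) y) (fo (T \<circ>\<^sub>F descended C Q F) y) (\<eta> y)
         (fm (descended C Q F \<circ>\<^sub>F t) x y c) =
       Cmp E (fo (descended C Q F \<circ>\<^sub>F t) x) (fo (T \<circ>\<^sub>F descended C Q F) x) (fo (T \<circ>\<^sub>F descended C Q F) y)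
         (fm (T \<circ>\<^sub>F descended C Q F) x y c) (\<eta> x)"
      using nat[OF xy' f(1)] xy' f by (simp add: descended_simps fo_t fm_t)
  qed
qed

end

section \<open>Modules that agree on their carriers\<close>

text \<open>Operations may differ outside the carriers, so that such records are not equal; but the
  identity map is an isomorphism between them.\<close>

definition same_module :: "('a, 'x) ring_scheme \<Rightarrow> ('a, 'm) rmod \<Rightarrow> ('a, 'm) rmod \<Rightarrow> bool" where
  "same_module R M M' \<longleftrightarrow> carrier M' = carrier M \<and> \<zero>\<^bsub>M'\<^esub> = \<zero>\<^bsub>M\<^esub> \<and>
    (\<forall>x\<in>carrier M. \<forall>y\<in>carrier M. x \<oplus>\<^bsub>M'\<^esub> y = x \<oplus>\<^bsub>M\<^esub> y) \<and>
    (\<forall>x\<in>carrier M. \<forall>a\<in>carrier R. ract M' x a = ract M x a)"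

lemma same_module_rmodule: "rmodule R M \<Longrightarrow> same_module R M M' \<Longrightarrow> rmodule R M'"
  by (rule rmodule_image[of R M "\<lambda>x. x"]) (simp_all add: same_module_def)

lemma same_module_Ob: "M \<in> Ob (RMod R) \<Longrightarrow> same_module R M M' \<Longrightarrow> M' \<in> Ob (RMod R)"
  using same_module_rmodule[of R M M'] by (simp add: same_module_def)

lemma same_module_rhom:
  assumes M: "rmodule R M" and N: "rmodule R N" and s: "same_module R M M'" "same_module R N N'" and f: "f \<in> rhom R M N"
  shows "f \<in> rhom R M' N'"
proof -
  interpret M: right_module R M by (rule right_moduleI[OF M])
  show ?thesis
    using s by (intro rhomI) (simp_all add: same_module_def rhomD[OF f])
qed

lemma same_module_arrows:
  assumes M: "M \<in> Ob (RMod R)" and s: "same_module R M M'"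
  shows "inverse_arrows (RMod R) M M' (\<lambda>x\<in>carrier M. x) (\<lambda>x\<in>carrier M. x)"
proof -
  have i: "(\<lambda>x\<in>carrier M. x) \<in> rhom R M M" using category_idt[OF category_RMod M] by simp
  have r: "same_module R M M" by (simp add: same_module_def)
  have c: "carrier M' = carrier M" using s by (simp add: same_module_def)
  have "(\<lambda>x\<in>carrier M. x) \<in> rhom R M M'" "(\<lambda>x\<in>carrier M. x) \<in> rhom R M' M"
    using same_module_rhom[OF _ _ r s i] same_module_rhom[OF _ _ s r i] M by simp_all
  then show ?thesis by (auto simp: inverse_arrows_def compose_def c)
qed

lemma same_module_isomorphic: "M \<in> Ob (RMod R) \<Longrightarrow> same_module R M M' \<Longrightarrow> isomorphic_in (RMod R) M M'"
  unfolding isomorphic_in_iff using same_module_arrows same_module_Ob by blast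

lemma same_module_naturally_isomorphic:
  assumes F: "is_functor C (RMod R) F" and s: "\<And>x. x \<in> Ob C \<Longrightarrow> same_module R (fo F x) (fo G x)"
    and m: "\<And>x y f. x \<in> Ob C \<Longrightarrow> y \<in> Ob C \<Longrightarrow> f \<in> Hom C x y \<Longrightarrow> fm G x y f = fm F x y f"
  shows "naturally_isomorphic C (RMod R) F G"
proof -
  note FD = is_functorD[OF F]
  have c: "carrier (fo G x) = carrier (fo F x)" if "x \<in> Ob C" for x using s[OF that] by (simp add: same_module_def)
  have FO: "rmodule R (fo F x)" if "x \<in> Ob C" for x using FD(3)[OF that] by simp
  have G: "is_functor C (RMod R) G"
  proof (rule is_functorI[OF FD(1,2)])
    show "fo G x \<in> Ob (RMod R)" if "x \<in> Ob C" for x using same_module_Ob[OF FD(3) s] that by blast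
    show "fm G x y f \<in> Hom (RMod R) (fo G x) (fo G y)" if "x \<in> Ob C" "y \<in> Ob C" "f \<in> Hom C x y" for x y f
      using same_module_rhom[OF FO FO s s] that FD(4)[OF that] by (simp add: m)
    show "fm G x x (Idt C x) = Idt (RMod R) (fo G x)" if "x \<in> Ob C" for x
      using FD(5)[OF that] m[OF that that category_idt[OF FD(1) that]] c[OF that] by simp
    fix x y z f g assume h: "x \<in> Ob C" "y \<in> Ob C" "z \<in> Ob C" "f \<in> Hom C x y" "g \<in> Hom C y z"
    show "fm G x z (Cmp C x y z g f) = Cmp (RMod R) (fo G x) (fo G y) (fo G z) (fm G y z g) (fm G x y f)"
      using FD(6)[OF h] m[OF h(1,3) category_cmp[OF FD(1) h]] h by (simp add: m c)
  qed
  show ?thesis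
  proof (rule naturally_isomorphicI[OF F G same_module_arrows[OF FD(3) s]])
    fix x y f assume h: "x \<in> Ob C" "y \<in> Ob C" "f \<in> Hom C x y"
    have r: "fm F x y f \<in> rhom R (fo F x) (fo F y)" using FD(4)[OF h] by simp
    have "compose (carrier (fo F x)) (\<lambda>v\<in>carrier (fo F y). v) (fm F x y f) = compose (carrier (fo F x)) (fm F x y f) (\<lambda>v\<in>carrier (fo F x). v)"
      by (auto simp: compose_def fun_eq_iff rhomD(2)[OF r])
    then show "Cmp (RMod R) (fo F x) (fo F y) (fo G y) (\<lambda>v\<in>carrier (fo F y). v) (fm F x y f) =
      Cmp (RMod R) (fo F x) (fo G x) (fo G y) (fm G x y f) (\<lambda>v\<in>carrier (fo F x). v)"
      by (simp add: m[OF h])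
  qed
qed

lemma reg_gmod_Ob: "graded_ring A \<Longrightarrow> small (carrier A) \<Longrightarrow> reg_gmod A \<in> Ob (Gr A)"
  using graded_ring.graded_module_reg[of A] by (simp add: graded_module_iff reg_gmod_def)

section \<open>The triple of a strongly graded algebra\<close>

context small_strongly_graded_ring
begin

abbreviation E where "E \<equiv> descended (Gr A) (quot_functor A) (deg0_functor A)"

lemma object_identity_quot: "object_identity (Gr A) (QGr A) (quot_functor A)"
  using quot_functor_isomorphism by (simp add: object_identity_def quot_functor_def)

lemma E_comp: "functor_eq (Gr A) (E \<circ>\<^sub>F quot_functor A) (deg0_functor A)"
  by (rule object_identity.descended_comp[OF object_identity_quot])

lemma deg0_equivalence: "cat_equivalence (Gr A) (RMod (deg0 A)) (deg0_functor A)"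
  by (rule cat_equivalence_deg0[OF universe small_ring])

text \<open>The degree zero functor descends to the quotient category and intertwines the shift with
  tensoring. That tensoring is an autoequivalence is deduced from the shift being one.\<close>

lemma triple_equivalence_E: "triple_equivalence (nc_proj A) (RMod (deg0 A), reg_rmod (deg0 A), tensor_functor A) E"
proof -
  interpret Q: object_identity "Gr A" "QGr A" "quot_functor A" by (rule object_identity_quot)
  interpret S: relabelling_pair A A shift "regrade_functor (- 1)" by (rule relabelling_pair_shift)
  have E: "cat_equivalence (QGr A) (RMod (deg0 A)) E" by (rule Q.cat_equivalence_descended[OF deg0_equivalence])
  have n: "naturally_isomorphic (QGr A) (RMod (deg0 A)) (E \<circ>\<^sub>F induced A shift) (tensor_functor A \<circ>\<^sub>F E)"
  by (metis Q.naturally_isomorphic_descended deg0_shift S.equivalence_Gr S.equivalence_QGr cat_equivalence_def S.induced_quot_functor is_functor_deg0 is_functor_tensor)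
  have T: "cat_equivalence (RMod (deg0 A)) (RMod (deg0 A)) (tensor_functor A)"
    by (rule cat_equivalence_conjugate[OF E S.equivalence_QGr is_functor_tensor n])
  have r: "reg_gmod A \<in> Ob (Gr A)" by (rule reg_gmod_Ob[OF graded_ring_axioms small_ring])
  \<comment> \<open>\<open>deg0_functor\<close> cuts the action down to degree zero whereas
    \<open>reg_rmod\<close> keeps the full multiplication, so the records are compared on the
    carrier.\<close>
  have "same_module (deg0 A) (fo (deg0_functor A) (reg_gmod A)) (reg_rmod (deg0 A))"
    by (simp add: same_module_def reg_rmod_def reg_gmod_def)
  then have i: "isomorphic_in (RMod (deg0 A)) (fo E (reg_gmod A)) (reg_rmod (deg0 A))"
    using same_module_isomorphic[OF deg0_functor_Ob[OF r]] by (simp add: Q.descended_simps)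
  show ?thesis
    using E n T i S.equivalence_QGr r
    by (simp add: triple_equivalence_def is_triple_def nc_proj_def isomorphic_in_def quot_functor_def del: Gr_simps RMod_simps)
qed

end

section \<open>Effect of the twist on degree zero and on tensoring\<close>

context zhang_setup
begin

lemma B_mult_0: "a \<in> homog A 0 \<Longrightarrow> b \<in> carrier A \<Longrightarrow> a \<otimes>\<^bsub>B\<^esub> b = a \<otimes> b"
  by (simp add: B_mult_homog zpower_zero)

text \<open>A product in one algebra is a product in the other after a power of
  \<open>\<sigma>\<close> is applied to the right factor, and powers preserve degrees; so the
  products of two components have the same span in both.\<close>

lemma strongly_graded_B:
  assumes "strongly_graded K A"
  shows "strongly_graded K B"
proof -
  have "homog A n \<cdot>\<^bsub>B\<^esub> homog A m = homog A n \<cdot>\<^bsub>A\<^esub> homog A m" for n m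
  proof (intro subset_antisym subsetI)
    fix x assume "x \<in> homog A n \<cdot>\<^bsub>B\<^esub> homog A m"
    then show "x \<in> homog A n \<cdot>\<^bsub>A\<^esub> homog A m"
    proof (induction rule: ideal_prod.induct)
      case (prod a b)
      then show ?case
        using ideal_prod.prod[of a "homog A n" "zpower A \<sigma> n b" "homog A m" A] by (simp add: B_mult_homog homog_carrier zpower_homog)
    next
      case (sum a b)
      then show ?case using ideal_prod.sum[of a A "homog A n" "homog A m" b] by simp
    qed
  next
    fix x assume "x \<in> homog A n \<cdot>\<^bsub>A\<^esub> homog A m"
    then show "x \<in> homog A n \<cdot>\<^bsub>B\<^esub> homog A m"
    proof (induction rule: ideal_prod.induct)
      case (prod a b)
      then have "zpower A \<sigma> (- n) b \<in> homog A m" by (simp add: zpower_homog)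
      then show ?case
        using ideal_prod.prod[of a "homog A n" "zpower A \<sigma> (- n) b" "homog A m" B] prod
        by (simp add: B_mult_homog homog_carrier zpower_inverse)
    next
      case (sum a b)
      then show ?case using ideal_prod.sum[of a B "homog A n" "homog A m" b] by simp
    qed
  qed
  then show ?thesis using assms graded_algebra_B by (simp add: strongly_graded_def)
qed

lemma same_algebra_deg0: "same_algebra K (deg0 B) (deg0 A)"
  by (simp add: same_algebra_def B_mult_0 homog_carrier)

text \<open>Multiplication in degree zero is the same, and \<open>rmodule\<close> and
  \<open>rhom\<close> consult the ring only on its carrier; so the categories are equal and not
  merely isomorphic.\<close>

lemma RMod_deg0_B: "RMod (deg0 B) = RMod (deg0 A)"
proof -
  have r: "ring (deg0 A)" "ring (deg0 B)" using ring_deg0 graded_ring.ring_deg0[OF graded_ring_B] .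
  have "rmodule (deg0 B) = (rmodule (deg0 A) :: ('u, 'u) rmod \<Rightarrow> bool)"
    by (rule ext) (simp add: rmodule_def r B_mult_0 homog_carrier cong: ball_cong_simp)
  moreover have "rhom (deg0 B) = (rhom (deg0 A) :: ('u, 'u) rmod \<Rightarrow> ('u, 'u) rmod \<Rightarrow> _)" by (intro ext) (simp add: rhom_def)
  ultimately show ?thesis by (simp add: RMod_def)
qed

text \<open>On degree zero the twisted action uses the zeroth power of \<open>\<sigma>\<close>. The
  records are equal because \<open>deg0_functor\<close> forgets the action of all other
  degrees.\<close>

lemma deg0_zhang:
  assumes "M \<in> Ob (Gr A)"
  shows "fo (deg0_functor B) (fo (zhang_functor A \<sigma>) M) = fo (deg0_functor A) M"
  using tf.twist_ract_homog[OF Gr_module[OF assms], of _ _ 0]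
  by (auto simp: deg0_functor_def zhang_functor_eq zpower_zero homog_carrier fun_eq_iff restrict_def)

text \<open>The balancing relation multiplies from the left by degree zero, where the power of
  \<open>\<sigma>\<close> applied to the other factor is the zeroth.\<close>

lemma tensor_rel_B: "tensor_rel B N = tensor_rel A N" "tensor_free B N = tensor_free A N"
proof -
  show f: "tensor_free B N = tensor_free A N" by (simp add: tensor_free_def)
  have "tensor_relators B N = tensor_relators A N"
    unfolding tensor_relators_def by (intro arg_cong2[where f = "(\<union>)"] Collect_cong iff_exI) (auto simp: B_mult_0 homog_carrier)
  then show "tensor_rel B N = tensor_rel A N"
    unfolding tensor_rel_def tensor_relators_def by (simp add: f)
qed

lemma tensor_mod_B:
  "carrier (tensor_mod B N) = carrier (tensor_mod A N)" "\<zero>\<^bsub>tensor_mod B N\<^esub> = \<zero>\<^bsub>tensor_mod A N\<^esub>"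
  "add (tensor_mod B N) = add (tensor_mod A N)"
  by (simp_all add: tensor_mod_def tensor_rel_B)

text \<open>The choice in \<open>copy_map\<close> depends on the carrier alone, so the copies for
  \<open>A\<close> and for the twist use the same injection.\<close>

lemma copy_map_B: "copy_map (tensor_mod B N) = copy_map (tensor_mod A N)"
  "uncopy_map (tensor_mod B N) = uncopy_map (tensor_mod A N)"
  by (simp_all add: copy_map_def uncopy_map_def tensor_mod_B)

lemma fm_tensor_B: "fm (tensor_functor B) = fm (tensor_functor A)"
  by (simp add: tensor_functor_def copy_mod_def copy_map_B tensor_mod_B tensor_map_def[abs_def] tensor_rel_B)

text \<open>Classes and representatives coincide for both algebras, so the two actions are compared
  on a representative \<open>c\<close>, whose second entries all have degree one.\<close>

lemma same_module_tensor_B: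
  assumes A: "copied_tensoring A N" and B: "copied_tensoring B N"
  shows "same_module (deg0 A) (fo (tensor_functor B) N)
    (fo (pullback (restrict \<sigma> (homog A 0)) \<circ>\<^sub>F tensor_functor A) N)"
proof -
  interpret N: copied_tensoring A N by fact
  interpret NB: tensoring B N using B by (simp add: copied_tensoring_def)
  have \<sigma>1: "zpower A \<sigma> 1 = \<sigma>" by (simp add: zpower_def)
  have "ract (tensor_mod B N) z a = ract (tensor_mod A N) z (\<sigma> a)" if z: "z \<in> carrier (tensor_mod A N)" and a: "a \<in> homog A 0" for z a
  proof -
    have \<sigma>a: "\<sigma> a \<in> homog A 0" using zpower_homog[OF a, of 1] by (simp add: \<sigma>1)
    obtain c where c: "Poly_Mapping.keys c \<subseteq> carrier N \<times> homog A 1" "z = tensor_class A N c" using z by (rule N.TN_cases)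
    have "tensor_class B N = tensor_class A N" by (intro ext) (simp add: tensor_class_def tensor_rel_B)
    moreover have "frag_extend (\<lambda>(x, b). frag_of (x, b \<otimes>\<^bsub>B\<^esub> a)) c = frag_extend (\<lambda>(x, b). frag_of (x, b \<otimes> \<sigma> a)) c"
      by (rule frag_extend_eq) (use c(1) a in \<open>auto simp: B_mult_homog homog_carrier \<sigma>1\<close>)
    ultimately show ?thesis
      using NB.TN_ract_cls[of a c] N.TN_ract_cls[OF \<sigma>a, of c] a c(2) by simp
  qed
  then show ?thesis
    by (auto simp: same_module_def pullback_def tensor_functor_fo copy_mod_def copy_map_B tensor_mod_B)
qed

end

section \<open>Assembly of the three statements\<close>

theorem theorem3p4:
  fixes K :: "('k, 'x) ring_scheme" and A :: "('k, 'u) galgebra" and \<sigma> :: "'u \<Rightarrow> 'u"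
  assumes "natLeq <o |UNIV :: 'u set|" and "regularCard |UNIV :: 'u set|"
    and "graded_algebra K A" and "small (carrier A)"
    and "graded_automorphism K A \<sigma>"
  shows
    "(graded_subspace K A (ideal_I A) \<and> ideal_I (zhang_twist A \<sigma>) = ideal_I A)
     \<and>
     (cat_equivalence (Gr A) (Gr (zhang_twist A \<sigma>)) (zhang_functor A \<sigma>) \<and>
      cat_equivalence (full_subcat (Gr A) (Tors A))
        (full_subcat (Gr (zhang_twist A \<sigma>)) (Tors (zhang_twist A \<sigma>))) (zhang_functor A \<sigma>) \<and>
      cat_equivalence (QGr A) (QGr (zhang_twist A \<sigma>)) (induced (zhang_twist A \<sigma>) (zhang_functor A \<sigma>)) \<and>
      functor_eq (Gr A)
        (induced (zhang_twist A \<sigma>) (zhang_functor A \<sigma>) \<circ>\<^sub>F quot_functor A)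
        (quot_functor (zhang_twist A \<sigma>) \<circ>\<^sub>F zhang_functor A \<sigma>) \<and>
      isomorphic_in (QGr (zhang_twist A \<sigma>))
        (fo (induced (zhang_twist A \<sigma>) (zhang_functor A \<sigma>)) (fo (quot_functor A) (reg_gmod A)))
        (fo (quot_functor (zhang_twist A \<sigma>)) (reg_gmod (zhang_twist A \<sigma>))))
     \<and>
     (strongly_graded K A \<longrightarrow>
       strongly_graded K (zhang_twist A \<sigma>) \<and>
       same_algebra K (deg0 (zhang_twist A \<sigma>)) (deg0 A) \<and>
       RMod (deg0 (zhang_twist A \<sigma>)) = RMod (deg0 A) \<and>
       cat_isomorphism (Gr A) (QGr A) (quot_functor A) \<and>
       cat_isomorphism (Gr (zhang_twist A \<sigma>)) (QGr (zhang_twist A \<sigma>))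
         (quot_functor (zhang_twist A \<sigma>)) \<and>
       cat_equivalence (Gr A) (RMod (deg0 A)) (deg0_functor A) \<and>
       cat_equivalence (Gr (zhang_twist A \<sigma>)) (RMod (deg0 (zhang_twist A \<sigma>)))
         (deg0_functor (zhang_twist A \<sigma>)) \<and>
       nc_proj (zhang_twist A \<sigma>) \<simeq>\<^sub>T
         (RMod (deg0 A), reg_rmod (deg0 A), pullback (restrict \<sigma> (homog A 0)) \<circ>\<^sub>F tensor_functor A) \<and>
       nc_proj A \<simeq>\<^sub>T (RMod (deg0 A), reg_rmod (deg0 A), tensor_functor A) \<and>
       (\<exists>E E\<^sub>\<sigma>.
          functor_eq (Gr A) (E \<circ>\<^sub>F quot_functor A) (deg0_functor A) \<and>
          functor_eq (Gr (zhang_twist A \<sigma>)) (E\<^sub>\<sigma> \<circ>\<^sub>F quot_functor (zhang_twist A \<sigma>))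
            (deg0_functor (zhang_twist A \<sigma>)) \<and>
          functor_eq (QGr A) (E\<^sub>\<sigma> \<circ>\<^sub>F induced (zhang_twist A \<sigma>) (zhang_functor A \<sigma>))
            (id_functor \<circ>\<^sub>F E) \<and>
          triple_equivalence (nc_proj A)
            (RMod (deg0 A), reg_rmod (deg0 A), tensor_functor A) E \<and>
          triple_equivalence (nc_proj (zhang_twist A \<sigma>))
            (RMod (deg0 A), reg_rmod (deg0 A),
             pullback (restrict \<sigma> (homog A 0)) \<circ>\<^sub>F tensor_functor A) E\<^sub>\<sigma>))"
    (is "?one \<and> ?two \<and> (?strong \<longrightarrow> ?three)")
proof -
  note universe = assms(1) and alg = assms(3) and sm = assms(4) and aut = assms(5)
  interpret zhang_setup K A \<sigma> using alg aut by (rule zhang_setup.intro)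
  interpret Z: relabelling_pair A B "zhang_functor A \<sigma>" untwist by (rule relabelling_pair_zhang)
  have r: "reg_gmod A \<in> Ob (Gr A)" "reg_gmod B \<in> Ob (Gr B)"
    using reg_gmod_Ob[OF graded_ring_axioms sm] reg_gmod_Ob[OF graded_ring_B] sm by (simp_all del: Gr_simps)
  have 1: ?one
    using graded_subspace_ideal_I[OF alg] ideal_I_B by simp
  \<comment> \<open>The regular module goes to the regular module on the nose, so the required
    isomorphism is an identity.\<close>
  have reg: "fo (induced B (zhang_functor A \<sigma>)) (fo (quot_functor A) (reg_gmod A)) = fo (quot_functor B) (reg_gmod B)"
    by (simp add: induced_def quot_functor_def zhang_reg)
  have 2: ?two
    unfolding reg
    using Z.equivalence_Gr Z.equivalence_Tors Z.equivalence_QGr Z.induced_quot_functor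
      isomorphic_in_refl[OF graded_ring.category_QGr[OF graded_ring_B], of "reg_gmod B"] r(2)
    by (simp add: QGr_def quot_functor_def)
  have 3: ?three if st: "strongly_graded K A"
  proof -
    have stB: "strongly_graded K B" by (rule strongly_graded_B[OF st])
    have sA: "small_strongly_graded_ring A" and sB: "small_strongly_graded_ring B"
      using st stB universe sm graded_ring_axioms graded_ring_B
      by (simp_all add: small_strongly_graded_ring_def small_graded_ring_def small_graded_ring_axioms_def
        strongly_graded_ring_def strongly_graded_ring_axioms_def strongly_graded_def)
    interpret SA: small_strongly_graded_ring A by (rule sA)
    let ?EA = "descended (Gr A) (quot_functor A) (deg0_functor A)" and ?EB = "descended (Gr B) (quot_functor B) (deg0_functor B)"
    let ?P = "pullback (restrict \<sigma> (homog A 0)) \<circ>\<^sub>F tensor_functor A"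
    note EA = SA.triple_equivalence_E
    \<comment> \<open>The general result for the twist speaks of \<open>tensor_functor B\<close> and
      \<open>reg_rmod (deg0 B)\<close>; both are now exchanged for their counterparts over
      \<open>A\<close>.\<close>
    have "naturally_isomorphic (RMod (deg0 A)) (RMod (deg0 A)) (tensor_functor B) ?P"
    proof (rule same_module_naturally_isomorphic)
      have "small_graded_ring B" using sB by (simp add: small_strongly_graded_ring_def)
      note gB = small_graded_ring.is_functor_tensor[OF this] small_graded_ring.copied_tensoringI[OF this]
      show "is_functor (RMod (deg0 A)) (RMod (deg0 A)) (tensor_functor B)" using gB(1) unfolding RMod_deg0_B .
      show "same_module (deg0 A) (fo (tensor_functor B) N) (fo ?P N)" if "N \<in> Ob (RMod (deg0 A))" for N
        using same_module_tensor_B[OF SA.copied_tensoringI gB(2)] that unfolding RMod_deg0_B by blast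
      show "fm ?P N N' f = fm (tensor_functor B) N N' f" for N N' f
        by (simp add: fm_tensor_B pullback_def)
    qed
    moreover have "isomorphic_in (RMod (deg0 A)) (reg_rmod (deg0 B)) (reg_rmod (deg0 A))"
    proof (rule same_module_isomorphic)
      have "triple_equivalence (nc_proj B) (RMod (deg0 A), reg_rmod (deg0 B), tensor_functor B) ?EB"
        using small_strongly_graded_ring.triple_equivalence_E[OF sB] unfolding RMod_deg0_B .
      then show "reg_rmod (deg0 B) \<in> Ob (RMod (deg0 A))"
        by (simp add: triple_equivalence_def is_triple_def split: prod.splits)
      show "same_module (deg0 A) (reg_rmod (deg0 B)) (reg_rmod (deg0 A))"
        by (simp add: same_module_def reg_rmod_def B_mult_0 homog_carrier)
    qed
    ultimately have EB: "triple_equivalence (nc_proj B) (RMod (deg0 A), reg_rmod (deg0 A), ?P) ?EB"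
      using triple_equivalence_cong[OF small_strongly_graded_ring.triple_equivalence_E[OF sB, unfolded RMod_deg0_B]] by blast
    have "functor_eq (QGr A) (?EB \<circ>\<^sub>F induced B (zhang_functor A \<sigma>)) (id_functor \<circ>\<^sub>F ?EA)"
      unfolding functor_eq_def
    proof (intro conjI ballI)
      interpret QA: object_identity "Gr A" "QGr A" "quot_functor A" by (rule SA.object_identity_quot)
      interpret QB: object_identity "Gr B" "QGr B" "quot_functor B"
        by (rule small_strongly_graded_ring.object_identity_quot[OF sB])
      have fo: "fo (induced B (zhang_functor A \<sigma>)) M = fo (zhang_functor A \<sigma>) M" for M by (simp add: induced_def)
      show "fo (?EB \<circ>\<^sub>F induced B (zhang_functor A \<sigma>)) M = fo (id_functor \<circ>\<^sub>F ?EA) M" if "M \<in> Ob (QGr A)" for M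
        using deg0_zhang[of M] that by (simp add: QA.descended_simps QB.descended_simps fo id_functor_def del: Gr_simps)
      fix M N c assume "M \<in> Ob (QGr A)" "N \<in> Ob (QGr A)" and c: "c \<in> Hom (QGr A) M N"
      then have MN: "M \<in> Ob (Gr A)" "N \<in> Ob (Gr A)" by (simp_all del: Gr_simps)
      \<comment> \<open>Each morphism of the quotient category comes from a homomorphism
        \<open>f\<close>, on which Zhang's functor is the identity; both composites then restrict
        \<open>f\<close> to the same degree zero part.\<close>
      obtain f where f: "f \<in> Hom (Gr A) M N" "c = fm (quot_functor A) M N f" by (rule QA.Hom_D_cases[OF MN c])
      have ff: "f \<in> Hom (Gr B) (fo (zhang_functor A \<sigma>) M) (fo (zhang_functor A \<sigma>) N)"
        using is_functorD(4)[OF Z.equivalence_Gr[unfolded cat_equivalence_def, THEN conjunct1] MN f(1)] by simp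
      have "fm (induced B (zhang_functor A \<sigma>)) M N c = fm (quot_functor B) (fo (zhang_functor A \<sigma>) M) (fo (zhang_functor A \<sigma>) N) f"
        using Z.induced_quot_functor MN f unfolding functor_eq_def by (simp add: QA.fo_Q del: Gr_simps)
      then show "fm (?EB \<circ>\<^sub>F induced B (zhang_functor A \<sigma>)) M N c = fm (id_functor \<circ>\<^sub>F ?EA) M N c"
        using QB.descended_simps(2)[OF Z.F.F_Ob[OF MN(1)] Z.F.F_Ob[OF MN(2)] ff, of "deg0_functor B"]
          QA.descended_simps(2)[OF MN f(1), of "deg0_functor A"] arg_cong[OF deg0_zhang[OF MN(1)], of carrier] f(2)
        by (simp add: fo id_functor_def del: Gr_simps)
    qed
    moreover have "cat_isomorphism (Gr B) (QGr B) (quot_functor B)" "cat_equivalence (Gr B) (RMod (deg0 B)) (deg0_functor B)"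
      "functor_eq (Gr B) (?EB \<circ>\<^sub>F quot_functor B) (deg0_functor B)"
      using strongly_graded_ring.quot_functor_isomorphism[of B] small_strongly_graded_ring.deg0_equivalence[OF sB]
        small_strongly_graded_ring.E_comp[OF sB] sB by (simp_all add: small_strongly_graded_ring_def)
    ultimately show ?thesis
      unfolding triple_equivalent_def
      by (intro conjI stB same_algebra_deg0 RMod_deg0_B SA.quot_functor_isomorphism SA.deg0_equivalence
        exI[of _ ?EA] exI[of _ ?EB] exI EA EB SA.E_comp)
  qed
  show ?thesis by (intro conjI impI 1 2 3)
qed

end
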